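(* Let $(\Gamma,\Lambda)$ be a valued quiver. Let $M$ be an indecomposable finite dimensional $k(\Gamma,\Lambda)$-module satisfying $(\Phi^+)^{\nu}M\cong P_x$, where $\nu\in\mathbb N=\{0,1,2,\dots\}$ and $P_x$ is the indecomposable projective $k(\Gamma,\Lambda)$-module associated with $x\in\Gamma_0$. (a) $S_M\sim S_{\nu+1,x}$. (b) If $S_M=x_1,\dots,x_s$, then $x_s=x$ and $M\cong F_{x_1}^-\cdots F_{x_{s-1}}^-(L_x)$, where $L_x$ is the simple projective $k(\Gamma,\sigma_{x_{s-1}}\cdots\sigma_{x_1}\Lambda)$-module associated with $x$.
   Context: Setting. $\Gamma=(\Gamma_0,\Gamma_1)$ is a finite graph with $|\Gamma_0|>1$ whose edges are two-element subsets of $\Gamma_0$, with a fixed valuation $\mathbf b$: nonnegative integers $b_{ij}$ ($i,j\in\Gamma_0$) with $b_{ii}=0$ for which there are positive integers $d_i$ with $d_ib_{ij}=d_jb_{ji}$ for all $i,j$; $\{i,j\}$ is an edge iff $b_{ij}\neq0$. $\Gamma$ is connected. An orientation $\Lambda$ turns each edge into an arrow by choosing its starting point and endpoint; all orientations considered are such that there are no oriented cycles. A modulation is fixed: division rings $\mathbf k_i$ ($i\in\Gamma_0$), and for each edge $\{i,j\}$ a $\mathbf k_i$-$\mathbf k_j$-bimodule ${}_iB_j$ and a $\mathbf k_j$-$\mathbf k_i$-bimodule ${}_jB_i$ with $\mathbf k_j$-$\mathbf k_i$-bimodule isomorphisms ${}_jB_i\cong\mathrm{Hom}_{\mathbf k_i}({}_iB_j,\mathbf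 k_i)\cong\mathrm{Hom}_{\mathbf k_j}({}_iB_j,\mathbf k_j)$ and $\dim_{\mathbf k_i}({}_iB_j)=b_{ij}$. The $\mathbf k_i$ are finite dimensional over a common central subfield $k$ acting centrally on all ${}_iB_j$. $(\Gamma,\Lambda)$ denotes the resulting valued quiver. Representations. A representation $(V,f)$ of $(\Gamma,\Lambda)$ consists of finite dimensional left $\mathbf k_i$-spaces $V_i$ and $\mathbf k_j$-linear maps $f_a:{}_jB_i\otimes_{\mathbf k_i}V_i\to V_j$ for all arrows $a:i\to j$; morphisms are the natural ones. With $\mathbf k=\prod_i\mathbf k_i$ and $B=\bigoplus_{i\to j}{}_jB_i$ (sum over arrows), $k(\Gamma,\Lambda)$ is the tensor ring of the $\mathbf k$-$\mathbf k$-bimodule $B$, a finite dimensional $k$-algebra; finite dimensional left $k(\Gamma,\Lambda)$-modules are identified with representations of $(\Gamma,\Lambda)$. $P_x=k(\Gamma,\Lambda)e_x$, where $e_x\in\mathbf k$ has $1$ in the $x$-th place and $0$ elsewhere. For any orientation, $L_x$ is the simple representation with $\mathbf k_x$ at $x$, $0$ at all other vertices, and zero maps; it is projective when $x$ is a sink. Reflection functors. For a vertex $x$, $\sigma_x\Lambda$ is obtained from $\Lambda$ by reversing all arrows incident with $x$. If $x$ is a sink (no arrow starts at $x$) with arrows $a_i:y_i\to x$, $i=1,\dots,l$, ending at it, $F_x^+$ sends a representation $(V,f)$ of $(\Gamma,\Lambda)$ to the representation $(W,g)$ of $(\Gamma,\sigma_x\Lambda)$ with $W_y=V_y$ for $y\ne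 x$; $W_x=\mathrm{Ker}\,h$ where $h:\bigoplus_i{}_xB_{y_i}\otimes_{\mathbf k_{y_i}}V_{y_i}\to V_x$ is induced by the $f_{a_i}$; $g_b=f_b$ for arrows $b$ not starting at $x$; and for the reversed arrow $x\to y_i$ the map ${}_{y_i}B_x\otimes_{\mathbf k_x}W_x\to W_{y_i}$ corresponds to the component $W_x\to{}_xB_{y_i}\otimes W_{y_i}$ of the inclusion under the natural isomorphism $\mathrm{Hom}_{\mathbf k_x}(W_x,{}_xB_{y_i}\otimes W_{y_i})\cong\mathrm{Hom}_{\mathbf k_{y_i}}({}_{y_i}B_x\otimes W_x,W_{y_i})$. Dually, if $x$ is a source (no arrow ends at $x$) with arrows $x\to y_i$, $F_x^-$ sends a representation $(V,f)$ to the representation of the quiver with orientation $\sigma_x$ applied, having the same spaces at $y\neq x$ and the same maps on arrows not incident with $x$, the space at $x$ being the cokernel of the map $V_x\to\bigoplus_i{}_xB_{y_i}\otimes V_{y_i}$ whose components $V_x\to{}_xB_{y_i}\otimes V_{y_i}$ correspond to the maps $f_{x\to y_i}:{}_{y_i}B_x\otimes V_x\to V_{y_i}$ under the natural isomorphism $\mathrm{Hom}_{\mathbf k_x}(V_x,{}_xB_{y_i}\otimes V_{y_i})\cong\mathrm{Hom}_{\mathbf k_{y_i}}({}_{y_i}B_x\otimes V_x,V_{y_i})$, and the maps for the reversed arrows $y_i\to x$ being the components of the cokernel projection. Both are defined on morphisms in the natural way. Admissible sequences. A sequence $S=x_1,\dots,x_s$ ($s\ge0$) of vertices is (+)-admissible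 on $(\Gamma,\Lambda)$ if it is empty or $x_1$ is a sink for $\Lambda$, $x_2$ is a sink for $\sigma_{x_1}\Lambda$, and so on. $\mathfrak S$ is the set of (+)-admissible sequences on $(\Gamma,\Lambda)$. Put $\Lambda^S=\sigma_{x_s}\cdots\sigma_{x_1}\Lambda$ and $F(S)=F_{x_s}^+\cdots F_{x_1}^+$ (the identity if $S=\emptyset$). $\mathrm{Supp}\,S$ is the set of vertices occurring in $S$. If $K\in\mathfrak S$ contains each vertex exactly once, then $\Lambda^K=\Lambda$ and $\Phi^+=F(K)$ is the Coxeter functor, which does not depend on the choice of $K$. $\sim$ is the equivalence relation on $\mathfrak S$ generated by interchanging two consecutive vertices $x_i,x_{i+1}$ not connected by an edge. For $S,T\in\mathfrak S$, $S$ is a subsequence of $T$, written $S\preccurlyeq T$, if $T\sim SU$ (concatenation) for some (+)-admissible sequence $U$ on $(\Gamma,\Lambda^S)$; it is proper if $S\not\sim T$. $S$ annihilates $M$ if $F(S)M=0$; it is a shortest sequence annihilating $M$ if in addition no proper subsequence of $S$ annihilates $M$. $M$ is preprojective if some $S\in\mathfrak S$ annihilates it; then a shortest sequence annihilating $M$ exists and is unique up to $\sim$, and it is denoted $S_M$. (A module $M$ with $(\Phi^+)^\nu M\cong P_x$ is preprojective.) Principal sequences. $(\Gamma_0,\Lambda)$ is the poset on $\Gamma_0$ with $x\le y$ iff there is a path (possibly of length $0$) from $x$ to $y$. A filter is a subset $F$ such that $x\in F$, $y\ge x$ imply $y\in F$; $\langle x\rangle=\{y: y\ge x\}$. The hull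 $H_\Lambda(F)$ of a filter $F$ is the smallest filter containing $F$ and every vertex of $\Gamma_0\setminus F$ connected by an edge to a vertex in $F$. Every nonempty $S\in\mathfrak S$ has a canonical form $S\sim S_1S_2\cdots S_r$, unique up to equivalence of each $S_i$, where each $S_i$ is nonempty and consists of distinct vertices and $\mathrm{Supp}\,S_i=\mathrm{Supp}\,(S_iS_{i+1}\cdots S_r)$ for all $i$; $r$ is the size of $S$. For $r\ge1$ and $x\in\Gamma_0$, $S_{r,x}$ denotes the (unique up to $\sim$) sequence in $\mathfrak S$ of size $r$ whose canonical form satisfies $\mathrm{Supp}\,S_r=\langle x\rangle$ and $\mathrm{Supp}\,S_i=H_\Lambda(\mathrm{Supp}\,S_{i+1})$ for $0<i<r$. *)

theory Defs
  imports "HOL-Algebra.Module" "HOL-Algebra.AbelCoset" "HOL-Algebra.Free_Abelian_Groups"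
begin

section \<open>Modules and bimodules over noncommutative rings\<close>

text \<open>The locale \<^locale>\<open>module\<close> of HOL-Algebra requires a commutative ring of scalars. Its record type
  is reused here; the fields \<^const>\<open>monoid.mult\<close> and \<^const>\<open>one\<close> of a module carry no information.\<close>

locale left_module = R?: ring R + M?: abelian_group M
  for R :: "('r, 'y) ring_scheme" (structure) and M :: "('r, 'v, 'z) module_scheme" (structure) +
  assumes smult_closed: "\<lbrakk>a \<in> carrier R; m \<in> carrier M\<rbrakk> \<Longrightarrow> a \<odot>\<^bsub>M\<^esub> m \<in> carrier M"
    and smult_l_distr: "\<lbrakk>a \<in> carrier R; b \<in> carrier R; m \<in> carrier M\<rbrakk> \<Longrightarrow>
      (a \<oplus>\<^bsub>R\<^esub> b) \<odot>\<^bsub>M\<^esub> m = a \<odot>\<^bsub>M\<^esub> m \<oplus>\<^bsub>M\<^esub> b \<odot>\<^bsub>M\<^esub> m"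
    and smult_r_distr: "\<lbrakk>a \<in> carrier R; m \<in> carrier M; n \<in> carrier M\<rbrakk> \<Longrightarrow>
      a \<odot>\<^bsub>M\<^esub> (m \<oplus>\<^bsub>M\<^esub> n) = a \<odot>\<^bsub>M\<^esub> m \<oplus>\<^bsub>M\<^esub> a \<odot>\<^bsub>M\<^esub> n"
    and smult_assoc: "\<lbrakk>a \<in> carrier R; b \<in> carrier R; m \<in> carrier M\<rbrakk> \<Longrightarrow>
      (a \<otimes>\<^bsub>R\<^esub> b) \<odot>\<^bsub>M\<^esub> m = a \<odot>\<^bsub>M\<^esub> (b \<odot>\<^bsub>M\<^esub> m)"
    and smult_one: "m \<in> carrier M \<Longrightarrow> \<one>\<^bsub>R\<^esub> \<odot>\<^bsub>M\<^esub> m = m"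

record ('r, 'b) bimodule = "('r, 'b) module" +
  rsmult :: "'b \<Rightarrow> 'r \<Rightarrow> 'b"

locale bimodule = left_module R M + S?: ring S
  for R :: "('r, 'y) ring_scheme" (structure) and S :: "('r, 'x) ring_scheme" (structure)
    and M :: "('r, 'b) bimodule" (structure) +
  assumes rsmult_closed: "\<lbrakk>m \<in> carrier M; s \<in> carrier S\<rbrakk> \<Longrightarrow> rsmult M m s \<in> carrier M"
    and rsmult_r_distr: "\<lbrakk>m \<in> carrier M; s \<in> carrier S; t \<in> carrier S\<rbrakk> \<Longrightarrow>
      rsmult M m (s \<oplus>\<^bsub>S\<^esub> t) = rsmult M m s \<oplus>\<^bsub>M\<^esub> rsmult M m t"
    and rsmult_l_distr: "\<lbrakk>m \<in> carrier M; n \<in> carrier M; s \<in> carrier S\<rbrakk> \<Longrightarrow>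
      rsmult M (m \<oplus>\<^bsub>M\<^esub> n) s = rsmult M m s \<oplus>\<^bsub>M\<^esub> rsmult M n s"
    and rsmult_assoc: "\<lbrakk>m \<in> carrier M; s \<in> carrier S; t \<in> carrier S\<rbrakk> \<Longrightarrow>
      rsmult M m (s \<otimes>\<^bsub>S\<^esub> t) = rsmult M (rsmult M m s) t"
    and rsmult_one: "m \<in> carrier M \<Longrightarrow> rsmult M m \<one>\<^bsub>S\<^esub> = m"
    and smult_rsmult: "\<lbrakk>a \<in> carrier R; m \<in> carrier M; s \<in> carrier S\<rbrakk> \<Longrightarrow>
      rsmult M (a \<odot>\<^bsub>M\<^esub> m) s = a \<odot>\<^bsub>M\<^esub> rsmult M m s"

definition division_ring :: "'r ring \<Rightarrow> bool" where
  "division_ring R \<longleftrightarrow> ring R \<and> \<one>\<^bsub>R\<^esub> \<noteq> \<zero>\<^bsub>R\<^esub> \<and> Units R = carrier R - {\<zero>\<^bsub>R\<^esub>}"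

text \<open>The ring \<open>R\<close> as a left module along a map \<open>e\<close> from the scalars to \<open>R\<close>.\<close>

definition scalar_module :: "'r ring \<Rightarrow> ('s \<Rightarrow> 'r) \<Rightarrow> ('s, 'r) module" where
  "scalar_module R e = \<lparr>carrier = carrier R, monoid.mult = undefined, one = undefined,
     ring.zero = \<zero>\<^bsub>R\<^esub>, ring.add = (\<oplus>\<^bsub>R\<^esub>), smult = (\<lambda>s r. e s \<otimes>\<^bsub>R\<^esub> r)\<rparr>"

definition has_dim :: "'r ring \<Rightarrow> ('r, 'v, 'z) module_scheme \<Rightarrow> nat \<Rightarrow> bool" where
  "has_dim R M n \<longleftrightarrow> (\<exists>X. X \<subseteq> carrier M \<and> finite X \<and> card X = n \<and>
     (\<forall>m\<in>carrier M. \<exists>!c. c \<in> X \<rightarrow>\<^sub>E carrier R \<and> m = (\<Oplus>\<^bsub>M\<^esub>v\<in>X. c v \<odot>\<^bsub>M\<^esub> v)))"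

definition fin_dim :: "'r ring \<Rightarrow> ('r, 'v, 'z) module_scheme \<Rightarrow> bool" where
  "fin_dim R M \<longleftrightarrow> (\<exists>n. has_dim R M n)"

definition ldim :: "'r ring \<Rightarrow> ('r, 'v, 'z) module_scheme \<Rightarrow> nat" where
  "ldim R M = (THE n. has_dim R M n)"

text \<open>Linear maps are normalised to be \<^const>\<open>undefined\<close> outside the carrier, so that they form a set
  of functions in which equality means equality on the carrier.\<close>

definition lin_hom ::
    "'r ring \<Rightarrow> ('r, 'v, 'z) module_scheme \<Rightarrow> ('r, 'w, 'y) module_scheme \<Rightarrow> ('v \<Rightarrow> 'w) set" where
  "lin_hom R M N = {f \<in> carrier M \<rightarrow>\<^sub>E carrier N.
     (\<forall>m\<in>carrier M. \<forall>n\<in>carrier M. f (m \<oplus>\<^bsub>M\<^esub> n) = f m \<oplus>\<^bsub>N\<^esub> f n) \<and>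
     (\<forall>a\<in>carrier R. \<forall>m\<in>carrier M. f (a \<odot>\<^bsub>M\<^esub> m) = a \<odot>\<^bsub>N\<^esub> f m)}"

text \<open>For an \<open>R\<close>-\<open>S\<close>-bimodule \<open>M\<close>, the \<open>S\<close>-\<open>R\<close>-bimodules of left \<open>R\<close>-linear maps \<open>M \<rightarrow> R\<close> and of right
  \<open>S\<close>-linear maps \<open>M \<rightarrow> S\<close>.\<close>

definition left_dual :: "'r ring \<Rightarrow> ('r, 'b) bimodule \<Rightarrow> ('r, 'b \<Rightarrow> 'r) bimodule" where
  "left_dual R M = \<lparr>carrier = lin_hom R M (scalar_module R (\<lambda>a. a)),
     monoid.mult = undefined, one = undefined,
     ring.zero = (\<lambda>m\<in>carrier M. \<zero>\<^bsub>R\<^esub>), ring.add = (\<lambda>f g. \<lambda>m\<in>carrier M. f m \<oplus>\<^bsub>R\<^esub> g m),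
     smult = (\<lambda>s f. \<lambda>m\<in>carrier M. f (rsmult M m s)),
     rsmult = (\<lambda>f a. \<lambda>m\<in>carrier M. f m \<otimes>\<^bsub>R\<^esub> a)\<rparr>"

definition right_dual :: "'r ring \<Rightarrow> ('r, 'b) bimodule \<Rightarrow> ('r, 'b \<Rightarrow> 'r) bimodule" where
  "right_dual S M = \<lparr>carrier = {f \<in> carrier M \<rightarrow>\<^sub>E carrier S.
       (\<forall>m\<in>carrier M. \<forall>n\<in>carrier M. f (m \<oplus>\<^bsub>M\<^esub> n) = f m \<oplus>\<^bsub>S\<^esub> f n) \<and>
       (\<forall>s\<in>carrier S. \<forall>m\<in>carrier M. f (rsmult M m s) = f m \<otimes>\<^bsub>S\<^esub> s)},
     monoid.mult = undefined, one = undefined,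
     ring.zero = (\<lambda>m\<in>carrier M. \<zero>\<^bsub>S\<^esub>), ring.add = (\<lambda>f g. \<lambda>m\<in>carrier M. f m \<oplus>\<^bsub>S\<^esub> g m),
     smult = (\<lambda>s f. \<lambda>m\<in>carrier M. s \<otimes>\<^bsub>S\<^esub> f m),
     rsmult = (\<lambda>f a. \<lambda>m\<in>carrier M. f (a \<odot>\<^bsub>M\<^esub> m))\<rparr>"

definition bimodule_iso ::
    "'r ring \<Rightarrow> 'r ring \<Rightarrow> ('r, 'b) bimodule \<Rightarrow> ('r, 'c) bimodule \<Rightarrow> ('b \<Rightarrow> 'c) \<Rightarrow> bool" where
  "bimodule_iso R S M N f \<longleftrightarrow> bij_betw f (carrier M) (carrier N) \<and>
     (\<forall>m\<in>carrier M. \<forall>n\<in>carrier M. f (m \<oplus>\<^bsub>M\<^esub> n) = f m \<oplus>\<^bsub>N\<^esub> f n) \<and>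
     (\<forall>a\<in>carrier R. \<forall>m\<in>carrier M. f (a \<odot>\<^bsub>M\<^esub> m) = a \<odot>\<^bsub>N\<^esub> f m) \<and>
     (\<forall>m\<in>carrier M. \<forall>s\<in>carrier S. f (rsmult M m s) = rsmult N (f m) s)"

definition quotient_module :: "('r, 'v) module \<Rightarrow> 'v set \<Rightarrow> ('r, 'v set) module" where
  "quotient_module M U = \<lparr>carrier = a_rcosets\<^bsub>M\<^esub> U, monoid.mult = undefined, one = undefined,
     ring.zero = U, ring.add = (<+>\<^bsub>M\<^esub>), smult = (\<lambda>a C. \<Union>m\<in>C. U +>\<^bsub>M\<^esub> (a \<odot>\<^bsub>M\<^esub> m))\<rparr>"

definition direct_sum :: "'i set \<Rightarrow> ('i \<Rightarrow> ('r, 'v) module) \<Rightarrow> ('r, 'i \<Rightarrow> 'v) module" where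
  "direct_sum I M = \<lparr>carrier = (\<Pi>\<^sub>E i\<in>I. carrier (M i)), monoid.mult = undefined, one = undefined,
     ring.zero = (\<lambda>i\<in>I. \<zero>\<^bsub>M i\<^esub>), ring.add = (\<lambda>u w. \<lambda>i\<in>I. u i \<oplus>\<^bsub>M i\<^esub> w i),
     smult = (\<lambda>a u. \<lambda>i\<in>I. a \<odot>\<^bsub>M i\<^esub> u i)\<rparr>"


section \<open>Tensor products and tensor rings\<close>

text \<open>The abelian group with generators \<open>X\<close> and relators \<open>Q\<close>, the class in it of a formal integer
  combination of generators, and the value at \<open>t\<close> of the homomorphism to \<open>A\<close> with \<open>x \<mapsto> g x\<close> on
  generators, for \<open>g\<close> respecting the relations (any representative of the class \<open>t\<close> will do).\<close>

definition presented :: "'a set \<Rightarrow> ('a \<Rightarrow>\<^sub>0 int) set \<Rightarrow> ('a \<Rightarrow>\<^sub>0 int) set monoid" where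
  "presented X Q = free_Abelian_group X Mod generate (free_Abelian_group X) Q"

definition presented_class :: "'a set \<Rightarrow> ('a \<Rightarrow>\<^sub>0 int) set \<Rightarrow> ('a \<Rightarrow>\<^sub>0 int) \<Rightarrow> ('a \<Rightarrow>\<^sub>0 int) set" where
  "presented_class X Q u = generate (free_Abelian_group X) Q #>\<^bsub>free_Abelian_group X\<^esub> u"

definition presented_lift :: "('r, 'v, 'z) module_scheme \<Rightarrow> ('a \<Rightarrow> 'v) \<Rightarrow> ('a \<Rightarrow>\<^sub>0 int) set \<Rightarrow> 'v" where
  "presented_lift A g t = (let u = SOME u. u \<in> t in
     \<Oplus>\<^bsub>A\<^esub>x\<in>Poly_Mapping.keys u. [Poly_Mapping.lookup u x] \<cdot>\<^bsub>A\<^esub> g x)"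

type_synonym ('b, 'v) tens = "('b \<times> 'v \<Rightarrow>\<^sub>0 int) set"

definition tensor_rel :: "'r ring \<Rightarrow> ('r, 'b) bimodule \<Rightarrow> ('r, 'v) module \<Rightarrow> ('b \<times> 'v \<Rightarrow>\<^sub>0 int) set" where
  "tensor_rel S B V =
     {frag_of (b \<oplus>\<^bsub>B\<^esub> b', v) - frag_of (b, v) - frag_of (b', v) | b b' v.
        b \<in> carrier B \<and> b' \<in> carrier B \<and> v \<in> carrier V} \<union>
     {frag_of (b, v \<oplus>\<^bsub>V\<^esub> v') - frag_of (b, v) - frag_of (b, v') | b v v'.
        b \<in> carrier B \<and> v \<in> carrier V \<and> v' \<in> carrier V} \<union>
     {frag_of (rsmult B b s, v) - frag_of (b, s \<odot>\<^bsub>V\<^esub> v) | b s v.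
        b \<in> carrier B \<and> s \<in> carrier S \<and> v \<in> carrier V}"

definition tensor_class ::
    "'r ring \<Rightarrow> ('r, 'b) bimodule \<Rightarrow> ('r, 'v) module \<Rightarrow> ('b \<times> 'v \<Rightarrow>\<^sub>0 int) \<Rightarrow> ('b, 'v) tens" where
  "tensor_class S B V = presented_class (carrier B \<times> carrier V) (tensor_rel S B V)"

definition pure_tensor ::
    "'r ring \<Rightarrow> ('r, 'b) bimodule \<Rightarrow> ('r, 'v) module \<Rightarrow> 'b \<Rightarrow> 'v \<Rightarrow> ('b, 'v) tens" where
  "pure_tensor S B V b v = tensor_class S B V (frag_of (b, v))"

text \<open>\<open>B \<otimes>\<^sub>S V\<close> for an \<open>R\<close>-\<open>S\<close>-bimodule \<open>B\<close> and a left \<open>S\<close>-module \<open>V\<close>, as a left \<open>R\<close>-module.\<close>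

definition tensor ::
    "'r ring \<Rightarrow> ('r, 'b) bimodule \<Rightarrow> ('r, 'v) module \<Rightarrow> ('r, ('b, 'v) tens) module" where
  "tensor S B V = (let G = presented (carrier B \<times> carrier V) (tensor_rel S B V) in
     \<lparr>carrier = carrier G, monoid.mult = undefined, one = undefined,
      ring.zero = \<one>\<^bsub>G\<^esub>, ring.add = (\<otimes>\<^bsub>G\<^esub>),
      smult = (\<lambda>a t. \<Union>u\<in>t. tensor_class S B V
        (frag_extend (\<lambda>(b, v). frag_of (a \<odot>\<^bsub>B\<^esub> b, v)) u))\<rparr>)"

definition tensor_lift :: "('r, 'w) module \<Rightarrow> ('b \<Rightarrow> 'v \<Rightarrow> 'w) \<Rightarrow> ('b, 'v) tens \<Rightarrow> 'w" where
  "tensor_lift A g = presented_lift A (\<lambda>(b, v). g b v)"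

text \<open>The map \<open>1 \<otimes> f : B \<otimes>\<^sub>S V \<rightarrow> B \<otimes>\<^sub>S W\<close>.\<close>

definition tensor_map ::
    "'r ring \<Rightarrow> ('r, 'b) bimodule \<Rightarrow> ('r, 'w) module \<Rightarrow> ('v \<Rightarrow> 'w) \<Rightarrow> ('b, 'v) tens \<Rightarrow> ('b, 'w) tens" where
  "tensor_map S B W f = tensor_lift (tensor S B W) (\<lambda>b v. pure_tensor S B W b (f v))"

text \<open>The tensor ring \<open>\<Oplus>\<^sub>n B\<^bsup>\<otimes>n\<^esup>\<close> of an \<open>R\<close>-\<open>R\<close>-bimodule \<open>B\<close>. A generator \<open>([b\<^sub>1,\<dots>,b\<^sub>n], s)\<close> stands for
  \<open>b\<^sub>1 \<otimes> \<dots> \<otimes> b\<^sub>n \<otimes> s\<close> in \<open>B \<otimes>\<^sub>R \<dots> \<otimes>\<^sub>R B \<otimes>\<^sub>R R\<close>, which is \<open>R\<close> for \<open>n = 0\<close> and is \<open>B\<^bsup>\<otimes>n\<^esup>\<close> for \<open>n > 0\<close>.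
  The relators are homogeneous in \<open>n\<close>, so that presenting all degrees at once gives the direct sum.\<close>

definition tensor_words :: "'s ring \<Rightarrow> ('s, 'b) bimodule \<Rightarrow> ('b list \<times> 's) set" where
  "tensor_words R B = {(bs, s). set bs \<subseteq> carrier B \<and> s \<in> carrier R}"

definition tensor_word_rel :: "'s ring \<Rightarrow> ('s, 'b) bimodule \<Rightarrow> ('b list \<times> 's \<Rightarrow>\<^sub>0 int) set" where
  "tensor_word_rel R B =
     {frag_of (us @ (b \<oplus>\<^bsub>B\<^esub> b') # ws, s) - frag_of (us @ b # ws, s) - frag_of (us @ b' # ws, s) |
        us b b' ws s. set us \<subseteq> carrier B \<and> b \<in> carrier B \<and> b' \<in> carrier B \<and>
          set ws \<subseteq> carrier B \<and> s \<in> carrier R} \<union>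
     {frag_of (us, s \<oplus>\<^bsub>R\<^esub> s') - frag_of (us, s) - frag_of (us, s') |
        us s s'. set us \<subseteq> carrier B \<and> s \<in> carrier R \<and> s' \<in> carrier R} \<union>
     {frag_of (us @ rsmult B b r # b' # ws, s) - frag_of (us @ b # (r \<odot>\<^bsub>B\<^esub> b') # ws, s) |
        us b r b' ws s. set us \<subseteq> carrier B \<and> b \<in> carrier B \<and> r \<in> carrier R \<and> b' \<in> carrier B \<and>
          set ws \<subseteq> carrier B \<and> s \<in> carrier R} \<union>
     {frag_of (us @ [rsmult B b r], s) - frag_of (us @ [b], r \<otimes>\<^bsub>R\<^esub> s) |
        us b r s. set us \<subseteq> carrier B \<and> b \<in> carrier B \<and> r \<in> carrier R \<and> s \<in> carrier R}"

definition tensor_word_class ::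
    "'s ring \<Rightarrow> ('s, 'b) bimodule \<Rightarrow> ('b list \<times> 's \<Rightarrow>\<^sub>0 int) \<Rightarrow> ('b list \<times> 's \<Rightarrow>\<^sub>0 int) set" where
  "tensor_word_class R B = presented_class (tensor_words R B) (tensor_word_rel R B)"

fun tensor_word_mult ::
    "'s ring \<Rightarrow> ('s, 'b) bimodule \<Rightarrow> 'b list \<times> 's \<Rightarrow> 'b list \<times> 's \<Rightarrow> 'b list \<times> 's" where
  "tensor_word_mult R B (bs, s) ([], t) = (bs, s \<otimes>\<^bsub>R\<^esub> t)"
| "tensor_word_mult R B (bs, s) (c # cs, t) = (bs @ (s \<odot>\<^bsub>B\<^esub> c) # cs, t)"

definition tensor_ring :: "'s ring \<Rightarrow> ('s, 'b) bimodule \<Rightarrow> ('b list \<times> 's \<Rightarrow>\<^sub>0 int) set ring" where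
  "tensor_ring R B = (let G = presented (tensor_words R B) (tensor_word_rel R B) in
     \<lparr>carrier = carrier G,
      monoid.mult = (\<lambda>p q. \<Union>u\<in>p. \<Union>w\<in>q. tensor_word_class R B
        (frag_extend (\<lambda>c. frag_extend (\<lambda>d. frag_of (tensor_word_mult R B c d)) w) u)),
      one = tensor_word_class R B (frag_of ([], \<one>\<^bsub>R\<^esub>)),
      ring.zero = \<one>\<^bsub>G\<^esub>, ring.add = (\<otimes>\<^bsub>G\<^esub>)\<rparr>)"

definition tensor_ring_scalar :: "'s ring \<Rightarrow> ('s, 'b) bimodule \<Rightarrow> 's \<Rightarrow> ('b list \<times> 's \<Rightarrow>\<^sub>0 int) set" where
  "tensor_ring_scalar R B s = tensor_word_class R B (frag_of ([], s))"

definition tensor_ring_elem :: "'s ring \<Rightarrow> ('s, 'b) bimodule \<Rightarrow> 'b \<Rightarrow> ('b list \<times> 's \<Rightarrow>\<^sub>0 int) set" where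
  "tensor_ring_elem R B b = tensor_word_class R B (frag_of ([b], \<one>\<^bsub>R\<^esub>))"


section \<open>Valued graphs, orientations and modulations\<close>

text \<open>The set of vertices is the finite type \<^typ>\<open>'i\<close>; the edges are determined by the valuation \<open>b\<close>.\<close>

definition edge :: "('i \<Rightarrow> 'i \<Rightarrow> nat) \<Rightarrow> 'i \<Rightarrow> 'i \<Rightarrow> bool" where
  "edge b i j \<longleftrightarrow> b i j \<noteq> 0"

definition valuation :: "('i::finite \<Rightarrow> 'i \<Rightarrow> nat) \<Rightarrow> bool" where
  "valuation b \<longleftrightarrow> (\<forall>i. b i i = 0) \<and>
     (\<exists>d::'i \<Rightarrow> nat. (\<forall>i. 0 < d i) \<and> (\<forall>i j. d i * b i j = d j * b j i))"

definition connected_graph :: "('i::finite \<Rightarrow> 'i \<Rightarrow> nat) \<Rightarrow> bool" where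
  "connected_graph b \<longleftrightarrow> (\<forall>i j. (edge b)\<^sup>*\<^sup>* i j)"

text \<open>An orientation is the set of its arrows; \<open>(i, j)\<close> is an arrow from \<open>i\<close> to \<open>j\<close>.\<close>

definition orientation :: "('i \<Rightarrow> 'i \<Rightarrow> nat) \<Rightarrow> ('i \<times> 'i) set \<Rightarrow> bool" where
  "orientation b \<Lambda> \<longleftrightarrow> (\<forall>(i, j)\<in>\<Lambda>. edge b i j) \<and>
     (\<forall>i j. edge b i j \<longrightarrow> ((i, j) \<in> \<Lambda>) \<noteq> ((j, i) \<in> \<Lambda>))"

text \<open>The bimodule \<open>\<^sub>iB\<^sub>j\<close> is \<open>bim i j\<close>. The map \<open>dual_iso i j\<close> is the chosen bimodule isomorphism from
  \<open>\<^sub>jB\<^sub>i\<close> to the left dual of \<open>\<^sub>iB\<^sub>j\<close>; it is part of the data since the reflection functors depend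
  on it. The common central subfield \<open>base\<close> sits in each division ring via the embedding \<open>emb i\<close>.\<close>

record ('i, 'r, 'b, 'f) modulation =
  val :: "'i \<Rightarrow> 'i \<Rightarrow> nat"
  dr :: "'i \<Rightarrow> 'r ring"
  bim :: "'i \<Rightarrow> 'i \<Rightarrow> ('r, 'b) bimodule"
  dual_iso :: "'i \<Rightarrow> 'i \<Rightarrow> 'b \<Rightarrow> 'b \<Rightarrow> 'r"
  base :: "'f ring"
  emb :: "'i \<Rightarrow> 'f \<Rightarrow> 'r"

definition is_modulation :: "('i::finite, 'r, 'b, 'f) modulation \<Rightarrow> bool" where
  "is_modulation \<M> \<longleftrightarrow>
     field (base \<M>) \<and>
     (\<forall>i. division_ring (dr \<M> i) \<and>
       emb \<M> i \<in> ring_hom (base \<M>) (dr \<M> i) \<and>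
       (\<forall>c\<in>carrier (base \<M>). \<forall>s\<in>carrier (dr \<M> i).
          emb \<M> i c \<otimes>\<^bsub>dr \<M> i\<^esub> s = s \<otimes>\<^bsub>dr \<M> i\<^esub> emb \<M> i c) \<and>
       fin_dim (base \<M>) (scalar_module (dr \<M> i) (emb \<M> i))) \<and>
     (\<forall>i j. edge (val \<M>) i j \<longrightarrow>
       bimodule (dr \<M> i) (dr \<M> j) (bim \<M> i j) \<and>
       has_dim (dr \<M> i) (bim \<M> i j) (val \<M> i j) \<and>
       (\<forall>c\<in>carrier (base \<M>). \<forall>m\<in>carrier (bim \<M> i j).
          emb \<M> i c \<odot>\<^bsub>bim \<M> i j\<^esub> m = rsmult (bim \<M> i j) m (emb \<M> j c)) \<and>
       bimodule_iso (dr \<M> j) (dr \<M> i) (bim \<M> j i) (left_dual (dr \<M> i) (bim \<M> i j)) (dual_iso \<M> i j) \<and>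
       (\<exists>f. bimodule_iso (dr \<M> j) (dr \<M> i) (bim \<M> j i) (right_dual (dr \<M> j) (bim \<M> i j)) f))"


section \<open>Representations\<close>

record ('i, 'r, 'b, 'v) rep =
  spc :: "'i \<Rightarrow> ('r, 'v) module"
  mp :: "'i \<Rightarrow> 'i \<Rightarrow> ('b, 'v) tens \<Rightarrow> 'v"

text \<open>\<open>\<^sub>jB\<^sub>i \<otimes> V\<close>, for a left vector space \<open>V\<close> over the division ring at \<open>i\<close>.\<close>

definition arrow_tensor ::
    "('i, 'r, 'b, 'f) modulation \<Rightarrow> 'i \<Rightarrow> 'i \<Rightarrow> ('r, 'v) module \<Rightarrow> ('r, ('b, 'v) tens) module" where
  "arrow_tensor \<M> j i V = tensor (dr \<M> i) (bim \<M> j i) V"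

definition is_rep ::
    "('i::finite, 'r, 'b, 'f) modulation \<Rightarrow> ('i \<times> 'i) set \<Rightarrow> ('i, 'r, 'b, 'v) rep \<Rightarrow> bool" where
  "is_rep \<M> \<Lambda> V \<longleftrightarrow>
     (\<forall>i. left_module (dr \<M> i) (spc V i) \<and> fin_dim (dr \<M> i) (spc V i)) \<and>
     (\<forall>(i, j)\<in>\<Lambda>. mp V i j \<in> lin_hom (dr \<M> j) (arrow_tensor \<M> j i (spc V i)) (spc V j))"

definition is_rep_hom ::
    "('i::finite, 'r, 'b, 'f) modulation \<Rightarrow> ('i \<times> 'i) set \<Rightarrow> ('i, 'r, 'b, 'v) rep \<Rightarrow>
     ('i, 'r, 'b, 'w) rep \<Rightarrow> ('i \<Rightarrow> 'v \<Rightarrow> 'w) \<Rightarrow> bool" where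
  "is_rep_hom \<M> \<Lambda> V W \<alpha> \<longleftrightarrow>
     (\<forall>i. \<alpha> i \<in> lin_hom (dr \<M> i) (spc V i) (spc W i)) \<and>
     (\<forall>(i, j)\<in>\<Lambda>. \<forall>t\<in>carrier (arrow_tensor \<M> j i (spc V i)).
        \<alpha> j (mp V i j t) = mp W i j (tensor_map (dr \<M> i) (bim \<M> j i) (spc W i) (\<alpha> i) t))"

definition rep_iso ::
    "('i::finite, 'r, 'b, 'f) modulation \<Rightarrow> ('i \<times> 'i) set \<Rightarrow> ('i, 'r, 'b, 'v) rep \<Rightarrow>
     ('i, 'r, 'b, 'w) rep \<Rightarrow> bool" where
  "rep_iso \<M> \<Lambda> V W \<longleftrightarrow> (\<exists>\<alpha>. is_rep_hom \<M> \<Lambda> V W \<alpha> \<and>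
     (\<forall>i. bij_betw (\<alpha> i) (carrier (spc V i)) (carrier (spc W i))))"

definition zero_rep :: "('i, 'r, 'b, 'v) rep \<Rightarrow> bool" where
  "zero_rep V \<longleftrightarrow> (\<forall>i. carrier (spc V i) = {\<zero>\<^bsub>spc V i\<^esub>})"

definition subrep ::
    "('i::finite, 'r, 'b, 'f) modulation \<Rightarrow> ('i \<times> 'i) set \<Rightarrow> ('i, 'r, 'b, 'v) rep \<Rightarrow>
     ('i \<Rightarrow> 'v set) \<Rightarrow> bool" where
  "subrep \<M> \<Lambda> V U \<longleftrightarrow> (\<forall>i. submodule (U i) (dr \<M> i) (spc V i)) \<and>
     (\<forall>(i, j)\<in>\<Lambda>. \<forall>b\<in>carrier (bim \<M> j i). \<forall>u\<in>U i.
        mp V i j (pure_tensor (dr \<M> i) (bim \<M> j i) (spc V i) b u) \<in> U j)"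

definition indecomposable_rep ::
    "('i::finite, 'r, 'b, 'f) modulation \<Rightarrow> ('i \<times> 'i) set \<Rightarrow> ('i, 'r, 'b, 'v) rep \<Rightarrow> bool" where
  "indecomposable_rep \<M> \<Lambda> V \<longleftrightarrow> \<not> zero_rep V \<and>
     (\<forall>U W. subrep \<M> \<Lambda> V U \<and> subrep \<M> \<Lambda> V W \<and>
        (\<forall>i. U i <+>\<^bsub>spc V i\<^esub> W i = carrier (spc V i) \<and> U i \<inter> W i = {\<zero>\<^bsub>spc V i\<^esub>}) \<longrightarrow>
        (\<forall>i. U i = {\<zero>\<^bsub>spc V i\<^esub>}) \<or> (\<forall>i. W i = {\<zero>\<^bsub>spc V i\<^esub>}))"


section \<open>The algebra of the valued quiver and its indecomposable projectives\<close>

definition product_ring :: "('i::finite, 'r, 'b, 'f) modulation \<Rightarrow> ('i \<Rightarrow> 'r) ring" where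
  "product_ring \<M> = \<lparr>carrier = {s. \<forall>i. s i \<in> carrier (dr \<M> i)},
     monoid.mult = (\<lambda>s t i. s i \<otimes>\<^bsub>dr \<M> i\<^esub> t i), one = (\<lambda>i. \<one>\<^bsub>dr \<M> i\<^esub>),
     ring.zero = (\<lambda>i. \<zero>\<^bsub>dr \<M> i\<^esub>), ring.add = (\<lambda>s t i. s i \<oplus>\<^bsub>dr \<M> i\<^esub> t i)\<rparr>"

definition arrow_bimodule ::
    "('i::finite, 'r, 'b, 'f) modulation \<Rightarrow> ('i \<times> 'i) set \<Rightarrow> ('i \<Rightarrow> 'r, 'i \<times> 'i \<Rightarrow> 'b) bimodule" where
  "arrow_bimodule \<M> \<Lambda> = \<lparr>carrier = (\<Pi>\<^sub>E (i, j)\<in>\<Lambda>. carrier (bim \<M> j i)),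
     monoid.mult = undefined, one = undefined,
     ring.zero = (\<lambda>(i, j)\<in>\<Lambda>. \<zero>\<^bsub>bim \<M> j i\<^esub>),
     ring.add = (\<lambda>b c. \<lambda>(i, j)\<in>\<Lambda>. b (i, j) \<oplus>\<^bsub>bim \<M> j i\<^esub> c (i, j)),
     smult = (\<lambda>s b. \<lambda>(i, j)\<in>\<Lambda>. s j \<odot>\<^bsub>bim \<M> j i\<^esub> b (i, j)),
     rsmult = (\<lambda>b s. \<lambda>(i, j)\<in>\<Lambda>. rsmult (bim \<M> j i) (b (i, j)) (s i))\<rparr>"

type_synonym ('i, 'r, 'b) quiver_elem = "(('i \<times> 'i \<Rightarrow> 'b) list \<times> ('i \<Rightarrow> 'r) \<Rightarrow>\<^sub>0 int) set"

definition quiver_algebra ::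
    "('i::finite, 'r, 'b, 'f) modulation \<Rightarrow> ('i \<times> 'i) set \<Rightarrow> ('i, 'r, 'b) quiver_elem ring" where
  "quiver_algebra \<M> \<Lambda> = tensor_ring (product_ring \<M>) (arrow_bimodule \<M> \<Lambda>)"

definition at_vertex ::
    "('i::finite, 'r, 'b, 'f) modulation \<Rightarrow> ('i \<times> 'i) set \<Rightarrow> 'i \<Rightarrow> 'r \<Rightarrow> ('i, 'r, 'b) quiver_elem" where
  "at_vertex \<M> \<Lambda> i s = tensor_ring_scalar (product_ring \<M>) (arrow_bimodule \<M> \<Lambda>)
     (\<lambda>j. if j = i then s else \<zero>\<^bsub>dr \<M> j\<^esub>)"

definition at_arrow ::
    "('i::finite, 'r, 'b, 'f) modulation \<Rightarrow> ('i \<times> 'i) set \<Rightarrow> 'i \<Rightarrow> 'i \<Rightarrow> 'b \<Rightarrow>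
     ('i, 'r, 'b) quiver_elem" where
  "at_arrow \<M> \<Lambda> i j b = tensor_ring_elem (product_ring \<M>) (arrow_bimodule \<M> \<Lambda>)
     (\<lambda>(i', j')\<in>\<Lambda>. if (i', j') = (i, j) then b else \<zero>\<^bsub>bim \<M> j' i'\<^esub>)"

definition idem ::
    "('i::finite, 'r, 'b, 'f) modulation \<Rightarrow> ('i \<times> 'i) set \<Rightarrow> 'i \<Rightarrow> ('i, 'r, 'b) quiver_elem" where
  "idem \<M> \<Lambda> i = at_vertex \<M> \<Lambda> i \<one>\<^bsub>dr \<M> i\<^esub>"

text \<open>The identification of left modules \<open>N\<close> over the quiver algebra with representations: the space at
  \<open>i\<close> is \<open>e\<^sub>i N\<close>, and the map of the arrow \<open>i \<rightarrow> j\<close> is \<open>b \<otimes> n \<mapsto> b n\<close>.\<close>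

definition rep_of_module ::
    "('i::finite, 'r, 'b, 'f) modulation \<Rightarrow> ('i \<times> 'i) set \<Rightarrow> (('i, 'r, 'b) quiver_elem, 'm) module \<Rightarrow>
     ('i, 'r, 'b, 'm) rep" where
  "rep_of_module \<M> \<Lambda> N = (let
     X = (\<lambda>i. \<lparr>carrier = (\<lambda>n. idem \<M> \<Lambda> i \<odot>\<^bsub>N\<^esub> n) ` carrier N,
            monoid.mult = undefined, one = undefined, ring.zero = \<zero>\<^bsub>N\<^esub>, ring.add = (\<oplus>\<^bsub>N\<^esub>),
            smult = (\<lambda>s n. at_vertex \<M> \<Lambda> i s \<odot>\<^bsub>N\<^esub> n)\<rparr>)
     in \<lparr>spc = X,
         mp = (\<lambda>i j. \<lambda>t\<in>carrier (arrow_tensor \<M> j i (X i)).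
            tensor_lift (X j) (\<lambda>b n. at_arrow \<M> \<Lambda> i j b \<odot>\<^bsub>N\<^esub> n) t)\<rparr>)"

definition projective_module ::
    "('i::finite, 'r, 'b, 'f) modulation \<Rightarrow> ('i \<times> 'i) set \<Rightarrow> 'i \<Rightarrow>
     (('i, 'r, 'b) quiver_elem, ('i, 'r, 'b) quiver_elem) module" where
  "projective_module \<M> \<Lambda> x = (let T = quiver_algebra \<M> \<Lambda> in
     \<lparr>carrier = (\<lambda>t. t \<otimes>\<^bsub>T\<^esub> idem \<M> \<Lambda> x) ` carrier T, monoid.mult = undefined, one = undefined,
      ring.zero = \<zero>\<^bsub>T\<^esub>, ring.add = (\<oplus>\<^bsub>T\<^esub>), smult = (\<otimes>\<^bsub>T\<^esub>)\<rparr>)"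

definition projective_rep ::
    "('i::finite, 'r, 'b, 'f) modulation \<Rightarrow> ('i \<times> 'i) set \<Rightarrow> 'i \<Rightarrow>
     ('i, 'r, 'b, ('i, 'r, 'b) quiver_elem) rep" where
  "projective_rep \<M> \<Lambda> x = rep_of_module \<M> \<Lambda> (projective_module \<M> \<Lambda> x)"


section \<open>Coordinate spaces and simple representations\<close>

text \<open>Kernels and cokernels of maps between tensor products have elements of a more complicated type than
  the spaces one starts with. In order that reflection functors can be iterated, the new space at the
  reflected vertex is the coordinate space isomorphic to the (finite dimensional) kernel or cokernel,
  along an arbitrary fixed isomorphism. Elements of spaces are therefore of type \<^typ>\<open>'v + 'r list\<close>,
  where \<^typ>\<open>'v\<close> is arbitrary and the right summand holds coordinate vectors.\<close>

definition coord_space :: "'r ring \<Rightarrow> nat \<Rightarrow> ('r, 'v + 'r list) module" where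
  "coord_space R n = \<lparr>carrier = Inr ` {xs. length xs = n \<and> set xs \<subseteq> carrier R},
     monoid.mult = undefined, one = undefined,
     ring.zero = Inr (replicate n \<zero>\<^bsub>R\<^esub>),
     ring.add = (\<lambda>u w. Inr (map2 (\<oplus>\<^bsub>R\<^esub>) (projr u) (projr w))),
     smult = (\<lambda>a u. Inr (map (\<lambda>s. a \<otimes>\<^bsub>R\<^esub> s) (projr u)))\<rparr>"

definition coord_iso :: "'r ring \<Rightarrow> ('r, 'w) module \<Rightarrow> 'v + 'r list \<Rightarrow> 'w" where
  "coord_iso R M = (SOME \<theta>. \<theta> \<in> lin_hom R (coord_space R (ldim R M)) M \<and>
     bij_betw \<theta> (carrier (coord_space R (ldim R M))) (carrier M))"

definition simple_rep ::
    "('i::finite, 'r, 'b, 'f) modulation \<Rightarrow> 'i \<Rightarrow> ('i, 'r, 'b, 'v + 'r list) rep" where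
  "simple_rep \<M> x = (let X = (\<lambda>i. coord_space (dr \<M> i) (if i = x then 1 else 0)) in
     \<lparr>spc = X, mp = (\<lambda>i j. \<lambda>t\<in>carrier (arrow_tensor \<M> j i (X i)). \<zero>\<^bsub>X j\<^esub>)\<rparr>)"


section \<open>Reflection functors\<close>

definition is_sink :: "('i \<times> 'i) set \<Rightarrow> 'i \<Rightarrow> bool" where
  "is_sink \<Lambda> x \<longleftrightarrow> (\<forall>y. (x, y) \<notin> \<Lambda>)"

definition reflect :: "'i \<Rightarrow> ('i \<times> 'i) set \<Rightarrow> ('i \<times> 'i) set" where
  "reflect x \<Lambda> = {(i, j). if i = x \<or> j = x then (j, i) \<in> \<Lambda> else (i, j) \<in> \<Lambda>}"

text \<open>The natural isomorphism \<open>Hom(W, \<^sub>xB\<^sub>y \<otimes> V) \<cong> Hom(\<^sub>yB\<^sub>x \<otimes> W, V)\<close>, for \<open>W\<close> a space at \<open>x\<close> and \<open>V\<close> a space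
  at \<open>y\<close>. It comes from the isomorphism of \<open>\<^sub>xB\<^sub>y\<close> with the left dual of \<open>\<^sub>yB\<^sub>x\<close>: the map \<open>c\<close> is sent to the
  map \<open>b' \<otimes> w \<mapsto> (ev\<^bsub>b'\<^esub> \<otimes> 1) (c w)\<close>, where \<open>ev\<^bsub>b'\<^esub>\<close> evaluates functionals on \<open>\<^sub>yB\<^sub>x\<close> at \<open>b'\<close>.\<close>

definition adjoint_map ::
    "('i::finite, 'r, 'b, 'f) modulation \<Rightarrow> 'i \<Rightarrow> 'i \<Rightarrow> ('r, 'w) module \<Rightarrow> ('r, 'v) module \<Rightarrow>
     ('w \<Rightarrow> ('b, 'v) tens) \<Rightarrow> ('b, 'w) tens \<Rightarrow> 'v" where
  "adjoint_map \<M> x y W V c = (\<lambda>t\<in>carrier (arrow_tensor \<M> y x W).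
     tensor_lift V (\<lambda>b' w. tensor_lift V (\<lambda>b v. dual_iso \<M> y x b b' \<odot>\<^bsub>V\<^esub> v) (c w)) t)"

text \<open>\<open>F\<^sub>x\<^sup>+\<close>, for a sink \<open>x\<close> of \<open>\<Lambda>\<close> and a representation of \<open>\<Lambda>\<close>.\<close>

definition reflect_plus ::
    "('i::finite, 'r, 'b, 'f) modulation \<Rightarrow> ('i \<times> 'i) set \<Rightarrow> 'i \<Rightarrow> ('i, 'r, 'b, 'v + 'r list) rep \<Rightarrow>
     ('i, 'r, 'b, 'v + 'r list) rep" where
  "reflect_plus \<M> \<Lambda> x V = (let
     N = {y. (y, x) \<in> \<Lambda>};
     D = direct_sum N (\<lambda>y. arrow_tensor \<M> x y (spc V y));
     h = (\<lambda>u. \<Oplus>\<^bsub>spc V x\<^esub>y\<in>N. mp V y x (u y));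
     Ker = D\<lparr>carrier := {u \<in> carrier D. h u = \<zero>\<^bsub>spc V x\<^esub>}\<rparr>;
     \<theta> = coord_iso (dr \<M> x) Ker;
     W = coord_space (dr \<M> x) (ldim (dr \<M> x) Ker)
     in \<lparr>spc = (spc V)(x := W),
         mp = (\<lambda>i j. if i = x
           then adjoint_map \<M> x j W (spc V j) (\<lambda>w\<in>carrier W. \<theta> w j)
           else mp V i j)\<rparr>)"

text \<open>\<open>F\<^sub>x\<^sup>-\<close>, for a source \<open>x\<close> of \<open>\<Lambda>\<close> and a representation of \<open>\<Lambda>\<close>.\<close>

definition reflect_minus ::
    "('i::finite, 'r, 'b, 'f) modulation \<Rightarrow> ('i \<times> 'i) set \<Rightarrow> 'i \<Rightarrow> ('i, 'r, 'b, 'v + 'r list) rep \<Rightarrow>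
     ('i, 'r, 'b, 'v + 'r list) rep" where
  "reflect_minus \<M> \<Lambda> x V = (let
     N = {y. (x, y) \<in> \<Lambda>};
     T = (\<lambda>y. arrow_tensor \<M> x y (spc V y));
     D = direct_sum N T;
     c = (\<lambda>y. inv_into (lin_hom (dr \<M> x) (spc V x) (T y))
                (adjoint_map \<M> x y (spc V x) (spc V y)) (mp V x y));
     Im = (\<lambda>v. \<lambda>y\<in>N. c y v) ` carrier (spc V x);
     Coker = quotient_module D Im;
     \<theta> = coord_iso (dr \<M> x) Coker;
     W = coord_space (dr \<M> x) (ldim (dr \<M> x) Coker)
     in \<lparr>spc = (spc V)(x := W),
         mp = (\<lambda>i j. if j = x
           then (\<lambda>t\<in>carrier (T i). inv_into (carrier W) \<theta>
                  (Im +>\<^bsub>D\<^esub> (\<lambda>y\<in>N. if y = i then t else \<zero>\<^bsub>T y\<^esub>)))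
           else mp V i j)\<rparr>)"


section \<open>Admissible sequences\<close>

fun admissible :: "('i \<times> 'i) set \<Rightarrow> 'i list \<Rightarrow> bool" where
  "admissible \<Lambda> [] \<longleftrightarrow> True"
| "admissible \<Lambda> (x # S) \<longleftrightarrow> is_sink \<Lambda> x \<and> admissible (reflect x \<Lambda>) S"

text \<open>\<open>\<Lambda>\<^sup>S\<close>; the first vertex of \<open>S\<close> is reflected first.\<close>

definition reflect_seq :: "('i \<times> 'i) set \<Rightarrow> 'i list \<Rightarrow> ('i \<times> 'i) set" where
  "reflect_seq \<Lambda> S = fold reflect S \<Lambda>"

fun reflect_plus_seq ::
    "('i::finite, 'r, 'b, 'f) modulation \<Rightarrow> ('i \<times> 'i) set \<Rightarrow> 'i list \<Rightarrow>
     ('i, 'r, 'b, 'v + 'r list) rep \<Rightarrow> ('i, 'r, 'b, 'v + 'r list) rep" where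
  "reflect_plus_seq \<M> \<Lambda> [] V = V"
| "reflect_plus_seq \<M> \<Lambda> (x # S) V = reflect_plus_seq \<M> (reflect x \<Lambda>) S (reflect_plus \<M> \<Lambda> x V)"

text \<open>The composite \<open>F\<^bsub>x\<^sub>1\<^esub>\<^sup>- \<cdots> F\<^bsub>x\<^sub>s\<^esub>\<^sup>-\<close> for \<open>S = x\<^sub>1,\<dots>,x\<^sub>s\<close>; it takes representations of
  \<open>\<Lambda>\<^sup>S\<close> to representations of \<open>\<Lambda>\<close>.\<close>

fun reflect_minus_seq ::
    "('i::finite, 'r, 'b, 'f) modulation \<Rightarrow> ('i \<times> 'i) set \<Rightarrow> 'i list \<Rightarrow>
     ('i, 'r, 'b, 'v + 'r list) rep \<Rightarrow> ('i, 'r, 'b, 'v + 'r list) rep" where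
  "reflect_minus_seq \<M> \<Lambda> [] V = V"
| "reflect_minus_seq \<M> \<Lambda> (x # S) V =
     reflect_minus \<M> (reflect x \<Lambda>) x (reflect_minus_seq \<M> (reflect x \<Lambda>) S V)"

text \<open>The sequences \<open>K\<close> for which \<open>F(K)\<close> is the Coxeter functor.\<close>

definition coxeter_seq :: "('i::finite \<times> 'i) set \<Rightarrow> 'i list \<Rightarrow> bool" where
  "coxeter_seq \<Lambda> K \<longleftrightarrow> admissible \<Lambda> K \<and> distinct K \<and> set K = UNIV"

definition seq_swap :: "('i \<Rightarrow> 'i \<Rightarrow> nat) \<Rightarrow> ('i \<times> 'i) set \<Rightarrow> 'i list \<Rightarrow> 'i list \<Rightarrow> bool" where
  "seq_swap b \<Lambda> S T \<longleftrightarrow> admissible \<Lambda> S \<and> admissible \<Lambda> T \<and>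
     (\<exists>us x y ws. S = us @ [x, y] @ ws \<and> T = us @ [y, x] @ ws \<and> \<not> edge b x y)"

definition seq_equiv :: "('i \<Rightarrow> 'i \<Rightarrow> nat) \<Rightarrow> ('i \<times> 'i) set \<Rightarrow> 'i list \<Rightarrow> 'i list \<Rightarrow> bool" where
  "seq_equiv b \<Lambda> S T \<longleftrightarrow> admissible \<Lambda> S \<and> admissible \<Lambda> T \<and> equivclp (seq_swap b \<Lambda>) S T"

definition subsequence :: "('i \<Rightarrow> 'i \<Rightarrow> nat) \<Rightarrow> ('i \<times> 'i) set \<Rightarrow> 'i list \<Rightarrow> 'i list \<Rightarrow> bool" where
  "subsequence b \<Lambda> S T \<longleftrightarrow> admissible \<Lambda> S \<and> admissible \<Lambda> T \<and>
     (\<exists>U. admissible (reflect_seq \<Lambda> S) U \<and> seq_equiv b \<Lambda> T (S @ U))"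

definition annihilates ::
    "('i::finite, 'r, 'b, 'f) modulation \<Rightarrow> ('i \<times> 'i) set \<Rightarrow> 'i list \<Rightarrow>
     ('i, 'r, 'b, 'v + 'r list) rep \<Rightarrow> bool" where
  "annihilates \<M> \<Lambda> S V \<longleftrightarrow> admissible \<Lambda> S \<and> zero_rep (reflect_plus_seq \<M> \<Lambda> S V)"

definition shortest_annihilating ::
    "('i::finite, 'r, 'b, 'f) modulation \<Rightarrow> ('i \<times> 'i) set \<Rightarrow> 'i list \<Rightarrow>
     ('i, 'r, 'b, 'v + 'r list) rep \<Rightarrow> bool" where
  "shortest_annihilating \<M> \<Lambda> S V \<longleftrightarrow> annihilates \<M> \<Lambda> S V \<and>
     (\<forall>T. subsequence (val \<M>) \<Lambda> T S \<and> \<not> seq_equiv (val \<M>) \<Lambda> T S \<longrightarrow> \<not> annihilates \<M> \<Lambda> T V)"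


section \<open>Principal sequences\<close>

text \<open>In the poset of vertices, \<open>x \<le> y\<close> means \<^term>\<open>(x, y) \<in> \<Lambda>\<^sup>*\<close>.\<close>

definition is_filter :: "('i \<times> 'i) set \<Rightarrow> 'i set \<Rightarrow> bool" where
  "is_filter \<Lambda> F \<longleftrightarrow> (\<forall>x y. x \<in> F \<and> (x, y) \<in> \<Lambda>\<^sup>* \<longrightarrow> y \<in> F)"

definition principal_filter :: "('i \<times> 'i) set \<Rightarrow> 'i \<Rightarrow> 'i set" where
  "principal_filter \<Lambda> x = {y. (x, y) \<in> \<Lambda>\<^sup>*}"

definition filter_hull :: "('i \<Rightarrow> 'i \<Rightarrow> nat) \<Rightarrow> ('i \<times> 'i) set \<Rightarrow> 'i set \<Rightarrow> 'i set" where
  "filter_hull b \<Lambda> F =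
     \<Inter>{G. is_filter \<Lambda> G \<and> F \<subseteq> G \<and> (\<forall>y. y \<notin> F \<and> (\<exists>z\<in>F. edge b y z) \<longrightarrow> y \<in> G)}"

definition canonical_form ::
    "('i \<Rightarrow> 'i \<Rightarrow> nat) \<Rightarrow> ('i \<times> 'i) set \<Rightarrow> 'i list \<Rightarrow> 'i list list \<Rightarrow> bool" where
  "canonical_form b \<Lambda> S Ss \<longleftrightarrow> seq_equiv b \<Lambda> S (concat Ss) \<and>
     (\<forall>T\<in>set Ss. T \<noteq> [] \<and> distinct T) \<and>
     (\<forall>i<length Ss. set (Ss ! i) = set (concat (drop i Ss)))"

text \<open>\<open>S\<close> is a representative of the class \<open>S\<^bsub>r,x\<^esub>\<close>. Blocks are numbered from \<open>0\<close> here.\<close>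

definition principal_seq ::
    "('i \<Rightarrow> 'i \<Rightarrow> nat) \<Rightarrow> ('i \<times> 'i) set \<Rightarrow> nat \<Rightarrow> 'i \<Rightarrow> 'i list \<Rightarrow> bool" where
  "principal_seq b \<Lambda> r x S \<longleftrightarrow> 0 < r \<and> (\<exists>Ss. canonical_form b \<Lambda> S Ss \<and> length Ss = r \<and>
     set (Ss ! (r - 1)) = principal_filter \<Lambda> x \<and>
     (\<forall>i. i + 1 < r \<longrightarrow> set (Ss ! i) = filter_hull b \<Lambda> (set (Ss ! (i + 1)))))"

end

theory Submission
  imports Defs
begin

text \<open>An indecomposable representation stays indecomposable under the reflections of an admissible sequence
  until it is annihilated, and it is annihilated by \<open>F\<^sub>y\<^sup>+\<close> only if it is concentrated at \<open>y\<close>. The occurrence of a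
  vertex at which this happens does not change when two consecutive vertices not joined by an edge are
  interchanged: a representation annihilated by two commuting reflections splits over the two sinks.
  Admissible sequences are determined up to \<open>\<sim>\<close> by the multiplicities of the vertices, and every
  admissible sequence is a subsequence of a power of a Coxeter sequence \<open>K\<close>. When \<open>F(K)\<close> is applied to \<open>P\<^sub>x\<close>, a
  vertex \<open>y\<close> reached before \<open>x\<close> gets the zero space, because the arrows into \<open>y\<close> induce an injection of
  their tensor products into the space at \<open>y\<close>; hence \<open>P\<^sub>x\<close> is annihilated precisely when \<open>x\<close> is reached.
  It follows that \<open>S\<close> annihilates \<open>M\<close> if and only if \<open>x\<close> occurs more than \<open>\<nu>\<close> times in \<open>S\<close>, and \<open>S\<^bsub>\<nu>+1,x\<^esub>\<close> has
  the smallest multiplicities among these sequences. Just before the last reflection the representation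
  is indecomposable and concentrated at the sink \<open>x\<close>, so it is \<open>L\<^sub>x\<close>, and \<open>F\<^sub>y\<^sup>-\<close> undoes \<open>F\<^sub>y\<^sup>+\<close> on indecomposable
  representations that are not annihilated.\<close>

section \<open>Linear algebra over division rings\<close>

text \<open>Two obstacles shape the argument. The hypothesis is only an isomorphism with
  \<open>P_x\<close>, while \<open>reflect_plus\<close> involves an arbitrary choice of coordinates.
  So no sink reflection is ever applied to an isomorphism: the facts about \<open>P_x\<close> that
  decide when it is annihilated (nonzero space at \<open>x\<close>, support above \<open>x\<close>,
  arrows into a vertex inducing an injection) are transported to the given representation, and the
  reflections act on that one. Interchanging two reflections must not cost an isomorphism either. It
  does not, because the coordinates chosen at a sink depend only on the kernel formed there, which
  is literally the same module in both orders; the results then agree on all arrows.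
  Indecomposability is treated as the absence of idempotent endomorphisms other than 0 and 1, since
  an idempotent can be carried across a kernel or a quotient component by component. The scalars are
  noncommutative, so dimension is built on the exchange property, with finite generation as the
  working form of finite dimension.\<close>

lemma (in abelian_group) minus_add_cancel: "x \<in> carrier G \<Longrightarrow> y \<in> carrier G \<Longrightarrow> (x \<ominus> y) \<oplus> y = x"
  by (simp add: minus_eq a_assoc l_neg)

lemma (in abelian_group) add_minus_cancel: "x \<in> carrier G \<Longrightarrow> y \<in> carrier G \<Longrightarrow> (x \<oplus> y) \<ominus> y = x"
  by (simp add: minus_eq a_assoc r_neg)

lemma (in abelian_group) minus_eq_zeroD: "x \<ominus> y = \<zero> \<Longrightarrow> x \<in> carrier G \<Longrightarrow> y \<in> carrier G \<Longrightarrow> x = y"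
  using minus_add_cancel[of x y] by simp

lemma (in abelian_group) minus_self: "x \<in> carrier G \<Longrightarrow> x \<ominus> x = \<zero>"
  by (simp add: minus_eq r_neg)

lemma (in abelian_group) add_minus_minus:
  "x \<in> carrier G \<Longrightarrow> y \<in> carrier G \<Longrightarrow> (x \<oplus> y) \<ominus> x \<ominus> y = \<zero>"
  using add_minus_cancel[of y x] by (simp add: a_comm minus_self)

lemma (in abelian_group) minus_eq_minusI:
  assumes "u \<oplus> c = u' \<oplus> c'" "u \<in> carrier G" "c \<in> carrier G" "u' \<in> carrier G" "c' \<in> carrier G"
  shows "u \<ominus> u' = c' \<ominus> c"
proof -
  have "u \<ominus> u' = (u \<oplus> c) \<oplus> (\<ominus> c \<oplus> \<ominus> u')" using assms(2-) by (simp add: minus_eq a_assoc r_neg2)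
  also have "\<dots> = (c' \<oplus> u') \<oplus> (\<ominus> u' \<oplus> \<ominus> c)" using assms by (simp add: a_comm)
  also have "\<dots> = c' \<ominus> c" using assms(2-) by (simp add: minus_eq a_assoc r_neg2)
  finally show ?thesis .
qed

section \<open>Additive and linear maps\<close>

definition additive_map :: "('v, 'z) ring_scheme \<Rightarrow> ('w, 'u) ring_scheme \<Rightarrow> ('v \<Rightarrow> 'w) \<Rightarrow> bool" where
  "additive_map M N f \<longleftrightarrow> f \<in> carrier M \<rightarrow> carrier N \<and>
     (\<forall>m\<in>carrier M. \<forall>n\<in>carrier M. f (m \<oplus>\<^bsub>M\<^esub> n) = f m \<oplus>\<^bsub>N\<^esub> f n)"

text \<open>Unlike \<open>lin_hom\<close> this leaves the values off the carrier free, so that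
  composites and pointwise formulas are maps without being restricted. \<open>lin_hom_iff\<close>
  and \<open>restrict_lin_hom\<close> translate between the two forms.\<close>

definition linear_map ::
    "('r, 'y) ring_scheme \<Rightarrow> ('r, 'v, 'z) module_scheme \<Rightarrow> ('r, 'w, 'u) module_scheme \<Rightarrow> ('v \<Rightarrow> 'w) \<Rightarrow> bool" where
  "linear_map R M N f \<longleftrightarrow> additive_map M N f \<and>
     (\<forall>a\<in>carrier R. \<forall>m\<in>carrier M. f (a \<odot>\<^bsub>M\<^esub> m) = a \<odot>\<^bsub>N\<^esub> f m)"

lemma additive_mapI:
  assumes "\<And>m. m \<in> carrier M \<Longrightarrow> f m \<in> carrier N"
    and "\<And>m n. m \<in> carrier M \<Longrightarrow> n \<in> carrier M \<Longrightarrow> f (m \<oplus>\<^bsub>M\<^esub> n) = f m \<oplus>\<^bsub>N\<^esub> f n"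
  shows "additive_map M N f"
  using assms by (auto simp: additive_map_def)

lemma linear_mapI:
  assumes "\<And>m. m \<in> carrier M \<Longrightarrow> f m \<in> carrier N"
    and "\<And>m n. m \<in> carrier M \<Longrightarrow> n \<in> carrier M \<Longrightarrow> f (m \<oplus>\<^bsub>M\<^esub> n) = f m \<oplus>\<^bsub>N\<^esub> f n"
    and "\<And>a m. a \<in> carrier R \<Longrightarrow> m \<in> carrier M \<Longrightarrow> f (a \<odot>\<^bsub>M\<^esub> m) = a \<odot>\<^bsub>N\<^esub> f m"
  shows "linear_map R M N f"
  using assms by (auto simp: linear_map_def additive_map_def)

lemma additive_mapD:
  assumes "additive_map M N f"
  shows additive_map_closed: "m \<in> carrier M \<Longrightarrow> f m \<in> carrier N"
    and additive_map_add: "m \<in> carrier M \<Longrightarrow> n \<in> carrier M \<Longrightarrow> f (m \<oplus>\<^bsub>M\<^esub> n) = f m \<oplus>\<^bsub>N\<^esub> f n"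
  using assms by (auto simp: additive_map_def)

lemma linear_mapD:
  assumes "linear_map R M N f"
  shows linear_map_additive: "additive_map M N f"
    and linear_map_closed: "m \<in> carrier M \<Longrightarrow> f m \<in> carrier N"
    and linear_map_add: "m \<in> carrier M \<Longrightarrow> n \<in> carrier M \<Longrightarrow> f (m \<oplus>\<^bsub>M\<^esub> n) = f m \<oplus>\<^bsub>N\<^esub> f n"
    and linear_map_smult: "a \<in> carrier R \<Longrightarrow> m \<in> carrier M \<Longrightarrow> f (a \<odot>\<^bsub>M\<^esub> m) = a \<odot>\<^bsub>N\<^esub> f m"
  using assms by (auto simp: linear_map_def additive_map_def)

lemma lin_hom_iff: "f \<in> lin_hom R M N \<longleftrightarrow> linear_map R M N f \<and> f \<in> extensional (carrier M)"
  by (auto simp: lin_hom_def linear_map_def additive_map_def PiE_def)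

lemma lin_hom_linear: "f \<in> lin_hom R M N \<Longrightarrow> linear_map R M N f"
  by (simp add: lin_hom_iff)

lemma linear_map_cong:
  assumes "abelian_monoid M" "\<And>a m. a \<in> carrier R \<Longrightarrow> m \<in> carrier M \<Longrightarrow> a \<odot>\<^bsub>M\<^esub> m \<in> carrier M"
    "\<And>m. m \<in> carrier M \<Longrightarrow> f m = g m"
  shows "linear_map R M N f \<longleftrightarrow> linear_map R M N g"
proof -
  interpret abelian_monoid M by fact
  show ?thesis using assms(2,3) by (auto simp: linear_map_def additive_map_def Pi_def)
qed

lemma restrict_lin_hom:
  assumes "left_module R M" "linear_map R M N f"
  shows "restrict f (carrier M) \<in> lin_hom R M N"
proof -
  interpret left_module R M by fact
  show ?thesis
    using assms(2) unfolding lin_hom_iff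
    by (subst linear_map_cong[of M R _ f]) (auto intro: M.abelian_monoid_axioms smult_closed)
qed

lemma additive_map_comp:
  assumes "additive_map L M f" "additive_map M N g"
  shows "additive_map L N (\<lambda>x. g (f x))"
  using assms by (auto simp: additive_map_def Pi_iff)

lemma linear_map_comp:
  assumes "linear_map R L M f" "linear_map R M N g"
  shows "linear_map R L N (\<lambda>x. g (f x))"
  using assms by (auto simp: linear_map_def additive_map_def Pi_iff)

lemma additive_map_zero:
  assumes "abelian_group M" "abelian_group N" "additive_map M N f"
  shows "f \<zero>\<^bsub>M\<^esub> = \<zero>\<^bsub>N\<^esub>"
proof -
  interpret M: abelian_group M by fact
  interpret N: abelian_group N by fact
  have c: "f \<zero>\<^bsub>M\<^esub> \<in> carrier N" using assms(3) by (simp add: additive_map_closed)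
  have "f \<zero>\<^bsub>M\<^esub> \<oplus>\<^bsub>N\<^esub> f \<zero>\<^bsub>M\<^esub> = f \<zero>\<^bsub>M\<^esub>"
    using additive_map_add[OF assms(3), of "\<zero>\<^bsub>M\<^esub>" "\<zero>\<^bsub>M\<^esub>"] by simp
  then show ?thesis using c by (metis N.add.l_cancel_one')
qed

lemma additive_map_neg:
  assumes "abelian_group M" "abelian_group N" "additive_map M N f" "m \<in> carrier M"
  shows "f (\<ominus>\<^bsub>M\<^esub> m) = \<ominus>\<^bsub>N\<^esub> f m"
proof -
  interpret M: abelian_group M by fact
  interpret N: abelian_group N by fact
  have "f (\<ominus>\<^bsub>M\<^esub> m) \<oplus>\<^bsub>N\<^esub> f m = \<zero>\<^bsub>N\<^esub>"
    using additive_map_add[OF assms(3), of "\<ominus>\<^bsub>M\<^esub> m" m] assms(4) additive_map_zero[OF assms(1-3)]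
    by (simp add: M.l_neg)
  then show ?thesis using assms(3,4) by (simp add: N.minus_equality[symmetric] additive_map_closed)
qed

lemma additive_map_minus:
  assumes "abelian_group M" "abelian_group N" "additive_map M N f" "m \<in> carrier M" "n \<in> carrier M"
  shows "f (m \<ominus>\<^bsub>M\<^esub> n) = f m \<ominus>\<^bsub>N\<^esub> f n"
proof -
  interpret M: abelian_group M by fact
  show ?thesis
    using additive_map_neg[OF assms(1-3,5)] assms by (simp add: a_minus_def additive_map_add)
qed

lemma additive_map_finsum:
  assumes "abelian_group M" "abelian_group N" "additive_map M N f" "finite A" "g \<in> A \<rightarrow> carrier M"
  shows "f (\<Oplus>\<^bsub>M\<^esub>i\<in>A. g i) = (\<Oplus>\<^bsub>N\<^esub>i\<in>A. f (g i))"
proof -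
  interpret M: abelian_group M by fact
  interpret N: abelian_group N by fact
  show ?thesis using assms(4,5)
  proof (induction A)
    case empty
    then show ?case by (simp add: additive_map_zero[OF assms(1-3)])
  next
    case (insert x A)
    have "(\<lambda>i. f (g i)) \<in> A \<rightarrow> carrier N" "f (g x) \<in> carrier N"
      using insert.prems additive_map_closed[OF assms(3)] by auto
    then show ?case
      using insert additive_map_add[OF assms(3), of "g x" "\<Oplus>\<^bsub>M\<^esub>i\<in>A. g i"]
      by (simp add: Pi_iff)
  qed
qed

lemma additive_map_inj_onI:
  assumes "abelian_group M" "abelian_group N" "additive_map M N f"
    and "\<And>m. m \<in> carrier M \<Longrightarrow> f m = \<zero>\<^bsub>N\<^esub> \<Longrightarrow> m = \<zero>\<^bsub>M\<^esub>"
  shows "inj_on f (carrier M)"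
proof (rule inj_onI)
  interpret M: abelian_group M by fact
  interpret N: abelian_group N by fact
  fix m n assume mn: "m \<in> carrier M" "n \<in> carrier M" "f m = f n"
  then have "f (m \<ominus>\<^bsub>M\<^esub> n) = \<zero>\<^bsub>N\<^esub>"
    using additive_map_minus[OF assms(1-3)] additive_map_closed[OF assms(3)]
    by (simp add: N.r_neg a_minus_def)
  then have "m \<ominus>\<^bsub>M\<^esub> n = \<zero>\<^bsub>M\<^esub>" using mn assms(4) by simp
  then show "m = n" using mn by (metis M.minus_eq_zeroD)
qed

lemma linear_map_inv_into:
  assumes "abelian_group M" "left_module R M" "linear_map R M N f" "bij_betw f (carrier M) (carrier N)"
  shows "linear_map R N M (inv_into (carrier M) f)"
proof -
  interpret M: left_module R M by fact
  let ?g = "inv_into (carrier M) f"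
  have g: "?g n \<in> carrier M" "f (?g n) = n" if "n \<in> carrier N" for n
    using that assms(4) by (auto simp: bij_betw_def inv_into_into f_inv_into_f)
  have eq: "?g (f m) = m" if "m \<in> carrier M" for m
    using that assms(4) by (simp add: bij_betw_def)
  show ?thesis
  proof (rule linear_mapI)
    fix m n assume mn: "m \<in> carrier N" "n \<in> carrier N"
    have "?g (f (?g m \<oplus>\<^bsub>M\<^esub> ?g n)) = ?g m \<oplus>\<^bsub>M\<^esub> ?g n" using g mn by (intro eq) auto
    then show "?g (m \<oplus>\<^bsub>N\<^esub> n) = ?g m \<oplus>\<^bsub>M\<^esub> ?g n" using g mn assms(3) by (simp add: linear_map_add)
  next
    fix a n assume an: "a \<in> carrier R" "n \<in> carrier N"
    have "?g (f (a \<odot>\<^bsub>M\<^esub> ?g n)) = a \<odot>\<^bsub>M\<^esub> ?g n" using g an by (intro eq) (auto intro: M.smult_closed)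
    then show "?g (a \<odot>\<^bsub>N\<^esub> n) = a \<odot>\<^bsub>M\<^esub> ?g n" using g an assms(3) by (simp add: linear_map_smult)
  qed (use g in auto)
qed

section \<open>Submodules, kernels, images and projections\<close>

context left_module
begin

lemma smult_zero [simp]: "a \<in> carrier R \<Longrightarrow> a \<odot>\<^bsub>M\<^esub> \<zero>\<^bsub>M\<^esub> = \<zero>\<^bsub>M\<^esub>"
proof -
  assume a: "a \<in> carrier R"
  have "additive_map M M (\<lambda>m. a \<odot>\<^bsub>M\<^esub> m)"
    using a by (intro additive_mapI) (auto intro: smult_closed smult_r_distr)
  then show ?thesis by (rule additive_map_zero[OF M.abelian_group_axioms M.abelian_group_axioms])
qed

lemma zero_smult [simp]: "m \<in> carrier M \<Longrightarrow> \<zero>\<^bsub>R\<^esub> \<odot>\<^bsub>M\<^esub> m = \<zero>\<^bsub>M\<^esub>"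
proof -
  assume m: "m \<in> carrier M"
  have "\<zero>\<^bsub>R\<^esub> \<odot>\<^bsub>M\<^esub> m \<oplus>\<^bsub>M\<^esub> \<zero>\<^bsub>R\<^esub> \<odot>\<^bsub>M\<^esub> m = \<zero>\<^bsub>R\<^esub> \<odot>\<^bsub>M\<^esub> m"
    using smult_l_distr[of "\<zero>\<^bsub>R\<^esub>" "\<zero>\<^bsub>R\<^esub>" m] m by simp
  then show ?thesis using m by (metis M.add.l_cancel_one' R.zero_closed smult_closed)
qed

lemma neg_smult: "\<lbrakk>a \<in> carrier R; m \<in> carrier M\<rbrakk> \<Longrightarrow> (\<ominus>\<^bsub>R\<^esub> a) \<odot>\<^bsub>M\<^esub> m = \<ominus>\<^bsub>M\<^esub> (a \<odot>\<^bsub>M\<^esub> m)"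
proof -
  assume a: "a \<in> carrier R" "m \<in> carrier M"
  have "(\<ominus>\<^bsub>R\<^esub> a) \<odot>\<^bsub>M\<^esub> m \<oplus>\<^bsub>M\<^esub> a \<odot>\<^bsub>M\<^esub> m = \<zero>\<^bsub>M\<^esub>"
    using smult_l_distr[of "\<ominus>\<^bsub>R\<^esub> a" a m] a by (simp add: R.l_neg)
  then show ?thesis using a by (simp add: M.minus_equality[symmetric] smult_closed)
qed

lemma smult_minus:
  "\<lbrakk>a \<in> carrier R; b \<in> carrier R; m \<in> carrier M\<rbrakk> \<Longrightarrow> (a \<ominus>\<^bsub>R\<^esub> b) \<odot>\<^bsub>M\<^esub> m = a \<odot>\<^bsub>M\<^esub> m \<ominus>\<^bsub>M\<^esub> b \<odot>\<^bsub>M\<^esub> m"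
  by (simp add: a_minus_def smult_l_distr neg_smult)

text \<open>Negatives come from the scalar -1, so only the closure conditions usual for modules
  remain to be checked.\<close>

lemma left_submoduleI:
  assumes "U \<subseteq> carrier M" "\<zero>\<^bsub>M\<^esub> \<in> U"
    and "\<And>a b. a \<in> U \<Longrightarrow> b \<in> U \<Longrightarrow> a \<oplus>\<^bsub>M\<^esub> b \<in> U"
    and "\<And>a x. a \<in> carrier R \<Longrightarrow> x \<in> U \<Longrightarrow> a \<odot>\<^bsub>M\<^esub> x \<in> U"
  shows "submodule U R M"
proof (intro submodule.intro subgroup.intro)
  fix x assume x: "x \<in> U"
  then have "\<ominus>\<^bsub>M\<^esub> x = (\<ominus>\<^bsub>R\<^esub> \<one>\<^bsub>R\<^esub>) \<odot>\<^bsub>M\<^esub> x" using assms(1) by (auto simp: neg_smult smult_one)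
  then show "inv\<^bsub>add_monoid M\<^esub> x \<in> U" using assms(4) x by (simp add: a_inv_def)
qed (use assms in \<open>auto simp: submodule_axioms_def\<close>)

lemma submoduleD:
  assumes "submodule U R M"
  shows submodule_subset: "U \<subseteq> carrier M"
    and submodule_carrier: "x \<in> U \<Longrightarrow> x \<in> carrier M"
    and submodule_zero: "\<zero>\<^bsub>M\<^esub> \<in> U"
    and submodule_add: "x \<in> U \<Longrightarrow> y \<in> U \<Longrightarrow> x \<oplus>\<^bsub>M\<^esub> y \<in> U"
    and submodule_smult: "a \<in> carrier R \<Longrightarrow> x \<in> U \<Longrightarrow> a \<odot>\<^bsub>M\<^esub> x \<in> U"
    and submodule_neg: "x \<in> U \<Longrightarrow> \<ominus>\<^bsub>M\<^esub> x \<in> U"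
    and submodule_minus: "x \<in> U \<Longrightarrow> y \<in> U \<Longrightarrow> x \<ominus>\<^bsub>M\<^esub> y \<in> U"
proof -
  interpret submodule U R M by fact
  show U: "U \<subseteq> carrier M" using subset by simp
  show "x \<in> U \<Longrightarrow> x \<in> carrier M" using U by auto
  show "\<zero>\<^bsub>M\<^esub> \<in> U" using one_closed by simp
  show add: "x \<in> U \<Longrightarrow> y \<in> U \<Longrightarrow> x \<oplus>\<^bsub>M\<^esub> y \<in> U" for x y using m_closed by simp
  show "a \<in> carrier R \<Longrightarrow> x \<in> U \<Longrightarrow> a \<odot>\<^bsub>M\<^esub> x \<in> U" by simp
  show neg: "x \<in> U \<Longrightarrow> \<ominus>\<^bsub>M\<^esub> x \<in> U" for x using m_inv_closed by (simp add: a_inv_def)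
  show "x \<in> U \<Longrightarrow> y \<in> U \<Longrightarrow> x \<ominus>\<^bsub>M\<^esub> y \<in> U" using add neg by (simp add: a_minus_def)
qed

lemma submodule_finsum:
  assumes "submodule U R M" "finite A" "f \<in> A \<rightarrow> U"
  shows "(\<Oplus>\<^bsub>M\<^esub>i\<in>A. f i) \<in> U"
  using assms(2,3)
proof (induction A)
  case (insert x A)
  have "f \<in> A \<rightarrow> carrier M" "f x \<in> carrier M" using insert.prems submodule_carrier[OF assms(1)] by auto
  then show ?case using insert submodule_add[OF assms(1)] by simp
qed (simp add: submodule_zero[OF assms(1)])

lemma submodule_left_module:
  assumes "submodule U R M"
  shows "left_module R (M\<lparr>carrier := U\<rparr>)"
proof -
  note U = submoduleD[OF assms]
  have "abelian_group (M\<lparr>carrier := U\<rparr>)"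
  proof (rule abelian_groupI)
    show "\<exists>y\<in>carrier (M\<lparr>carrier := U\<rparr>). y \<oplus>\<^bsub>M\<lparr>carrier := U\<rparr>\<^esub> x = \<zero>\<^bsub>M\<lparr>carrier := U\<rparr>\<^esub>"
      if "x \<in> carrier (M\<lparr>carrier := U\<rparr>)" for x
      using that U(2,6) by (auto intro!: bexI[of _ "\<ominus>\<^bsub>M\<^esub> x"] simp: M.l_neg)
  qed (use U in \<open>auto simp: M.a_ac\<close>)
  then show ?thesis
    using U by (intro left_module.intro left_module_axioms.intro R.ring_axioms)
      (auto intro: smult_l_distr smult_r_distr smult_assoc smult_one)
qed

lemma submodule_zero_set: "submodule {\<zero>\<^bsub>M\<^esub>} R M"
  by (rule left_submoduleI) auto

lemma submodule_carrier_set: "submodule (carrier M) R M"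
  by (rule left_submoduleI) (auto intro: smult_closed)

lemma kernel_submodule:
  assumes "left_module R N" "linear_map R M N f"
  shows "submodule {m \<in> carrier M. f m = \<zero>\<^bsub>N\<^esub>} R M"
proof -
  interpret N: left_module R N by fact
  have "f \<zero>\<^bsub>M\<^esub> = \<zero>\<^bsub>N\<^esub>"
    using assms(2) by (intro additive_map_zero M.abelian_group_axioms N.abelian_group_axioms) (rule linear_mapD)
  then show ?thesis
    by (intro left_submoduleI) (auto simp: linear_map_add[OF assms(2)] linear_map_smult[OF assms(2)] intro: smult_closed)
qed

lemma image_submodule:
  assumes "left_module R N" "linear_map R M N f" "submodule U R M"
  shows "submodule (f ` U) R N"
proof -
  interpret N: left_module R N by fact
  note U = submoduleD[OF assms(3)]
  have z: "f \<zero>\<^bsub>M\<^esub> = \<zero>\<^bsub>N\<^esub>"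
    using assms(2) by (intro additive_map_zero M.abelian_group_axioms N.abelian_group_axioms) (rule linear_mapD)
  show ?thesis
  proof (rule N.left_submoduleI)
    show "f ` U \<subseteq> carrier N" using U(2) linear_map_closed[OF assms(2)] by auto
    show "\<zero>\<^bsub>N\<^esub> \<in> f ` U" using z U(3) by (metis imageI)
    show "a \<oplus>\<^bsub>N\<^esub> b \<in> f ` U" if ab: "a \<in> f ` U" "b \<in> f ` U" for a b
    proof -
      obtain m n where "m \<in> U" "n \<in> U" "a = f m" "b = f n" using ab by auto
      then show ?thesis using U linear_map_add[OF assms(2), of m n] by (metis imageI)
    qed
    show "a \<odot>\<^bsub>N\<^esub> x \<in> f ` U" if ab: "a \<in> carrier R" "x \<in> f ` U" for a x
    proof -
      obtain m where "m \<in> U" "x = f m" using ab by auto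
      then show ?thesis using U linear_map_smult[OF assms(2), of a m] ab(1) by (metis imageI)
    qed
  qed
qed

text \<open>A trivial intersection makes the \<open>U\<close>-component of a vector unique, so that
  choosing it by \<open>SOME\<close> yields a linear map. These projections supply the idempotents
  with which indecomposability is tested.\<close>

lemma projection_exists:
  assumes "submodule U R M" "submodule C R M" "U \<inter> C = {\<zero>\<^bsub>M\<^esub>}"
    and "\<And>m. m \<in> carrier M \<Longrightarrow> \<exists>u\<in>U. \<exists>c\<in>C. m = u \<oplus>\<^bsub>M\<^esub> c"
  obtains p where "linear_map R M M p" "p \<in> carrier M \<rightarrow> U" "\<And>u. u \<in> U \<Longrightarrow> p u = u"
    "\<And>c. c \<in> C \<Longrightarrow> p c = \<zero>\<^bsub>M\<^esub>" "\<And>m. m \<in> carrier M \<Longrightarrow> m \<ominus>\<^bsub>M\<^esub> p m \<in> C"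
proof -
  note U = submoduleD[OF assms(1)] and C = submoduleD[OF assms(2)]
  define p where "p m = (SOME u. u \<in> U \<and> (\<exists>c\<in>C. m = u \<oplus>\<^bsub>M\<^esub> c))" for m
  have uniq: "u = u'" if "u \<in> U" "c \<in> C" "u' \<in> U" "c' \<in> C" "u \<oplus>\<^bsub>M\<^esub> c = u' \<oplus>\<^bsub>M\<^esub> c'" for u c u' c'
  proof -
    have car: "u \<in> carrier M" "c \<in> carrier M" "u' \<in> carrier M" "c' \<in> carrier M" using that U(2) C(2) by auto
    then have "u \<ominus>\<^bsub>M\<^esub> u' = c' \<ominus>\<^bsub>M\<^esub> c" using M.minus_eq_minusI[OF that(5)] by simp
    then have "u \<ominus>\<^bsub>M\<^esub> u' \<in> U \<inter> C" using U(7)[OF that(1,3)] C(7)[OF that(4,2)] by simp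
    then have "u \<ominus>\<^bsub>M\<^esub> u' = \<zero>\<^bsub>M\<^esub>" using assms(3) by simp
    then show ?thesis using car by (rule_tac M.minus_eq_zeroD)
  qed
  have p: "p m \<in> U \<and> (\<exists>c\<in>C. m = p m \<oplus>\<^bsub>M\<^esub> c)" if "m \<in> carrier M" for m
    unfolding p_def by (rule someI_ex) (use assms(4)[OF that] in blast)
  have peq: "p m = u" if "u \<in> U" "c \<in> C" "m = u \<oplus>\<^bsub>M\<^esub> c" for m u c
  proof -
    have "m \<in> carrier M" using that U(2) C(2) by auto
    then show ?thesis using p[of m] that uniq by metis
  qed
  show thesis
  proof
    show "linear_map R M M p"
    proof (rule linear_mapI)
      fix m n assume mn: "m \<in> carrier M" "n \<in> carrier M"
      obtain c d where cd: "c \<in> C" "m = p m \<oplus>\<^bsub>M\<^esub> c" "d \<in> C" "n = p n \<oplus>\<^bsub>M\<^esub> d" using p mn by metis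
      have "m \<oplus>\<^bsub>M\<^esub> n = (p m \<oplus>\<^bsub>M\<^esub> p n) \<oplus>\<^bsub>M\<^esub> (c \<oplus>\<^bsub>M\<^esub> d)"
      proof -
        have car: "p m \<in> carrier M" "p n \<in> carrier M" "c \<in> carrier M" "d \<in> carrier M"
          using p mn cd U(2) C(2) by auto
        have "m \<oplus>\<^bsub>M\<^esub> n = (p m \<oplus>\<^bsub>M\<^esub> c) \<oplus>\<^bsub>M\<^esub> (p n \<oplus>\<^bsub>M\<^esub> d)" using cd by simp
        then show ?thesis using car by (simp add: M.a_ac)
      qed
      then show "p (m \<oplus>\<^bsub>M\<^esub> n) = p m \<oplus>\<^bsub>M\<^esub> p n" using p mn cd U(4) C(4) by (intro peq) auto
    next
      fix a m assume am: "a \<in> carrier R" "m \<in> carrier M"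
      obtain c where c: "c \<in> C" "m = p m \<oplus>\<^bsub>M\<^esub> c" using p am by metis
      have "a \<odot>\<^bsub>M\<^esub> m = a \<odot>\<^bsub>M\<^esub> p m \<oplus>\<^bsub>M\<^esub> a \<odot>\<^bsub>M\<^esub> c"
        using c p[OF am(2)] U(2) C(2) am(1) smult_r_distr by metis
      then show "p (a \<odot>\<^bsub>M\<^esub> m) = a \<odot>\<^bsub>M\<^esub> p m" using p am c U(5) C(5) by (intro peq) auto
    qed (use p U(2) in auto)
    show "p \<in> carrier M \<rightarrow> U" using p by auto
    show "p u = u" if "u \<in> U" for u
      by (rule peq[OF that C(3)]) (use that U(2) in simp)
    show "p c = \<zero>\<^bsub>M\<^esub>" if "c \<in> C" for c
      by (rule peq[OF U(3) that]) (use that C(2) in simp)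
    show "m \<ominus>\<^bsub>M\<^esub> p m \<in> C" if m: "m \<in> carrier M" for m
    proof -
      obtain c where c: "c \<in> C" "m = p m \<oplus>\<^bsub>M\<^esub> c" using p m by metis
      have "(c \<oplus>\<^bsub>M\<^esub> p m) \<ominus>\<^bsub>M\<^esub> p m = c" using p[OF m] c(1) U(2) C(2) by (intro M.add_minus_cancel) auto
      moreover have "m = c \<oplus>\<^bsub>M\<^esub> p m" using c p[OF m] U(2) C(2) by (metis M.a_comm)
      ultimately have "m \<ominus>\<^bsub>M\<^esub> p m = c" by simp
      then show ?thesis using c by simp
    qed
  qed
qed

end

section \<open>Spans and finite generation\<close>

definition span :: "('r, 'y) ring_scheme \<Rightarrow> ('r, 'v, 'z) module_scheme \<Rightarrow> 'v set \<Rightarrow> 'v set" where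
  "span R M X = \<Inter>{U. submodule U R M \<and> X \<subseteq> U}"

text \<open>\<open>fin_dim\<close> asks for a basis in terms of unique coordinates. Finite
  generation passes to images, direct sums and tensor products without any choice of basis, and
  \<open>fin_dim_iff\<close> identifies the two over a division ring.\<close>

definition finitely_generated :: "('r, 'y) ring_scheme \<Rightarrow> ('r, 'v, 'z) module_scheme \<Rightarrow> bool" where
  "finitely_generated R M \<longleftrightarrow> (\<exists>X. finite X \<and> X \<subseteq> carrier M \<and> span R M X = carrier M)"

lemma span_superset: "X \<subseteq> span R M X"
  by (auto simp: span_def)

lemma span_least: "submodule U R M \<Longrightarrow> X \<subseteq> U \<Longrightarrow> span R M X \<subseteq> U"
  by (auto simp: span_def)

lemma span_mono: "X \<subseteq> Y \<Longrightarrow> span R M X \<subseteq> span R M Y"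
  by (auto simp: span_def)

context left_module
begin

lemma span_submodule:
  assumes "X \<subseteq> carrier M"
  shows "submodule (span R M X) R M"
proof -
  have "carrier M \<in> {U. submodule U R M \<and> X \<subseteq> U}" using submodule_carrier_set assms by simp
  then have "span R M X \<subseteq> carrier M" by (auto simp: span_def)
  then show ?thesis
    by (rule left_submoduleI) (auto simp: span_def submodule_zero submodule_add submodule_smult)
qed

lemma span_closed: "X \<subseteq> carrier M \<Longrightarrow> span R M X \<subseteq> carrier M"
  using span_submodule submodule_subset by blast

lemma span_subset_spanI:
  "Y \<subseteq> carrier M \<Longrightarrow> X \<subseteq> span R M Y \<Longrightarrow> span R M X \<subseteq> span R M Y"
  by (simp add: span_least span_submodule)

text \<open>The elements of this form already constitute a submodule containing \<open>x\<close> and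
  \<open>X\<close>.\<close>

lemma span_insert:
  assumes "x \<in> carrier M" "X \<subseteq> carrier M" "y \<in> span R M (insert x X)"
  obtains a u where "a \<in> carrier R" "u \<in> span R M X" "y = a \<odot>\<^bsub>M\<^esub> x \<oplus>\<^bsub>M\<^esub> u"
proof -
  note S = submoduleD[OF span_submodule[OF assms(2)]]
  let ?U = "{a \<odot>\<^bsub>M\<^esub> x \<oplus>\<^bsub>M\<^esub> u | a u. a \<in> carrier R \<and> u \<in> span R M X}"
  have "submodule ?U R M"
  proof (rule left_submoduleI)
    show "?U \<subseteq> carrier M" using assms(1) S(2) by (auto intro: smult_closed)
    show "\<zero>\<^bsub>M\<^esub> \<in> ?U"
      using assms(1) S(3) by (auto intro!: exI[of _ "\<zero>\<^bsub>R\<^esub>"] exI[of _ "\<zero>\<^bsub>M\<^esub>"])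
  next
    fix y z assume "y \<in> ?U" "z \<in> ?U"
    then obtain a u b w where yz: "a \<in> carrier R" "u \<in> span R M X" "y = a \<odot>\<^bsub>M\<^esub> x \<oplus>\<^bsub>M\<^esub> u"
      "b \<in> carrier R" "w \<in> span R M X" "z = b \<odot>\<^bsub>M\<^esub> x \<oplus>\<^bsub>M\<^esub> w" by blast
    then have "y \<oplus>\<^bsub>M\<^esub> z = (a \<oplus>\<^bsub>R\<^esub> b) \<odot>\<^bsub>M\<^esub> x \<oplus>\<^bsub>M\<^esub> (u \<oplus>\<^bsub>M\<^esub> w)"
      using assms(1) S(2) by (simp add: smult_l_distr smult_closed M.add.m_ac)
    then show "y \<oplus>\<^bsub>M\<^esub> z \<in> ?U" using yz S(4) by blast
  next
    fix b y assume b: "b \<in> carrier R" and "y \<in> ?U"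
    then obtain a u where y: "a \<in> carrier R" "u \<in> span R M X" "y = a \<odot>\<^bsub>M\<^esub> x \<oplus>\<^bsub>M\<^esub> u" by blast
    then have "b \<odot>\<^bsub>M\<^esub> y = (b \<otimes>\<^bsub>R\<^esub> a) \<odot>\<^bsub>M\<^esub> x \<oplus>\<^bsub>M\<^esub> b \<odot>\<^bsub>M\<^esub> u"
      using assms(1) S(2) b by (simp add: smult_r_distr smult_assoc smult_closed)
    then show "b \<odot>\<^bsub>M\<^esub> y \<in> ?U" using y b S(5) by blast
  qed
  moreover have "insert x X \<subseteq> ?U"
  proof -
    have "x = \<one>\<^bsub>R\<^esub> \<odot>\<^bsub>M\<^esub> x \<oplus>\<^bsub>M\<^esub> \<zero>\<^bsub>M\<^esub>" using assms(1) by (simp add: smult_one)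
    then have "x \<in> ?U" using S(3) by blast
    moreover have "u = \<zero>\<^bsub>R\<^esub> \<odot>\<^bsub>M\<^esub> x \<oplus>\<^bsub>M\<^esub> u" if "u \<in> X" for u using assms(1,2) that by auto
    then have "u \<in> ?U" if "u \<in> X" for u using that span_superset[of X R M] by blast
    ultimately show ?thesis by auto
  qed
  ultimately have "span R M (insert x X) \<subseteq> ?U" by (rule span_least)
  then show thesis using assms(3) that by blast
qed

text \<open>Connects the intersection of submodules with the linear combinations that occur in
  \<open>has_dim\<close>. The combinations form a submodule containing \<open>X\<close>, and every
  submodule containing \<open>X\<close> contains them.\<close>

lemma span_finite_eq:
  assumes "finite X" "X \<subseteq> carrier M"
  shows "span R M X = {\<Oplus>\<^bsub>M\<^esub>v\<in>X. c v \<odot>\<^bsub>M\<^esub> v | c. c \<in> X \<rightarrow>\<^sub>E carrier R}" (is "_ = ?U")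
proof
  have "submodule ?U R M"
  proof (rule left_submoduleI)
    have cl: "(\<lambda>v. c v \<odot>\<^bsub>M\<^esub> v) \<in> X \<rightarrow> carrier M" if "c \<in> X \<rightarrow>\<^sub>E carrier R" for c
      using that assms(2) by (auto intro!: smult_closed)
    then show "?U \<subseteq> carrier M" by auto
    have "(\<Oplus>\<^bsub>M\<^esub>v\<in>X. (\<lambda>v\<in>X. \<zero>\<^bsub>R\<^esub>) v \<odot>\<^bsub>M\<^esub> v) = \<zero>\<^bsub>M\<^esub>"
      using assms(2) by (subst M.add.finprod_cong'[OF refl, of "\<lambda>_. \<zero>\<^bsub>M\<^esub>"]) auto
    moreover have "(\<lambda>v\<in>X. \<zero>\<^bsub>R\<^esub>) \<in> X \<rightarrow>\<^sub>E carrier R" by auto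
    ultimately show "\<zero>\<^bsub>M\<^esub> \<in> ?U" by (intro CollectI exI[of _ "\<lambda>v\<in>X. \<zero>\<^bsub>R\<^esub>"] conjI) (rule sym)
  next
    fix a b assume "a \<in> ?U" "b \<in> ?U"
    then obtain c d where cd: "c \<in> X \<rightarrow>\<^sub>E carrier R" "d \<in> X \<rightarrow>\<^sub>E carrier R"
      "a = (\<Oplus>\<^bsub>M\<^esub>v\<in>X. c v \<odot>\<^bsub>M\<^esub> v)" "b = (\<Oplus>\<^bsub>M\<^esub>v\<in>X. d v \<odot>\<^bsub>M\<^esub> v)" by blast
    have cdX: "c v \<in> carrier R" "d v \<in> carrier R" "v \<in> carrier M" if "v \<in> X" for v
      using cd(1,2) assms(2) that by auto
    have "a \<oplus>\<^bsub>M\<^esub> b = (\<Oplus>\<^bsub>M\<^esub>v\<in>X. c v \<odot>\<^bsub>M\<^esub> v \<oplus>\<^bsub>M\<^esub> d v \<odot>\<^bsub>M\<^esub> v)"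
      unfolding cd(3,4) using cd(1,2) assms(2)
      by (subst M.finsum_addf) (auto intro!: smult_closed)
    also have "\<dots> = (\<Oplus>\<^bsub>M\<^esub>v\<in>X. (\<lambda>v\<in>X. c v \<oplus>\<^bsub>R\<^esub> d v) v \<odot>\<^bsub>M\<^esub> v)"
      using cdX
      by (intro M.add.finprod_cong'[OF refl]) (auto intro!: smult_closed smult_l_distr[symmetric])
    finally show "a \<oplus>\<^bsub>M\<^esub> b \<in> ?U"
      using cdX by (intro CollectI exI[of _ "\<lambda>v\<in>X. c v \<oplus>\<^bsub>R\<^esub> d v"] conjI) auto
  next
    fix r a assume r: "r \<in> carrier R" and "a \<in> ?U"
    then obtain c where c: "c \<in> X \<rightarrow>\<^sub>E carrier R" "a = (\<Oplus>\<^bsub>M\<^esub>v\<in>X. c v \<odot>\<^bsub>M\<^esub> v)" by blast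
    have cX: "c v \<in> carrier R" "v \<in> carrier M" if "v \<in> X" for v
      using c(1) assms(2) that by auto
    have "additive_map M M (\<lambda>m. r \<odot>\<^bsub>M\<^esub> m)"
      using r by (intro additive_mapI) (auto intro: smult_closed smult_r_distr)
    then have "r \<odot>\<^bsub>M\<^esub> a = (\<Oplus>\<^bsub>M\<^esub>v\<in>X. r \<odot>\<^bsub>M\<^esub> (c v \<odot>\<^bsub>M\<^esub> v))"
      unfolding c(2) using c(1) assms
      by (subst additive_map_finsum[OF M.abelian_group_axioms M.abelian_group_axioms]) (auto intro!: smult_closed)
    also have "\<dots> = (\<Oplus>\<^bsub>M\<^esub>v\<in>X. (\<lambda>v\<in>X. r \<otimes>\<^bsub>R\<^esub> c v) v \<odot>\<^bsub>M\<^esub> v)"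
      using cX r
      by (intro M.add.finprod_cong'[OF refl]) (auto intro!: smult_closed smult_assoc[symmetric])
    finally show "r \<odot>\<^bsub>M\<^esub> a \<in> ?U"
      using cX r by (intro CollectI exI[of _ "\<lambda>v\<in>X. r \<otimes>\<^bsub>R\<^esub> c v"] conjI) auto
  qed
  moreover have "X \<subseteq> ?U"
  proof
    fix x assume x: "x \<in> X"
    let ?c = "\<lambda>v\<in>X. if v = x then \<one>\<^bsub>R\<^esub> else \<zero>\<^bsub>R\<^esub>"
    have "(\<Oplus>\<^bsub>M\<^esub>v\<in>X. ?c v \<odot>\<^bsub>M\<^esub> v) = (\<Oplus>\<^bsub>M\<^esub>v\<in>X. if x = v then v else \<zero>\<^bsub>M\<^esub>)"
      using assms(2) by (intro M.add.finprod_cong'[OF refl]) (auto simp: smult_one)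
    also have "\<dots> = x"
      using x assms by (subst M.add.finprod_singleton[where f="\<lambda>v. v"]) auto
    finally have "(\<Oplus>\<^bsub>M\<^esub>v\<in>X. ?c v \<odot>\<^bsub>M\<^esub> v) = x" .
    then show "x \<in> ?U" by (intro CollectI exI[of _ ?c] conjI) auto
  qed
  ultimately show "span R M X \<subseteq> ?U" by (rule span_least)
next
  note S = submoduleD[OF span_submodule[OF assms(2)]]
  show "?U \<subseteq> span R M X"
    using span_superset[of X R M]
    by (auto intro!: submodule_finsum[OF span_submodule[OF assms(2)] assms(1)] S(5))
qed

lemma span_finite_coeffs:
  assumes "finite X" "X \<subseteq> carrier M" "m \<in> span R M X"
  obtains c where "c \<in> X \<rightarrow>\<^sub>E carrier R" "m = (\<Oplus>\<^bsub>M\<^esub>v\<in>X. c v \<odot>\<^bsub>M\<^esub> v)"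
proof -
  have "\<exists>c. m = (\<Oplus>\<^bsub>M\<^esub>v\<in>X. c v \<odot>\<^bsub>M\<^esub> v) \<and> c \<in> X \<rightarrow>\<^sub>E carrier R"
    using assms(3) unfolding span_finite_eq[OF assms(1,2)] mem_Collect_eq .
  then show thesis using that by metis
qed

end

text \<open>The elements of \<open>M\<close> that are mapped into the span of the image of
  \<open>X\<close> form a submodule containing \<open>X\<close>, hence are all of
  \<open>M\<close>.\<close>

lemma finitely_generated_image:
  assumes "left_module R M" "left_module R N" "linear_map R M N f" "f ` carrier M = carrier N"
    and "finitely_generated R M"
  shows "finitely_generated R N"
proof -
  interpret M: left_module R M by fact
  interpret N: left_module R N by fact
  obtain X where X: "finite X" "X \<subseteq> carrier M" "span R M X = carrier M"
    using assms(5) by (auto simp: finitely_generated_def)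
  have fX: "f ` X \<subseteq> carrier N" using X(2) assms(4) by auto
  note S = N.submoduleD[OF N.span_submodule[OF fX]]
  have z: "f \<zero>\<^bsub>M\<^esub> = \<zero>\<^bsub>N\<^esub>"
    using assms(3) by (intro additive_map_zero M.abelian_group_axioms N.abelian_group_axioms) (rule linear_mapD)
  have "submodule {m \<in> carrier M. f m \<in> span R N (f ` X)} R M"
    using S by (intro M.left_submoduleI)
      (auto simp: z linear_map_add[OF assms(3)] linear_map_smult[OF assms(3)] intro: M.smult_closed)
  moreover have "X \<subseteq> {m \<in> carrier M. f m \<in> span R N (f ` X)}"
    using X(2) span_superset[of "f ` X" R N] by auto
  ultimately have "carrier M \<subseteq> {m \<in> carrier M. f m \<in> span R N (f ` X)}"
    unfolding X(3)[symmetric] by (rule span_least)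
  then have "f ` carrier M \<subseteq> span R N (f ` X)" by (intro image_subsetI) (simp add: subset_iff)
  then have "carrier N \<subseteq> span R N (f ` X)" using assms(4) by simp
  then show ?thesis
    unfolding finitely_generated_def using X(1) fX S(1) by (intro exI[of _ "f ` X"]) auto
qed

section \<open>Exchange, complements and dimension over a division ring\<close>

lemma division_ring_inverse:
  assumes "division_ring R" "a \<in> carrier R" "a \<noteq> \<zero>\<^bsub>R\<^esub>"
  obtains b where "b \<in> carrier R" "b \<otimes>\<^bsub>R\<^esub> a = \<one>\<^bsub>R\<^esub>" "a \<otimes>\<^bsub>R\<^esub> b = \<one>\<^bsub>R\<^esub>"
proof -
  have "a \<in> Units R" using assms by (auto simp: division_ring_def)
  then show thesis using that by (auto simp: Units_def)
qed

locale vector_space_dr = left_module R M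
  for R :: "'r ring" (structure) and M :: "('r, 'v, 'z) module_scheme" (structure) +
  assumes division_ring: "division_ring R"
begin

lemma smult_cancel_submodule:
  assumes "submodule U R M" "a \<in> carrier R" "a \<noteq> \<zero>\<^bsub>R\<^esub>" "m \<in> carrier M" "a \<odot>\<^bsub>M\<^esub> m \<in> U"
  shows "m \<in> U"
proof -
  obtain b where b: "b \<in> carrier R" "b \<otimes>\<^bsub>R\<^esub> a = \<one>\<^bsub>R\<^esub>"
    using division_ring_inverse[OF division_ring assms(2,3)] by blast
  have "b \<odot>\<^bsub>M\<^esub> (a \<odot>\<^bsub>M\<^esub> m) = m" using b assms by (simp add: smult_assoc[symmetric] smult_one)
  then show ?thesis using submodule_smult[OF assms(1) b(1) assms(5)] by simp
qed

text \<open>Write \<open>y = a x + u\<close>. As \<open>y\<close> is not in the span of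
  \<open>X\<close>, the coefficient \<open>a\<close> is nonzero, and its left inverse turns
  \<open>a x = y - u\<close> into an expression for \<open>x\<close>.\<close>

lemma span_exchange:
  assumes "x \<in> carrier M" "X \<subseteq> carrier M" "y \<in> span R M (insert x X)" "y \<notin> span R M X"
  shows "x \<in> span R M (insert y X)"
proof -
  obtain a u where au: "a \<in> carrier R" "u \<in> span R M X" "y = a \<odot>\<^bsub>M\<^esub> x \<oplus>\<^bsub>M\<^esub> u"
    using span_insert[OF assms(1-3)] .
  have u: "u \<in> carrier M" using span_closed[OF assms(2)] au(2) by auto
  have ycar: "y \<in> carrier M" using au u assms(1) by (auto intro: smult_closed)
  have "a \<noteq> \<zero>\<^bsub>R\<^esub>" using au u assms by auto
  have yX: "insert y X \<subseteq> carrier M" using ycar assms(2) by simp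
  note S = submoduleD[OF span_submodule[OF yX]]
  have "y \<in> span R M (insert y X)" "u \<in> span R M (insert y X)"
    using span_superset[of "insert y X" R M] au(2) span_mono[of X "insert y X" R M] by auto
  then have "y \<ominus>\<^bsub>M\<^esub> u \<in> span R M (insert y X)" using S(7) by auto
  moreover have "y \<ominus>\<^bsub>M\<^esub> u = a \<odot>\<^bsub>M\<^esub> x"
    unfolding au(3) using u assms(1) au(1) by (simp add: M.minus_eq M.a_assoc smult_closed M.r_neg)
  ultimately show ?thesis
    using smult_cancel_submodule[OF span_submodule[OF yX] au(1) \<open>a \<noteq> \<zero>\<^bsub>R\<^esub>\<close> assms(1)] by simp
qed

text \<open>Take a finite set \<open>F\<close> of least size that together with \<open>U\<close>
  spans \<open>M\<close>; its span is the complement. A nonzero vector common to \<open>U\<close>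
  and the span of \<open>F\<close> could take the place of an element of \<open>F\<close>,
  contradicting the choice of \<open>F\<close>.\<close>

lemma complement_exists:
  assumes U: "submodule U R M" and fg: "finitely_generated R M"
  obtains C where "submodule C R M" "U \<inter> C = {\<zero>\<^bsub>M\<^esub>}"
    "\<And>m. m \<in> carrier M \<Longrightarrow> \<exists>u\<in>U. \<exists>c\<in>C. m = u \<oplus>\<^bsub>M\<^esub> c"
proof -
  let ?P = "\<lambda>F. finite F \<and> F \<subseteq> carrier M \<and> span R M (U \<union> F) = carrier M"
  note Us = submoduleD[OF U]
  obtain X where X: "finite X" "X \<subseteq> carrier M" "span R M X = carrier M"
    using fg by (auto simp: finitely_generated_def)
  have "?P X"
    using X Us(1) span_mono[of X "U \<union> X" R M] span_closed[of "U \<union> X"] by auto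
  then obtain F where F: "?P F" and min: "\<And>F'. ?P F' \<Longrightarrow> card F \<le> card F'"
    using ex_has_least_nat[of ?P X card] by blast
  have Fc: "F \<subseteq> carrier M" using F by simp
  note S = submoduleD[OF span_submodule[OF Fc]]
  have "w = \<zero>\<^bsub>M\<^esub>" if w: "w \<in> U" "w \<in> span R M F" for w
  proof (rule ccontr)
    assume "w \<noteq> \<zero>\<^bsub>M\<^esub>"
    \<comment> \<open>A least subset of \<open>F\<close> whose span contains \<open>w\<close> has
      the property that \<open>w\<close> drops out of the span as soon as any \<open>f\<close> is
      removed, which is what the exchange of \<open>f\<close> for \<open>w\<close> requires.\<close>
    let ?Q = "\<lambda>G. G \<subseteq> F \<and> w \<in> span R M G"
    obtain G where G: "?Q G" and Gmin: "\<And>G'. ?Q G' \<Longrightarrow> card G \<le> card G'"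
      using ex_has_least_nat[of ?Q F card] w by blast
    have finG: "finite G" using G F finite_subset by blast
    have "G \<noteq> {}"
      using G \<open>w \<noteq> \<zero>\<^bsub>M\<^esub>\<close> span_least[OF submodule_zero_set, of "{}"] by auto
    then obtain f where f: "f \<in> G" by auto
    have fF: "f \<in> F" "f \<in> carrier M" using f G F by auto
    have Gc: "G - {f} \<subseteq> carrier M" using G Fc by auto
    have w1: "w \<notin> span R M (G - {f})"
      using Gmin[of "G - {f}"] G f card_Diff1_less[OF finG f] by (auto simp del: card_Diff_insert)
    have w2: "w \<in> span R M (insert f (G - {f}))" using G f by (simp add: insert_absorb)
    have "f \<in> span R M (insert w (G - {f}))"
      by (rule span_exchange[OF fF(2) Gc w2 w1])
    also have "\<dots> \<subseteq> span R M (U \<union> (F - {f}))" using w G by (intro span_mono) auto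
    finally have ff: "f \<in> span R M (U \<union> (F - {f}))" .
    have sub: "U \<union> (F - {f}) \<subseteq> carrier M" using Us(1) Fc by auto
    have "U \<union> F \<subseteq> span R M (U \<union> (F - {f}))"
      using ff span_superset[of "U \<union> (F - {f})" R M] by blast
    then have "span R M (U \<union> F) \<subseteq> span R M (U \<union> (F - {f}))"
      by (rule span_subset_spanI[OF sub])
    then have "?P (F - {f})" using F span_closed[OF sub] by auto
    then show False using min[of "F - {f}"] fF F by (metis card_Diff1_less leD)
  qed
  then have "U \<inter> span R M F = {\<zero>\<^bsub>M\<^esub>}" using Us(3) S(3) by blast
  moreover have "\<exists>u\<in>U. \<exists>c\<in>span R M F. m = u \<oplus>\<^bsub>M\<^esub> c" if m: "m \<in> carrier M" for m
  proof -
    let ?T = "{u \<oplus>\<^bsub>M\<^esub> c | u c. u \<in> U \<and> c \<in> span R M F}"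
    have "submodule ?T R M"
    proof (rule left_submoduleI)
      show "?T \<subseteq> carrier M" using Us(2) S(2) by auto
      show "\<zero>\<^bsub>M\<^esub> \<in> ?T" using Us(3) S(3) by (auto intro!: exI[of _ "\<zero>\<^bsub>M\<^esub>"])
    next
      fix a b assume "a \<in> ?T" "b \<in> ?T"
      then obtain u c u' c' where *: "u \<in> U" "c \<in> span R M F" "a = u \<oplus>\<^bsub>M\<^esub> c"
        "u' \<in> U" "c' \<in> span R M F" "b = u' \<oplus>\<^bsub>M\<^esub> c'" by blast
      then have "a \<oplus>\<^bsub>M\<^esub> b = (u \<oplus>\<^bsub>M\<^esub> u') \<oplus>\<^bsub>M\<^esub> (c \<oplus>\<^bsub>M\<^esub> c')" using Us(2) S(2) by (simp add: M.add.m_ac)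
      then show "a \<oplus>\<^bsub>M\<^esub> b \<in> ?T" using * Us(4) S(4) by blast
    next
      fix r a assume r: "r \<in> carrier R" "a \<in> ?T"
      then obtain u c where *: "u \<in> U" "c \<in> span R M F" "a = u \<oplus>\<^bsub>M\<^esub> c" by blast
      then have "r \<odot>\<^bsub>M\<^esub> a = r \<odot>\<^bsub>M\<^esub> u \<oplus>\<^bsub>M\<^esub> r \<odot>\<^bsub>M\<^esub> c" using Us(2) S(2) r by (simp add: smult_r_distr)
      then show "r \<odot>\<^bsub>M\<^esub> a \<in> ?T" using * Us(5) S(5) r by blast
    qed
    moreover have "U \<union> F \<subseteq> ?T"
    proof -
      have "u = u \<oplus>\<^bsub>M\<^esub> \<zero>\<^bsub>M\<^esub>" if "u \<in> U" for u using that Us(2) by simp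
      moreover have "c = \<zero>\<^bsub>M\<^esub> \<oplus>\<^bsub>M\<^esub> c" if "c \<in> F" for c using that Fc by auto
      ultimately show ?thesis using Us(3) S(3) span_superset[of F R M] by blast
    qed
    ultimately have "span R M (U \<union> F) \<subseteq> ?T" by (rule span_least)
    then show ?thesis using m F by blast
  qed
  ultimately show thesis using that span_submodule[OF Fc] by blast
qed

text \<open>The projection along a complement maps \<open>M\<close> onto \<open>U\<close> and
  carries generators to generators.\<close>

lemma finitely_generated_submodule:
  assumes "submodule U R M" "finitely_generated R M"
  shows "finitely_generated R (M\<lparr>carrier := U\<rparr>)"
proof -
  obtain C where C: "submodule C R M" "U \<inter> C = {\<zero>\<^bsub>M\<^esub>}"
    "\<And>m. m \<in> carrier M \<Longrightarrow> \<exists>u\<in>U. \<exists>c\<in>C. m = u \<oplus>\<^bsub>M\<^esub> c"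
    using complement_exists[OF assms] by blast
  obtain p where p: "linear_map R M M p" "p \<in> carrier M \<rightarrow> U" "\<And>u. u \<in> U \<Longrightarrow> p u = u"
    using projection_exists[OF assms(1) C] by metis
  have "linear_map R M (M\<lparr>carrier := U\<rparr>) p"
    using p(1,2) by (auto simp: linear_map_def additive_map_def)
  moreover have "p ` carrier M = U"
    using p(2,3) submodule_subset[OF assms(1)] by (auto simp: image_iff subset_iff) metis
  ultimately show ?thesis
    using finitely_generated_image[OF left_module_axioms submodule_left_module[OF assms(1)]] assms(2) by simp
qed

definition independent :: "'v set \<Rightarrow> bool" where
  "independent X \<longleftrightarrow> (\<forall>v\<in>X. v \<notin> span R M (X - {v}))"

lemma independent_mono: "independent X \<Longrightarrow> Y \<subseteq> X \<Longrightarrow> independent Y"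
  unfolding independent_def using span_mono[of "Y - {v}" "X - {v}" R M for v] by blast

lemma independent_insert:
  assumes "independent X" "X \<subseteq> carrier M" "x \<in> carrier M" "x \<notin> span R M X"
  shows "independent (insert x X)"
  unfolding independent_def
proof
  fix v assume v: "v \<in> insert x X"
  have xX: "x \<notin> X" using assms(4) span_superset[of X R M] by auto
  show "v \<notin> span R M (insert x X - {v})"
  proof (cases "v = x")
    case True
    then show ?thesis using assms(4) xX by simp
  next
    case False
    then have vX: "v \<in> X" using v by simp
    have eq: "insert x X - {v} = insert x (X - {v})" using False by auto
    show ?thesis
    proof
      assume v1: "v \<in> span R M (insert x X - {v})"
      have "X - {v} \<subseteq> carrier M" "v \<notin> span R M (X - {v})"
        using assms(1,2) vX by (auto simp: independent_def)
      then have "x \<in> span R M (insert v (X - {v}))"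
        by (rule span_exchange[OF assms(3) _ v1[unfolded eq]])
      then show False using assms(4) vX by (simp add: insert_absorb)
    qed
  qed
qed

text \<open>Steinitz exchange, by induction on the number of elements of \<open>Y\<close> outside
  \<open>X\<close>. If \<open>y\<close> is such an element, some \<open>x\<close> of
  \<open>X\<close> is not in the span of the rest of \<open>Y\<close>, since otherwise
  \<open>y\<close> would be. Replacing \<open>y\<close> by \<open>x\<close> keeps the independence
  and the size of \<open>Y\<close>.\<close>

lemma independent_card_le:
  assumes "finite X" "X \<subseteq> carrier M" "finite Y" "Y \<subseteq> span R M X" "independent Y"
  shows "card Y \<le> card X"
  using assms(3-)
proof (induction "card (Y - X)" arbitrary: Y rule: less_induct)
  case less
  show ?case
  proof (cases "Y \<subseteq> X")
    case True
    then show ?thesis using assms(1) card_mono by blast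
  next
    case False
    then obtain y where y: "y \<in> Y" "y \<notin> X" by auto
    have Yc: "Y - {y} \<subseteq> carrier M" using less.prems span_closed[OF assms(2)] by auto
    have "\<not> X \<subseteq> span R M (Y - {y})"
    proof
      assume "X \<subseteq> span R M (Y - {y})"
      then have "span R M X \<subseteq> span R M (Y - {y})" by (rule span_subset_spanI[OF Yc])
      then show False using y less.prems by (auto simp: independent_def)
    qed
    then obtain x where x: "x \<in> X" "x \<notin> span R M (Y - {y})" by auto
    have xY: "x \<notin> Y - {y}" using x(2) span_superset[of "Y - {y}" R M] by auto
    let ?Y = "insert x (Y - {y})"
    have "?Y - X \<subset> Y - X" using x y by auto
    then have "card (?Y - X) < card (Y - X)" using less.prems by (intro psubset_card_mono) auto
    moreover have "independent ?Y"
      using independent_mono[OF less.prems(3), of "Y - {y}"] x assms(2) Yc by (intro independent_insert) auto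
    moreover have "?Y \<subseteq> span R M X" using x less.prems span_superset[of X R M] by auto
    ultimately have "card ?Y \<le> card X" using less by auto
    moreover have "card ?Y = card Y" using xY y less.prems(1) by (metis card_Suc_Diff1 card_insert_disjoint finite_Diff)
    ultimately show ?thesis by simp
  qed
qed

text \<open>If the coefficients differ at \<open>v\<close>, then a nonzero multiple of
  \<open>v\<close> lies in the span of the other elements, and so does \<open>v\<close>.\<close>

lemma independent_coeffs_unique:
  assumes "finite X" "X \<subseteq> carrier M" "independent X" "c \<in> X \<rightarrow>\<^sub>E carrier R" "d \<in> X \<rightarrow>\<^sub>E carrier R"
    and eq: "(\<Oplus>\<^bsub>M\<^esub>v\<in>X. c v \<odot>\<^bsub>M\<^esub> v) = (\<Oplus>\<^bsub>M\<^esub>v\<in>X. d v \<odot>\<^bsub>M\<^esub> v)"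
  shows "c = d"
proof (rule PiE_ext[OF assms(4,5)], rule ccontr)
  fix v assume v: "v \<in> X" and ne: "c v \<noteq> d v"
  have Xv: "X - {v} \<subseteq> carrier M" using assms(2) by auto
  note S = submoduleD[OF span_submodule[OF Xv]]
  have car: "c w \<odot>\<^bsub>M\<^esub> w \<in> carrier M" "d w \<odot>\<^bsub>M\<^esub> w \<in> carrier M" "w \<in> carrier M" "c w \<in> carrier R" "d w \<in> carrier R"
    if "w \<in> X" for w using that assms by (auto intro!: smult_closed)
  define s where "s = (\<Oplus>\<^bsub>M\<^esub>w\<in>X - {v}. c w \<odot>\<^bsub>M\<^esub> w)"
  define t where "t = (\<Oplus>\<^bsub>M\<^esub>w\<in>X - {v}. d w \<odot>\<^bsub>M\<^esub> w)"
  have st: "s \<in> span R M (X - {v})" "t \<in> span R M (X - {v})"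
    unfolding s_def t_def using assms car span_superset[of "X - {v}" R M]
    by (auto intro!: submodule_finsum[OF span_submodule[OF Xv]] S(5))
  have stc: "s \<in> carrier M" "t \<in> carrier M" using st S(2) by auto
  have "c v \<odot>\<^bsub>M\<^esub> v \<oplus>\<^bsub>M\<^esub> s = (\<Oplus>\<^bsub>M\<^esub>w\<in>insert v (X - {v}). c w \<odot>\<^bsub>M\<^esub> w)"
    unfolding s_def using assms(1) v car by (subst M.finsum_insert) auto
  moreover have "d v \<odot>\<^bsub>M\<^esub> v \<oplus>\<^bsub>M\<^esub> t = (\<Oplus>\<^bsub>M\<^esub>w\<in>insert v (X - {v}). d w \<odot>\<^bsub>M\<^esub> w)"
    unfolding t_def using assms(1) v car by (subst M.finsum_insert) auto
  ultimately have e: "c v \<odot>\<^bsub>M\<^esub> v \<oplus>\<^bsub>M\<^esub> s = d v \<odot>\<^bsub>M\<^esub> v \<oplus>\<^bsub>M\<^esub> t"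
    using eq v by (simp add: insert_absorb)
  have "(c v \<ominus>\<^bsub>R\<^esub> d v) \<odot>\<^bsub>M\<^esub> v = t \<ominus>\<^bsub>M\<^esub> s"
    using M.minus_eq_minusI[OF e] car[OF v] stc by (simp add: smult_minus)
  then have "(c v \<ominus>\<^bsub>R\<^esub> d v) \<odot>\<^bsub>M\<^esub> v \<in> span R M (X - {v})" using S(7) st by simp
  moreover have "c v \<ominus>\<^bsub>R\<^esub> d v \<noteq> \<zero>\<^bsub>R\<^esub>" using ne car(4,5)[OF v] R.minus_eq_zeroD by blast
  ultimately have "v \<in> span R M (X - {v})"
    using smult_cancel_submodule[OF span_submodule[OF Xv], of "c v \<ominus>\<^bsub>R\<^esub> d v" v] car[OF v] by simp
  then show False using assms(3) v by (simp add: independent_def)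
qed

lemma has_dim_iff:
  "has_dim R M n \<longleftrightarrow> (\<exists>X. X \<subseteq> carrier M \<and> finite X \<and> card X = n \<and> independent X \<and> span R M X = carrier M)"
proof -
  have "(\<forall>m\<in>carrier M. \<exists>!c. c \<in> X \<rightarrow>\<^sub>E carrier R \<and> m = (\<Oplus>\<^bsub>M\<^esub>v\<in>X. c v \<odot>\<^bsub>M\<^esub> v)) \<longleftrightarrow>
      independent X \<and> span R M X = carrier M" (is "?L \<longleftrightarrow> ?R") if X: "X \<subseteq> carrier M" "finite X" for X
  proof
    assume L: ?L
    have "carrier M \<subseteq> span R M X" unfolding span_finite_eq[OF X(2,1)] using L by blast
    then have sp: "span R M X = carrier M" using span_closed[OF X(1)] by auto
    have "independent X"
      unfolding independent_def
    proof (intro ballI notI)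
      fix v assume v: "v \<in> X" and "v \<in> span R M (X - {v})"
      then obtain c where c: "c \<in> X - {v} \<rightarrow>\<^sub>E carrier R" "v = (\<Oplus>\<^bsub>M\<^esub>w\<in>X - {v}. c w \<odot>\<^bsub>M\<^esub> w)"
        using X by (elim span_finite_coeffs[rotated 2]) auto
      \<comment> \<open>Two expansions of \<open>v\<close>: one from the dependence, with
        coefficient 0 at \<open>v\<close>, and the trivial one with coefficient 1. Uniqueness would
        force 1 = 0.\<close>
      let ?c = "\<lambda>w\<in>X. if w = v then \<zero>\<^bsub>R\<^esub> else c w" and ?d = "\<lambda>w\<in>X. if w = v then \<one>\<^bsub>R\<^esub> else \<zero>\<^bsub>R\<^esub>"
      have cc: "c w \<in> carrier R" "w \<in> carrier M" "c w \<odot>\<^bsub>M\<^esub> w \<in> carrier M" if "w \<in> X" "w \<noteq> v" for w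
        using c(1) that X by (auto intro!: smult_closed)
      have vc: "v \<in> carrier M" using v X by auto
      have "(\<Oplus>\<^bsub>M\<^esub>w\<in>X. ?c w \<odot>\<^bsub>M\<^esub> w) = (\<Oplus>\<^bsub>M\<^esub>w\<in>insert v (X - {v}). ?c w \<odot>\<^bsub>M\<^esub> w)"
        using v by (simp add: insert_absorb)
      also have "\<dots> = \<zero>\<^bsub>M\<^esub> \<oplus>\<^bsub>M\<^esub> (\<Oplus>\<^bsub>M\<^esub>w\<in>X - {v}. ?c w \<odot>\<^bsub>M\<^esub> w)"
        using X cc vc v by (subst M.finsum_insert) auto
      also have "(\<Oplus>\<^bsub>M\<^esub>w\<in>X - {v}. ?c w \<odot>\<^bsub>M\<^esub> w) = (\<Oplus>\<^bsub>M\<^esub>w\<in>X - {v}. c w \<odot>\<^bsub>M\<^esub> w)"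
        using cc by (intro M.add.finprod_cong'[OF refl]) auto
      finally have 1: "v = (\<Oplus>\<^bsub>M\<^esub>w\<in>X. ?c w \<odot>\<^bsub>M\<^esub> w)" using c vc by simp
      have "(\<Oplus>\<^bsub>M\<^esub>w\<in>X. ?d w \<odot>\<^bsub>M\<^esub> w) = (\<Oplus>\<^bsub>M\<^esub>w\<in>X. if v = w then w else \<zero>\<^bsub>M\<^esub>)"
        using X by (intro M.add.finprod_cong'[OF refl]) (auto simp: smult_one)
      also have "\<dots> = v" using v X by (subst M.add.finprod_singleton[where f="\<lambda>v. v"]) auto
      finally have 2: "v = (\<Oplus>\<^bsub>M\<^esub>w\<in>X. ?d w \<odot>\<^bsub>M\<^esub> w)" by simp
      have "?c \<in> X \<rightarrow>\<^sub>E carrier R" "?d \<in> X \<rightarrow>\<^sub>E carrier R" using cc by auto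
      then have "?c = ?d" using L vc 1 2 by blast
      then have "?c v = ?d v" by metis
      then show False using v division_ring by (simp add: division_ring_def)
    qed
    then show ?R using sp by simp
  next
    assume R: ?R
    show ?L
    proof
      fix m assume m: "m \<in> carrier M"
      then have "m \<in> span R M X" using R by simp
      then obtain c where c: "c \<in> X \<rightarrow>\<^sub>E carrier R" "m = (\<Oplus>\<^bsub>M\<^esub>v\<in>X. c v \<odot>\<^bsub>M\<^esub> v)"
        by (rule span_finite_coeffs[OF X(2,1)])
      show "\<exists>!c. c \<in> X \<rightarrow>\<^sub>E carrier R \<and> m = (\<Oplus>\<^bsub>M\<^esub>v\<in>X. c v \<odot>\<^bsub>M\<^esub> v)"
      proof (rule ex1I)
        show "c \<in> X \<rightarrow>\<^sub>E carrier R \<and> m = (\<Oplus>\<^bsub>M\<^esub>v\<in>X. c v \<odot>\<^bsub>M\<^esub> v)" using c by (rule conjI)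
      next
        fix d assume d: "d \<in> X \<rightarrow>\<^sub>E carrier R \<and> m = (\<Oplus>\<^bsub>M\<^esub>v\<in>X. d v \<odot>\<^bsub>M\<^esub> v)"
        show "d = c"
          by (rule independent_coeffs_unique[OF X(2,1) conjunct1[OF R] conjunct1[OF d] c(1)])
            (rule trans[OF sym[OF conjunct2[OF d]] c(2)])
      qed
    qed
  qed
  then show ?thesis unfolding has_dim_def by (intro iff_exI conj_cong refl)
qed

text \<open>This is what gives the \<open>THE\<close> in \<open>ldim\<close> its meaning.\<close>

lemma has_dim_unique: "has_dim R M m \<Longrightarrow> has_dim R M n \<Longrightarrow> m = n"
  unfolding has_dim_iff using independent_card_le by (metis le_antisym)

lemma has_dim_ldim: "fin_dim R M \<Longrightarrow> has_dim R M (ldim R M)"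
  unfolding fin_dim_def ldim_def using has_dim_unique by (metis theI)

text \<open>A spanning set of least size is independent.\<close>

lemma fin_dim_iff: "fin_dim R M \<longleftrightarrow> finitely_generated R M"
proof
  assume "fin_dim R M"
  then show "finitely_generated R M" by (auto simp: fin_dim_def has_dim_iff finitely_generated_def)
next
  assume "finitely_generated R M"
  then obtain X where X: "finite X" "X \<subseteq> carrier M" "span R M X = carrier M"
    by (auto simp: finitely_generated_def)
  let ?P = "\<lambda>Y. finite Y \<and> Y \<subseteq> carrier M \<and> span R M Y = carrier M"
  obtain Y where Y: "?P Y" and min: "\<And>Z. ?P Z \<Longrightarrow> card Y \<le> card Z"
    using ex_has_least_nat[of ?P X card] X by blast
  have "independent Y"
    unfolding independent_def
  proof (intro ballI notI)
    fix v assume v: "v \<in> Y" and vs: "v \<in> span R M (Y - {v})"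
    have sub: "Y - {v} \<subseteq> carrier M" using Y by auto
    have "Y \<subseteq> span R M (Y - {v})" using vs span_superset[of "Y - {v}" R M] by auto
    then have "span R M Y \<subseteq> span R M (Y - {v})" by (rule span_subset_spanI[OF sub])
    then have "?P (Y - {v})" using Y span_closed[OF sub] by auto
    then show False using min[of "Y - {v}"] v Y by (metis card_Diff1_less leD)
  qed
  then show "fin_dim R M" unfolding fin_dim_def has_dim_iff using Y by blast
qed

end

section \<open>Presented abelian groups and tensor products\<close>

text \<open>Only the additive structure of \<open>M\<close> is tied to the presentation, so that one
  development serves both the tensor products, which are modules, and the tensor ring.\<close>

locale presented_group =
  fixes X :: "'a set" and Q :: "('a \<Rightarrow>\<^sub>0 int) set" and M :: "(('a \<Rightarrow>\<^sub>0 int) set, 'm) ring_scheme" (structure)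
  assumes relators: "q \<in> Q \<Longrightarrow> Poly_Mapping.keys q \<subseteq> X"
    and carrier_eq: "carrier M = carrier (presented X Q)"
    and zero_eq: "\<zero>\<^bsub>M\<^esub> = \<one>\<^bsub>presented X Q\<^esub>"
    and add_eq: "(\<oplus>\<^bsub>M\<^esub>) = (\<otimes>\<^bsub>presented X Q\<^esub>)"
begin

definition relations :: "('a \<Rightarrow>\<^sub>0 int) set" where
  "relations = generate (free_Abelian_group X) Q"

abbreviation cls :: "('a \<Rightarrow>\<^sub>0 int) \<Rightarrow> ('a \<Rightarrow>\<^sub>0 int) set" where
  "cls \<equiv> presented_class X Q"

lemma relations_subgroup: "subgroup relations (free_Abelian_group X)"
  unfolding relations_def using relators by (intro group.generate_is_subgroup) auto

lemma relations_closed: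
  shows relations_zero: "0 \<in> relations"
    and relations_add: "u \<in> relations \<Longrightarrow> v \<in> relations \<Longrightarrow> u + v \<in> relations"
    and relations_keys: "u \<in> relations \<Longrightarrow> Poly_Mapping.keys u \<subseteq> X"
    and relations_neg: "u \<in> relations \<Longrightarrow> - u \<in> relations"
    and relations_minus: "u \<in> relations \<Longrightarrow> v \<in> relations \<Longrightarrow> u - v \<in> relations"
proof -
  interpret subgroup relations "free_Abelian_group X" by (rule relations_subgroup)
  show "0 \<in> relations" using one_closed by simp
  show add: "u \<in> relations \<Longrightarrow> v \<in> relations \<Longrightarrow> u + v \<in> relations" for u v using m_closed by simp
  show keys: "u \<in> relations \<Longrightarrow> Poly_Mapping.keys u \<subseteq> X" for u using mem_carrier by simp
  show neg: "u \<in> relations \<Longrightarrow> - u \<in> relations" for u using m_inv_closed[of u] keys[of u] by simp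
  show "u \<in> relations \<Longrightarrow> v \<in> relations \<Longrightarrow> u - v \<in> relations" using add neg[of v] by fastforce
qed

lemma relations_superset: "Q \<subseteq> relations"
  unfolding relations_def by (auto intro: generate.incl)

text \<open>The step for differences covers sums and negatives as well, since 0 is a
  relation.\<close>

lemma relations_induct [consumes 1, case_names zero gen diff]:
  assumes "u \<in> relations" "P 0" "\<And>q. q \<in> Q \<Longrightarrow> P q"
    and "\<And>u v. u \<in> relations \<Longrightarrow> v \<in> relations \<Longrightarrow> P u \<Longrightarrow> P v \<Longrightarrow> P (u - v)"
  shows "P u"
proof -
  have Q: "q \<in> relations" if "q \<in> Q" for q using that relations_superset by auto
  have neg: "P (- u)" if "u \<in> relations" "P u" for u
    using assms(4)[of 0 u] that assms(2) relations_zero by simp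
  have "u \<in> relations \<and> P u"
    using assms(1)[unfolded relations_def]
  proof (induction rule: generate.induct)
    case (inv h)
    then show ?case using Q neg assms(3) relations_neg relators by simp
  next
    case (eng a b)
    have "P (a - (- b))" using assms(4)[of a "- b"] eng neg relations_neg by simp
    then show ?case using eng relations_add by simp
  qed (use Q assms(2,3) relations_zero in auto)
  then show ?thesis by simp
qed

lemma cls_eq: "cls u = (\<lambda>h. h + u) ` relations"
  by (auto simp: presented_class_def relations_def[symmetric] r_coset_def)

lemma cls_self: "u \<in> cls u"
  unfolding cls_eq using relations_zero by (auto intro: image_eqI[of _ _ 0])

lemma cls_eq_iff: "cls u = cls v \<longleftrightarrow> u - v \<in> relations"
proof
  assume "cls u = cls v"
  then have "u \<in> cls v" using cls_self by auto
  then show "u - v \<in> relations" by (auto simp: cls_eq)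
next
  have sub: "cls u \<subseteq> cls v" if "u - v \<in> relations" for u v
  proof
    fix w assume "w \<in> cls u"
    then obtain h where h: "h \<in> relations" "w = h + u" by (auto simp: cls_eq)
    then have "w = (h + (u - v)) + v" by simp
    then show "w \<in> cls v" unfolding cls_eq using h that relations_add by blast
  qed
  assume uv: "u - v \<in> relations"
  then have "v - u \<in> relations" using relations_neg by fastforce
  then show "cls u = cls v" using sub uv by blast
qed

lemma in_cls_iff: "w \<in> cls u \<longleftrightarrow> w - u \<in> relations"
  unfolding cls_eq by (auto intro: image_eqI[of _ _ "w - u"])

lemma normal_relations: "normal relations (free_Abelian_group X)"
  by (rule comm_group.subgroup_imp_normal[OF abelian_free_Abelian_group relations_subgroup])

lemma carrier_cls: "carrier M = {cls u | u. Poly_Mapping.keys u \<subseteq> X}"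
  by (auto simp: carrier_eq presented_def FactGroup_def RCOSETS_def presented_class_def)

lemma cls_closed: "Poly_Mapping.keys u \<subseteq> X \<Longrightarrow> cls u \<in> carrier M"
  unfolding carrier_cls by blast

lemma cls_frag_closed: "x \<in> X \<Longrightarrow> cls (frag_of x) \<in> carrier M"
  by (simp add: cls_closed)

lemma cls_cases:
  assumes "t \<in> carrier M" obtains u where "Poly_Mapping.keys u \<subseteq> X" "t = cls u"
  using assms unfolding carrier_cls by blast

lemma cls_add: "Poly_Mapping.keys u \<subseteq> X \<Longrightarrow> Poly_Mapping.keys v \<subseteq> X \<Longrightarrow> cls u \<oplus> cls v = cls (u + v)"
  using normal.rcos_sum[OF normal_relations, of u v]
  by (simp add: add_eq presented_def presented_class_def relations_def FactGroup_def)

lemma cls_zero: "\<zero> = cls 0"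
  by (simp add: zero_eq presented_def presented_class_def FactGroup_def relations_def[symmetric] r_coset_def)

lemma keys_add_sub: "Poly_Mapping.keys u \<subseteq> X \<Longrightarrow> Poly_Mapping.keys v \<subseteq> X \<Longrightarrow> Poly_Mapping.keys (u + v) \<subseteq> X"
  using keys_add[of u v] by blast

lemma abelian_group: "abelian_group M"
proof (rule abelian_groupI)
  fix x y z assume "x \<in> carrier M" "y \<in> carrier M" "z \<in> carrier M"
  then obtain u v w where "Poly_Mapping.keys u \<subseteq> X" "x = cls u" "Poly_Mapping.keys v \<subseteq> X" "y = cls v"
    "Poly_Mapping.keys w \<subseteq> X" "z = cls w" by (metis cls_cases)
  then show "x \<oplus> y \<oplus> z = x \<oplus> (y \<oplus> z)" by (simp add: cls_add keys_add_sub add.assoc)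
next
  fix x y assume "x \<in> carrier M" "y \<in> carrier M"
  then obtain u v where "Poly_Mapping.keys u \<subseteq> X" "x = cls u" "Poly_Mapping.keys v \<subseteq> X" "y = cls v"
    by (metis cls_cases)
  then show "x \<oplus> y \<in> carrier M" "x \<oplus> y = y \<oplus> x" by (simp_all add: cls_add keys_add_sub cls_closed add.commute)
next
  fix x assume "x \<in> carrier M"
  then obtain u where u: "Poly_Mapping.keys u \<subseteq> X" "x = cls u" by (metis cls_cases)
  then show "\<zero> \<oplus> x = x" by (simp add: cls_add cls_zero)
  show "\<exists>y\<in>carrier M. y \<oplus> x = \<zero>"
    using u by (intro bexI[of _ "cls (- u)"]) (simp_all add: cls_add cls_zero cls_closed)
qed (simp add: cls_zero cls_closed)

lemma cls_minus:
  assumes "Poly_Mapping.keys u \<subseteq> X" "Poly_Mapping.keys v \<subseteq> X"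
  shows "cls u \<ominus> cls v = cls (u - v)"
proof -
  interpret M: abelian_group M by (rule abelian_group)
  have k: "Poly_Mapping.keys (u - v) \<subseteq> X" using keys_diff[of u v] assms by blast
  then have "cls (u - v) \<oplus> cls v = cls u" using assms by (simp add: cls_add)
  then show ?thesis using k assms M.add_minus_cancel[of "cls (u - v)" "cls v"] by (simp add: cls_closed)
qed

lemma presented_induct [consumes 1, case_names gen zero diff]:
  assumes "t \<in> carrier M" "\<And>x. x \<in> X \<Longrightarrow> P (cls (frag_of x))"
    and "P \<zero>" "\<And>s t. s \<in> carrier M \<Longrightarrow> t \<in> carrier M \<Longrightarrow> P s \<Longrightarrow> P t \<Longrightarrow> P (s \<ominus> t)"
  shows "P t"
proof -
  obtain u where u: "Poly_Mapping.keys u \<subseteq> X" "t = cls u" using assms(1) by (metis cls_cases)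
  have "P (cls u)"
  proof (rule free_Abelian_group_induct[OF u(1), of "\<lambda>u. P (cls u)"])
    fix x y
    assume "Poly_Mapping.keys x \<subseteq> X" "Poly_Mapping.keys y \<subseteq> X" "P (cls x)" "P (cls y)"
    then show "P (cls (x - y))" using assms(4)[of "cls x" "cls y"] by (simp add: cls_minus cls_closed)
  qed (use assms(2,3) cls_zero in auto)
  then show ?thesis using u by simp
qed

lemma additive_eqI:
  assumes A: "abelian_group A" and fg: "additive_map M A f" "additive_map M A g"
    and eq: "\<And>x. x \<in> X \<Longrightarrow> f (cls (frag_of x)) = g (cls (frag_of x))" and t: "t \<in> carrier M"
  shows "f t = g t"
  using t
proof (induction t rule: presented_induct)
  case (diff s t)
  then show ?case
    using additive_map_minus[OF abelian_group A fg(1)] additive_map_minus[OF abelian_group A fg(2)] by simp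
next
  case zero
  then show ?case using additive_map_zero[OF abelian_group A fg(1)] additive_map_zero[OF abelian_group A fg(2)] by simp
qed (rule eq)

text \<open>An additive map of free groups sending relators to relations descends to classes; the union over
  representatives in the definitions of scalar multiplication and of products evaluates to the image class.\<close>

lemma union_cls:
  fixes \<psi> :: "('a \<Rightarrow>\<^sub>0 int) \<Rightarrow> ('b \<Rightarrow>\<^sub>0 int)"
  assumes N: "presented_group X' Q' N"
    and add: "\<And>u v. \<psi> (u - v) = \<psi> u - \<psi> v"
    and Q: "\<And>q. q \<in> Q \<Longrightarrow> \<psi> q \<in> presented_group.relations X' Q'"
  shows "(\<Union>u\<in>cls v. presented_class X' Q' (\<psi> u)) = presented_class X' Q' (\<psi> v)"
proof -
  interpret N: presented_group X' Q' N by fact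
  have z: "\<psi> 0 = 0" using add[of 0 0] by simp
  have rel: "\<psi> h \<in> N.relations" if "h \<in> relations" for h
    using that
  proof (induction rule: relations_induct)
    case zero
    then show ?case using z N.relations_zero by simp
  qed (use Q add N.relations_minus in auto)
  have "N.cls (\<psi> u) = N.cls (\<psi> v)" if "u \<in> cls v" for u
    unfolding N.cls_eq_iff using that rel[of "u - v"] add in_cls_iff by simp
  then show ?thesis using cls_self by blast
qed

end

section \<open>Evaluation of formal combinations and the universal property\<close>

definition frag_eval :: "('r, 'v, 'z) module_scheme \<Rightarrow> ('a \<Rightarrow> 'v) \<Rightarrow> ('a \<Rightarrow>\<^sub>0 int) \<Rightarrow> 'v" where
  "frag_eval A g u = (\<Oplus>\<^bsub>A\<^esub>x\<in>Poly_Mapping.keys u. [Poly_Mapping.lookup u x] \<cdot>\<^bsub>A\<^esub> g x)"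

text \<open>Lets combinations with different supports be summed over a common finite set; the
  additional terms are zero multiples.\<close>

lemma frag_eval_superset:
  assumes "abelian_group A" "g \<in> X \<rightarrow> carrier A" "finite K" "Poly_Mapping.keys u \<subseteq> K" "K \<subseteq> X"
  shows "frag_eval A g u = (\<Oplus>\<^bsub>A\<^esub>x\<in>K. [Poly_Mapping.lookup u x] \<cdot>\<^bsub>A\<^esub> g x)"
proof -
  interpret A: abelian_group A by fact
  have "[(0::int)] \<cdot>\<^bsub>A\<^esub> y = \<zero>\<^bsub>A\<^esub>" for y by (simp add: add_pow_def int_pow_def)
  then show ?thesis
    unfolding frag_eval_def using assms(2-)
    by (intro A.add.finprod_mono_neutral_cong_left) (auto simp: in_keys_iff)
qed

lemma frag_eval_closed:
  assumes "abelian_group A" "g \<in> X \<rightarrow> carrier A" "Poly_Mapping.keys u \<subseteq> X"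
  shows "frag_eval A g u \<in> carrier A"
proof -
  interpret A: abelian_group A by fact
  show ?thesis unfolding frag_eval_def using assms(2,3) by (intro A.finsum_closed) auto
qed

lemma frag_eval_add:
  assumes "abelian_group A" "g \<in> X \<rightarrow> carrier A" "Poly_Mapping.keys u \<subseteq> X" "Poly_Mapping.keys v \<subseteq> X"
  shows "frag_eval A g (u + v) = frag_eval A g u \<oplus>\<^bsub>A\<^esub> frag_eval A g v"
proof -
  interpret A: abelian_group A by fact
  let ?K = "Poly_Mapping.keys u \<union> Poly_Mapping.keys v"
  have K: "finite ?K" "?K \<subseteq> X" using assms by auto
  have car: "g x \<in> carrier A" if "x \<in> ?K" for x using that K(2) assms(2) by auto
  have "frag_eval A g (u + v) = (\<Oplus>\<^bsub>A\<^esub>x\<in>?K. [Poly_Mapping.lookup (u + v) x] \<cdot>\<^bsub>A\<^esub> g x)"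
    by (rule frag_eval_superset[OF assms(1,2) K(1) keys_add K(2)])
  also have "\<dots> = (\<Oplus>\<^bsub>A\<^esub>x\<in>?K. [Poly_Mapping.lookup u x] \<cdot>\<^bsub>A\<^esub> g x \<oplus>\<^bsub>A\<^esub> [Poly_Mapping.lookup v x] \<cdot>\<^bsub>A\<^esub> g x)"
    by (intro A.add.finprod_cong'[OF refl])
      (use car in \<open>auto simp: Poly_Mapping.lookup_add A.add.int_pow_mult\<close>)
  also have "\<dots> = frag_eval A g u \<oplus>\<^bsub>A\<^esub> frag_eval A g v"
    using car by (simp add: A.finsum_addf frag_eval_superset[OF assms(1,2) K(1) _ K(2)] Pi_iff)
  finally show ?thesis .
qed

lemma frag_eval_frag_of:
  assumes "abelian_group A" "g x \<in> carrier A"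
  shows "frag_eval A g (frag_of x) = g x"
proof -
  interpret A: abelian_group A by fact
  show ?thesis using assms(2) by (simp add: frag_eval_def)
qed

lemma frag_eval_diff:
  assumes "abelian_group A" "g \<in> X \<rightarrow> carrier A" "Poly_Mapping.keys u \<subseteq> X" "Poly_Mapping.keys v \<subseteq> X"
  shows "frag_eval A g (u - v) = frag_eval A g u \<ominus>\<^bsub>A\<^esub> frag_eval A g v"
proof -
  interpret A: abelian_group A by fact
  have k: "Poly_Mapping.keys (u - v) \<subseteq> X" using keys_diff[of u v] assms by blast
  have "frag_eval A g u = frag_eval A g (u - v) \<oplus>\<^bsub>A\<^esub> frag_eval A g v"
    using frag_eval_add[OF assms(1,2) k assms(4)] by simp
  then show ?thesis
    using A.add_minus_cancel frag_eval_closed[OF assms(1,2)] k assms(4) by metis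
qed

context presented_group
begin

text \<open>As \<open>g\<close> kills the relators, \<open>frag_eval\<close> is constant on classes,
  so the representative picked by \<open>SOME\<close> in \<open>presented_lift\<close> is
  immaterial.\<close>

lemma presented_lift:
  assumes A: "abelian_group A" and g: "g \<in> X \<rightarrow> carrier A"
    and Q: "\<And>q. q \<in> Q \<Longrightarrow> frag_eval A g q = \<zero>\<^bsub>A\<^esub>"
  shows presented_lift_additive: "additive_map M A (presented_lift A g)"
    and presented_lift_gen: "x \<in> X \<Longrightarrow> presented_lift A g (cls (frag_of x)) = g x"
proof -
  interpret A: abelian_group A by fact
  have rel: "frag_eval A g h = \<zero>\<^bsub>A\<^esub>" if "h \<in> relations" for h
    using that
  proof (induction rule: relations_induct)
    case zero
    then show ?case by (simp add: frag_eval_def)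
  next
    case (diff u v)
    then show ?case by (simp add: frag_eval_diff[OF A g] relations_keys A.minus_self)
  qed (use Q in auto)
  have eval: "presented_lift A g (cls v) = frag_eval A g v" if v: "Poly_Mapping.keys v \<subseteq> X" for v
  proof -
    define u where "u = (SOME u. u \<in> cls v)"
    have "u \<in> cls v" unfolding u_def by (rule someI[of _ v]) (rule cls_self)
    then have h: "u - v \<in> relations" using in_cls_iff by simp
    have "frag_eval A g ((u - v) + v) = frag_eval A g v"
      using frag_eval_add[OF A g relations_keys[OF h] v] rel[OF h] frag_eval_closed[OF A g v] by simp
    then show ?thesis by (simp add: presented_lift_def Let_def u_def frag_eval_def)
  qed
  show "additive_map M A (presented_lift A g)"
  proof (rule additive_mapI)
    fix s t assume "s \<in> carrier M" "t \<in> carrier M"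
    then obtain u v where "Poly_Mapping.keys u \<subseteq> X" "s = cls u" "Poly_Mapping.keys v \<subseteq> X" "t = cls v"
      by (metis cls_cases)
    then show "presented_lift A g (s \<oplus> t) = presented_lift A g s \<oplus>\<^bsub>A\<^esub> presented_lift A g t"
      by (simp add: cls_add eval keys_add_sub frag_eval_add[OF A g])
  qed (metis cls_cases eval frag_eval_closed[OF A g])
  show "x \<in> X \<Longrightarrow> presented_lift A g (cls (frag_of x)) = g x"
    using g by (simp add: eval frag_eval_frag_of[OF A] Pi_iff)
qed

end

section \<open>The tensor product of a bimodule with a left module\<close>

definition balanced ::
    "'r ring \<Rightarrow> ('r, 'b) bimodule \<Rightarrow> ('r, 'v) module \<Rightarrow> ('r, 'w) module \<Rightarrow> ('b \<Rightarrow> 'v \<Rightarrow> 'w) \<Rightarrow> bool" where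
  "balanced S B V A g \<longleftrightarrow> (\<forall>b\<in>carrier B. additive_map V A (g b)) \<and>
     (\<forall>v\<in>carrier V. additive_map B A (\<lambda>b. g b v)) \<and>
     (\<forall>b\<in>carrier B. \<forall>s\<in>carrier S. \<forall>v\<in>carrier V. g (rsmult B b s) v = g b (s \<odot>\<^bsub>V\<^esub> v))"

lemma tensor_rel_add_left:
  "b \<in> carrier B \<Longrightarrow> b' \<in> carrier B \<Longrightarrow> v \<in> carrier V \<Longrightarrow>
    frag_of (b \<oplus>\<^bsub>B\<^esub> b', v) - frag_of (b, v) - frag_of (b', v) \<in> tensor_rel S B V"
  unfolding tensor_rel_def by (rule UnI1, rule UnI1, rule CollectI, intro exI conjI, rule refl)

lemma tensor_rel_add_right:
  "b \<in> carrier B \<Longrightarrow> v \<in> carrier V \<Longrightarrow> v' \<in> carrier V \<Longrightarrow>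
    frag_of (b, v \<oplus>\<^bsub>V\<^esub> v') - frag_of (b, v) - frag_of (b, v') \<in> tensor_rel S B V"
  unfolding tensor_rel_def by (rule UnI1, rule UnI2, rule CollectI, intro exI conjI, rule refl)

lemma tensor_rel_rsmult:
  "b \<in> carrier B \<Longrightarrow> s \<in> carrier S \<Longrightarrow> v \<in> carrier V \<Longrightarrow>
    frag_of (rsmult B b s, v) - frag_of (b, s \<odot>\<^bsub>V\<^esub> v) \<in> tensor_rel S B V"
  unfolding tensor_rel_def by (rule UnI2, rule CollectI, intro exI conjI, rule refl)

lemma tensor_rel_cases [consumes 1, case_names add_left add_right rsmult]:
  assumes "q \<in> tensor_rel S B V"
    and "\<And>b b' v. q = frag_of (b \<oplus>\<^bsub>B\<^esub> b', v) - frag_of (b, v) - frag_of (b', v) \<Longrightarrow>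
      b \<in> carrier B \<Longrightarrow> b' \<in> carrier B \<Longrightarrow> v \<in> carrier V \<Longrightarrow> thesis"
    and "\<And>b v v'. q = frag_of (b, v \<oplus>\<^bsub>V\<^esub> v') - frag_of (b, v) - frag_of (b, v') \<Longrightarrow>
      b \<in> carrier B \<Longrightarrow> v \<in> carrier V \<Longrightarrow> v' \<in> carrier V \<Longrightarrow> thesis"
    and "\<And>b s v. q = frag_of (rsmult B b s, v) - frag_of (b, s \<odot>\<^bsub>V\<^esub> v) \<Longrightarrow>
      b \<in> carrier B \<Longrightarrow> s \<in> carrier S \<Longrightarrow> v \<in> carrier V \<Longrightarrow> thesis"
  shows thesis
  using assms(1) unfolding tensor_rel_def
  by (elim UnE CollectE exE conjE) (fact assms(2-4))+

locale tensor_product = B: bimodule R S B + V: left_module S V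
  for R S :: "'r ring" and B :: "('r, 'b) bimodule" and V :: "('r, 'v) module"
begin

abbreviation "T \<equiv> tensor S B V"
abbreviation "pure \<equiv> pure_tensor S B V"

sublocale presented_group "carrier B \<times> carrier V" "tensor_rel S B V" T
proof
  fix q assume "q \<in> tensor_rel S B V"
  then show "Poly_Mapping.keys q \<subseteq> carrier B \<times> carrier V"
    by (cases rule: tensor_rel_cases)
      (auto dest!: subsetD[OF keys_diff] simp: B.rsmult_closed V.smult_closed)
qed (auto simp: tensor_def Let_def)

sublocale T: abelian_group T by (rule abelian_group)

lemma pure_eq: "pure b v = cls (frag_of (b, v))"
  by (simp add: pure_tensor_def tensor_class_def)

lemma pure_closed: "b \<in> carrier B \<Longrightarrow> v \<in> carrier V \<Longrightarrow> pure b v \<in> carrier T"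
  unfolding pure_eq by (rule cls_frag_closed) simp

lemma tensor_induct [consumes 1, case_names pure zero diff]:
  assumes "t \<in> carrier T" "\<And>b v. b \<in> carrier B \<Longrightarrow> v \<in> carrier V \<Longrightarrow> P (pure b v)" "P \<zero>\<^bsub>T\<^esub>"
    and "\<And>s t. s \<in> carrier T \<Longrightarrow> t \<in> carrier T \<Longrightarrow> P s \<Longrightarrow> P t \<Longrightarrow> P (s \<ominus>\<^bsub>T\<^esub> t)"
  shows "P t"
proof (rule presented_induct[OF assms(1) _ assms(3,4)])
  fix x assume "x \<in> carrier B \<times> carrier V"
  then obtain b v where "x = (b, v)" "b \<in> carrier B" "v \<in> carrier V" by auto
  then show "P (cls (frag_of x))" using assms(2)[of b v] by (simp add: pure_eq)
qed

lemma tensor_eqI: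
  assumes "abelian_group A" "additive_map T A f" "additive_map T A g" "t \<in> carrier T"
    and "\<And>b v. b \<in> carrier B \<Longrightarrow> v \<in> carrier V \<Longrightarrow> f (pure b v) = g (pure b v)"
  shows "f t = g t"
proof (rule additive_eqI[OF assms(1-3) _ assms(4)])
  fix x assume "x \<in> carrier B \<times> carrier V"
  then obtain b v where "x = (b, v)" "b \<in> carrier B" "v \<in> carrier V" by auto
  then show "f (cls (frag_of x)) = g (cls (frag_of x))" using assms(5)[of b v] by (simp add: pure_eq)
qed

lemma pure_add_left:
  assumes "b \<in> carrier B" "c \<in> carrier B" "v \<in> carrier V"
  shows "pure (b \<oplus>\<^bsub>B\<^esub> c) v = pure b v \<oplus>\<^bsub>T\<^esub> pure c v"
proof -
  have "frag_of (b \<oplus>\<^bsub>B\<^esub> c, v) - frag_of (b, v) - frag_of (c, v) \<in> relations"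
    using assms by (intro subsetD[OF relations_superset] tensor_rel_add_left)
  then show ?thesis using assms unfolding pure_eq by (subst cls_add) (auto simp: cls_eq_iff diff_diff_eq)
qed

lemma pure_add_right:
  assumes "b \<in> carrier B" "v \<in> carrier V" "w \<in> carrier V"
  shows "pure b (v \<oplus>\<^bsub>V\<^esub> w) = pure b v \<oplus>\<^bsub>T\<^esub> pure b w"
proof -
  have "frag_of (b, v \<oplus>\<^bsub>V\<^esub> w) - frag_of (b, v) - frag_of (b, w) \<in> relations"
    using assms by (intro subsetD[OF relations_superset] tensor_rel_add_right)
  then show ?thesis using assms unfolding pure_eq by (subst cls_add) (auto simp: cls_eq_iff diff_diff_eq)
qed

lemma pure_rsmult:
  assumes "b \<in> carrier B" "s \<in> carrier S" "v \<in> carrier V"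
  shows "pure (rsmult B b s) v = pure b (s \<odot>\<^bsub>V\<^esub> v)"
proof -
  have "frag_of (rsmult B b s, v) - frag_of (b, s \<odot>\<^bsub>V\<^esub> v) \<in> relations"
    using assms by (intro subsetD[OF relations_superset] tensor_rel_rsmult)
  then show ?thesis unfolding pure_eq by (simp add: cls_eq_iff)
qed

lemma balanced_pure: "balanced S B V T pure"
  by (auto simp: balanced_def additive_map_def pure_closed pure_add_left pure_add_right pure_rsmult)

lemma pure_zero_right: "b \<in> carrier B \<Longrightarrow> pure b \<zero>\<^bsub>V\<^esub> = \<zero>\<^bsub>T\<^esub>"
  using balanced_pure
  by (intro additive_map_zero[OF V.abelian_group_axioms T.abelian_group_axioms]) (auto simp: balanced_def)

text \<open>The left action sends relators to relators, the balancing ones because it commutes with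
  the right action. Hence the union over representatives is a single class.\<close>

lemma smult_cls:
  assumes "a \<in> carrier R" "Poly_Mapping.keys u \<subseteq> carrier B \<times> carrier V"
  shows "a \<odot>\<^bsub>T\<^esub> cls u = cls (frag_extend (\<lambda>(b, v). frag_of (a \<odot>\<^bsub>B\<^esub> b, v)) u)"
proof -
  let ?\<psi> = "frag_extend (\<lambda>(b, v). frag_of (a \<odot>\<^bsub>B\<^esub> b, v))"
  have "?\<psi> q \<in> relations" if q: "q \<in> tensor_rel S B V" for q
  proof -
    have "?\<psi> q \<in> tensor_rel S B V"
      using q
    proof (cases rule: tensor_rel_cases)
      case (add_left b b' v)
      then have "?\<psi> q = frag_of (a \<odot>\<^bsub>B\<^esub> b \<oplus>\<^bsub>B\<^esub> a \<odot>\<^bsub>B\<^esub> b', v) - frag_of (a \<odot>\<^bsub>B\<^esub> b, v) - frag_of (a \<odot>\<^bsub>B\<^esub> b', v)"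
        using assms(1) by (simp add: frag_extend_diff B.smult_r_distr)
      then show ?thesis using add_left assms(1) by (simp add: tensor_rel_add_left B.smult_closed)
    next
      case (add_right b v v')
      then have "?\<psi> q = frag_of (a \<odot>\<^bsub>B\<^esub> b, v \<oplus>\<^bsub>V\<^esub> v') - frag_of (a \<odot>\<^bsub>B\<^esub> b, v) - frag_of (a \<odot>\<^bsub>B\<^esub> b, v')"
        by (simp add: frag_extend_diff)
      then show ?thesis using add_right assms(1) by (simp add: tensor_rel_add_right B.smult_closed)
    next
      case (rsmult b s v)
      then have "?\<psi> q = frag_of (rsmult B (a \<odot>\<^bsub>B\<^esub> b) s, v) - frag_of (a \<odot>\<^bsub>B\<^esub> b, s \<odot>\<^bsub>V\<^esub> v)"
        using assms(1) by (simp add: frag_extend_diff B.smult_rsmult)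
      then show ?thesis using rsmult assms(1) by (simp add: tensor_rel_rsmult B.smult_closed)
    qed
    then show ?thesis using relations_superset by auto
  qed
  then have "(\<Union>w\<in>cls u. cls (?\<psi> w)) = cls (?\<psi> u)"
    by (intro union_cls[OF presented_group_axioms]) (auto simp: frag_extend_diff)
  then show ?thesis by (simp add: tensor_def Let_def tensor_class_def)
qed

lemma smult_pure: "a \<in> carrier R \<Longrightarrow> b \<in> carrier B \<Longrightarrow> v \<in> carrier V \<Longrightarrow> a \<odot>\<^bsub>T\<^esub> pure b v = pure (a \<odot>\<^bsub>B\<^esub> b) v"
  by (simp add: pure_eq smult_cls)

lemma smult_additive:
  assumes a: "a \<in> carrier R"
  shows "additive_map T T (\<lambda>t. a \<odot>\<^bsub>T\<^esub> t)"
proof (rule additive_mapI)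
  let ?X = "carrier B \<times> carrier V"
  let ?\<psi> = "frag_extend (\<lambda>(b, v). frag_of (a \<odot>\<^bsub>B\<^esub> b, v))"
  have keys: "Poly_Mapping.keys (?\<psi> u) \<subseteq> ?X" if "Poly_Mapping.keys u \<subseteq> ?X" for u
    using that keys_frag_extend[of "\<lambda>(b, v). frag_of (a \<odot>\<^bsub>B\<^esub> b, v)" u] a
    by (fastforce intro: B.smult_closed)
  fix s assume s: "s \<in> carrier T"
  then obtain u where u: "Poly_Mapping.keys u \<subseteq> ?X" "s = cls u" by (metis cls_cases)
  then show "a \<odot>\<^bsub>T\<^esub> s \<in> carrier T" using a keys by (simp add: smult_cls cls_closed)
  fix t assume t: "t \<in> carrier T"
  then obtain v where v: "Poly_Mapping.keys v \<subseteq> ?X" "t = cls v" by (metis cls_cases)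
  show "a \<odot>\<^bsub>T\<^esub> (s \<oplus>\<^bsub>T\<^esub> t) = a \<odot>\<^bsub>T\<^esub> s \<oplus>\<^bsub>T\<^esub> a \<odot>\<^bsub>T\<^esub> t"
    using u v a keys by (simp add: cls_add smult_cls keys_add_sub frag_extend_add)
qed

text \<open>Each law equates two additive maps of the tensor product, so it is checked on pure
  tensors, where it comes from a law of \<open>B\<close>.\<close>

lemma left_module: "left_module R T"
proof (intro left_module.intro left_module_axioms.intro B.R.ring_axioms T.abelian_group_axioms)
  note sa = smult_additive
  note ai = additive_map_closed[OF smult_additive] additive_map_add[OF smult_additive]
  show cl: "a \<odot>\<^bsub>T\<^esub> t \<in> carrier T" if "a \<in> carrier R" "t \<in> carrier T" for a t using ai that by simp
  show "a \<odot>\<^bsub>T\<^esub> (s \<oplus>\<^bsub>T\<^esub> t) = a \<odot>\<^bsub>T\<^esub> s \<oplus>\<^bsub>T\<^esub> a \<odot>\<^bsub>T\<^esub> t"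
    if "a \<in> carrier R" "s \<in> carrier T" "t \<in> carrier T" for a s t using ai that by simp
  show "(a \<oplus>\<^bsub>R\<^esub> b) \<odot>\<^bsub>T\<^esub> t = a \<odot>\<^bsub>T\<^esub> t \<oplus>\<^bsub>T\<^esub> b \<odot>\<^bsub>T\<^esub> t" if ab: "a \<in> carrier R" "b \<in> carrier R" "t \<in> carrier T" for a b t
  proof (rule tensor_eqI[OF T.abelian_group_axioms _ _ ab(3)])
    show "additive_map T T (\<lambda>t. (a \<oplus>\<^bsub>R\<^esub> b) \<odot>\<^bsub>T\<^esub> t)" using ab by (intro sa) simp
    show "additive_map T T (\<lambda>t. a \<odot>\<^bsub>T\<^esub> t \<oplus>\<^bsub>T\<^esub> b \<odot>\<^bsub>T\<^esub> t)"
      using ai ab(1,2) by (intro additive_mapI) (auto simp: T.a_ac)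
    show "(a \<oplus>\<^bsub>R\<^esub> b) \<odot>\<^bsub>T\<^esub> pure c v = a \<odot>\<^bsub>T\<^esub> pure c v \<oplus>\<^bsub>T\<^esub> b \<odot>\<^bsub>T\<^esub> pure c v" if "c \<in> carrier B" "v \<in> carrier V" for c v
      using that ab by (simp add: smult_pure B.smult_l_distr pure_add_left B.smult_closed)
  qed
  show "(a \<otimes>\<^bsub>R\<^esub> b) \<odot>\<^bsub>T\<^esub> t = a \<odot>\<^bsub>T\<^esub> (b \<odot>\<^bsub>T\<^esub> t)" if ab: "a \<in> carrier R" "b \<in> carrier R" "t \<in> carrier T" for a b t
  proof (rule tensor_eqI[OF T.abelian_group_axioms _ _ ab(3)])
    show "additive_map T T (\<lambda>t. (a \<otimes>\<^bsub>R\<^esub> b) \<odot>\<^bsub>T\<^esub> t)" using ab by (intro sa) simp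
    show "additive_map T T (\<lambda>t. a \<odot>\<^bsub>T\<^esub> (b \<odot>\<^bsub>T\<^esub> t))" using ab by (intro additive_map_comp[OF sa sa])
    show "(a \<otimes>\<^bsub>R\<^esub> b) \<odot>\<^bsub>T\<^esub> pure c v = a \<odot>\<^bsub>T\<^esub> (b \<odot>\<^bsub>T\<^esub> pure c v)" if "c \<in> carrier B" "v \<in> carrier V" for c v
      using that ab by (simp add: smult_pure B.smult_assoc B.smult_closed)
  qed
  show "\<one>\<^bsub>R\<^esub> \<odot>\<^bsub>T\<^esub> t = t" if t: "t \<in> carrier T" for t
  proof (rule tensor_eqI[OF T.abelian_group_axioms _ _ t])
    show "additive_map T T (\<lambda>t. t)" by (rule additive_mapI) simp_all
    show "\<one>\<^bsub>R\<^esub> \<odot>\<^bsub>T\<^esub> pure c v = pure c v" if "c \<in> carrier B" "v \<in> carrier V" for c v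
      using that by (simp add: smult_pure B.smult_one)
  qed (rule sa, simp)
qed

lemma tensor_lift:
  assumes A: "abelian_group A" and g: "balanced S B V A g"
  shows tensor_lift_additive: "additive_map T A (tensor_lift A g)"
    and tensor_lift_pure: "b \<in> carrier B \<Longrightarrow> v \<in> carrier V \<Longrightarrow> tensor_lift A g (pure b v) = g b v"
proof -
  interpret A: abelian_group A by fact
  let ?X = "carrier B \<times> carrier V" and ?g = "\<lambda>(b, v). g b v"
  have gX: "?g \<in> ?X \<rightarrow> carrier A" using g by (auto simp: balanced_def additive_map_def)
  have cl: "g b v \<in> carrier A" if "b \<in> carrier B" "v \<in> carrier V" for b v using funcset_mem[OF gX, of "(b, v)"] that by simp
  have ev: "frag_eval A ?g (frag_of (b, v)) = g b v" if "b \<in> carrier B" "v \<in> carrier V" for b v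
    using that cl by (subst frag_eval_frag_of[OF A]) auto
  have Q: "frag_eval A ?g q = \<zero>\<^bsub>A\<^esub>" if "q \<in> tensor_rel S B V" for q
    using that
  proof (cases rule: tensor_rel_cases)
    case *: (add_left b b' v)
    have k: "Poly_Mapping.keys (frag_of (b \<oplus>\<^bsub>B\<^esub> b', v) - frag_of (b, v)) \<subseteq> ?X"
      using * keys_diff[of "frag_of (b \<oplus>\<^bsub>B\<^esub> b', v)" "frag_of (b, v)"] by auto
    have "g (b \<oplus>\<^bsub>B\<^esub> b') v = g b v \<oplus>\<^bsub>A\<^esub> g b' v" using g * by (auto simp: balanced_def additive_map_def)
    then show ?thesis using * k cl
      by (simp add: frag_eval_diff[OF A gX] ev A.minus_eq A.a_ac A.r_neg1 A.r_neg)
  next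
    case *: (add_right b v v')
    have k: "Poly_Mapping.keys (frag_of (b, v \<oplus>\<^bsub>V\<^esub> v') - frag_of (b, v)) \<subseteq> ?X"
      using * keys_diff[of "frag_of (b, v \<oplus>\<^bsub>V\<^esub> v')" "frag_of (b, v)"] by auto
    have "g b (v \<oplus>\<^bsub>V\<^esub> v') = g b v \<oplus>\<^bsub>A\<^esub> g b v'" using g * by (auto simp: balanced_def additive_map_def)
    then show ?thesis using * k cl
      by (simp add: frag_eval_diff[OF A gX] ev A.minus_eq A.a_ac A.r_neg1 A.r_neg)
  next
    case *: (rsmult b s v)
    have "g (rsmult B b s) v = g b (s \<odot>\<^bsub>V\<^esub> v)" using g * by (auto simp: balanced_def)
    then show ?thesis using * cl
      by (simp add: frag_eval_diff[OF A gX] ev A.minus_self B.rsmult_closed V.smult_closed)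
  qed
  show "additive_map T A (tensor_lift A g)"
    unfolding tensor_lift_def by (rule presented_lift_additive[OF A gX Q])
  show "b \<in> carrier B \<Longrightarrow> v \<in> carrier V \<Longrightarrow> tensor_lift A g (pure b v) = g b v"
    unfolding tensor_lift_def pure_eq by (subst presented_lift_gen[OF A gX Q]) auto
qed

lemma tensor_lift_linear:
  assumes A: "left_module R A" and g: "balanced S B V A g"
    and lin: "\<And>a b v. a \<in> carrier R \<Longrightarrow> b \<in> carrier B \<Longrightarrow> v \<in> carrier V \<Longrightarrow> g (a \<odot>\<^bsub>B\<^esub> b) v = a \<odot>\<^bsub>A\<^esub> g b v"
  shows "linear_map R T A (tensor_lift A g)"
proof -
  interpret A: left_module R A by fact
  interpret T: left_module R T by (rule left_module)
  note L = tensor_lift_additive[OF A.abelian_group_axioms g]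
  show ?thesis
    unfolding linear_map_def
  proof (intro conjI L ballI)
    fix a t assume at: "a \<in> carrier R" "t \<in> carrier T"
    show "tensor_lift A g (a \<odot>\<^bsub>T\<^esub> t) = a \<odot>\<^bsub>A\<^esub> tensor_lift A g t"
    proof (rule tensor_eqI[OF A.abelian_group_axioms _ _ at(2)])
      show "additive_map T A (\<lambda>t. tensor_lift A g (a \<odot>\<^bsub>T\<^esub> t))"
        by (rule additive_map_comp[OF smult_additive[OF at(1)] L])
      show "additive_map T A (\<lambda>t. a \<odot>\<^bsub>A\<^esub> tensor_lift A g t)"
        using additive_mapD[OF L] at(1) by (intro additive_mapI) (auto intro: A.smult_closed A.smult_r_distr)
      show "tensor_lift A g (a \<odot>\<^bsub>T\<^esub> pure b v) = a \<odot>\<^bsub>A\<^esub> tensor_lift A g (pure b v)"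
        if "b \<in> carrier B" "v \<in> carrier V" for b v
        using that at(1) lin
        by (simp add: smult_pure tensor_lift_pure[OF A.abelian_group_axioms g] B.smult_closed)
    qed
  qed
qed

text \<open>The pure tensors of generators suffice. The factor in \<open>B\<close> becomes arbitrary
  while \<open>v\<close> is still a generator, and only afterwards is \<open>v\<close>
  released.\<close>

lemma finitely_generated_tensor:
  assumes "finitely_generated R B" "finitely_generated S V"
  shows "finitely_generated R T"
proof -
  interpret T: left_module R T by (rule left_module)
  obtain X where X: "finite X" "X \<subseteq> carrier B" "span R B X = carrier B"
    using assms(1) by (auto simp: finitely_generated_def)
  obtain Y where Y: "finite Y" "Y \<subseteq> carrier V" "span S V Y = carrier V"
    using assms(2) by (auto simp: finitely_generated_def)
  let ?Z = "(\<lambda>(b, v). pure b v) ` (X \<times> Y)"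
  have Z: "?Z \<subseteq> carrier T" using X(2) Y(2) pure_closed by auto
  note S = T.submoduleD[OF T.span_submodule[OF Z]]
  have 1: "pure b v \<in> span R T ?Z" if b: "b \<in> carrier B" and v: "v \<in> Y" for b v
  proof -
    have vc: "v \<in> carrier V" using v Y by auto
    have "pure \<zero>\<^bsub>B\<^esub> v = \<zero>\<^bsub>T\<^esub>"
      using balanced_pure vc
      by (intro additive_map_zero[OF B.M.abelian_group_axioms T.abelian_group_axioms, of "\<lambda>b. pure b v"])
        (auto simp: balanced_def)
    then have "submodule {b \<in> carrier B. pure b v \<in> span R T ?Z} R B"
      using S vc by (intro B.left_submoduleI) (auto simp: pure_add_left smult_pure[symmetric] B.smult_closed)
    moreover have "X \<subseteq> {b \<in> carrier B. pure b v \<in> span R T ?Z}"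
      using X v span_superset[of ?Z R T] by auto
    ultimately have "span R B X \<subseteq> {b \<in> carrier B. pure b v \<in> span R T ?Z}" by (rule span_least)
    then show ?thesis using b X(3) by auto
  qed
  \<comment> \<open>The condition is imposed for all \<open>b\<close> at once: closure under a
    scalar \<open>s\<close> rests on \<open>b \<otimes> s v = b s \<otimes> v\<close>, which changes
    \<open>b\<close>.\<close>
  have 2: "pure b v \<in> span R T ?Z" if b: "b \<in> carrier B" and v: "v \<in> carrier V" for b v
  proof -
    have "submodule {v \<in> carrier V. \<forall>b\<in>carrier B. pure b v \<in> span R T ?Z} S V"
      using S by (intro V.left_submoduleI)
        (auto simp: pure_add_right pure_rsmult[symmetric] pure_zero_right B.rsmult_closed V.smult_closed)
    moreover have "Y \<subseteq> {v \<in> carrier V. \<forall>b\<in>carrier B. pure b v \<in> span R T ?Z}"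
      using Y 1 by auto
    ultimately have "span S V Y \<subseteq> {v \<in> carrier V. \<forall>b\<in>carrier B. pure b v \<in> span R T ?Z}" by (rule span_least)
    then show ?thesis using b v Y(3) by auto
  qed
  have "t \<in> span R T ?Z" if "t \<in> carrier T" for t
    using that by (induction rule: tensor_induct) (use 2 S in auto)
  then have "span R T ?Z = carrier T" using S by blast
  then show ?thesis unfolding finitely_generated_def using X(1) Y(1) Z by (intro exI[of _ ?Z]) auto
qed

end

lemma tensor_map_props:
  fixes R S :: "'r ring"
  assumes B: "bimodule R S B" and V: "left_module S V" and W: "left_module S W" and f: "linear_map S V W f"
  shows tensor_map_linear: "linear_map R (tensor S B V) (tensor S B W) (tensor_map S B W f)"
    and tensor_map_pure: "b \<in> carrier B \<Longrightarrow> v \<in> carrier V \<Longrightarrow>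
      tensor_map S B W f (pure_tensor S B V b v) = pure_tensor S B W b (f v)"
proof -
  interpret B: bimodule R S B by fact
  interpret V: tensor_product R S B V using B V by (intro tensor_product.intro)
  interpret W: tensor_product R S B W using B W by (intro tensor_product.intro)
  have bal: "balanced S B V W.T (\<lambda>b v. W.pure b (f v))"
    using linear_mapD[OF f]
    by (auto simp: balanced_def additive_map_def W.pure_closed W.pure_add_left W.pure_add_right W.pure_rsmult)
  show "linear_map R V.T W.T (tensor_map S B W f)"
    unfolding tensor_map_def
    by (rule V.tensor_lift_linear[OF W.left_module bal])
      (simp add: W.smult_pure linear_map_closed[OF f])
  show "b \<in> carrier B \<Longrightarrow> v \<in> carrier V \<Longrightarrow> tensor_map S B W f (V.pure b v) = W.pure b (f v)"
    unfolding tensor_map_def by (rule V.tensor_lift_pure[OF W.T.abelian_group_axioms bal])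
qed

section \<open>Direct sums, coordinate spaces and quotients\<close>

definition ds_inj :: "'i set \<Rightarrow> ('i \<Rightarrow> ('r, 'v) module) \<Rightarrow> 'i \<Rightarrow> 'v \<Rightarrow> 'i \<Rightarrow> 'v" where
  "ds_inj I M i t = (\<lambda>j\<in>I. if j = i then t else \<zero>\<^bsub>M j\<^esub>)"

locale module_family =
  fixes R :: "('r, 'y) ring_scheme" and I :: "'i set" and M :: "'i \<Rightarrow> ('r, 'v) module"
  assumes ring: "ring R" and fin: "finite I" and mods: "i \<in> I \<Longrightarrow> left_module R (M i)"
begin

abbreviation "D \<equiv> direct_sum I M"

lemma ds_simps:
  shows ds_carrier: "u \<in> carrier D \<longleftrightarrow> u \<in> extensional I \<and> (\<forall>i\<in>I. u i \<in> carrier (M i))"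
    and ds_zero: "\<zero>\<^bsub>D\<^esub> = (\<lambda>i\<in>I. \<zero>\<^bsub>M i\<^esub>)"
    and ds_add: "u \<oplus>\<^bsub>D\<^esub> w = (\<lambda>i\<in>I. u i \<oplus>\<^bsub>M i\<^esub> w i)"
    and ds_smult: "a \<odot>\<^bsub>D\<^esub> u = (\<lambda>i\<in>I. a \<odot>\<^bsub>M i\<^esub> u i)"
  by (auto simp: direct_sum_def PiE_def)

lemma ds_mem: "u \<in> carrier D \<Longrightarrow> i \<in> I \<Longrightarrow> u i \<in> carrier (M i)"
  by (simp add: ds_carrier)

lemma ds_eqI: "u \<in> carrier D \<Longrightarrow> w \<in> carrier D \<Longrightarrow> (\<And>i. i \<in> I \<Longrightarrow> u i = w i) \<Longrightarrow> u = w"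
  unfolding ds_carrier by (metis extensionalityI)

lemma left_module: "left_module R D"
proof -
  have ab: "abelian_group (M i)" if "i \<in> I" for i using mods[OF that] by (rule left_module.axioms)
  have mon: "abelian_monoid (M i)" if "i \<in> I" for i using ab[OF that] by (rule abelian_group.axioms)
  note cl = abelian_monoid.a_closed[OF mon] abelian_monoid.zero_closed[OF mon] abelian_monoid.a_assoc[OF mon]
    abelian_monoid.a_comm[OF mon] abelian_monoid.l_zero[OF mon]
    left_module.smult_closed[OF mods]
  have "abelian_group D"
  proof (rule abelian_groupI)
    fix x assume x: "x \<in> carrier D"
    show "\<exists>y\<in>carrier D. y \<oplus>\<^bsub>D\<^esub> x = \<zero>\<^bsub>D\<^esub>"
      using x abelian_group.a_inv_closed[OF ab] abelian_group.l_neg[OF ab]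
      by (intro bexI[of _ "\<lambda>i\<in>I. \<ominus>\<^bsub>M i\<^esub> x i"]) (auto simp: ds_simps intro!: restrict_ext)
  next
    fix x assume x: "x \<in> carrier D"
    show "\<zero>\<^bsub>D\<^esub> \<oplus>\<^bsub>D\<^esub> x = x" using x cl by (intro ds_eqI) (auto simp: ds_simps)
  qed (use cl in \<open>auto simp: ds_simps intro!: restrict_ext\<close>)
  then show ?thesis
  proof (intro left_module.intro left_module_axioms.intro ring)
    fix m assume "m \<in> carrier D"
    then show "\<one>\<^bsub>R\<^esub> \<odot>\<^bsub>D\<^esub> m = m"
      using left_module.smult_one[OF mods] cl ring.ring_simprules(6)[OF ring] by (intro ds_eqI) (auto simp: ds_simps)
  qed (use cl left_module.smult_l_distr[OF mods] left_module.smult_r_distr[OF mods]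
    left_module.smult_assoc[OF mods] in \<open>auto simp: ds_simps intro!: restrict_ext\<close>)
qed

sublocale D: left_module R D by (rule left_module)

lemma mod_abelian: "i \<in> I \<Longrightarrow> abelian_group (M i)"
  using mods by (rule left_module.axioms)

lemma proj_linear: "i \<in> I \<Longrightarrow> linear_map R D (M i) (\<lambda>u. u i)"
  by (intro linear_mapI) (auto simp: ds_simps)

lemma inj_closed: "i \<in> I \<Longrightarrow> t \<in> carrier (M i) \<Longrightarrow> ds_inj I M i t \<in> carrier D"
  using abelian_monoid.zero_closed[OF abelian_group.axioms(1)[OF mod_abelian]]
  by (auto simp: ds_inj_def ds_simps)

lemma inj_linear: "i \<in> I \<Longrightarrow> linear_map R (M i) D (ds_inj I M i)"
proof (rule linear_mapI)
  assume i: "i \<in> I"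
  show "ds_inj I M i (s \<oplus>\<^bsub>M i\<^esub> t) = ds_inj I M i s \<oplus>\<^bsub>D\<^esub> ds_inj I M i t" for s t
    using abelian_monoid.zero_closed[OF abelian_group.axioms(1)[OF mod_abelian]]
      abelian_monoid.l_zero[OF abelian_group.axioms(1)[OF mod_abelian]]
    by (auto simp: ds_inj_def ds_simps intro!: restrict_ext)
  show "ds_inj I M i (a \<odot>\<^bsub>M i\<^esub> t) = a \<odot>\<^bsub>D\<^esub> ds_inj I M i t" if "a \<in> carrier R" for a t
    using left_module.smult_zero[OF mods that] by (auto simp: ds_inj_def ds_simps intro!: restrict_ext)
qed (rule inj_closed)

lemma sum_inj:
  assumes u: "u \<in> carrier D"
  shows "u = (\<Oplus>\<^bsub>D\<^esub>i\<in>I. ds_inj I M i (u i))"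
proof (rule ds_eqI[OF u])
  have cl: "(\<lambda>i. ds_inj I M i (u i)) \<in> I \<rightarrow> carrier D" using inj_closed ds_mem[OF u] by auto
  then show "(\<Oplus>\<^bsub>D\<^esub>i\<in>I. ds_inj I M i (u i)) \<in> carrier D" by (rule D.M.finsum_closed)
  fix j assume j: "j \<in> I"
  interpret Mj: left_module R "M j" by (rule mods[OF j])
  have "(\<Oplus>\<^bsub>D\<^esub>i\<in>I. ds_inj I M i (u i)) j = (\<Oplus>\<^bsub>M j\<^esub>i\<in>I. ds_inj I M i (u i) j)"
    by (rule additive_map_finsum[OF D.M.abelian_group_axioms Mj.abelian_group_axioms
          linear_map_additive[OF proj_linear[OF j]] fin cl])
  also have "\<dots> = (\<Oplus>\<^bsub>M j\<^esub>i\<in>I. if j = i then u j else \<zero>\<^bsub>M j\<^esub>)"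
    using j ds_mem[OF u j] by (intro Mj.M.add.finprod_cong'[OF refl]) (auto simp: ds_inj_def)
  also have "\<dots> = u j"
    using j ds_mem[OF u j] fin by (subst Mj.M.add.finprod_singleton[where f="\<lambda>_. u j"]) auto
  finally show "u j = (\<Oplus>\<^bsub>D\<^esub>i\<in>I. ds_inj I M i (u i)) j" by simp
qed

lemma sum_map_linear:
  assumes A: "left_module R A" and f: "\<And>i. i \<in> I \<Longrightarrow> linear_map R (M i) A (f i)"
  shows "linear_map R D A (\<lambda>u. \<Oplus>\<^bsub>A\<^esub>i\<in>I. f i (u i))"
proof -
  interpret A: left_module R A by fact
  have cl: "f i (u i) \<in> carrier A" if "u \<in> carrier D" "i \<in> I" for u i
    using linear_map_closed[OF f] ds_mem that by auto
  show ?thesis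
  proof (rule linear_mapI)
    fix u w assume uw: "u \<in> carrier D" "w \<in> carrier D"
    have "(\<Oplus>\<^bsub>A\<^esub>i\<in>I. f i ((u \<oplus>\<^bsub>D\<^esub> w) i)) = (\<Oplus>\<^bsub>A\<^esub>i\<in>I. f i (u i) \<oplus>\<^bsub>A\<^esub> f i (w i))"
      using cl uw linear_map_add[OF f] ds_mem
      by (intro A.M.add.finprod_cong'[OF refl]) (auto simp: ds_add)
    also have "\<dots> = (\<Oplus>\<^bsub>A\<^esub>i\<in>I. f i (u i)) \<oplus>\<^bsub>A\<^esub> (\<Oplus>\<^bsub>A\<^esub>i\<in>I. f i (w i))"
      using cl uw by (intro A.M.finsum_addf) auto
    finally show "(\<Oplus>\<^bsub>A\<^esub>i\<in>I. f i ((u \<oplus>\<^bsub>D\<^esub> w) i)) = (\<Oplus>\<^bsub>A\<^esub>i\<in>I. f i (u i)) \<oplus>\<^bsub>A\<^esub> (\<Oplus>\<^bsub>A\<^esub>i\<in>I. f i (w i))" .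
  next
    fix a u assume au: "a \<in> carrier R" "u \<in> carrier D"
    have sa: "additive_map A A (\<lambda>m. a \<odot>\<^bsub>A\<^esub> m)"
      using au by (intro additive_mapI) (auto intro: A.smult_closed A.smult_r_distr)
    have "(\<Oplus>\<^bsub>A\<^esub>i\<in>I. f i ((a \<odot>\<^bsub>D\<^esub> u) i)) = (\<Oplus>\<^bsub>A\<^esub>i\<in>I. a \<odot>\<^bsub>A\<^esub> f i (u i))"
      using cl au linear_map_smult[OF f] ds_mem
      by (intro A.M.add.finprod_cong'[OF refl]) (auto simp: ds_smult intro: A.smult_closed)
    also have "\<dots> = a \<odot>\<^bsub>A\<^esub> (\<Oplus>\<^bsub>A\<^esub>i\<in>I. f i (u i))"
      using cl au by (intro additive_map_finsum[OF A.M.abelian_group_axioms A.M.abelian_group_axioms sa fin, symmetric]) auto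
    finally show "(\<Oplus>\<^bsub>A\<^esub>i\<in>I. f i ((a \<odot>\<^bsub>D\<^esub> u) i)) = a \<odot>\<^bsub>A\<^esub> (\<Oplus>\<^bsub>A\<^esub>i\<in>I. f i (u i))" .
  qed (use cl in \<open>auto intro!: A.M.finsum_closed\<close>)
qed

lemma sum_map_inj:
  assumes A: "abelian_group A" and f: "\<And>i. i \<in> I \<Longrightarrow> additive_map (M i) A (f i)"
    and i: "i \<in> I" "t \<in> carrier (M i)"
  shows "(\<Oplus>\<^bsub>A\<^esub>j\<in>I. f j (ds_inj I M i t j)) = f i t"
proof -
  interpret A: abelian_group A by fact
  have fc: "f i t \<in> carrier A" using additive_map_closed[OF f[OF i(1)] i(2)] .
  have "(\<Oplus>\<^bsub>A\<^esub>j\<in>I. f j (ds_inj I M i t j)) = (\<Oplus>\<^bsub>A\<^esub>j\<in>I. if i = j then f i t else \<zero>\<^bsub>A\<^esub>)"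
    using fc additive_map_zero[OF mod_abelian A f]
    by (intro A.add.finprod_cong'[OF refl]) (auto simp: ds_inj_def)
  also have "\<dots> = f i t"
    using fc i fin by (subst A.add.finprod_singleton[where f="\<lambda>_. f i t"]) auto
  finally show ?thesis .
qed

lemma finitely_generated_direct_sum:
  assumes "\<And>i. i \<in> I \<Longrightarrow> finitely_generated R (M i)"
  shows "finitely_generated R D"
proof -
  have "\<exists>X. finite X \<and> X \<subseteq> carrier (M i) \<and> span R (M i) X = carrier (M i)" if "i \<in> I" for i
    using assms[OF that] by (simp add: finitely_generated_def)
  then obtain X where X: "\<And>i. i \<in> I \<Longrightarrow> finite (X i)" "\<And>i. i \<in> I \<Longrightarrow> X i \<subseteq> carrier (M i)"
    "\<And>i. i \<in> I \<Longrightarrow> span R (M i) (X i) = carrier (M i)" by metis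
  let ?Z = "\<Union>i\<in>I. ds_inj I M i ` X i"
  have Z: "?Z \<subseteq> carrier D" using X(2) inj_closed by auto
  note S = D.submoduleD[OF D.span_submodule[OF Z]]
  have 1: "ds_inj I M i t \<in> span R D ?Z" if i: "i \<in> I" and t: "t \<in> carrier (M i)" for i t
  proof -
    interpret Mi: left_module R "M i" by (rule mods[OF i])
    note L = inj_linear[OF i]
    have "ds_inj I M i \<zero>\<^bsub>M i\<^esub> = \<zero>\<^bsub>D\<^esub>"
      by (rule additive_map_zero[OF Mi.M.abelian_group_axioms D.M.abelian_group_axioms linear_map_additive[OF L]])
    then have "submodule {m \<in> carrier (M i). ds_inj I M i m \<in> span R D ?Z} R (M i)"
      using S by (intro Mi.left_submoduleI) (auto simp: linear_map_add[OF L] linear_map_smult[OF L] Mi.smult_closed)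
    moreover have "X i \<subseteq> {m \<in> carrier (M i). ds_inj I M i m \<in> span R D ?Z}"
      using X(2)[OF i] i span_superset[of ?Z R D] by auto
    ultimately have "span R (M i) (X i) \<subseteq> {m \<in> carrier (M i). ds_inj I M i m \<in> span R D ?Z}" by (rule span_least)
    then show ?thesis using t X(3)[OF i] by auto
  qed
  have "u \<in> span R D ?Z" if u: "u \<in> carrier D" for u
  proof -
    have "(\<Oplus>\<^bsub>D\<^esub>i\<in>I. ds_inj I M i (u i)) \<in> span R D ?Z"
      using 1 ds_mem[OF u] by (intro D.submodule_finsum[OF D.span_submodule[OF Z] fin]) auto
    then show ?thesis using sum_inj[OF u] by simp
  qed
  then have "span R D ?Z = carrier D" using S(1) by blast
  then show ?thesis unfolding finitely_generated_def using X(1) fin Z by (intro exI[of _ ?Z]) auto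
qed

end

section \<open>Coordinate spaces\<close>

lemma coord_carrier: "p \<in> carrier (coord_space R n) \<longleftrightarrow> (\<exists>xs. p = Inr xs \<and> length xs = n \<and> set xs \<subseteq> carrier R)"
  by (auto simp: coord_space_def)

lemma coord_space_left_module:
  assumes "ring R"
  shows "left_module R (coord_space R n :: ('r, 'v + 'r list) module)" (is "left_module R ?C")
proof -
  interpret R: ring R by fact
  have add: "Inr xs \<oplus>\<^bsub>?C\<^esub> Inr ys = Inr (map2 (\<oplus>\<^bsub>R\<^esub>) xs ys)" for xs ys by (simp add: coord_space_def)
  have sm: "a \<odot>\<^bsub>?C\<^esub> Inr xs = Inr (map (\<lambda>s. a \<otimes>\<^bsub>R\<^esub> s) xs)" for a xs by (simp add: coord_space_def)
  have zero: "\<zero>\<^bsub>?C\<^esub> = Inr (replicate n \<zero>\<^bsub>R\<^esub>)" by (simp add: coord_space_def)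
  have E: "\<exists>xs. p = Inr xs \<and> length xs = n \<and> (\<forall>i<n. xs ! i \<in> carrier R)" if "p \<in> carrier ?C" for p
    using that by (force simp: coord_carrier intro: subsetD[OF _ nth_mem])
  have Cl: "Inr xs \<in> carrier ?C" if "length xs = n" "\<forall>i<n. xs ! i \<in> carrier R" for xs :: "'r list"
    using that by (auto simp: coord_carrier set_conv_nth)
  have "abelian_group ?C"
  proof (rule abelian_groupI)
    fix x y z assume "x \<in> carrier ?C" "y \<in> carrier ?C" "z \<in> carrier ?C"
    then obtain xs ys zs where *: "x = Inr xs" "length xs = n" "\<forall>i<n. xs ! i \<in> carrier R" "y = Inr ys" "length ys = n"
      "\<forall>i<n. ys ! i \<in> carrier R" "z = Inr zs" "length zs = n" "\<forall>i<n. zs ! i \<in> carrier R" using E by metis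
    then show "x \<oplus>\<^bsub>?C\<^esub> y \<oplus>\<^bsub>?C\<^esub> z = x \<oplus>\<^bsub>?C\<^esub> (y \<oplus>\<^bsub>?C\<^esub> z)"
      by (auto simp: add list_eq_iff_nth_eq R.a_assoc)
  next
    fix x y assume "x \<in> carrier ?C" "y \<in> carrier ?C"
    then obtain xs ys where *: "x = Inr xs" "length xs = n" "\<forall>i<n. xs ! i \<in> carrier R" "y = Inr ys" "length ys = n"
      "\<forall>i<n. ys ! i \<in> carrier R" using E by metis
    show "x \<oplus>\<^bsub>?C\<^esub> y \<in> carrier ?C" unfolding *(1,4) add by (rule Cl) (use * in auto)
    show "x \<oplus>\<^bsub>?C\<^esub> y = y \<oplus>\<^bsub>?C\<^esub> x" using * by (auto simp: add list_eq_iff_nth_eq R.a_comm)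
  next
    fix x assume "x \<in> carrier ?C"
    then obtain xs where *: "x = Inr xs" "length xs = n" "\<forall>i<n. xs ! i \<in> carrier R" using E by metis
    then show "\<zero>\<^bsub>?C\<^esub> \<oplus>\<^bsub>?C\<^esub> x = x" by (auto simp: add zero list_eq_iff_nth_eq)
    show "\<exists>y\<in>carrier ?C. y \<oplus>\<^bsub>?C\<^esub> x = \<zero>\<^bsub>?C\<^esub>"
    proof (rule bexI)
      show "Inr (map (\<lambda>s. \<ominus>\<^bsub>R\<^esub> s) xs) \<in> carrier ?C" by (rule Cl) (use * in auto)
      show "Inr (map (\<lambda>s. \<ominus>\<^bsub>R\<^esub> s) xs) \<oplus>\<^bsub>?C\<^esub> x = \<zero>\<^bsub>?C\<^esub>"
        using * by (auto simp: add zero list_eq_iff_nth_eq R.l_neg)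
    qed
  qed (auto simp: zero intro!: Cl)
  then show ?thesis
  proof (intro left_module.intro left_module_axioms.intro R.ring_axioms)
    fix a m assume a: "a \<in> carrier R" and "m \<in> carrier ?C"
    then obtain xs where *: "m = Inr xs" "length xs = n" "\<forall>i<n. xs ! i \<in> carrier R" using E by metis
    show "a \<odot>\<^bsub>?C\<^esub> m \<in> carrier ?C" unfolding *(1) sm by (rule Cl) (use a * in auto)
    fix b assume b: "b \<in> carrier R"
    show "(a \<oplus>\<^bsub>R\<^esub> b) \<odot>\<^bsub>?C\<^esub> m = a \<odot>\<^bsub>?C\<^esub> m \<oplus>\<^bsub>?C\<^esub> b \<odot>\<^bsub>?C\<^esub> m"
      using a b * by (auto simp: sm add list_eq_iff_nth_eq R.l_distr)
    show "(a \<otimes>\<^bsub>R\<^esub> b) \<odot>\<^bsub>?C\<^esub> m = a \<odot>\<^bsub>?C\<^esub> (b \<odot>\<^bsub>?C\<^esub> m)"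
      using a b * by (auto simp: sm list_eq_iff_nth_eq R.m_assoc)
  next
    fix a m p assume a: "a \<in> carrier R" and "m \<in> carrier ?C" "p \<in> carrier ?C"
    then obtain xs ys where *: "m = Inr xs" "length xs = n" "\<forall>i<n. xs ! i \<in> carrier R" "p = Inr ys" "length ys = n"
      "\<forall>i<n. ys ! i \<in> carrier R" using E by metis
    then show "a \<odot>\<^bsub>?C\<^esub> (m \<oplus>\<^bsub>?C\<^esub> p) = a \<odot>\<^bsub>?C\<^esub> m \<oplus>\<^bsub>?C\<^esub> a \<odot>\<^bsub>?C\<^esub> p"
      using a by (auto simp: sm add list_eq_iff_nth_eq R.r_distr)
  next
    fix m assume "m \<in> carrier ?C"
    then obtain xs where *: "m = Inr xs" "length xs = n" "\<forall>i<n. xs ! i \<in> carrier R" using E by metis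
    then show "\<one>\<^bsub>R\<^esub> \<odot>\<^bsub>?C\<^esub> m = m" by (auto simp: sm list_eq_iff_nth_eq)
  qed
qed

text \<open>A basis enumerated by \<open>e\<close> sends a coordinate list to the corresponding
  combination. Surjectivity and injectivity of this map are existence and uniqueness of
  coordinates.\<close>

lemma (in vector_space_dr) coord_iso_exists:
  assumes "has_dim R M n"
  shows "\<exists>\<theta>. \<theta> \<in> lin_hom R (coord_space R n :: ('r, 'u + 'r list) module) M \<and>
    bij_betw \<theta> (carrier (coord_space R n)) (carrier M)"
proof -
  let ?C = "coord_space R n :: ('r, 'u + 'r list) module"
  interpret C: left_module R ?C by (rule coord_space_left_module[OF R.ring_axioms])
  obtain X where X: "X \<subseteq> carrier M" "finite X" "card X = n" "independent X" "span R M X = carrier M"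
    using assms unfolding has_dim_iff by metis
  obtain e where e: "bij_betw e {0..<n} X" using ex_bij_betw_nat_finite[OF X(2)] X(3) by auto
  have eX: "e i \<in> X" "e i \<in> carrier M" if "i < n" for i
    using e that X(1) by (auto simp: bij_betw_def)
  define \<theta> where "\<theta> = (\<lambda>p::'u + 'r list. \<Oplus>\<^bsub>M\<^esub>i\<in>{0..<n}. (projr p ! i) \<odot>\<^bsub>M\<^esub> e i)"
  \<comment> \<open>The same coordinates indexed by basis vectors instead of positions, the form in
    which their uniqueness is available.\<close>
  define cf where "cf p = (\<lambda>v\<in>X. projr p ! (inv_into {0..<n} e v))" for p :: "'u + 'r list"
  have pc: "projr p ! i \<in> carrier R" if "p \<in> carrier ?C" "i < n" for p i
    using that by (auto simp: coord_carrier)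
  have cl: "(projr p ! i) \<odot>\<^bsub>M\<^esub> e i \<in> carrier M" if "p \<in> carrier ?C" "i < n" for p i
    using pc[OF that] eX that by (auto intro: smult_closed)
  have inve: "inv_into {0..<n} e v < n" "e (inv_into {0..<n} e v) = v" if "v \<in> X" for v
    using e that by (auto simp: bij_betw_def f_inv_into_f)
  have cfc: "cf p \<in> X \<rightarrow>\<^sub>E carrier R" if "p \<in> carrier ?C" for p
    using pc[OF that] inve by (auto simp: cf_def)
  have cfe: "cf p (e i) = projr p ! i" if "i < n" for p i
    using that eX e by (auto simp: cf_def bij_betw_def)
  have th: "\<theta> p = (\<Oplus>\<^bsub>M\<^esub>v\<in>X. cf p v \<odot>\<^bsub>M\<^esub> v)" if p: "p \<in> carrier ?C" for p
  proof -
    have inj: "inj_on e {0..<n}" and im: "e ` {0..<n} = X" using e by (auto simp: bij_betw_def)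
    have f: "(\<lambda>v. cf p v \<odot>\<^bsub>M\<^esub> v) \<in> e ` {0..<n} \<rightarrow> carrier M"
      using cfc[OF p] X(1) unfolding im by (auto intro!: smult_closed)
    have "(\<Oplus>\<^bsub>M\<^esub>v\<in>e ` {0..<n}. cf p v \<odot>\<^bsub>M\<^esub> v) = (\<Oplus>\<^bsub>M\<^esub>i\<in>{0..<n}. cf p (e i) \<odot>\<^bsub>M\<^esub> e i)"
      by (rule M.add.finprod_reindex[OF f inj])
    also have "\<dots> = \<theta> p" unfolding \<theta>_def
      using cl[OF p] cfe by (intro M.add.finprod_cong'[OF refl]) auto
    finally show ?thesis unfolding im by simp
  qed
  have "linear_map R ?C M \<theta>"
  proof (rule linear_mapI)
    fix p q assume pq: "p \<in> carrier ?C" "q \<in> carrier ?C"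
    have e: "projr (p \<oplus>\<^bsub>?C\<^esub> q) ! i = projr p ! i \<oplus>\<^bsub>R\<^esub> projr q ! i" if "i < n" for i
      using pq that by (auto simp: coord_carrier) (simp add: coord_space_def)
    have "\<theta> (p \<oplus>\<^bsub>?C\<^esub> q) = (\<Oplus>\<^bsub>M\<^esub>i\<in>{0..<n}. (projr p ! i) \<odot>\<^bsub>M\<^esub> e i \<oplus>\<^bsub>M\<^esub> (projr q ! i) \<odot>\<^bsub>M\<^esub> e i)"
      unfolding \<theta>_def using cl[OF pq(1)] cl[OF pq(2)] pc[OF pq(1)] pc[OF pq(2)] eX
      by (intro M.add.finprod_cong'[OF refl]) (auto simp: e smult_l_distr)
    also have "\<dots> = \<theta> p \<oplus>\<^bsub>M\<^esub> \<theta> q"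
      unfolding \<theta>_def using cl[OF pq(1)] cl[OF pq(2)] by (intro M.finsum_addf) auto
    finally show "\<theta> (p \<oplus>\<^bsub>?C\<^esub> q) = \<theta> p \<oplus>\<^bsub>M\<^esub> \<theta> q" .
  next
    fix a p assume ap: "a \<in> carrier R" "p \<in> carrier ?C"
    have e: "projr (a \<odot>\<^bsub>?C\<^esub> p) ! i = a \<otimes>\<^bsub>R\<^esub> projr p ! i" if "i < n" for i
      using ap that by (auto simp: coord_carrier) (simp add: coord_space_def)
    have sa: "additive_map M M (\<lambda>m. a \<odot>\<^bsub>M\<^esub> m)"
      using ap by (intro additive_mapI) (auto intro: smult_closed smult_r_distr)
    have "a \<odot>\<^bsub>M\<^esub> \<theta> p = (\<Oplus>\<^bsub>M\<^esub>i\<in>{0..<n}. a \<odot>\<^bsub>M\<^esub> ((projr p ! i) \<odot>\<^bsub>M\<^esub> e i))"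
      unfolding \<theta>_def using cl[OF ap(2)]
      by (intro additive_map_finsum[OF M.abelian_group_axioms M.abelian_group_axioms sa]) auto
    also have "\<dots> = \<theta> (a \<odot>\<^bsub>?C\<^esub> p)" unfolding \<theta>_def
      using ap cl[OF ap(2)] pc[OF ap(2)] eX
      by (intro M.add.finprod_cong'[OF refl]) (auto simp: e smult_assoc intro!: smult_closed)
    finally show "\<theta> (a \<odot>\<^bsub>?C\<^esub> p) = a \<odot>\<^bsub>M\<^esub> \<theta> p" by simp
  qed (use cl in \<open>auto simp: \<theta>_def intro!: M.finsum_closed\<close>)
  moreover have "bij_betw \<theta> (carrier ?C) (carrier M)"
    unfolding bij_betw_def
  proof
    show "inj_on \<theta> (carrier ?C)"
    proof (rule inj_onI)
      fix p q assume pq: "p \<in> carrier ?C" "q \<in> carrier ?C" "\<theta> p = \<theta> q"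
      have "cf p = cf q"
        by (rule independent_coeffs_unique[OF X(2,1,4) cfc[OF pq(1)] cfc[OF pq(2)]])
          (use pq th in simp)
      then have "projr p ! i = projr q ! i" if "i < n" for i using cfe[OF that] by metis
      then show "p = q" using pq(1,2) by (auto simp: coord_carrier list_eq_iff_nth_eq)
    qed
    show "\<theta> ` carrier ?C = carrier M"
    proof
      show "\<theta> ` carrier ?C \<subseteq> carrier M" using cl by (auto simp: \<theta>_def intro!: M.finsum_closed)
      show "carrier M \<subseteq> \<theta> ` carrier ?C"
      proof
        fix m assume "m \<in> carrier M"
        then have "m \<in> span R M X" using X by simp
        then obtain c where c: "c \<in> X \<rightarrow>\<^sub>E carrier R" "m = (\<Oplus>\<^bsub>M\<^esub>v\<in>X. c v \<odot>\<^bsub>M\<^esub> v)"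
          by (rule span_finite_coeffs[OF X(2,1)])
        define p :: "'u + 'r list" where "p = Inr (map (\<lambda>i. c (e i)) [0..<n])"
        have p: "p \<in> carrier ?C" using c(1) eX by (auto simp: p_def coord_carrier)
        have "cf p v = c v" if "v \<in> X" for v using inve[OF that] that by (simp add: cf_def p_def)
        then have "cf p = c" by (intro PiE_ext[OF cfc[OF p] c(1)])
        then have "m = \<theta> p" using th[OF p] c(2) by simp
        then show "m \<in> \<theta> ` carrier ?C" using p by blast
      qed
    qed
  qed
  ultimately have "restrict \<theta> (carrier ?C) \<in> lin_hom R ?C M"
    "bij_betw (restrict \<theta> (carrier ?C)) (carrier ?C) (carrier M)"
    by (auto intro: restrict_lin_hom C.left_module_axioms simp: bij_betw_restrict_eq)
  then show ?thesis by blast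
qed

text \<open>By finite dimensionality the description inside the \<open>SOME\<close> of
  \<open>coord_iso\<close> is satisfiable. Which isomorphism is chosen stays unknown.\<close>

lemma coord_iso:
  fixes M :: "('r, 'w) module"
  assumes "division_ring R" "left_module R M" "fin_dim R M"
  shows coord_iso_linear: "linear_map R (coord_space R (ldim R M) :: ('r, 'u + 'r list) module) M (coord_iso R M)"
    and coord_iso_bij: "bij_betw (coord_iso R M :: 'u + 'r list \<Rightarrow> 'w) (carrier (coord_space R (ldim R M))) (carrier M)"
    and coord_fin_dim: "fin_dim R (coord_space R (ldim R M) :: ('r, 'u + 'r list) module)"
proof -
  let ?C = "coord_space R (ldim R M) :: ('r, 'u + 'r list) module"
  interpret vector_space_dr R M using assms by (intro vector_space_dr.intro vector_space_dr_axioms.intro)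
  interpret C: vector_space_dr R ?C
    using assms(1) coord_space_left_module[OF R.ring_axioms] by (intro vector_space_dr.intro vector_space_dr_axioms.intro)
  have *: "coord_iso R M \<in> lin_hom R ?C M \<and> bij_betw (coord_iso R M) (carrier ?C) (carrier M)"
    unfolding coord_iso_def by (rule someI_ex[OF coord_iso_exists[OF has_dim_ldim[OF assms(3)]]])
  then show l: "linear_map R ?C M (coord_iso R M)" and b: "bij_betw (coord_iso R M) (carrier ?C) (carrier M)"
    by (auto simp: lin_hom_iff)
  have "linear_map R M ?C (inv_into (carrier ?C) (coord_iso R M))"
    by (rule linear_map_inv_into[OF C.M.abelian_group_axioms C.left_module_axioms l b])
  then have "finitely_generated R ?C"
    using finitely_generated_image[OF left_module_axioms C.left_module_axioms] assms(3) fin_dim_iff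
      bij_betw_inv_into[OF b] by (simp add: bij_betw_def)
  then show "fin_dim R ?C" using C.fin_dim_iff by simp
qed

section \<open>Quotient modules\<close>

locale quotient = left_module R M for R :: "('r, 'y) ring_scheme" and M :: "('r, 'v) module" +
  fixes U assumes sub: "submodule U R M"
begin

abbreviation "C \<equiv> quotient_module M U"

lemma coset_eq_iff:
  assumes "x \<in> carrier M" "y \<in> carrier M"
  shows "U +>\<^bsub>M\<^esub> x = U +>\<^bsub>M\<^esub> y \<longleftrightarrow> x \<ominus>\<^bsub>M\<^esub> y \<in> U"
proof
  note U = submoduleD[OF sub]
  assume "U +>\<^bsub>M\<^esub> x = U +>\<^bsub>M\<^esub> y"
  moreover have "x \<in> U +>\<^bsub>M\<^esub> x"
    unfolding a_r_coset_def' using U(3) assms(1) by (auto intro!: bexI[of _ "\<zero>\<^bsub>M\<^esub>"])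
  ultimately obtain u where "u \<in> U" "x = u \<oplus>\<^bsub>M\<^esub> y" unfolding a_r_coset_def' by auto
  then show "x \<ominus>\<^bsub>M\<^esub> y \<in> U" using M.add_minus_cancel U(2) assms by simp
next
  note U = submoduleD[OF sub]
  assume xy: "x \<ominus>\<^bsub>M\<^esub> y \<in> U"
  have "x = (x \<ominus>\<^bsub>M\<^esub> y) \<oplus>\<^bsub>M\<^esub> y" using assms by (simp add: M.minus_add_cancel)
  then have "x \<in> U +>\<^bsub>M\<^esub> y" unfolding a_r_coset_def' using xy by blast
  then show "U +>\<^bsub>M\<^esub> x = U +>\<^bsub>M\<^esub> y"
    using M.a_repr_independence[OF _ assms(2)] sub by (auto simp: submodule_def)
qed

lemma coset_mem_iff:
  assumes "x \<in> carrier M" "y \<in> carrier M"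
  shows "y \<in> U +>\<^bsub>M\<^esub> x \<longleftrightarrow> y \<ominus>\<^bsub>M\<^esub> x \<in> U"
proof
  note U = submoduleD[OF sub]
  show "y \<in> U +>\<^bsub>M\<^esub> x \<Longrightarrow> y \<ominus>\<^bsub>M\<^esub> x \<in> U"
    unfolding a_r_coset_def' using M.add_minus_cancel U(2) assms by auto
  assume xy: "y \<ominus>\<^bsub>M\<^esub> x \<in> U"
  have "y = (y \<ominus>\<^bsub>M\<^esub> x) \<oplus>\<^bsub>M\<^esub> x" using assms by (simp add: M.minus_add_cancel)
  then show "y \<in> U +>\<^bsub>M\<^esub> x" unfolding a_r_coset_def' using xy by blast
qed

lemma quotient_carrier: "carrier C = (\<lambda>m. U +>\<^bsub>M\<^esub> m) ` carrier M"
  by (auto simp: quotient_module_def A_RCOSETS_def')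

lemma quotient_add: "x \<in> carrier M \<Longrightarrow> y \<in> carrier M \<Longrightarrow> (U +>\<^bsub>M\<^esub> x) \<oplus>\<^bsub>C\<^esub> (U +>\<^bsub>M\<^esub> y) = U +>\<^bsub>M\<^esub> (x \<oplus>\<^bsub>M\<^esub> y)"
proof -
  have "abelian_subgroup U M"
    using sub by (intro abelian_subgroupI3 additive_subgroup.intro M.abelian_group_axioms) (simp add: submodule_def)
  then show "x \<in> carrier M \<Longrightarrow> y \<in> carrier M \<Longrightarrow> ?thesis"
    by (simp add: quotient_module_def abelian_subgroup.a_rcos_sum)
qed

text \<open>\<open>quotient_module\<close> multiplies a coset by forming the union of the cosets of
  all multiples. These cosets coincide because \<open>U\<close> is stable under scalars.\<close>

lemma quotient_smult:
  assumes "a \<in> carrier R" "x \<in> carrier M"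
  shows "a \<odot>\<^bsub>C\<^esub> (U +>\<^bsub>M\<^esub> x) = U +>\<^bsub>M\<^esub> (a \<odot>\<^bsub>M\<^esub> x)"
proof -
  note U = submoduleD[OF sub]
  have "U +>\<^bsub>M\<^esub> (a \<odot>\<^bsub>M\<^esub> m) = U +>\<^bsub>M\<^esub> (a \<odot>\<^bsub>M\<^esub> x)" if m: "m \<in> U +>\<^bsub>M\<^esub> x" for m
  proof -
    obtain u where u: "u \<in> U" "m = u \<oplus>\<^bsub>M\<^esub> x" using m unfolding a_r_coset_def' by auto
    have "a \<odot>\<^bsub>M\<^esub> m \<ominus>\<^bsub>M\<^esub> a \<odot>\<^bsub>M\<^esub> x = a \<odot>\<^bsub>M\<^esub> u"
      using u U(2)[OF u(1)] assms by (simp add: smult_r_distr M.add_minus_cancel smult_closed)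
    then show ?thesis using u U(2)[OF u(1)] U(5) assms by (simp add: coset_eq_iff smult_closed)
  qed
  moreover have "x \<in> U +>\<^bsub>M\<^esub> x" using assms U(3) by (simp add: coset_mem_iff M.minus_self)
  ultimately have "(\<Union>m\<in>U +>\<^bsub>M\<^esub> x. U +>\<^bsub>M\<^esub> (a \<odot>\<^bsub>M\<^esub> m)) = U +>\<^bsub>M\<^esub> (a \<odot>\<^bsub>M\<^esub> x)" by blast
  then show ?thesis by (simp add: quotient_module_def)
qed

lemma quotient_zero: "\<zero>\<^bsub>C\<^esub> = U +>\<^bsub>M\<^esub> \<zero>\<^bsub>M\<^esub>"
  using submodule_subset[OF sub] by (simp add: quotient_module_def)

lemma left_module_quotient: "left_module R C"
proof -
  have "abelian_group C"
  proof (rule abelian_groupI)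
    fix X assume "X \<in> carrier C"
    then obtain x where x: "x \<in> carrier M" "X = U +>\<^bsub>M\<^esub> x" by (auto simp: quotient_carrier)
    show "\<zero>\<^bsub>C\<^esub> \<oplus>\<^bsub>C\<^esub> X = X" using x by (simp add: quotient_zero quotient_add)
    show "\<exists>Y\<in>carrier C. Y \<oplus>\<^bsub>C\<^esub> X = \<zero>\<^bsub>C\<^esub>"
      using x by (intro bexI[of _ "U +>\<^bsub>M\<^esub> (\<ominus>\<^bsub>M\<^esub> x)"]) (auto simp: quotient_zero quotient_add quotient_carrier M.l_neg)
  qed (auto simp: quotient_carrier quotient_add quotient_zero M.a_ac)
  then show ?thesis
    by (intro left_module.intro left_module_axioms.intro R.ring_axioms)
      (auto simp: quotient_carrier quotient_add quotient_smult smult_closed smult_l_distr smult_r_distr smult_assoc smult_one)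
qed

lemma coset_map_linear: "linear_map R M C (\<lambda>m. U +>\<^bsub>M\<^esub> m)"
  by (intro linear_mapI) (auto simp: quotient_carrier quotient_add quotient_smult)

end

section \<open>The adjunction between \<open>\<^sub>yB\<^sub>x \<otimes> _\<close> and \<open>\<^sub>xB\<^sub>y \<otimes> _\<close>\<close>

text \<open>Uniqueness of coordinates makes them left linear functionals; they are the raw material
  of \<open>dual_basis\<close>.\<close>

lemma (in vector_space_dr) coordinate_functionals:
  assumes "has_dim R M n"
  obtains X \<phi> where "finite X" "X \<subseteq> carrier M"
    "\<And>v. v \<in> X \<Longrightarrow> linear_map R M (scalar_module R (\<lambda>a. a)) (\<phi> v)"
    "\<And>m. m \<in> carrier M \<Longrightarrow> m = (\<Oplus>\<^bsub>M\<^esub>v\<in>X. \<phi> v m \<odot>\<^bsub>M\<^esub> v)"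
proof -
  obtain X where X: "X \<subseteq> carrier M" "finite X" "card X = n" "independent X" "span R M X = carrier M"
    using assms unfolding has_dim_iff by metis
  have "\<exists>c. c \<in> X \<rightarrow>\<^sub>E carrier R \<and> m = (\<Oplus>\<^bsub>M\<^esub>v\<in>X. c v \<odot>\<^bsub>M\<^esub> v)" if "m \<in> carrier M" for m
  proof -
    have "m \<in> span R M X" using that X(5) by simp
    then show ?thesis by (rule span_finite_coeffs[OF X(2,1)]) (intro exI conjI)
  qed
  then obtain c where c: "\<And>m. m \<in> carrier M \<Longrightarrow> c m \<in> X \<rightarrow>\<^sub>E carrier R"
    "\<And>m. m \<in> carrier M \<Longrightarrow> m = (\<Oplus>\<^bsub>M\<^esub>v\<in>X. c m v \<odot>\<^bsub>M\<^esub> v)" by metis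
  have cX: "c m v \<in> carrier R" "v \<in> carrier M" if "m \<in> carrier M" "v \<in> X" for m v
    using c(1)[OF that(1)] that X(1) by auto
  show thesis
  proof
    fix v assume v: "v \<in> X"
    show "linear_map R M (scalar_module R (\<lambda>a. a)) (\<lambda>m. c m v)"
    proof (rule linear_mapI)
      fix m n assume mn: "m \<in> carrier M" "n \<in> carrier M"
      let ?s = "\<lambda>v\<in>X. c m v \<oplus>\<^bsub>R\<^esub> c n v"
      have "(\<Oplus>\<^bsub>M\<^esub>v\<in>X. ?s v \<odot>\<^bsub>M\<^esub> v) = (\<Oplus>\<^bsub>M\<^esub>v\<in>X. c m v \<odot>\<^bsub>M\<^esub> v \<oplus>\<^bsub>M\<^esub> c n v \<odot>\<^bsub>M\<^esub> v)"
        using cX mn by (intro M.add.finprod_cong'[OF refl]) (auto simp: smult_l_distr smult_closed)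
      also have "\<dots> = (\<Oplus>\<^bsub>M\<^esub>v\<in>X. c m v \<odot>\<^bsub>M\<^esub> v) \<oplus>\<^bsub>M\<^esub> (\<Oplus>\<^bsub>M\<^esub>v\<in>X. c n v \<odot>\<^bsub>M\<^esub> v)"
        using cX mn by (intro M.finsum_addf) (auto simp: smult_closed)
      also have "\<dots> = m \<oplus>\<^bsub>M\<^esub> n" using c(2)[OF mn(1)] c(2)[OF mn(2)] by simp
      also have "\<dots> = (\<Oplus>\<^bsub>M\<^esub>v\<in>X. c (m \<oplus>\<^bsub>M\<^esub> n) v \<odot>\<^bsub>M\<^esub> v)" using mn by (intro c(2)) simp
      finally have "?s = c (m \<oplus>\<^bsub>M\<^esub> n)"
        using cX mn c(1) by (intro independent_coeffs_unique[OF X(2,1,4)]) auto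
      then have "?s v = c (m \<oplus>\<^bsub>M\<^esub> n) v" by simp
      then show "c (m \<oplus>\<^bsub>M\<^esub> n) v = c m v \<oplus>\<^bsub>scalar_module R (\<lambda>a. a)\<^esub> c n v" using v by (simp add: scalar_module_def)
    next
      fix a m assume am: "a \<in> carrier R" "m \<in> carrier M"
      let ?s = "\<lambda>v\<in>X. a \<otimes>\<^bsub>R\<^esub> c m v"
      have sa: "additive_map M M (\<lambda>m. a \<odot>\<^bsub>M\<^esub> m)"
        using am by (intro additive_mapI) (auto intro: smult_closed smult_r_distr)
      have "(\<Oplus>\<^bsub>M\<^esub>v\<in>X. ?s v \<odot>\<^bsub>M\<^esub> v) = (\<Oplus>\<^bsub>M\<^esub>v\<in>X. a \<odot>\<^bsub>M\<^esub> (c m v \<odot>\<^bsub>M\<^esub> v))"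
        using cX am by (intro M.add.finprod_cong'[OF refl]) (auto simp: smult_assoc smult_closed)
      also have "\<dots> = a \<odot>\<^bsub>M\<^esub> (\<Oplus>\<^bsub>M\<^esub>v\<in>X. c m v \<odot>\<^bsub>M\<^esub> v)"
        using cX am
        by (intro additive_map_finsum[OF M.abelian_group_axioms M.abelian_group_axioms sa X(2), symmetric]) (auto simp: smult_closed)
      also have "\<dots> = a \<odot>\<^bsub>M\<^esub> m" using c(2)[OF am(2)] by simp
      also have "\<dots> = (\<Oplus>\<^bsub>M\<^esub>v\<in>X. c (a \<odot>\<^bsub>M\<^esub> m) v \<odot>\<^bsub>M\<^esub> v)" using am by (intro c(2)) (rule smult_closed)
      finally have "?s = c (a \<odot>\<^bsub>M\<^esub> m)"
        using cX am c(1) by (intro independent_coeffs_unique[OF X(2,1,4)]) (auto simp: smult_closed)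
      then have "?s v = c (a \<odot>\<^bsub>M\<^esub> m) v" by simp
      then show "c (a \<odot>\<^bsub>M\<^esub> m) v = a \<odot>\<^bsub>scalar_module R (\<lambda>a. a)\<^esub> c m v" using v by (simp add: scalar_module_def)
    qed (use cX v in \<open>simp add: scalar_module_def\<close>)
  qed (use X c(2) in auto)
qed

text \<open>The map \<open>ev\<^bsub>b'\<^esub> \<otimes> 1 : \<^sub>xB\<^sub>y \<otimes> V \<rightarrow> V\<close> for \<open>b'\<close> in \<open>\<^sub>yB\<^sub>x\<close>.\<close>

definition dual_eval ::
    "('i::finite, 'r, 'b, 'f) modulation \<Rightarrow> 'i \<Rightarrow> 'i \<Rightarrow> ('r, 'v) module \<Rightarrow> 'b \<Rightarrow> ('b, 'v) tens \<Rightarrow> 'v" where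
  "dual_eval \<M> x y V b' = tensor_lift V (\<lambda>b v. dual_iso \<M> y x b b' \<odot>\<^bsub>V\<^esub> v)"

section \<open>Modulations and the pairing along an edge\<close>

locale valued_modulation =
  fixes \<M> :: "('i::finite, 'r, 'b, 'f) modulation"
  assumes valuation: "valuation (val \<M>)" and modulation: "is_modulation \<M>"
begin

abbreviation "E \<equiv> edge (val \<M>)"
abbreviation "k \<equiv> dr \<M>"
abbreviation "B \<equiv> bim \<M>"
abbreviation "tens \<equiv> arrow_tensor \<M>"

text \<open>The symmetrizers \<open>d\<close> are positive, so the two valuations of a pair of
  vertices vanish together.\<close>

lemma edge_sym: "E i j \<Longrightarrow> E j i"
proof -
  obtain d :: "'i \<Rightarrow> nat" where d: "\<forall>i. 0 < d i" "\<forall>i j. d i * val \<M> i j = d j * val \<M> j i"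
    using valuation by (auto simp: valuation_def)
  show "E i j \<Longrightarrow> E j i" using d(1)[rule_format, of i] d(2)[rule_format, of i j] unfolding edge_def by (metis mult_is_0 less_irrefl)
qed

lemma edge_irrefl: "\<not> E i i"
  using valuation by (simp add: valuation_def edge_def)

lemma division_ring_k: "division_ring (k i)"
  using modulation by (simp add: is_modulation_def)

lemma ring_k: "ring (k i)"
  using division_ring_k[of i] by (simp add: division_ring_def)

lemma bimodule_B: "E i j \<Longrightarrow> bimodule (k i) (k j) (B i j)"
  using modulation by (simp add: is_modulation_def)

lemma has_dim_B: "E i j \<Longrightarrow> has_dim (k i) (B i j) (val \<M> i j)"
  using modulation by (simp add: is_modulation_def)

lemma dual_iso: "E i j \<Longrightarrow> bimodule_iso (k j) (k i) (B j i) (left_dual (k i) (B i j)) (dual_iso \<M> i j)"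
  using modulation by (simp add: is_modulation_def)

lemma vector_space_k: "left_module (k i) V \<Longrightarrow> vector_space_dr (k i) V"
  by (simp add: vector_space_dr_def vector_space_dr_axioms_def division_ring_k)

lemma finitely_generated_B: "E i j \<Longrightarrow> finitely_generated (k i) (B i j)"
proof -
  assume e: "E i j"
  interpret bimodule "k i" "k j" "B i j" by (rule bimodule_B[OF e])
  interpret vector_space_dr "k i" "B i j" by (rule vector_space_k[OF left_module_axioms])
  show ?thesis using has_dim_B[OF e] fin_dim_iff by (auto simp: fin_dim_def)
qed

lemma tensor_product_B: "E j i \<Longrightarrow> left_module (k i) V \<Longrightarrow> tensor_product (k j) (k i) (B j i) V"
  by (simp add: tensor_product_def bimodule_B)

lemma tens_left_module: "E j i \<Longrightarrow> left_module (k i) V \<Longrightarrow> left_module (k j) (tens j i V)"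
  unfolding arrow_tensor_def using tensor_product.left_module[OF tensor_product_B] .

lemma tens_finitely_generated:
  assumes "E j i" "left_module (k i) V" "fin_dim (k i) V"
  shows "finitely_generated (k j) (tens j i V)"
proof -
  interpret V: vector_space_dr "k i" V by (rule vector_space_k[OF assms(2)])
  show ?thesis
    unfolding arrow_tensor_def
    using tensor_product.finitely_generated_tensor[OF tensor_product_B[OF assms(1,2)]]
      finitely_generated_B[OF assms(1)] assms(3) V.fin_dim_iff by simp
qed

end

locale modulation_edge = valued_modulation \<M> for \<M> :: "('i::finite, 'r, 'b, 'f) modulation" +
  fixes x y :: 'i
  assumes edge: "E x y"
begin

abbreviation "dual b b' \<equiv> dual_iso \<M> y x b b'"

sublocale Bxy: bimodule "k x" "k y" "B x y" by (rule bimodule_B[OF edge])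
sublocale Byx: bimodule "k y" "k x" "B y x" by (rule bimodule_B[OF edge_sym[OF edge]])

lemma dual_lin_hom: "b \<in> carrier (B x y) \<Longrightarrow> dual_iso \<M> y x b \<in> lin_hom (k y) (B y x) (scalar_module (k y) (\<lambda>a. a))"
  using dual_iso[OF edge_sym[OF edge]] by (auto simp: bimodule_iso_def left_dual_def bij_betw_def)

lemma dual_props:
  assumes "b \<in> carrier (B x y)" "b' \<in> carrier (B y x)"
  shows dual_closed: "dual b b' \<in> carrier (k y)"
    and dual_add_right: "c' \<in> carrier (B y x) \<Longrightarrow> dual b (b' \<oplus>\<^bsub>B y x\<^esub> c') = dual b b' \<oplus>\<^bsub>k y\<^esub> dual b c'"
    and dual_smult_right: "a \<in> carrier (k y) \<Longrightarrow> dual b (a \<odot>\<^bsub>B y x\<^esub> b') = a \<otimes>\<^bsub>k y\<^esub> dual b b'"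
    and dual_add_left: "c \<in> carrier (B x y) \<Longrightarrow> dual (b \<oplus>\<^bsub>B x y\<^esub> c) b' = dual b b' \<oplus>\<^bsub>k y\<^esub> dual c b'"
    and dual_rsmult_left: "a \<in> carrier (k y) \<Longrightarrow> dual (rsmult (B x y) b a) b' = dual b b' \<otimes>\<^bsub>k y\<^esub> a"
    and dual_smult_left: "s \<in> carrier (k x) \<Longrightarrow> dual (s \<odot>\<^bsub>B x y\<^esub> b) b' = dual b (rsmult (B y x) b' s)"
  using dual_lin_hom[OF assms(1)] dual_iso[OF edge_sym[OF edge]] assms
  by (auto simp: lin_hom_def scalar_module_def bimodule_iso_def left_dual_def)

lemma dual_surj:
  assumes "linear_map (k y) (B y x) (scalar_module (k y) (\<lambda>a. a)) f"
  obtains b where "b \<in> carrier (B x y)" "\<And>b'. b' \<in> carrier (B y x) \<Longrightarrow> dual b b' = f b'"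
proof -
  have "restrict f (carrier (B y x)) \<in> carrier (left_dual (k y) (B y x))"
    using restrict_lin_hom[OF Byx.left_module_axioms assms] by (simp add: left_dual_def)
  moreover have "dual_iso \<M> y x ` carrier (B x y) = carrier (left_dual (k y) (B y x))"
    using dual_iso[OF edge_sym[OF edge]] by (simp add: bimodule_iso_def bij_betw_def)
  ultimately obtain b where b: "b \<in> carrier (B x y)" "dual_iso \<M> y x b = restrict f (carrier (B y x))"
    by (metis imageE)
  then show thesis using that by simp
qed

lemma dual_eqI:
  assumes "b \<in> carrier (B x y)" "c \<in> carrier (B x y)" "\<And>b'. b' \<in> carrier (B y x) \<Longrightarrow> dual b b' = dual c b'"
  shows "b = c"
proof -
  have "dual_iso \<M> y x b = dual_iso \<M> y x c"
    using dual_lin_hom[OF assms(1)] dual_lin_hom[OF assms(2)] assms(3)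
    by (intro extensionalityI[of _ "carrier (B y x)"]) (auto simp: lin_hom_iff)
  then show ?thesis
    using dual_iso[OF edge_sym[OF edge]] assms(1,2) by (auto simp: bimodule_iso_def bij_betw_def inj_on_def)
qed

text \<open>A basis of \<open>B y x\<close> has coordinate functionals, and these are represented by
  elements \<open>\<beta> v\<close> of \<open>B x y\<close> through \<open>dual_iso\<close>. The
  expansion of \<open>b\<close> holds because both sides pair equally with every element of
  \<open>B y x\<close>.\<close>

lemma dual_basis:
  obtains X \<beta> where "finite X" "X \<subseteq> carrier (B y x)" "\<beta> \<in> X \<rightarrow> carrier (B x y)"
    "\<And>b. b \<in> carrier (B x y) \<Longrightarrow> b = (\<Oplus>\<^bsub>B x y\<^esub>v\<in>X. rsmult (B x y) (\<beta> v) (dual b v))"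
proof -
  interpret Y: vector_space_dr "k y" "B y x" by (rule vector_space_k[OF Byx.left_module_axioms])
  obtain X \<phi> where X: "finite X" "X \<subseteq> carrier (B y x)"
    "\<And>v. v \<in> X \<Longrightarrow> linear_map (k y) (B y x) (scalar_module (k y) (\<lambda>a. a)) (\<phi> v)"
    "\<And>m. m \<in> carrier (B y x) \<Longrightarrow> m = (\<Oplus>\<^bsub>B y x\<^esub>v\<in>X. \<phi> v m \<odot>\<^bsub>B y x\<^esub> v)"
    using that by (rule Y.coordinate_functionals[OF has_dim_B[OF edge_sym[OF edge]]])
  have "\<exists>b\<in>carrier (B x y). \<forall>b'\<in>carrier (B y x). dual b b' = \<phi> v b'" if "v \<in> X" for v
    using dual_surj[OF X(3)[OF that]] by metis
  then obtain \<beta> where \<beta>: "\<And>v. v \<in> X \<Longrightarrow> \<beta> v \<in> carrier (B x y)"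
    "\<And>v b'. v \<in> X \<Longrightarrow> b' \<in> carrier (B y x) \<Longrightarrow> dual (\<beta> v) b' = \<phi> v b'" by metis
  have "b = (\<Oplus>\<^bsub>B x y\<^esub>v\<in>X. rsmult (B x y) (\<beta> v) (dual b v))" if b: "b \<in> carrier (B x y)" for b
  proof (rule dual_eqI[OF b])
    have cl: "(\<lambda>v. rsmult (B x y) (\<beta> v) (dual b v)) \<in> X \<rightarrow> carrier (B x y)"
      using \<beta> X(2) dual_closed[OF b] by (auto intro!: Bxy.rsmult_closed)
    then show "(\<Oplus>\<^bsub>B x y\<^esub>v\<in>X. rsmult (B x y) (\<beta> v) (dual b v)) \<in> carrier (B x y)"
      by (rule Bxy.M.finsum_closed)
    fix b' assume b': "b' \<in> carrier (B y x)"
    have 1: "additive_map (B x y) (k y) (\<lambda>b. dual b b')"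
      using b' by (intro additive_mapI) (auto simp: dual_closed dual_add_left)
    have 2: "additive_map (B y x) (k y) (\<lambda>b'. dual b b')"
      using b by (intro additive_mapI) (auto simp: dual_closed dual_add_right)
    have fc: "\<phi> v b' \<in> carrier (k y)" "v \<in> carrier (B y x)" if "v \<in> X" for v
      using linear_map_closed[OF X(3)[OF that] b'] X(2) that by (auto simp: scalar_module_def)
    have "dual (\<Oplus>\<^bsub>B x y\<^esub>v\<in>X. rsmult (B x y) (\<beta> v) (dual b v)) b' =
        (\<Oplus>\<^bsub>k y\<^esub>v\<in>X. dual (rsmult (B x y) (\<beta> v) (dual b v)) b')"
      by (rule additive_map_finsum[OF Bxy.M.abelian_group_axioms ring.is_abelian_group[OF ring_k] 1 X(1) cl])
    also have "\<dots> = (\<Oplus>\<^bsub>k y\<^esub>v\<in>X. dual b (\<phi> v b' \<odot>\<^bsub>B y x\<^esub> v))"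
      using \<beta> b b' fc dual_closed
      by (intro abelian_monoid.finsum_cong'[OF abelian_group.axioms(1)[OF ring.is_abelian_group[OF ring_k]] refl]) (auto simp: dual_rsmult_left dual_smult_right)
    also have "\<dots> = dual b (\<Oplus>\<^bsub>B y x\<^esub>v\<in>X. \<phi> v b' \<odot>\<^bsub>B y x\<^esub> v)"
      using fc by (intro additive_map_finsum[OF Byx.M.abelian_group_axioms ring.is_abelian_group[OF ring_k] 2 X(1), symmetric])
        (auto simp: Byx.smult_closed)
    also have "\<dots> = dual b b'" using X(4)[OF b'] by simp
    finally show "dual b b' = dual (\<Oplus>\<^bsub>B x y\<^esub>v\<in>X. rsmult (B x y) (\<beta> v) (dual b v)) b'" by simp
  qed
  moreover have "\<beta> \<in> X \<rightarrow> carrier (B x y)" using \<beta>(1) by auto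
  ultimately show thesis using that[OF X(1,2)] by simp
qed

end

locale modulation_edge_space = modulation_edge \<M> x y + V: left_module "dr \<M> y" V
  for \<M> :: "('i::finite, 'r, 'b, 'f) modulation" and x y :: 'i and V :: "('r, 'v) module"
begin

sublocale tp: tensor_product "k x" "k y" "B x y" V by (rule tensor_product_B[OF edge V.left_module_axioms])

abbreviation "ev \<equiv> dual_eval \<M> x y V"

lemma ev_balanced:
  assumes "b' \<in> carrier (B y x)"
  shows "balanced (k y) (B x y) V V (\<lambda>b v. dual b b' \<odot>\<^bsub>V\<^esub> v)"
  unfolding balanced_def additive_map_def using assms
  by (auto simp: V.smult_closed V.smult_r_distr V.smult_l_distr dual_closed dual_add_left dual_rsmult_left V.smult_assoc)

lemma ev_additive: "b' \<in> carrier (B y x) \<Longrightarrow> additive_map tp.T V (ev b')"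
  unfolding dual_eval_def by (rule tp.tensor_lift_additive[OF V.M.abelian_group_axioms ev_balanced])

lemma ev_pure: "b' \<in> carrier (B y x) \<Longrightarrow> b \<in> carrier (B x y) \<Longrightarrow> v \<in> carrier V \<Longrightarrow> ev b' (tp.pure b v) = dual b b' \<odot>\<^bsub>V\<^esub> v"
  unfolding dual_eval_def by (rule tp.tensor_lift_pure[OF V.M.abelian_group_axioms ev_balanced])

lemma ev_closed: "b' \<in> carrier (B y x) \<Longrightarrow> t \<in> carrier tp.T \<Longrightarrow> ev b' t \<in> carrier V"
  by (rule additive_map_closed[OF ev_additive])

lemma ev_add_index:
  assumes "b' \<in> carrier (B y x)" "c' \<in> carrier (B y x)" "t \<in> carrier tp.T"
  shows "ev (b' \<oplus>\<^bsub>B y x\<^esub> c') t = ev b' t \<oplus>\<^bsub>V\<^esub> ev c' t"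
proof (rule tp.tensor_eqI[OF V.M.abelian_group_axioms _ _ assms(3)])
  show "additive_map tp.T V (ev (b' \<oplus>\<^bsub>B y x\<^esub> c'))" using assms by (intro ev_additive) simp
  show "additive_map tp.T V (\<lambda>t. ev b' t \<oplus>\<^bsub>V\<^esub> ev c' t)"
    using assms(1,2) by (intro additive_mapI) (auto simp: ev_closed additive_map_add[OF ev_additive] V.M.a_ac)
qed (use assms(1,2) in \<open>auto simp: ev_pure dual_add_right dual_closed V.smult_l_distr\<close>)

lemma ev_smult_index:
  assumes "a \<in> carrier (k y)" "b' \<in> carrier (B y x)" "t \<in> carrier tp.T"
  shows "ev (a \<odot>\<^bsub>B y x\<^esub> b') t = a \<odot>\<^bsub>V\<^esub> ev b' t"
proof (rule tp.tensor_eqI[OF V.M.abelian_group_axioms _ _ assms(3)])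
  show "additive_map tp.T V (ev (a \<odot>\<^bsub>B y x\<^esub> b'))" using assms by (intro ev_additive) (rule Byx.smult_closed)
  show "additive_map tp.T V (\<lambda>t. a \<odot>\<^bsub>V\<^esub> ev b' t)"
    using assms(1,2)
    by (intro additive_mapI) (auto simp: ev_closed additive_map_add[OF ev_additive] V.smult_closed V.smult_r_distr)
qed (use assms(1,2) in \<open>auto simp: ev_pure dual_smult_right dual_closed V.smult_assoc Byx.smult_closed\<close>)

lemma ev_rsmult_index:
  assumes "s \<in> carrier (k x)" "b' \<in> carrier (B y x)" "t \<in> carrier tp.T"
  shows "ev (rsmult (B y x) b' s) t = ev b' (s \<odot>\<^bsub>tp.T\<^esub> t)"
proof (rule tp.tensor_eqI[OF V.M.abelian_group_axioms _ _ assms(3)])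
  show "additive_map tp.T V (ev (rsmult (B y x) b' s))" using assms by (intro ev_additive) (rule Byx.rsmult_closed)
  show "additive_map tp.T V (\<lambda>t. ev b' (s \<odot>\<^bsub>tp.T\<^esub> t))"
    by (rule additive_map_comp[OF tp.smult_additive[OF assms(1)] ev_additive[OF assms(2)]])
qed (use assms(1,2) in \<open>auto simp: ev_pure tp.smult_pure dual_smult_left Bxy.smult_closed Byx.rsmult_closed\<close>)

text \<open>The dual basis expansion tensored with \<open>V\<close>: an element of the tensor
  product is recovered from finitely many of its evaluations. This is why evaluations separate
  elements in \<open>ev_eqI\<close>.\<close>

lemma ev_expansion:
  obtains X \<beta> where "finite X" "X \<subseteq> carrier (B y x)" "\<beta> \<in> X \<rightarrow> carrier (B x y)"
    "\<And>t. t \<in> carrier tp.T \<Longrightarrow> t = (\<Oplus>\<^bsub>tp.T\<^esub>v\<in>X. tp.pure (\<beta> v) (ev v t))"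
proof -
  obtain X \<beta> where X: "finite X" "X \<subseteq> carrier (B y x)" "\<beta> \<in> X \<rightarrow> carrier (B x y)"
    "\<And>b. b \<in> carrier (B x y) \<Longrightarrow> b = (\<Oplus>\<^bsub>B x y\<^esub>v\<in>X. rsmult (B x y) (\<beta> v) (dual b v))"
    using that by (rule dual_basis)
  have Xc: "v \<in> carrier (B y x)" "\<beta> v \<in> carrier (B x y)" if "v \<in> X" for v using that X(2,3) by auto
  have "t = (\<Oplus>\<^bsub>tp.T\<^esub>v\<in>X. tp.pure (\<beta> v) (ev v t))" if t: "t \<in> carrier tp.T" for t
  proof (rule tp.tensor_eqI[OF tp.T.abelian_group_axioms _ _ t])
    show "additive_map tp.T tp.T (\<lambda>t. t)" by (rule additive_mapI) simp_all
    show "additive_map tp.T tp.T (\<lambda>t. \<Oplus>\<^bsub>tp.T\<^esub>v\<in>X. tp.pure (\<beta> v) (ev v t))"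
    proof (rule additive_mapI)
      fix s t assume st: "s \<in> carrier tp.T" "t \<in> carrier tp.T"
      have "(\<Oplus>\<^bsub>tp.T\<^esub>v\<in>X. tp.pure (\<beta> v) (ev v (s \<oplus>\<^bsub>tp.T\<^esub> t))) =
          (\<Oplus>\<^bsub>tp.T\<^esub>v\<in>X. tp.pure (\<beta> v) (ev v s) \<oplus>\<^bsub>tp.T\<^esub> tp.pure (\<beta> v) (ev v t))"
        using st Xc by (intro tp.T.add.finprod_cong'[OF refl])
          (auto simp: additive_map_add[OF ev_additive] tp.pure_add_right ev_closed tp.pure_closed)
      also have "\<dots> = (\<Oplus>\<^bsub>tp.T\<^esub>v\<in>X. tp.pure (\<beta> v) (ev v s)) \<oplus>\<^bsub>tp.T\<^esub> (\<Oplus>\<^bsub>tp.T\<^esub>v\<in>X. tp.pure (\<beta> v) (ev v t))"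
        using st Xc by (intro tp.T.finsum_addf) (auto simp: ev_closed tp.pure_closed)
      finally show "(\<Oplus>\<^bsub>tp.T\<^esub>v\<in>X. tp.pure (\<beta> v) (ev v (s \<oplus>\<^bsub>tp.T\<^esub> t))) =
        (\<Oplus>\<^bsub>tp.T\<^esub>v\<in>X. tp.pure (\<beta> v) (ev v s)) \<oplus>\<^bsub>tp.T\<^esub> (\<Oplus>\<^bsub>tp.T\<^esub>v\<in>X. tp.pure (\<beta> v) (ev v t))" .
    qed (use Xc in \<open>auto intro!: tp.T.finsum_closed simp: ev_closed tp.pure_closed\<close>)
    fix b w assume bw: "b \<in> carrier (B x y)" "w \<in> carrier V"
    have pa: "additive_map (B x y) tp.T (\<lambda>b. tp.pure b w)"
      using tp.balanced_pure bw(2) by (simp add: balanced_def)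
    have dc: "dual b v \<in> carrier (k y)" if "v \<in> X" for v using bw(1) Xc(1)[OF that] by (rule dual_closed)
    have cl: "(\<lambda>v. rsmult (B x y) (\<beta> v) (dual b v)) \<in> X \<rightarrow> carrier (B x y)"
      using Xc dc by (auto intro!: Bxy.rsmult_closed)
    have "tp.pure b w = tp.pure (\<Oplus>\<^bsub>B x y\<^esub>v\<in>X. rsmult (B x y) (\<beta> v) (dual b v)) w"
      using X(4)[OF bw(1)] by simp
    also have "\<dots> = (\<Oplus>\<^bsub>tp.T\<^esub>v\<in>X. tp.pure (rsmult (B x y) (\<beta> v) (dual b v)) w)"
      by (rule additive_map_finsum[OF Bxy.M.abelian_group_axioms tp.T.abelian_group_axioms pa X(1) cl])
    also have "\<dots> = (\<Oplus>\<^bsub>tp.T\<^esub>v\<in>X. tp.pure (\<beta> v) (ev v (tp.pure b w)))"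
      using Xc bw dc by (intro tp.T.add.finprod_cong'[OF refl])
        (auto simp: ev_pure tp.pure_rsmult tp.pure_closed V.smult_closed)
    finally show "tp.pure b w = (\<Oplus>\<^bsub>tp.T\<^esub>v\<in>X. tp.pure (\<beta> v) (ev v (tp.pure b w)))" .
  qed
  then show thesis by (rule that[OF X(1-3)])
qed

lemma ev_eqI:
  assumes "s \<in> carrier tp.T" "t \<in> carrier tp.T" "\<And>b'. b' \<in> carrier (B y x) \<Longrightarrow> ev b' s = ev b' t"
  shows "s = t"
proof -
  obtain X \<beta> where X: "finite X" "X \<subseteq> carrier (B y x)" "\<beta> \<in> X \<rightarrow> carrier (B x y)"
    "\<And>t. t \<in> carrier tp.T \<Longrightarrow> t = (\<Oplus>\<^bsub>tp.T\<^esub>v\<in>X. tp.pure (\<beta> v) (ev v t))"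
    using that by (rule ev_expansion)
  have "(\<Oplus>\<^bsub>tp.T\<^esub>v\<in>X. tp.pure (\<beta> v) (ev v s)) = (\<Oplus>\<^bsub>tp.T\<^esub>v\<in>X. tp.pure (\<beta> v) (ev v t))"
    using assms X(2,3) by (intro tp.T.add.finprod_cong'[OF refl]) (auto simp: ev_closed tp.pure_closed subset_iff Pi_iff)
  then show ?thesis using X(4)[OF assms(1)] X(4)[OF assms(2)] by simp
qed

end

context modulation_edge
begin

text \<open>Serves to carry maps between the spaces at \<open>y\<close> across the adjunction. On a
  pure tensor it is the linearity of \<open>f\<close>.\<close>

lemma ev_natural:
  assumes V: "left_module (k y) V" and W: "left_module (k y) W" and f: "linear_map (k y) V W f"
    and b': "b' \<in> carrier (B y x)" and t: "t \<in> carrier (tens x y V)"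
  shows "f (dual_eval \<M> x y V b' t) = dual_eval \<M> x y W b' (tensor_map (k y) (B x y) W f t)"
proof -
  interpret V: modulation_edge_space \<M> x y V using V by (intro modulation_edge_space.intro modulation_edge_axioms)
  interpret W: modulation_edge_space \<M> x y W using W by (intro modulation_edge_space.intro modulation_edge_axioms)
  note tm = tensor_map_props[OF Bxy.bimodule_axioms V W f]
  show ?thesis
  proof (rule V.tp.tensor_eqI[OF W.V.M.abelian_group_axioms])
    show "additive_map V.tp.T W (\<lambda>t. f (V.ev b' t))"
      by (rule additive_map_comp[OF V.ev_additive[OF b'] linear_map_additive[OF f]])
    show "additive_map V.tp.T W (\<lambda>t. W.ev b' (tensor_map (k y) (B x y) W f t))"
      by (rule additive_map_comp[OF linear_map_additive[OF tm(1)] W.ev_additive[OF b']])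
    show "t \<in> carrier V.tp.T" using t by (simp add: arrow_tensor_def)
  qed (use b' in \<open>simp add: V.ev_pure W.ev_pure tm(2) linear_map_smult[OF f] linear_map_closed[OF f] dual_closed\<close>)
qed

text \<open>That the inner formula is balanced over \<open>k x\<close> is
  \<open>ev_rsmult_index\<close>: the right action on \<open>b'\<close> is dual to the left action
  on the tensor product.\<close>

lemma adjoint_map_props:
  assumes W: "left_module (k x) W" and V: "left_module (k y) V" and c: "linear_map (k x) W (tens x y V) c"
  shows adjoint_map_lin_hom: "adjoint_map \<M> x y W V c \<in> lin_hom (k y) (tens y x W) V"
    and adjoint_map_pure: "b' \<in> carrier (B y x) \<Longrightarrow> w \<in> carrier W \<Longrightarrow>
      adjoint_map \<M> x y W V c (pure_tensor (k x) (B y x) W b' w) = dual_eval \<M> x y V b' (c w)"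
proof -
  interpret V: modulation_edge_space \<M> x y V using V by (intro modulation_edge_space.intro modulation_edge_axioms)
  interpret W: tensor_product "k y" "k x" "B y x" W by (rule tensor_product_B[OF edge_sym[OF edge] W])
  have cT: "linear_map (k x) W V.tp.T c" using c by (simp add: arrow_tensor_def)
  note cl = linear_mapD[OF cT]
  have bal: "balanced (k x) (B y x) W V (\<lambda>b' w. V.ev b' (c w))"
    unfolding balanced_def additive_map_def
    by (auto simp: cl V.ev_closed V.ev_add_index V.ev_rsmult_index additive_map_add[OF V.ev_additive])
  have L: "linear_map (k y) W.T V (tensor_lift V (\<lambda>b' w. V.ev b' (c w)))"
    by (rule W.tensor_lift_linear[OF V.V.left_module_axioms bal]) (simp add: V.ev_smult_index cl)
  have eq: "adjoint_map \<M> x y W V c = restrict (tensor_lift V (\<lambda>b' w. V.ev b' (c w))) (carrier W.T)"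
    by (simp add: adjoint_map_def dual_eval_def arrow_tensor_def)
  show "adjoint_map \<M> x y W V c \<in> lin_hom (k y) (tens y x W) V"
    unfolding eq arrow_tensor_def by (rule restrict_lin_hom[OF W.left_module L])
  show "adjoint_map \<M> x y W V c (W.pure b' w) = V.ev b' (c w)" if "b' \<in> carrier (B y x)" "w \<in> carrier W"
    unfolding eq using that W.tensor_lift_pure[OF V.V.M.abelian_group_axioms bal] W.pure_closed by simp
qed

text \<open>Evaluations separate elements. \<open>reflect_minus\<close> recovers a map from its
  adjoint by \<open>inv_into\<close>, and injectivity identifies the recovered map with any preimage
  that is exhibited.\<close>

lemma adjoint_map_inj_on:
  assumes W: "left_module (k x) W" and V: "left_module (k y) V"
  shows "inj_on (adjoint_map \<M> x y W V) (lin_hom (k x) W (tens x y V))"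
proof (rule inj_onI)
  interpret V: modulation_edge_space \<M> x y V using V by (intro modulation_edge_space.intro modulation_edge_axioms)
  fix c d assume cd: "c \<in> lin_hom (k x) W (tens x y V)" "d \<in> lin_hom (k x) W (tens x y V)"
    and eq: "adjoint_map \<M> x y W V c = adjoint_map \<M> x y W V d"
  note lin = cd[THEN lin_hom_linear]
  show "c = d"
  proof (rule extensionalityI[of _ "carrier W"])
    show "c \<in> extensional (carrier W)" "d \<in> extensional (carrier W)" using cd by (auto simp: lin_hom_iff)
    fix w assume w: "w \<in> carrier W"
    show "c w = d w"
    proof (rule V.ev_eqI)
      show "c w \<in> carrier V.tp.T" "d w \<in> carrier V.tp.T"
        using linear_map_closed[OF lin(1) w] linear_map_closed[OF lin(2) w] by (auto simp: arrow_tensor_def)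
    qed (use adjoint_map_pure[OF W V lin(1) _ w] adjoint_map_pure[OF W V lin(2) _ w] eq in metis)
  qed
qed

end

section \<open>Indecomposable representations and idempotents\<close>

text \<open>Compatibility with the structure maps is required on pure tensors, which generate; this
  keeps \<open>tensor_map\<close> out of the construction of endomorphisms.\<close>

definition idem_endo ::
    "('i::finite, 'r, 'b, 'f) modulation \<Rightarrow> ('i \<times> 'i) set \<Rightarrow> ('i, 'r, 'b, 'v) rep \<Rightarrow> ('i \<Rightarrow> 'v \<Rightarrow> 'v) \<Rightarrow> bool" where
  "idem_endo \<M> \<Lambda> V \<pi> \<longleftrightarrow> (\<forall>i. linear_map (dr \<M> i) (spc V i) (spc V i) (\<pi> i)) \<and>
     (\<forall>i. \<forall>v\<in>carrier (spc V i). \<pi> i (\<pi> i v) = \<pi> i v) \<and>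
     (\<forall>(i, j)\<in>\<Lambda>. \<forall>b\<in>carrier (bim \<M> j i). \<forall>v\<in>carrier (spc V i).
        \<pi> j (mp V i j (pure_tensor (dr \<M> i) (bim \<M> j i) (spc V i) b v)) =
        mp V i j (pure_tensor (dr \<M> i) (bim \<M> j i) (spc V i) b (\<pi> i v)))"

context valued_modulation
begin

lemma rep_left_module: "is_rep \<M> \<Lambda> V \<Longrightarrow> left_module (k i) (spc V i)"
  by (simp add: is_rep_def)

lemma rep_fin_dim: "is_rep \<M> \<Lambda> V \<Longrightarrow> fin_dim (k i) (spc V i)"
  by (simp add: is_rep_def)

lemma rep_mp: "is_rep \<M> \<Lambda> V \<Longrightarrow> (i, j) \<in> \<Lambda> \<Longrightarrow> mp V i j \<in> lin_hom (k j) (tens j i (spc V i)) (spc V j)"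
  by (auto simp: is_rep_def)

lemma rep_mp_linear: "is_rep \<M> \<Lambda> V \<Longrightarrow> (i, j) \<in> \<Lambda> \<Longrightarrow> linear_map (k j) (tens j i (spc V i)) (spc V j) (mp V i j)"
  by (rule lin_hom_linear[OF rep_mp])

lemma arrow_edge: "orientation (val \<M>) \<Lambda> \<Longrightarrow> (i, j) \<in> \<Lambda> \<Longrightarrow> E j i"
  by (rule edge_sym) (auto simp: orientation_def)

lemma arrow_tensor_product:
  "orientation (val \<M>) \<Lambda> \<Longrightarrow> is_rep \<M> \<Lambda> V \<Longrightarrow> (i, j) \<in> \<Lambda> \<Longrightarrow> tensor_product (k j) (k i) (B j i) (spc V i)"
  by (rule tensor_product_B[OF arrow_edge rep_left_module])

text \<open>The image and the kernel of an idempotent endomorphism are complementary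
  subrepresentations, by \<open>v = \<pi> v + (v - \<pi> v)\<close>, and one of them has to
  vanish.\<close>

lemma idem_endo_cases:
  assumes ori: "orientation (val \<M>) \<Lambda>" and rep: "is_rep \<M> \<Lambda> V" and ind: "indecomposable_rep \<M> \<Lambda> V"
    and endo: "idem_endo \<M> \<Lambda> V \<pi>"
  shows "(\<forall>i. \<forall>v\<in>carrier (spc V i). \<pi> i v = \<zero>\<^bsub>spc V i\<^esub>) \<or> (\<forall>i. \<forall>v\<in>carrier (spc V i). \<pi> i v = v)"
proof -
  have lin: "linear_map (k i) (spc V i) (spc V i) (\<pi> i)" for i using endo by (simp add: idem_endo_def)
  have idem: "\<pi> i (\<pi> i v) = \<pi> i v" if "v \<in> carrier (spc V i)" for i v using endo that by (simp add: idem_endo_def)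
  have comp: "\<pi> j (mp V i j (pure_tensor (k i) (B j i) (spc V i) b v)) = mp V i j (pure_tensor (k i) (B j i) (spc V i) b (\<pi> i v))"
    if "(i, j) \<in> \<Lambda>" "b \<in> carrier (B j i)" "v \<in> carrier (spc V i)" for i j b v
    using endo that by (auto simp: idem_endo_def)
  define U where "U i = \<pi> i ` carrier (spc V i)" for i
  define W where "W i = {v \<in> carrier (spc V i). \<pi> i v = \<zero>\<^bsub>spc V i\<^esub>}" for i
  have Usub: "submodule (U i) (k i) (spc V i)" for i
    unfolding U_def using left_module.image_submodule[OF rep_left_module[OF rep] rep_left_module[OF rep] lin]
      left_module.submodule_carrier_set[OF rep_left_module[OF rep]] by blast
  have Wsub: "submodule (W i) (k i) (spc V i)" for i
    unfolding W_def by (rule left_module.kernel_submodule[OF rep_left_module[OF rep] rep_left_module[OF rep] lin])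
  have fixed: "\<pi> i u = u" if "u \<in> U i" for i u using that idem by (auto simp: U_def)
  have diff: "v \<ominus>\<^bsub>spc V i\<^esub> \<pi> i v \<in> W i" if v: "v \<in> carrier (spc V i)" for i v
  proof -
    interpret Vi: left_module "k i" "spc V i" by (rule rep_left_module[OF rep])
    show ?thesis
      using v linear_map_closed[OF lin v] idem[OF v]
        additive_map_minus[OF Vi.M.abelian_group_axioms Vi.M.abelian_group_axioms linear_map_additive[OF lin], of v "\<pi> i v"]
      by (simp add: W_def Vi.M.minus_self)
  qed
  have cl: "mp V i j (pure_tensor (k i) (B j i) (spc V i) b v) \<in> carrier (spc V j)"
    if "(i, j) \<in> \<Lambda>" "b \<in> carrier (B j i)" "v \<in> carrier (spc V i)" for i j b v
  proof -
    interpret tensor_product "k j" "k i" "B j i" "spc V i" by (rule arrow_tensor_product[OF ori rep that(1)])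
    show ?thesis
      using linear_map_closed[OF rep_mp_linear[OF rep that(1)]] pure_closed[OF that(2,3)] by (simp add: arrow_tensor_def)
  qed
  have "subrep \<M> \<Lambda> V U"
    unfolding subrep_def
  proof (intro conjI allI Usub ballI, clarify)
    fix i j b u assume *: "(i, j) \<in> \<Lambda>" "b \<in> carrier (B j i)" "u \<in> U i"
    have uc: "u \<in> carrier (spc V i)" using *(3) linear_map_closed[OF lin] by (auto simp: U_def)
    have "mp V i j (pure_tensor (k i) (B j i) (spc V i) b u) =
        \<pi> j (mp V i j (pure_tensor (k i) (B j i) (spc V i) b u))"
      using comp[OF *(1,2) uc] fixed[OF *(3)] by simp
    then show "mp V i j (pure_tensor (k i) (B j i) (spc V i) b u) \<in> U j"
      unfolding U_def using cl[OF *(1,2) uc] by (metis imageI)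
  qed
  moreover have "subrep \<M> \<Lambda> V W"
    unfolding subrep_def
  proof (intro conjI allI Wsub ballI, clarify)
    fix i j b u assume *: "(i, j) \<in> \<Lambda>" "b \<in> carrier (B j i)" "u \<in> W i"
    have uc: "u \<in> carrier (spc V i)" "\<pi> i u = \<zero>\<^bsub>spc V i\<^esub>" using *(3) by (auto simp: W_def)
    interpret Vi: left_module "k i" "spc V i" by (rule rep_left_module[OF rep])
    interpret Vj: left_module "k j" "spc V j" by (rule rep_left_module[OF rep])
    interpret tensor_product "k j" "k i" "B j i" "spc V i" by (rule arrow_tensor_product[OF ori rep *(1)])
    have "\<pi> j (mp V i j (pure b u)) = mp V i j \<zero>\<^bsub>T\<^esub>"
      using comp[OF *(1,2) uc(1)] uc(2) pure_zero_right[OF *(2)] by simp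
    also have "\<dots> = \<zero>\<^bsub>spc V j\<^esub>"
      using additive_map_zero[OF T.abelian_group_axioms Vj.M.abelian_group_axioms]
        linear_map_additive[OF rep_mp_linear[OF rep *(1)]] by (simp add: arrow_tensor_def)
    finally show "mp V i j (pure b u) \<in> W j" using cl[OF *(1,2) uc(1)] by (simp add: W_def)
  qed
  moreover have "U i <+>\<^bsub>spc V i\<^esub> W i = carrier (spc V i) \<and> U i \<inter> W i = {\<zero>\<^bsub>spc V i\<^esub>}" for i
  proof
    interpret Vi: left_module "k i" "spc V i" by (rule rep_left_module[OF rep])
    note Us = Vi.submoduleD[OF Usub] and Ws = Vi.submoduleD[OF Wsub]
    show "U i <+>\<^bsub>spc V i\<^esub> W i = carrier (spc V i)"
    proof
      show "U i <+>\<^bsub>spc V i\<^esub> W i \<subseteq> carrier (spc V i)" using Us(2) Ws(2) by (auto simp: set_add_def')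
      show "carrier (spc V i) \<subseteq> U i <+>\<^bsub>spc V i\<^esub> W i"
      proof
        fix v assume v: "v \<in> carrier (spc V i)"
        have "v = \<pi> i v \<oplus>\<^bsub>spc V i\<^esub> (v \<ominus>\<^bsub>spc V i\<^esub> \<pi> i v)"
          using v linear_map_closed[OF lin v] Vi.M.minus_add_cancel by (simp add: Vi.M.a_comm)
        moreover have "\<pi> i v \<in> U i" using v by (simp add: U_def)
        ultimately show "v \<in> U i <+>\<^bsub>spc V i\<^esub> W i" unfolding set_add_def' using diff[OF v] by blast
      qed
    qed
    have "v = \<zero>\<^bsub>spc V i\<^esub>" if "v \<in> U i" "v \<in> W i" for v using fixed[OF that(1)] that(2) by (simp add: W_def)
    then show "U i \<inter> W i = {\<zero>\<^bsub>spc V i\<^esub>}" using Us(3) Ws(3) by blast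
  qed
  ultimately have "(\<forall>i. U i = {\<zero>\<^bsub>spc V i\<^esub>}) \<or> (\<forall>i. W i = {\<zero>\<^bsub>spc V i\<^esub>})"
    using ind unfolding indecomposable_rep_def by blast
  then show ?thesis
  proof
    assume "\<forall>i. U i = {\<zero>\<^bsub>spc V i\<^esub>}"
    then have "\<pi> i v = \<zero>\<^bsub>spc V i\<^esub>" if "v \<in> carrier (spc V i)" for i v
      using that unfolding U_def by (metis imageI singletonD)
    then show ?thesis by blast
  next
    assume W0: "\<forall>i. W i = {\<zero>\<^bsub>spc V i\<^esub>}"
    have "\<pi> i v = v" if v: "v \<in> carrier (spc V i)" for i v
    proof -
      interpret Vi: left_module "k i" "spc V i" by (rule rep_left_module[OF rep])
      have "v \<ominus>\<^bsub>spc V i\<^esub> \<pi> i v = \<zero>\<^bsub>spc V i\<^esub>" using diff[OF v] W0 by simp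
      then have "v = \<pi> i v" by (rule Vi.M.minus_eq_zeroD[OF _ v linear_map_closed[OF lin v]])
      then show ?thesis by simp
    qed
    then show ?thesis by blast
  qed
qed

text \<open>The projections along a decomposition into subrepresentations form an idempotent
  endomorphism. Together with \<open>idem_endo_cases\<close> this characterises the indecomposable
  ones among the nonzero representations.\<close>

lemma indecomposableI:
  assumes ori: "orientation (val \<M>) \<Lambda>" and rep: "is_rep \<M> \<Lambda> V" and nz: "\<not> zero_rep V"
    and endo: "\<And>\<pi>. idem_endo \<M> \<Lambda> V \<pi> \<Longrightarrow>
      (\<forall>i. \<forall>v\<in>carrier (spc V i). \<pi> i v = \<zero>\<^bsub>spc V i\<^esub>) \<or> (\<forall>i. \<forall>v\<in>carrier (spc V i). \<pi> i v = v)"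
  shows "indecomposable_rep \<M> \<Lambda> V"
  unfolding indecomposable_rep_def
proof (intro conjI nz allI impI, elim conjE)
  fix U W assume U: "subrep \<M> \<Lambda> V U" and W: "subrep \<M> \<Lambda> V W"
    and dec: "\<forall>i. U i <+>\<^bsub>spc V i\<^esub> W i = carrier (spc V i) \<and> U i \<inter> W i = {\<zero>\<^bsub>spc V i\<^esub>}"
  have Us: "submodule (U i) (k i) (spc V i)" and Ws: "submodule (W i) (k i) (spc V i)" for i
    using U W by (auto simp: subrep_def)
  have "\<exists>p. linear_map (k i) (spc V i) (spc V i) p \<and> p \<in> carrier (spc V i) \<rightarrow> U i \<and> (\<forall>u\<in>U i. p u = u) \<and>
      (\<forall>c\<in>W i. p c = \<zero>\<^bsub>spc V i\<^esub>) \<and> (\<forall>m\<in>carrier (spc V i). m \<ominus>\<^bsub>spc V i\<^esub> p m \<in> W i)" for i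
  proof -
    interpret Vi: left_module "k i" "spc V i" by (rule rep_left_module[OF rep])
    have cap: "U i \<inter> W i = {\<zero>\<^bsub>spc V i\<^esub>}" using dec by simp
    have s: "\<exists>u\<in>U i. \<exists>c\<in>W i. m = u \<oplus>\<^bsub>spc V i\<^esub> c" if "m \<in> carrier (spc V i)" for m
      using dec that unfolding set_add_def' by blast
    obtain p where "linear_map (k i) (spc V i) (spc V i) p" "p \<in> carrier (spc V i) \<rightarrow> U i" "\<And>u. u \<in> U i \<Longrightarrow> p u = u"
      "\<And>c. c \<in> W i \<Longrightarrow> p c = \<zero>\<^bsub>spc V i\<^esub>" "\<And>m. m \<in> carrier (spc V i) \<Longrightarrow> m \<ominus>\<^bsub>spc V i\<^esub> p m \<in> W i"
      using s that by (rule Vi.projection_exists[OF Us Ws cap])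
    then show ?thesis by blast
  qed
  then obtain p where p: "\<And>i. linear_map (k i) (spc V i) (spc V i) (p i)" "\<And>i. p i \<in> carrier (spc V i) \<rightarrow> U i"
    "\<And>i u. u \<in> U i \<Longrightarrow> p i u = u" "\<And>i c. c \<in> W i \<Longrightarrow> p i c = \<zero>\<^bsub>spc V i\<^esub>"
    "\<And>i m. m \<in> carrier (spc V i) \<Longrightarrow> m \<ominus>\<^bsub>spc V i\<^esub> p i m \<in> W i" by metis
  have "idem_endo \<M> \<Lambda> V p"
    unfolding idem_endo_def
  proof (intro conjI allI ballI p(1), use p(2,3) in blast, clarify)
    fix i j b v assume *: "(i, j) \<in> \<Lambda>" "b \<in> carrier (B j i)" "v \<in> carrier (spc V i)"
    interpret Vi: left_module "k i" "spc V i" by (rule rep_left_module[OF rep])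
    interpret Vj: left_module "k j" "spc V j" by (rule rep_left_module[OF rep])
    interpret tensor_product "k j" "k i" "B j i" "spc V i" by (rule arrow_tensor_product[OF ori rep *(1)])
    note mplin = rep_mp_linear[OF rep *(1), unfolded arrow_tensor_def]
    define u where "u = p i v" define w where "w = v \<ominus>\<^bsub>spc V i\<^esub> p i v"
    have uw: "u \<in> U i" "w \<in> W i" using p(2,5) *(3) by (auto simp: u_def w_def)
    have uwc: "u \<in> carrier (spc V i)" "w \<in> carrier (spc V i)"
      using uw Vi.submodule_carrier[OF Us] Vi.submodule_carrier[OF Ws] by auto
    have v: "v = u \<oplus>\<^bsub>spc V i\<^esub> w"
      using Vi.M.minus_add_cancel[OF *(3), of u] uwc by (simp add: u_def w_def Vi.M.a_comm)
    have mu: "mp V i j (pure b u) \<in> U j" "mp V i j (pure b w) \<in> W j"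
      using U W uw * by (auto simp: subrep_def)
    have muc: "mp V i j (pure b u) \<in> carrier (spc V j)" "mp V i j (pure b w) \<in> carrier (spc V j)"
      using mu Vj.submodule_carrier[OF Us] Vj.submodule_carrier[OF Ws] by auto
    have "mp V i j (pure b v) = mp V i j (pure b u) \<oplus>\<^bsub>spc V j\<^esub> mp V i j (pure b w)"
      unfolding v using uwc *(2) by (simp add: pure_add_right linear_map_add[OF mplin] pure_closed)
    then have "p j (mp V i j (pure b v)) = mp V i j (pure b u)"
      using muc p(3)[OF mu(1)] p(4)[OF mu(2)] by (simp add: linear_map_add[OF p(1)])
    then show "p j (mp V i j (pure b v)) = mp V i j (pure b (p i v))" by (simp add: u_def)
  qed
  then have "(\<forall>i. \<forall>v\<in>carrier (spc V i). p i v = \<zero>\<^bsub>spc V i\<^esub>) \<or> (\<forall>i. \<forall>v\<in>carrier (spc V i). p i v = v)" by (rule endo)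
  then show "(\<forall>i. U i = {\<zero>\<^bsub>spc V i\<^esub>}) \<or> (\<forall>i. W i = {\<zero>\<^bsub>spc V i\<^esub>})"
  proof
    assume z: "\<forall>i. \<forall>v\<in>carrier (spc V i). p i v = \<zero>\<^bsub>spc V i\<^esub>"
    have "U i = {\<zero>\<^bsub>spc V i\<^esub>}" for i
    proof -
      interpret Vi: left_module "k i" "spc V i" by (rule rep_left_module[OF rep])
      have "u = \<zero>\<^bsub>spc V i\<^esub>" if "u \<in> U i" for u
        using z p(3)[OF that] Vi.submodule_carrier[OF Us that] by metis
      then show ?thesis using Vi.submodule_zero[OF Us] by blast
    qed
    then show ?thesis by blast
  next
    assume id: "\<forall>i. \<forall>v\<in>carrier (spc V i). p i v = v"
    have "W i = {\<zero>\<^bsub>spc V i\<^esub>}" for i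
    proof -
      interpret Vi: left_module "k i" "spc V i" by (rule rep_left_module[OF rep])
      have "u = \<zero>\<^bsub>spc V i\<^esub>" if "u \<in> W i" for u
        using id p(4)[OF that] Vi.submodule_carrier[OF Ws that] by metis
      then show ?thesis using Vi.submodule_zero[OF Ws] by blast
    qed
    then show ?thesis by blast
  qed
qed

end

section \<open>The reflection functor at a sink\<close>

lemma reflect_iff: "(i, j) \<in> reflect x \<Lambda> \<longleftrightarrow> (if i = x \<or> j = x then (j, i) \<in> \<Lambda> else (i, j) \<in> \<Lambda>)"
  by (simp add: reflect_def)

lemma (in tensor_product) zero_tensor:
  assumes "carrier V = {\<zero>\<^bsub>V\<^esub>}"
  shows "carrier T = {\<zero>\<^bsub>T\<^esub>}"
proof -
  have "t = \<zero>\<^bsub>T\<^esub>" if "t \<in> carrier T" for t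
    using that
  proof (induction rule: tensor_induct)
    case (pure b v)
    then show ?case using pure_zero_right assms by simp
  qed (auto simp: T.minus_self)
  then show ?thesis by auto
qed

text \<open>All that the combinatorics of admissible sequences uses of the graph; it is thereby kept
  free of the modulation.\<close>

locale symmetric_graph =
  fixes b :: "'i::finite \<Rightarrow> 'i \<Rightarrow> nat"
  assumes sym: "edge b i j \<Longrightarrow> edge b j i" and irrefl: "\<not> edge b i i"
begin

lemma orientationD:
  assumes "orientation b \<Lambda>"
  shows "(i, j) \<in> \<Lambda> \<Longrightarrow> edge b i j" "edge b i j \<Longrightarrow> (i, j) \<in> \<Lambda> \<or> (j, i) \<in> \<Lambda>" "(i, i) \<notin> \<Lambda>"
  using assms irrefl by (auto simp: orientation_def)

lemma orientation_reflect: "orientation b \<Lambda> \<Longrightarrow> orientation b (reflect x \<Lambda>)"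
proof -
  assume o: "orientation b \<Lambda>"
  show ?thesis
    unfolding orientation_def
  proof (intro conjI allI impI ballI, clarify)
    fix i j assume "(i, j) \<in> reflect x \<Lambda>"
    then have "(i, j) \<in> \<Lambda> \<or> (j, i) \<in> \<Lambda>" by (auto simp: reflect_iff split: if_splits)
    then show "edge b i j" using orientationD(1)[OF o] sym by blast
  next
    fix i j assume "edge b i j"
    then have "((i, j) \<in> \<Lambda>) \<noteq> ((j, i) \<in> \<Lambda>)" using o by (simp add: orientation_def)
    then show "((i, j) \<in> reflect x \<Lambda>) \<noteq> ((j, i) \<in> reflect x \<Lambda>)" by (auto simp: reflect_iff)
  qed
qed

end

sublocale valued_modulation < gr: symmetric_graph "val \<M>"
  by (rule symmetric_graph.intro) (rule edge_sym, assumption, rule edge_irrefl)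

text \<open>Gives names to the pieces bound by \<open>let\<close> in \<open>reflect_plus\<close>:
  the sum map \<open>h\<close>, its kernel, the coordinates \<open>\<theta>\<close> of the kernel
  and the coordinate space \<open>W\<close>.\<close>

locale sink_reflection = valued_modulation \<M>
  for \<M> :: "('i::finite, 'r, 'b, 'f) modulation" +
  fixes \<Lambda> :: "('i \<times> 'i) set" and x :: 'i and V :: "('i, 'r, 'b, 'v + 'r list) rep"
  assumes orientation: "orientation (val \<M>) \<Lambda>" and sink: "is_sink \<Lambda> x" and rep: "is_rep \<M> \<Lambda> V"
begin

definition N where "N = {y. (y, x) \<in> \<Lambda>}"
abbreviation "TT y \<equiv> tens x y (spc V y)"
definition h where "h = (\<lambda>u. \<Oplus>\<^bsub>spc V x\<^esub>y\<in>N. mp V y x (u y))"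
definition Ker where
  "Ker = (direct_sum N TT)\<lparr>carrier := {u \<in> carrier (direct_sum N TT). h u = \<zero>\<^bsub>spc V x\<^esub>}\<rparr>"
definition \<theta> :: "'v + 'r list \<Rightarrow> 'i \<Rightarrow> ('b, 'v + 'r list) tens" where "\<theta> = coord_iso (k x) Ker"
definition W :: "('r, 'v + 'r list) module" where "W = coord_space (k x) (ldim (k x) Ker)"
definition F where "F = reflect_plus \<M> \<Lambda> x V"

lemma spc_F: "spc F = (spc V)(x := W)"
  by (simp add: F_def reflect_plus_def Let_def W_def Ker_def h_def N_def)

lemma mp_F: "mp F i j = (if i = x then adjoint_map \<M> x j W (spc V j) (\<lambda>w\<in>carrier W. \<theta> w j) else mp V i j)"
  by (simp add: F_def reflect_plus_def Let_def W_def \<theta>_def Ker_def h_def N_def)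

lemma N_edge: "y \<in> N \<Longrightarrow> E x y"
  using arrow_edge[OF orientation] by (simp add: N_def)

lemma x_notin_N: "x \<notin> N"
  using N_edge edge_irrefl by blast

lemma N_ne: "y \<in> N \<Longrightarrow> y \<noteq> x"
  using x_notin_N by blast

sublocale ds: module_family "k x" N TT
  by (rule module_family.intro) (auto intro: ring_k tens_left_module N_edge rep_left_module[OF rep])

sublocale Vx: vector_space_dr "k x" "spc V x"
  by (rule vector_space_k[OF rep_left_module[OF rep]])

lemma mp_linear: "y \<in> N \<Longrightarrow> linear_map (k x) (TT y) (spc V x) (mp V y x)"
  by (rule rep_mp_linear[OF rep]) (simp add: N_def)

lemma h_linear: "linear_map (k x) ds.D (spc V x) h"
  unfolding h_def by (rule ds.sum_map_linear[OF Vx.left_module_axioms mp_linear])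

lemma h_inj: "y \<in> N \<Longrightarrow> t \<in> carrier (TT y) \<Longrightarrow> h (ds_inj N TT y t) = mp V y x t"
  unfolding h_def by (rule ds.sum_map_inj[OF Vx.M.abelian_group_axioms linear_map_additive[OF mp_linear]])

lemma Ker_submodule: "submodule (carrier Ker) (k x) ds.D"
  unfolding Ker_def using ds.D.kernel_submodule[OF Vx.left_module_axioms h_linear] by simp

lemma Ker_simps: "\<zero>\<^bsub>Ker\<^esub> = \<zero>\<^bsub>ds.D\<^esub>" "(\<oplus>\<^bsub>Ker\<^esub>) = (\<oplus>\<^bsub>ds.D\<^esub>)" "(\<odot>\<^bsub>Ker\<^esub>) = (\<odot>\<^bsub>ds.D\<^esub>)"
  "u \<in> carrier Ker \<longleftrightarrow> u \<in> carrier ds.D \<and> h u = \<zero>\<^bsub>spc V x\<^esub>"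
  by (auto simp: Ker_def)

lemma Ker_left_module: "left_module (k x) Ker"
  using ds.D.submodule_left_module[OF Ker_submodule] by (simp add: Ker_def)

text \<open>The kernel sits in a finite direct sum of finitely generated tensor products. Without
  this the choice made by \<open>coord_iso\<close> would be void.\<close>

lemma Ker_fin_dim: "fin_dim (k x) Ker"
proof -
  interpret D: vector_space_dr "k x" ds.D by (rule vector_space_k[OF ds.D.left_module_axioms])
  interpret K: vector_space_dr "k x" Ker by (rule vector_space_k[OF Ker_left_module])
  have "finitely_generated (k x) ds.D"
    by (rule ds.finitely_generated_direct_sum)
      (auto intro: tens_finitely_generated N_edge rep_left_module[OF rep] rep_fin_dim[OF rep])
  then have "finitely_generated (k x) (ds.D\<lparr>carrier := carrier Ker\<rparr>)"
    by (rule D.finitely_generated_submodule[OF Ker_submodule])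
  then show ?thesis using K.fin_dim_iff by (simp add: Ker_def)
qed

lemma \<theta>_linear: "linear_map (k x) W Ker \<theta>"
  unfolding W_def \<theta>_def by (rule coord_iso_linear[OF division_ring_k Ker_left_module Ker_fin_dim])

lemma \<theta>_bij: "bij_betw \<theta> (carrier W) (carrier Ker)"
  unfolding W_def \<theta>_def by (rule coord_iso_bij[OF division_ring_k Ker_left_module Ker_fin_dim])

lemma W_left_module: "left_module (k x) W"
  unfolding W_def by (rule coord_space_left_module[OF ring_k])

lemma W_fin_dim: "fin_dim (k x) W"
  unfolding W_def by (rule coord_fin_dim[OF division_ring_k Ker_left_module Ker_fin_dim])

lemma \<theta>_closed: "w \<in> carrier W \<Longrightarrow> \<theta> w \<in> carrier ds.D"
  using linear_map_closed[OF \<theta>_linear] Ker_simps(4) by blast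

lemma \<theta>_linear_D: "linear_map (k x) W ds.D \<theta>"
  using \<theta>_linear \<theta>_closed by (auto simp: linear_map_def additive_map_def Ker_simps)

lemma \<theta>_component_linear: "y \<in> N \<Longrightarrow> linear_map (k x) W (TT y) (\<lambda>w. \<theta> w y)"
  by (rule linear_map_comp[OF \<theta>_linear_D ds.proj_linear])

lemma \<theta>_restrict_linear: "y \<in> N \<Longrightarrow> linear_map (k x) W (TT y) (\<lambda>w\<in>carrier W. \<theta> w y)"
  using restrict_lin_hom[OF W_left_module \<theta>_component_linear] by (simp add: lin_hom_iff)

lemma modulation_edge: "y \<in> N \<Longrightarrow> modulation_edge \<M> x y"
  by (intro modulation_edge.intro modulation_edge_axioms.intro valued_modulation_axioms N_edge)

text \<open>The working form of the new structure maps: by adjunction they are evaluations of the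
  components of the kernel inclusion.\<close>

lemma mp_F_pure:
  assumes "y \<in> N" "b' \<in> carrier (B y x)" "w \<in> carrier W"
  shows "mp F x y (pure_tensor (k x) (B y x) W b' w) = dual_eval \<M> x y (spc V y) b' (\<theta> w y)"
  using modulation_edge.adjoint_map_pure[OF modulation_edge[OF assms(1)] W_left_module rep_left_module[OF rep]
      \<theta>_restrict_linear[OF assms(1)] assms(2,3)] assms(3)
  by (simp add: mp_F)

lemma rep_F: "is_rep \<M> (reflect x \<Lambda>) F"
  unfolding is_rep_def
proof (intro conjI allI ballI, goal_cases)
  case (1 i)
  then show ?case using W_left_module rep_left_module[OF rep] by (simp add: spc_F)
next
  case (2 i)
  then show ?case using W_fin_dim rep_fin_dim[OF rep] by (simp add: spc_F)
next
  case (3 a)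
  obtain i j where a: "a = (i, j)" by (cases a)
  have ij: "(i, j) \<in> reflect x \<Lambda>" using 3 a by simp
  have "mp F i j \<in> lin_hom (k j) (tens j i (spc F i)) (spc F j)"
  proof (cases "i = x")
    case True
    then have j: "j \<in> N" using ij by (auto simp: reflect_iff N_def)
    then show ?thesis
      using True modulation_edge.adjoint_map_lin_hom[OF modulation_edge[OF j] W_left_module
          rep_left_module[OF rep] \<theta>_restrict_linear[OF j]] N_ne[OF j]
      by (simp add: mp_F spc_F)
  next
    case False
    then have "j \<noteq> x" "(i, j) \<in> \<Lambda>" using ij sink by (auto simp: reflect_iff is_sink_def split: if_splits)
    then show ?thesis using rep_mp[OF rep] False by (simp add: mp_F spc_F)
  qed
  then show ?case by (simp add: a)
qed

lemma W_zeroI: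
  assumes "\<And>u. u \<in> carrier ds.D \<Longrightarrow> h u = \<zero>\<^bsub>spc V x\<^esub> \<Longrightarrow> u = \<zero>\<^bsub>ds.D\<^esub>"
  shows "carrier W = {\<zero>\<^bsub>W\<^esub>}"
proof -
  interpret W: left_module "k x" W by (rule W_left_module)
  have "w = \<zero>\<^bsub>W\<^esub>" if w: "w \<in> carrier W" for w
  proof -
    have "\<theta> w = \<zero>\<^bsub>ds.D\<^esub>" "\<theta> \<zero>\<^bsub>W\<^esub> = \<zero>\<^bsub>ds.D\<^esub>"
      using linear_map_closed[OF \<theta>_linear] w assms Ker_simps(4) by auto
    then show ?thesis using \<theta>_bij w by (auto simp: bij_betw_def inj_on_def)
  qed
  then show ?thesis by auto
qed

lemma zero_TT:
  assumes "y \<in> N" "carrier (spc V y) = {\<zero>\<^bsub>spc V y\<^esub>}"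
  shows "carrier (TT y) = {\<zero>\<^bsub>TT y\<^esub>}"
  unfolding arrow_tensor_def
  by (rule tensor_product.zero_tensor[OF tensor_product_B[OF N_edge[OF assms(1)] rep_left_module[OF rep]] assms(2)])

lemma W_zero_if_neighbours_zero:
  assumes "\<And>y. y \<in> N \<Longrightarrow> carrier (spc V y) = {\<zero>\<^bsub>spc V y\<^esub>}"
  shows "carrier W = {\<zero>\<^bsub>W\<^esub>}"
proof (rule W_zeroI)
  fix u assume u: "u \<in> carrier ds.D"
  show "u = \<zero>\<^bsub>ds.D\<^esub>"
  proof (rule ds.ds_eqI[OF u])
    show "u i = \<zero>\<^bsub>ds.D\<^esub> i" if "i \<in> N" for i
      using ds.ds_mem[OF u that] zero_TT[OF that assms[OF that]] that by (simp add: ds.ds_zero)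
  qed simp
qed

text \<open>With all neighbours zero, the direct sum whose kernel is taken is zero as well.\<close>

lemma zero_F_if_concentrated:
  assumes "\<And>y. y \<noteq> x \<Longrightarrow> carrier (spc V y) = {\<zero>\<^bsub>spc V y\<^esub>}"
  shows "zero_rep F"
  using W_zero_if_neighbours_zero assms N_ne by (auto simp: zero_rep_def spc_F)

lemma zero_F: "zero_rep V \<Longrightarrow> zero_rep F"
  by (rule zero_F_if_concentrated) (simp add: zero_rep_def)

lemma concentrated_if_zero_F: "zero_rep F \<Longrightarrow> y \<noteq> x \<Longrightarrow> carrier (spc V y) = {\<zero>\<^bsub>spc V y\<^esub>}"
  unfolding zero_rep_def spc_F by (metis fun_upd_other)

text \<open>Split the image of \<open>h\<close> off the space at \<open>x\<close>. No arrow leaves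
  \<open>x\<close>, and everything arriving at \<open>x\<close> lies in the image of
  \<open>h\<close>, so the projection \<open>q\<close> onto the complement extends by zero to an
  endomorphism. If it is 0, then \<open>h\<close> is onto; if it is the identity, the representation
  lives at \<open>x\<close> alone and is annihilated.\<close>

lemma h_surj:
  assumes ind: "indecomposable_rep \<M> \<Lambda> V" and nz: "\<not> zero_rep F"
  shows "h ` carrier ds.D = carrier (spc V x)"
proof -
  have im: "submodule (h ` carrier ds.D) (k x) (spc V x)"
    by (rule ds.D.image_submodule[OF Vx.left_module_axioms h_linear ds.D.submodule_carrier_set])
  have fg: "finitely_generated (k x) (spc V x)" using rep_fin_dim[OF rep] Vx.fin_dim_iff by simp
  obtain C where C: "submodule C (k x) (spc V x)" "h ` carrier ds.D \<inter> C = {\<zero>\<^bsub>spc V x\<^esub>}"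
    "\<And>m. m \<in> carrier (spc V x) \<Longrightarrow> \<exists>u\<in>h ` carrier ds.D. \<exists>c\<in>C. m = u \<oplus>\<^bsub>spc V x\<^esub> c"
    using that by (rule Vx.complement_exists[OF im fg])
  obtain p where p: "linear_map (k x) (spc V x) (spc V x) p" "p \<in> carrier (spc V x) \<rightarrow> h ` carrier ds.D"
    "\<And>u. u \<in> h ` carrier ds.D \<Longrightarrow> p u = u" "\<And>c. c \<in> C \<Longrightarrow> p c = \<zero>\<^bsub>spc V x\<^esub>"
    "\<And>m. m \<in> carrier (spc V x) \<Longrightarrow> m \<ominus>\<^bsub>spc V x\<^esub> p m \<in> C"
    using C(3) that by (rule Vx.projection_exists[OF im C(1,2)])
  define q where "q v = v \<ominus>\<^bsub>spc V x\<^esub> p v" for v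
  have pc: "p v \<in> carrier (spc V x)" if "v \<in> carrier (spc V x)" for v using linear_map_closed[OF p(1) that] .
  have q: "linear_map (k x) (spc V x) (spc V x) q"
  proof (rule linear_mapI)
    fix m n assume "m \<in> carrier (spc V x)" "n \<in> carrier (spc V x)"
    then show "q (m \<oplus>\<^bsub>spc V x\<^esub> n) = q m \<oplus>\<^bsub>spc V x\<^esub> q n"
      using pc by (simp add: q_def linear_map_add[OF p(1)] Vx.M.minus_eq Vx.M.minus_add Vx.M.a_ac)
  next
    fix a m assume am: "a \<in> carrier (k x)" "m \<in> carrier (spc V x)"
    have "additive_map (spc V x) (spc V x) (\<lambda>m. a \<odot>\<^bsub>spc V x\<^esub> m)"
      using am by (intro additive_mapI) (auto intro: Vx.smult_closed Vx.smult_r_distr)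
    then show "q (a \<odot>\<^bsub>spc V x\<^esub> m) = a \<odot>\<^bsub>spc V x\<^esub> q m"
      using am pc additive_map_minus[OF Vx.M.abelian_group_axioms Vx.M.abelian_group_axioms]
      by (simp add: q_def linear_map_smult[OF p(1)])
  qed (use pc in \<open>simp add: q_def\<close>)
  have pp: "p (p v) = p v" if "v \<in> carrier (spc V x)" for v using p(2,3) that by auto
  have qq: "q (q v) = q v" if v: "v \<in> carrier (spc V x)" for v
    using additive_map_minus[OF Vx.M.abelian_group_axioms Vx.M.abelian_group_axioms linear_map_additive[OF p(1)], of v "p v"]
      v pc pp[OF v] by (simp add: q_def Vx.M.minus_self) (simp add: Vx.M.minus_eq)
  have qh: "q u = \<zero>\<^bsub>spc V x\<^esub>" if "u \<in> h ` carrier ds.D" for u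
    using p(3)[OF that] that Vx.submodule_carrier[OF im] by (simp add: q_def Vx.M.minus_self)
  define \<pi> where "\<pi> i = (if i = x then q else (\<lambda>_. \<zero>\<^bsub>spc V i\<^esub>))" for i
  have "idem_endo \<M> \<Lambda> V \<pi>"
    unfolding idem_endo_def
  proof (intro conjI allI ballI, goal_cases)
    case (1 i)
    interpret Vi: left_module "k i" "spc V i" by (rule rep_left_module[OF rep])
    show ?case using q by (cases "i = x") (auto simp: \<pi>_def intro!: linear_mapI)
  next
    case (2 i v)
    then show ?case using qq by (cases "i = x") (simp_all add: \<pi>_def)
  next
    case (3 a)
    obtain i j where a: "a = (i, j)" by (cases a)
    have ij: "(i, j) \<in> \<Lambda>" using 3 a by simp
    have ix: "i \<noteq> x" using ij sink by (auto simp: is_sink_def)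
    interpret Vi: left_module "k i" "spc V i" by (rule rep_left_module[OF rep])
    interpret Vj: left_module "k j" "spc V j" by (rule rep_left_module[OF rep])
    interpret tensor_product "k j" "k i" "B j i" "spc V i" by (rule arrow_tensor_product[OF orientation rep ij])
    note mplin = rep_mp_linear[OF rep ij, unfolded arrow_tensor_def]
    have mz: "mp V i j \<zero>\<^bsub>T\<^esub> = \<zero>\<^bsub>spc V j\<^esub>"
      by (rule additive_map_zero[OF T.abelian_group_axioms Vj.M.abelian_group_axioms linear_map_additive[OF mplin]])
    have "\<pi> j (mp V i j (pure b v)) = mp V i j (pure b (\<pi> i v))"
      if bv: "b \<in> carrier (B j i)" "v \<in> carrier (spc V i)" for b v
    proof (cases "j = x")
      case True
      then have i: "i \<in> N" using ij by (simp add: N_def)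
      have t: "pure b v \<in> carrier (TT i)" using pure_closed[OF bv] True by (simp add: arrow_tensor_def)
      have "mp V i x (pure b v) \<in> h ` carrier ds.D"
        using imageI[OF ds.inj_closed[OF i t], of h] h_inj[OF i t] by simp
      then show ?thesis using qh True ix pure_zero_right[OF bv(1)] mz by (simp add: \<pi>_def)
    next
      case False
      then show ?thesis using ix pure_zero_right[OF bv(1)] mz by (simp add: \<pi>_def)
    qed
    then show ?case by (simp add: a)
  qed
  then consider "\<forall>i. \<forall>v\<in>carrier (spc V i). \<pi> i v = \<zero>\<^bsub>spc V i\<^esub>" | "\<forall>i. \<forall>v\<in>carrier (spc V i). \<pi> i v = v"
    using idem_endo_cases[OF orientation rep ind] by blast
  then show ?thesis
  proof cases
    case 1
    have "v \<in> h ` carrier ds.D" if v: "v \<in> carrier (spc V x)" for v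
    proof -
      have "q v = \<zero>\<^bsub>spc V x\<^esub>" using 1[rule_format, OF v] by (simp add: \<pi>_def)
      then have "v = p v" unfolding q_def by (rule Vx.M.minus_eq_zeroD[OF _ v pc[OF v]])
      moreover have "p v \<in> h ` carrier ds.D" using p(2) v by blast
      ultimately show ?thesis by simp
    qed
    then show ?thesis using Vx.submodule_subset[OF im] by auto
  next
    case 2
    have "carrier (spc V y) = {\<zero>\<^bsub>spc V y\<^esub>}" if "y \<noteq> x" for y
    proof -
      interpret Vy: left_module "k y" "spc V y" by (rule rep_left_module[OF rep])
      have "v = \<zero>\<^bsub>spc V y\<^esub>" if "v \<in> carrier (spc V y)" for v
        using 2[rule_format, OF that] \<open>y \<noteq> x\<close> by (simp add: \<pi>_def)
      then show ?thesis by auto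
    qed
    then have "zero_rep F" by (rule zero_F_if_concentrated)
    then show ?thesis using nz by simp
  qed
qed

text \<open>An idempotent endomorphism \<open>p\<close> of the reflected representation is lifted
  back to \<open>V\<close>. Since \<open>h\<close> is onto, the space at \<open>x\<close> is the
  quotient of the direct sum by the kernel, and the endomorphism that \<open>p\<close> induces on
  the direct sum descends to it. If the lift is 0 or 1, then so is \<open>p\<close> away from
  \<open>x\<close>, hence also on the direct sum and on its kernel.\<close>

lemma indecomposable_F:
  assumes ind: "indecomposable_rep \<M> \<Lambda> V" and nz: "\<not> zero_rep F"
  shows "indecomposable_rep \<M> (reflect x \<Lambda>) F"
proof (rule indecomposableI[OF gr.orientation_reflect[OF orientation] rep_F nz])
  fix p assume endo: "idem_endo \<M> (reflect x \<Lambda>) F p"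
  note surj = h_surj[OF ind nz]
  have pF: "linear_map (k i) (spc F i) (spc F i) (p i)" for i using endo by (simp add: idem_endo_def)
  have pid: "p i (p i v) = p i v" if "v \<in> carrier (spc F i)" for i v using endo that by (simp add: idem_endo_def)
  have comp: "p j (mp F i j (pure_tensor (k i) (B j i) (spc F i) b v)) = mp F i j (pure_tensor (k i) (B j i) (spc F i) b (p i v))"
    if "(i, j) \<in> reflect x \<Lambda>" "b \<in> carrier (B j i)" "v \<in> carrier (spc F i)" for i j b v
    using endo that by (auto simp: idem_endo_def)
  have plin: "linear_map (k y) (spc V y) (spc V y) (p y)" if "y \<noteq> x" for y using pF[of y] that by (simp add: spc_F)
  have plinx: "linear_map (k x) W W (p x)" using pF[of x] by (simp add: spc_F)
  interpret W: left_module "k x" W by (rule W_left_module)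
  define e where "e y = tensor_map (k y) (B x y) (spc V y) (p y)" for y
  have tp: "tensor_product (k x) (k y) (B x y) (spc V y)" if "y \<in> N" for y
    by (rule tensor_product_B[OF N_edge[OF that] rep_left_module[OF rep]])
  have TTeq: "TT y = tensor (k y) (B x y) (spc V y)" for y by (simp add: arrow_tensor_def)
  have e_lin: "linear_map (k x) (TT y) (TT y) (e y)" if "y \<in> N" for y
    unfolding e_def TTeq
    by (rule tensor_map_linear[OF bimodule_B[OF N_edge[OF that]] rep_left_module[OF rep] rep_left_module[OF rep] plin[OF N_ne[OF that]]])
  have e_pure: "e y (pure_tensor (k y) (B x y) (spc V y) b v) = pure_tensor (k y) (B x y) (spc V y) b (p y v)"
    if "y \<in> N" "b \<in> carrier (B x y)" "v \<in> carrier (spc V y)" for y b v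
    unfolding e_def
    by (rule tensor_map_pure[OF bimodule_B[OF N_edge[OF that(1)]] rep_left_module[OF rep] rep_left_module[OF rep] plin[OF N_ne[OF that(1)]] that(2,3)])
  have e_eqI: "e y t = f t" if y: "y \<in> N" and t: "t \<in> carrier (TT y)" and f: "additive_map (TT y) (TT y) f"
    and eq: "\<And>b v. b \<in> carrier (B x y) \<Longrightarrow> v \<in> carrier (spc V y) \<Longrightarrow>
      pure_tensor (k y) (B x y) (spc V y) b (p y v) = f (pure_tensor (k y) (B x y) (spc V y) b v)" for y t f
  proof -
    interpret tp: tensor_product "k x" "k y" "B x y" "spc V y" by (rule tp[OF y])
    show ?thesis
      by (rule tp.tensor_eqI[OF tp.T.abelian_group_axioms linear_map_additive[OF e_lin[OF y, unfolded TTeq]]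
            f[unfolded TTeq] t[unfolded TTeq]]) (use e_pure[OF y] eq in simp)
  qed
  \<comment> \<open>The endomorphism of the direct sum that acts by \<open>1 \<otimes> p y\<close>
    on the summand of \<open>y\<close>.\<close>
  define Ed where "Ed u = (\<lambda>y\<in>N. e y (u y))" for u :: "'i \<Rightarrow> ('b, 'v + 'r list) tens"
  have Ed_closed: "Ed u \<in> carrier ds.D" if "u \<in> carrier ds.D" for u
    using linear_map_closed[OF e_lin] ds.ds_mem[OF that] by (auto simp: Ed_def ds.ds_carrier)
  have Ed_add: "Ed (u \<oplus>\<^bsub>ds.D\<^esub> w) = Ed u \<oplus>\<^bsub>ds.D\<^esub> Ed w" if "u \<in> carrier ds.D" "w \<in> carrier ds.D" for u w
    using linear_map_add[OF e_lin] ds.ds_mem that by (auto simp: Ed_def ds.ds_add intro!: restrict_ext)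
  have Ed_smult: "Ed (a \<odot>\<^bsub>ds.D\<^esub> u) = a \<odot>\<^bsub>ds.D\<^esub> Ed u" if "a \<in> carrier (k x)" "u \<in> carrier ds.D" for a u
    using linear_map_smult[OF e_lin] ds.ds_mem that by (auto simp: Ed_def ds.ds_smult intro!: restrict_ext)
  have Ed_lin: "linear_map (k x) ds.D ds.D Ed"
    by (intro linear_mapI Ed_closed Ed_add Ed_smult)
  have Ed_idem: "Ed (Ed u) = Ed u" if u: "u \<in> carrier ds.D" for u
  proof -
    have "e y (e y t) = e y t" if y: "y \<in> N" and t: "t \<in> carrier (TT y)" for y t
    proof (rule e_eqI[OF y t, symmetric])
      show "additive_map (TT y) (TT y) (\<lambda>t. e y (e y t))"
        by (rule additive_map_comp[OF linear_map_additive[OF e_lin[OF y]] linear_map_additive[OF e_lin[OF y]]])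
      show "pure_tensor (k y) (B x y) (spc V y) b (p y v) = e y (e y (pure_tensor (k y) (B x y) (spc V y) b v))"
        if "b \<in> carrier (B x y)" "v \<in> carrier (spc V y)" for b v
        using that y pid[of v y] linear_map_closed[OF plin[OF N_ne[OF y]]] N_ne[OF y] by (simp add: e_pure spc_F)
    qed
    then show ?thesis using ds.ds_mem[OF u] by (auto simp: Ed_def intro!: restrict_ext)
  qed
  \<comment> \<open>The embedding of \<open>W\<close> intertwines \<open>p x\<close> with
    \<open>Ed\<close>. The structure maps of \<open>F\<close> are expressed through evaluations, so
    the components are compared by \<open>ev_eqI\<close>.\<close>
  have \<theta>_p: "\<theta> (p x w) = Ed (\<theta> w)" if w: "w \<in> carrier W" for w
  proof (rule ds.ds_eqI[OF \<theta>_closed[OF linear_map_closed[OF plinx w]] Ed_closed[OF \<theta>_closed[OF w]]])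
    fix y assume y: "y \<in> N"
    interpret me: modulation_edge \<M> x y by (rule modulation_edge[OF y])
    interpret ms: modulation_edge_space \<M> x y "spc V y"
      by (intro modulation_edge_space.intro me.modulation_edge_axioms rep_left_module[OF rep])
    have t: "\<theta> w y \<in> carrier (TT y)" by (rule ds.ds_mem[OF \<theta>_closed[OF w] y])
    have yN: "(x, y) \<in> reflect x \<Lambda>" using y by (simp add: reflect_iff N_def)
    have "\<theta> (p x w) y = e y (\<theta> w y)"
    proof (rule ms.ev_eqI)
      show "\<theta> (p x w) y \<in> carrier ms.tp.T"
        using ds.ds_mem[OF \<theta>_closed[OF linear_map_closed[OF plinx w]] y] by (simp add: TTeq)
      show "e y (\<theta> w y) \<in> carrier ms.tp.T" using linear_map_closed[OF e_lin[OF y] t] by (simp add: TTeq)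
      fix b' assume b': "b' \<in> carrier (B y x)"
      have "ms.ev b' (\<theta> (p x w) y) = mp F x y (pure_tensor (k x) (B y x) W b' (p x w))"
        by (rule mp_F_pure[OF y b' linear_map_closed[OF plinx w], symmetric])
      also have "\<dots> = p y (mp F x y (pure_tensor (k x) (B y x) W b' w))"
        using comp[OF yN b', of w] w by (simp add: spc_F)
      also have "\<dots> = p y (ms.ev b' (\<theta> w y))" by (simp add: mp_F_pure[OF y b' w])
      also have "\<dots> = ms.ev b' (e y (\<theta> w y))"
        unfolding e_def
        by (rule me.ev_natural[OF rep_left_module[OF rep] rep_left_module[OF rep] plin[OF N_ne[OF y]] b' t])
      finally show "ms.ev b' (\<theta> (p x w) y) = ms.ev b' (e y (\<theta> w y))" .
    qed
    then show "\<theta> (p x w) y = Ed (\<theta> w) y" using y by (simp add: Ed_def)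
  qed
  \<comment> \<open>Every element of the kernel is some \<open>\<theta> w\<close>, so
    \<open>\<theta>_p\<close> makes \<open>Ed\<close> preserve the kernel.\<close>
  have kerE: "h (Ed u) = \<zero>\<^bsub>spc V x\<^esub>" if u: "u \<in> carrier ds.D" "h u = \<zero>\<^bsub>spc V x\<^esub>" for u
  proof -
    have "u \<in> \<theta> ` carrier W" using \<theta>_bij u Ker_simps(4) by (auto simp: bij_betw_def)
    then obtain w where w: "w \<in> carrier W" "u = \<theta> w" by auto
    then have "Ed u \<in> carrier Ker" using \<theta>_p linear_map_closed[OF \<theta>_linear linear_map_closed[OF plinx w(1)]] by simp
    then show ?thesis using Ker_simps(4) by blast
  qed
  note hcl = linear_map_closed[OF h_linear] and hadd = linear_map_add[OF h_linear] and hsm = linear_map_smult[OF h_linear]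
  have well: "h (Ed u) = h (Ed u')" if u: "u \<in> carrier ds.D" "u' \<in> carrier ds.D" "h u = h u'" for u u'
  proof -
    have hm: "additive_map ds.D (spc V x) h" "additive_map ds.D (spc V x) (\<lambda>u. h (Ed u))"
      using linear_map_additive[OF h_linear] linear_map_additive[OF linear_map_comp[OF Ed_lin h_linear]] by auto
    note mi = additive_map_minus[OF ds.D.M.abelian_group_axioms Vx.M.abelian_group_axioms]
    have "h (u \<ominus>\<^bsub>ds.D\<^esub> u') = \<zero>\<^bsub>spc V x\<^esub>" using mi[OF hm(1) u(1,2)] u hcl by (simp add: Vx.M.minus_self)
    then have "h (Ed (u \<ominus>\<^bsub>ds.D\<^esub> u')) = \<zero>\<^bsub>spc V x\<^esub>" using kerE u by simp
    then have "h (Ed u) \<ominus>\<^bsub>spc V x\<^esub> h (Ed u') = \<zero>\<^bsub>spc V x\<^esub>" using mi[OF hm(2) u(1,2)] by simp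
    then show ?thesis by (rule Vx.M.minus_eq_zeroD) (use u Ed_closed hcl in auto)
  qed
  \<comment> \<open>The map induced on the space at \<open>x\<close>: it sends \<open>h u\<close> to
    \<open>h (Ed u)\<close>, and \<open>well\<close> makes the choice of \<open>u\<close>
    harmless.\<close>
  define q where "q v = h (Ed (SOME u. u \<in> carrier ds.D \<and> h u = v))" for v
  have qh: "q (h u) = h (Ed u)" if u: "u \<in> carrier ds.D" for u
  proof -
    have "(SOME u'. u' \<in> carrier ds.D \<and> h u' = h u) \<in> carrier ds.D \<and> h (SOME u'. u' \<in> carrier ds.D \<and> h u' = h u) = h u"
      by (rule someI[of _ u]) (use u in simp)
    then show ?thesis unfolding q_def using well u by blast
  qed
  have obt: "\<exists>u\<in>carrier ds.D. v = h u" if "v \<in> carrier (spc V x)" for v using surj that by auto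
  have q_lin: "linear_map (k x) (spc V x) (spc V x) q"
  proof (rule linear_mapI)
    fix m assume "m \<in> carrier (spc V x)"
    then obtain u where u: "u \<in> carrier ds.D" "m = h u" using obt by blast
    then show "q m \<in> carrier (spc V x)" using qh Ed_closed hcl by simp
    show "q (a \<odot>\<^bsub>spc V x\<^esub> m) = a \<odot>\<^bsub>spc V x\<^esub> q m" if a: "a \<in> carrier (k x)" for a
    proof -
      have "a \<odot>\<^bsub>spc V x\<^esub> m = h (a \<odot>\<^bsub>ds.D\<^esub> u)" using hsm a u by simp
      then show ?thesis using u a qh[of "a \<odot>\<^bsub>ds.D\<^esub> u"] qh[OF u(1)] Ed_smult Ed_closed hsm
        by (simp add: ds.D.smult_closed)
    qed
    fix n assume "n \<in> carrier (spc V x)"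
    then obtain w where w: "w \<in> carrier ds.D" "n = h w" using obt by blast
    have "m \<oplus>\<^bsub>spc V x\<^esub> n = h (u \<oplus>\<^bsub>ds.D\<^esub> w)" using hadd u w by simp
    then show "q (m \<oplus>\<^bsub>spc V x\<^esub> n) = q m \<oplus>\<^bsub>spc V x\<^esub> q n"
      using u w qh[of "u \<oplus>\<^bsub>ds.D\<^esub> w"] qh[OF u(1)] qh[OF w(1)] Ed_add Ed_closed hadd by simp
  qed
  define \<pi> where "\<pi> i = (if i = x then q else p i)" for i
  have "idem_endo \<M> \<Lambda> V \<pi>"
    unfolding idem_endo_def
  proof (intro conjI allI ballI, goal_cases)
    case (1 i)
    show ?case using q_lin plin by (simp add: \<pi>_def)
  next
    case (2 i v)
    show ?case
    proof (cases "i = x")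
      case True
      then obtain u where u: "u \<in> carrier ds.D" "v = h u" using obt 2 by blast
      then show ?thesis using qh Ed_closed Ed_idem True by (simp add: \<pi>_def)
    next
      case False
      then show ?thesis using pid[of v i] 2 by (simp add: \<pi>_def spc_F)
    qed
  next
    case (3 a)
    obtain i j where a: "a = (i, j)" by (cases a)
    have ij: "(i, j) \<in> \<Lambda>" using 3 a by simp
    have ix: "i \<noteq> x" using ij sink by (auto simp: is_sink_def)
    interpret tensor_product "k j" "k i" "B j i" "spc V i" by (rule arrow_tensor_product[OF orientation rep ij])
    have "\<pi> j (mp V i j (pure b v)) = mp V i j (pure b (\<pi> i v))"
      if bv: "b \<in> carrier (B j i)" "v \<in> carrier (spc V i)" for b v
    proof (cases "j = x")
      case True
      then have i: "i \<in> N" using ij by (simp add: N_def)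
      have b: "b \<in> carrier (B x i)" using bv True by simp
      have t: "pure b v \<in> carrier (TT i)" using pure_closed[OF bv] True by (simp add: TTeq)
      have "q (mp V i x (pure b v)) = h (Ed (ds_inj N TT i (pure b v)))"
        using qh[OF ds.inj_closed[OF i t]] h_inj[OF i t] True by simp
      also have "Ed (ds_inj N TT i (pure b v)) = ds_inj N TT i (e i (pure b v))"
      proof -
        have "e j \<zero>\<^bsub>TT j\<^esub> = \<zero>\<^bsub>TT j\<^esub>" if "j \<in> N" for j
          using additive_map_zero[OF ds.mod_abelian[OF that] ds.mod_abelian[OF that] linear_map_additive[OF e_lin[OF that]]] .
        then show ?thesis by (auto simp: Ed_def ds_inj_def intro!: restrict_ext)
      qed
      also have "h (ds_inj N TT i (e i (pure b v))) = mp V i x (e i (pure b v))"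
        by (rule h_inj[OF i linear_map_closed[OF e_lin[OF i] t]])
      also have "e i (pure b v) = pure b (p i v)" using e_pure[OF i b bv(2)] True by simp
      finally show ?thesis using True ix by (simp add: \<pi>_def)
    next
      case False
      then have "(i, j) \<in> reflect x \<Lambda>" using ij ix by (simp add: reflect_iff)
      then show ?thesis using comp[of i j b v] bv ix False by (simp add: \<pi>_def spc_F mp_F)
    qed
    then show ?case by (simp add: a)
  qed
  then consider "\<forall>i. \<forall>v\<in>carrier (spc V i). \<pi> i v = \<zero>\<^bsub>spc V i\<^esub>" | "\<forall>i. \<forall>v\<in>carrier (spc V i). \<pi> i v = v"
    using idem_endo_cases[OF orientation rep ind] by blast
  then show "(\<forall>i. \<forall>v\<in>carrier (spc F i). p i v = \<zero>\<^bsub>spc F i\<^esub>) \<or> (\<forall>i. \<forall>v\<in>carrier (spc F i). p i v = v)"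
  proof cases
    case 1
    have p0: "p y v = \<zero>\<^bsub>spc V y\<^esub>" if "y \<noteq> x" "v \<in> carrier (spc V y)" for y v
      using 1[rule_format, of v y] that by (simp add: \<pi>_def)
    have "p x w = \<zero>\<^bsub>W\<^esub>" if w: "w \<in> carrier W" for w
    proof -
      have "e y t = \<zero>\<^bsub>TT y\<^esub>" if y: "y \<in> N" and t: "t \<in> carrier (TT y)" for y t
      proof (rule e_eqI[OF y t])
        interpret tp: tensor_product "k x" "k y" "B x y" "spc V y" by (rule tp[OF y])
        show "additive_map (TT y) (TT y) (\<lambda>_. \<zero>\<^bsub>TT y\<^esub>)" by (intro additive_mapI) (auto simp: TTeq)
        show "pure_tensor (k y) (B x y) (spc V y) b (p y v) = \<zero>\<^bsub>TT y\<^esub>"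
          if "b \<in> carrier (B x y)" "v \<in> carrier (spc V y)" for b v
          using p0[OF N_ne[OF y] that(2)] tp.pure_zero_right[OF that(1)] by (simp add: TTeq)
      qed
      then have "Ed (\<theta> w) = \<zero>\<^bsub>ds.D\<^esub>"
        using ds.ds_mem[OF \<theta>_closed[OF w]] by (auto simp: Ed_def ds.ds_zero intro!: restrict_ext)
      moreover have "\<theta> \<zero>\<^bsub>W\<^esub> = \<zero>\<^bsub>ds.D\<^esub>"
        by (rule additive_map_zero[OF W.M.abelian_group_axioms ds.D.M.abelian_group_axioms linear_map_additive[OF \<theta>_linear_D]])
      ultimately have "\<theta> (p x w) = \<theta> \<zero>\<^bsub>W\<^esub>" using \<theta>_p[OF w] by simp
      then show ?thesis using \<theta>_bij linear_map_closed[OF plinx w] by (auto simp: bij_betw_def inj_on_def)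
    qed
    then show ?thesis using p0 by (simp add: spc_F)
  next
    case 2
    have p1: "p y v = v" if "y \<noteq> x" "v \<in> carrier (spc V y)" for y v
      using 2[rule_format, of v y] that by (simp add: \<pi>_def)
    have "p x w = w" if w: "w \<in> carrier W" for w
    proof -
      have "e y t = t" if y: "y \<in> N" and t: "t \<in> carrier (TT y)" for y t
      proof (rule e_eqI[OF y t])
        show "additive_map (TT y) (TT y) (\<lambda>t. t)" by (intro additive_mapI) auto
      qed (simp add: p1[OF N_ne[OF y]])
      then have "Ed (\<theta> w) = \<theta> w"
        using ds.ds_mem[OF \<theta>_closed[OF w]] by (intro ds.ds_eqI Ed_closed \<theta>_closed w) (auto simp: Ed_def)
      then have "\<theta> (p x w) = \<theta> w" using \<theta>_p[OF w] by simp
      then show ?thesis using \<theta>_bij linear_map_closed[OF plinx w] w by (auto simp: bij_betw_def inj_on_def)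
    qed
    then show ?thesis using p1 by (simp add: spc_F)
  qed
qed

end

section \<open>The reflection functor at a source\<close>

text \<open>The universal property of a quotient, with a surjection \<open>h\<close> in place of the
  projection to cosets.\<close>

lemma linear_map_factor:
  assumes D: "left_module R D" and A: "left_module R A" and C: "left_module R C"
    and h: "linear_map R D A h" "h ` carrier D = carrier A" and f: "linear_map R D C f"
    and ker: "\<And>u. u \<in> carrier D \<Longrightarrow> h u = \<zero>\<^bsub>A\<^esub> \<Longrightarrow> f u = \<zero>\<^bsub>C\<^esub>"
  obtains g where "linear_map R A C g" "\<And>u. u \<in> carrier D \<Longrightarrow> g (h u) = f u"
proof -
  interpret D: left_module R D by fact
  interpret A: left_module R A by fact
  interpret C: left_module R C by fact
  define s where "s a = (SOME u. u \<in> carrier D \<and> h u = a)" for a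
  have s: "s a \<in> carrier D" "h (s a) = a" if "a \<in> carrier A" for a
  proof -
    have "a \<in> h ` carrier D" using that h(2) by simp
    then have "\<exists>u. u \<in> carrier D \<and> h u = a" by blast
    then have "s a \<in> carrier D \<and> h (s a) = a" unfolding s_def by (rule someI_ex)
    then show "s a \<in> carrier D" "h (s a) = a" by auto
  qed
  have well: "f u = f u'" if u: "u \<in> carrier D" "u' \<in> carrier D" "h u = h u'" for u u'
  proof -
    have "h (u \<ominus>\<^bsub>D\<^esub> u') = \<zero>\<^bsub>A\<^esub>"
      using additive_map_minus[OF D.M.abelian_group_axioms A.M.abelian_group_axioms linear_map_additive[OF h(1)] u(1,2)]
        u linear_map_closed[OF h(1)] by (simp add: A.M.minus_self)
    then have "f u \<ominus>\<^bsub>C\<^esub> f u' = \<zero>\<^bsub>C\<^esub>"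
      using additive_map_minus[OF D.M.abelian_group_axioms C.M.abelian_group_axioms linear_map_additive[OF f] u(1,2)]
        u ker by simp
    then show ?thesis by (rule C.M.minus_eq_zeroD) (use u linear_map_closed[OF f] in auto)
  qed
  have gh: "f (s (h u)) = f u" if "u \<in> carrier D" for u
    using that s linear_map_closed[OF h(1)] by (intro well) auto
  have "linear_map R A C (\<lambda>a. f (s a))"
  proof (rule linear_mapI)
    fix m n assume mn: "m \<in> carrier A" "n \<in> carrier A"
    have "f (s (h (s m \<oplus>\<^bsub>D\<^esub> s n))) = f (s m \<oplus>\<^bsub>D\<^esub> s n)" using s mn by (intro gh) simp
    then show "f (s (m \<oplus>\<^bsub>A\<^esub> n)) = f (s m) \<oplus>\<^bsub>C\<^esub> f (s n)"
      using s mn by (simp add: linear_map_add[OF h(1)] linear_map_add[OF f])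
  next
    fix a m assume am: "a \<in> carrier R" "m \<in> carrier A"
    have "f (s (h (a \<odot>\<^bsub>D\<^esub> s m))) = f (a \<odot>\<^bsub>D\<^esub> s m)" using s am by (intro gh) (rule D.smult_closed)
    then show "f (s (a \<odot>\<^bsub>A\<^esub> m)) = a \<odot>\<^bsub>C\<^esub> f (s m)"
      using s am by (simp add: linear_map_smult[OF h(1)] linear_map_smult[OF f])
  qed (use s linear_map_closed[OF f] in auto)
  then show thesis using that gh by blast
qed

text \<open>By functoriality the inverse is the tensor map of the inverse of
  \<open>f\<close>.\<close>

lemma tensor_map_bij:
  fixes R S :: "'r ring"
  assumes B: "bimodule R S B" and V: "left_module S V" and W: "left_module S W"
    and f: "linear_map S V W f" "bij_betw f (carrier V) (carrier W)"
  shows "bij_betw (tensor_map S B W f) (carrier (tensor S B V)) (carrier (tensor S B W))"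
proof -
  interpret V: tensor_product R S B V using B V by (intro tensor_product.intro)
  interpret W: tensor_product R S B W using B W by (intro tensor_product.intro)
  let ?g = "inv_into (carrier V) f"
  have g: "linear_map S W V ?g" by (rule linear_map_inv_into[OF V.V.M.abelian_group_axioms V f])
  note tf = tensor_map_props[OF B V W f(1)] and tg = tensor_map_props[OF B W V g]
  have gf: "?g (f v) = v" if "v \<in> carrier V" for v using that f(2) by (simp add: bij_betw_def)
  have fg: "f (?g w) = w" if "w \<in> carrier W" for w using that f(2) by (simp add: bij_betw_def f_inv_into_f)
  show ?thesis
  proof (rule bij_betw_byWitness[where f' = "tensor_map S B V ?g"])
    show "\<forall>t\<in>carrier V.T. tensor_map S B V ?g (tensor_map S B W f t) = t"
    proof
      fix t assume t: "t \<in> carrier V.T"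
      show "tensor_map S B V ?g (tensor_map S B W f t) = t"
      proof (rule V.tensor_eqI[OF V.T.abelian_group_axioms _ _ t])
        show "additive_map V.T V.T (\<lambda>t. tensor_map S B V ?g (tensor_map S B W f t))"
          by (rule additive_map_comp[OF linear_map_additive[OF tf(1)] linear_map_additive[OF tg(1)]])
        show "additive_map V.T V.T (\<lambda>t. t)" by (rule additive_mapI) simp_all
      qed (simp add: tf(2) tg(2) linear_map_closed[OF f(1)] gf)
    qed
    show "\<forall>t\<in>carrier W.T. tensor_map S B W f (tensor_map S B V ?g t) = t"
    proof
      fix t assume t: "t \<in> carrier W.T"
      show "tensor_map S B W f (tensor_map S B V ?g t) = t"
      proof (rule W.tensor_eqI[OF W.T.abelian_group_axioms _ _ t])
        show "additive_map W.T W.T (\<lambda>t. tensor_map S B W f (tensor_map S B V ?g t))"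
          by (rule additive_map_comp[OF linear_map_additive[OF tg(1)] linear_map_additive[OF tf(1)]])
        show "additive_map W.T W.T (\<lambda>t. t)" by (rule additive_mapI) simp_all
      qed (simp add: tf(2) tg(2) linear_map_closed[OF g] fg)
    qed
  qed (use linear_map_closed[OF tf(1)] linear_map_closed[OF tg(1)] in auto)
qed

lemma linear_map_bijI:
  assumes "left_module R M" "left_module R N" "linear_map R M N f" "f ` carrier M = carrier N"
    and "\<And>m. m \<in> carrier M \<Longrightarrow> f m = \<zero>\<^bsub>N\<^esub> \<Longrightarrow> m = \<zero>\<^bsub>M\<^esub>"
  shows "bij_betw f (carrier M) (carrier N)"
proof -
  interpret M: left_module R M by fact
  interpret N: left_module R N by fact
  show ?thesis
    unfolding bij_betw_def
    using additive_map_inj_onI[OF M.M.abelian_group_axioms N.M.abelian_group_axioms linear_map_additive[OF assms(3)]]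
      assms(4,5) by blast
qed

context sink_reflection
begin

text \<open>For a source \<open>x\<close>, the cokernel defining \<open>F\<^sub>x\<^sup>-Y\<close> is the quotient of the direct sum by the image of
  \<open>Ker h\<close> when \<open>Y \<cong> F\<^sub>x\<^sup>+V\<close>, hence is isomorphic to \<open>V\<^sub>x\<close> when \<open>h\<close> is onto.\<close>

lemma reflect_minus_inverse:
  fixes Y :: "('i, 'r, 'b, 'v + 'r list) rep"
  assumes surj: "h ` carrier ds.D = carrier (spc V x)"
    and Y: "is_rep \<M> (reflect x \<Lambda>) Y" and iso: "rep_iso \<M> (reflect x \<Lambda>) F Y"
  shows "is_rep \<M> \<Lambda> (reflect_minus \<M> (reflect x \<Lambda>) x Y)"
    and "rep_iso \<M> \<Lambda> V (reflect_minus \<M> (reflect x \<Lambda>) x Y)"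
proof -
  \<comment> \<open>\<open>Y\<close> is merely isomorphic to \<open>F\<close>, since in an iteration
    it is itself the result of undoing the later reflections. Everything is transported along
    \<open>\<beta>\<close>.\<close>
  obtain \<beta> where \<beta>: "is_rep_hom \<M> (reflect x \<Lambda>) F Y \<beta>"
    "\<And>i. bij_betw (\<beta> i) (carrier (spc F i)) (carrier (spc Y i))"
    using iso by (auto simp: rep_iso_def)
  have \<beta>_hom: "\<beta> i \<in> lin_hom (k i) (spc F i) (spc Y i)" for i using \<beta>(1) by (simp add: is_rep_hom_def)
  note \<beta>_lin = lin_hom_linear[OF \<beta>_hom]
  have \<beta>_mp: "\<beta> j (mp F i j t) = mp Y i j (tensor_map (k i) (B j i) (spc Y i) (\<beta> i) t)"
    if "(i, j) \<in> reflect x \<Lambda>" "t \<in> carrier (tens j i (spc F i))" for i j t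
    using \<beta>(1) that by (auto simp: is_rep_hom_def)
  note Ymod = rep_left_module[OF Y]
  note Vmod = rep_left_module[OF rep]
  define S where "S y = tens x y (spc Y y)" for y
  interpret dY: module_family "k x" N S
    unfolding S_def by (rule module_family.intro) (auto intro: ring_k tens_left_module N_edge Ymod)
  interpret W: left_module "k x" W by (rule W_left_module)
  interpret Yx: left_module "k x" "spc Y x" by (rule Ymod)
  have \<beta>x: "linear_map (k x) W (spc Y x) (\<beta> x)" "bij_betw (\<beta> x) (carrier W) (carrier (spc Y x))"
    using \<beta>_lin[of x] \<beta>(2)[of x] by (simp_all add: spc_F)
  have \<beta>y: "linear_map (k y) (spc V y) (spc Y y) (\<beta> y)" "bij_betw (\<beta> y) (carrier (spc V y)) (carrier (spc Y y))"
    if "y \<noteq> x" for y using \<beta>_lin[of y] \<beta>(2)[of y] that by (simp_all add: spc_F)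
  define \<gamma> where "\<gamma> = inv_into (carrier W) (\<beta> x)"
  have \<gamma>_lin: "linear_map (k x) (spc Y x) W \<gamma>"
    unfolding \<gamma>_def by (rule linear_map_inv_into[OF W.M.abelian_group_axioms W.left_module_axioms \<beta>x])
  have \<beta>\<gamma>: "\<beta> x (\<gamma> v) = v" if "v \<in> carrier (spc Y x)" for v
    using that \<beta>x(2) by (simp add: \<gamma>_def bij_betw_def f_inv_into_f)
  have \<gamma>_image: "\<gamma> ` carrier (spc Y x) = carrier W"
    using bij_betw_inv_into[OF \<beta>x(2)] by (simp add: \<gamma>_def bij_betw_def)
  define \<tau> where "\<tau> y = tensor_map (k y) (B x y) (spc Y y) (\<beta> y)" for y
  have \<tau>_lin: "linear_map (k x) (TT y) (S y) (\<tau> y)" if "y \<in> N" for y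
    unfolding \<tau>_def S_def arrow_tensor_def
    by (rule tensor_map_linear[OF bimodule_B[OF N_edge[OF that]] Vmod Ymod \<beta>y(1)[OF N_ne[OF that]]])
  have \<tau>_bij: "bij_betw (\<tau> y) (carrier (TT y)) (carrier (S y))" if "y \<in> N" for y
    unfolding \<tau>_def S_def arrow_tensor_def
    by (rule tensor_map_bij[OF bimodule_B[OF N_edge[OF that]] Vmod Ymod \<beta>y[OF N_ne[OF that]]])
  define \<tau>D where "\<tau>D u = (\<lambda>y\<in>N. \<tau> y (u y))" for u :: "'i \<Rightarrow> ('b, 'v + 'r list) tens"
  have \<tau>D_lin: "linear_map (k x) ds.D dY.D \<tau>D"
  proof (rule linear_mapI)
    fix u w assume u: "u \<in> carrier ds.D" "w \<in> carrier ds.D"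
    show "\<tau>D (u \<oplus>\<^bsub>ds.D\<^esub> w) = \<tau>D u \<oplus>\<^bsub>dY.D\<^esub> \<tau>D w"
      using linear_map_add[OF \<tau>_lin] ds.ds_mem u by (auto simp: \<tau>D_def ds.ds_add dY.ds_add intro!: restrict_ext)
  next
    fix a u assume u: "a \<in> carrier (k x)" "u \<in> carrier ds.D"
    show "\<tau>D (a \<odot>\<^bsub>ds.D\<^esub> u) = a \<odot>\<^bsub>dY.D\<^esub> \<tau>D u"
      using linear_map_smult[OF \<tau>_lin] ds.ds_mem u by (auto simp: \<tau>D_def ds.ds_smult dY.ds_smult intro!: restrict_ext)
  qed (use linear_map_closed[OF \<tau>_lin] ds.ds_mem in \<open>auto simp: \<tau>D_def dY.ds_carrier\<close>)
  have \<tau>D_surj: "\<tau>D ` carrier ds.D = carrier dY.D"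
  proof
    show "\<tau>D ` carrier ds.D \<subseteq> carrier dY.D" using linear_map_closed[OF \<tau>D_lin] by auto
    show "carrier dY.D \<subseteq> \<tau>D ` carrier ds.D"
    proof
      fix u assume u: "u \<in> carrier dY.D"
      let ?w = "\<lambda>y\<in>N. inv_into (carrier (TT y)) (\<tau> y) (u y)"
      have im: "u y \<in> \<tau> y ` carrier (TT y)" if "y \<in> N" for y
        using \<tau>_bij[OF that] dY.ds_mem[OF u that] by (simp add: bij_betw_def)
      have w: "?w \<in> carrier ds.D" using inv_into_into[OF im] by (simp add: ds.ds_carrier)
      have "\<tau>D ?w = u"
        by (rule dY.ds_eqI[OF linear_map_closed[OF \<tau>D_lin w] u]) (simp add: \<tau>D_def f_inv_into_f[OF im])
      then show "u \<in> \<tau>D ` carrier ds.D" using w by (intro image_eqI[of _ _ ?w]) simp_all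
    qed
  qed
  have \<tau>D_inj: "u = w" if "u \<in> carrier ds.D" "w \<in> carrier ds.D" "\<tau>D u = \<tau>D w" for u w
  proof (rule ds.ds_eqI[OF that(1,2)])
    fix y assume y: "y \<in> N"
    have "\<tau> y (u y) = \<tau> y (w y)" using fun_cong[OF that(3), of y] y by (simp add: \<tau>D_def)
    then show "u y = w y" using \<tau>_bij[OF y] ds.ds_mem[OF _ y] that(1,2) by (auto simp: bij_betw_def inj_on_def)
  qed
  define c where "c y = inv_into (lin_hom (k x) (spc Y x) (S y)) (adjoint_map \<M> x y (spc Y x) (spc Y y)) (mp Y x y)" for y
  have c_eq: "c y v = \<tau> y (\<theta> (\<gamma> v) y)" if y: "y \<in> N" and v: "v \<in> carrier (spc Y x)" for y v
  proof -
    interpret me: modulation_edge \<M> x y by (rule modulation_edge[OF y])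
    \<comment> \<open>The map that \<open>inv_into\<close> has to return: the
      \<open>y\<close>-component of the kernel inclusion of \<open>F\<close>, transported to
      \<open>Y\<close>. Its adjoint turns out to be the structure map of \<open>Y\<close>.\<close>
    let ?c = "\<lambda>v\<in>carrier (spc Y x). \<tau> y (\<theta> (\<gamma> v) y)"
    have "linear_map (k x) (spc Y x) (S y) (\<lambda>v. \<tau> y (\<theta> (\<gamma> v) y))"
      by (rule linear_map_comp[OF linear_map_comp[OF \<gamma>_lin \<theta>_component_linear[OF y]] \<tau>_lin[OF y]])
    then have c: "?c \<in> lin_hom (k x) (spc Y x) (S y)" by (rule restrict_lin_hom[OF Ymod])
    have cT: "linear_map (k x) (spc Y x) (tens x y (spc Y y)) ?c" using lin_hom_linear[OF c] by (simp add: S_def)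
    have yx: "(x, y) \<in> reflect x \<Lambda>" using y by (simp add: reflect_iff N_def)
    interpret tW: tensor_product "k y" "k x" "B y x" W by (rule tensor_product_B[OF edge_sym[OF N_edge[OF y]] W_left_module])
    interpret tY: tensor_product "k y" "k x" "B y x" "spc Y x" by (rule tensor_product_B[OF edge_sym[OF N_edge[OF y]] Ymod])
    interpret Yy: left_module "k y" "spc Y y" by (rule Ymod)
    have adj: "adjoint_map \<M> x y (spc Y x) (spc Y y) ?c \<in> lin_hom (k y) (tens y x (spc Y x)) (spc Y y)"
      by (rule me.adjoint_map_lin_hom[OF Ymod Ymod cT])
    have mpY: "mp Y x y \<in> lin_hom (k y) (tens y x (spc Y x)) (spc Y y)" by (rule rep_mp[OF Y yx])
    have "adjoint_map \<M> x y (spc Y x) (spc Y y) ?c = mp Y x y"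
    proof (rule extensionalityI[of _ "carrier (tens y x (spc Y x))"])
      fix t assume t: "t \<in> carrier (tens y x (spc Y x))"
      show "adjoint_map \<M> x y (spc Y x) (spc Y y) ?c t = mp Y x y t"
      proof (rule tY.tensor_eqI[OF Yy.M.abelian_group_axioms _ _ t[unfolded arrow_tensor_def]])
        show "additive_map tY.T (spc Y y) (adjoint_map \<M> x y (spc Y x) (spc Y y) ?c)"
          using linear_map_additive[OF lin_hom_linear[OF adj]] by (simp add: arrow_tensor_def)
        show "additive_map tY.T (spc Y y) (mp Y x y)"
          using linear_map_additive[OF lin_hom_linear[OF mpY]] by (simp add: arrow_tensor_def)
        fix b' v assume b': "b' \<in> carrier (B y x)" and v: "v \<in> carrier (spc Y x)"
        have gv: "\<gamma> v \<in> carrier W" by (rule linear_map_closed[OF \<gamma>_lin v])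
        have t: "\<theta> (\<gamma> v) y \<in> carrier (TT y)" by (rule linear_map_closed[OF \<theta>_component_linear[OF y] gv])
        have "adjoint_map \<M> x y (spc Y x) (spc Y y) ?c (tY.pure b' v) = dual_eval \<M> x y (spc Y y) b' (\<tau> y (\<theta> (\<gamma> v) y))"
          using me.adjoint_map_pure[OF Ymod Ymod cT b' v] v by simp
        also have "\<dots> = \<beta> y (dual_eval \<M> x y (spc V y) b' (\<theta> (\<gamma> v) y))"
          unfolding \<tau>_def by (rule me.ev_natural[OF Vmod Ymod \<beta>y(1)[OF N_ne[OF y]] b' t, symmetric])
        also have "\<dots> = \<beta> y (mp F x y (tW.pure b' (\<gamma> v)))" by (simp add: mp_F_pure[OF y b' gv])
        also have "\<dots> = mp Y x y (tensor_map (k x) (B y x) (spc Y x) (\<beta> x) (tW.pure b' (\<gamma> v)))"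
          using \<beta>_mp[OF yx, of "tW.pure b' (\<gamma> v)"] tW.pure_closed[OF b' gv] by (simp add: spc_F arrow_tensor_def)
        also have "tensor_map (k x) (B y x) (spc Y x) (\<beta> x) (tW.pure b' (\<gamma> v)) = tY.pure b' v"
          using tensor_map_pure[OF me.Byx.bimodule_axioms W_left_module Ymod \<beta>x(1) b' gv] \<beta>\<gamma>[OF v] by simp
        finally show "adjoint_map \<M> x y (spc Y x) (spc Y y) ?c (tY.pure b' v) = mp Y x y (tY.pure b' v)" .
      qed
    qed (use adj mpY in \<open>auto simp: lin_hom_iff\<close>)
    then have "c y = inv_into (lin_hom (k x) (spc Y x) (S y)) (adjoint_map \<M> x y (spc Y x) (spc Y y))
        (adjoint_map \<M> x y (spc Y x) (spc Y y) ?c)" by (simp add: c_def)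
    also have "\<dots> = ?c"
      by (rule inv_into_f_f[OF _ c]) (use me.adjoint_map_inj_on[OF Ymod Ymod] in \<open>simp add: S_def\<close>)
    finally show ?thesis using v by simp
  qed
  define Im where "Im = (\<lambda>v. \<lambda>y\<in>N. c y v) ` carrier (spc Y x)"
  \<comment> \<open>The image divided out by the source reflection is the transported kernel of
    \<open>h\<close>.\<close>
  have Im_eq: "Im = \<tau>D ` carrier Ker"
  proof -
    have "(\<lambda>y\<in>N. c y v) = \<tau>D (\<theta> (\<gamma> v))" if "v \<in> carrier (spc Y x)" for v
      using c_eq that by (auto simp: \<tau>D_def intro!: restrict_ext)
    then have "Im = (\<lambda>v. \<tau>D (\<theta> (\<gamma> v))) ` carrier (spc Y x)" unfolding Im_def by (intro image_cong refl)
    also have "\<dots> = \<tau>D ` \<theta> ` \<gamma> ` carrier (spc Y x)" by (simp add: image_image)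
    also have "\<theta> ` \<gamma> ` carrier (spc Y x) = carrier Ker" using \<gamma>_image \<theta>_bij by (simp add: bij_betw_def)
    finally show ?thesis .
  qed
  have Im_sub: "submodule Im (k x) dY.D"
    unfolding Im_eq by (rule ds.D.image_submodule[OF dY.left_module \<tau>D_lin Ker_submodule])
  interpret Q: quotient "k x" dY.D Im
    by (intro quotient.intro quotient_axioms.intro dY.left_module Im_sub)
  interpret Qm: left_module "k x" Q.C by (rule Q.left_module_quotient)
  define \<kappa> where "\<kappa> u = Im +>\<^bsub>dY.D\<^esub> \<tau>D u" for u
  have \<kappa>_lin: "linear_map (k x) ds.D Q.C \<kappa>"
    unfolding \<kappa>_def by (rule linear_map_comp[OF \<tau>D_lin Q.coset_map_linear])
  have \<kappa>_surj: "\<kappa> ` carrier ds.D = carrier Q.C"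
  proof -
    have "\<kappa> ` carrier ds.D = (\<lambda>m. Im +>\<^bsub>dY.D\<^esub> m) ` (\<tau>D ` carrier ds.D)" by (simp add: \<kappa>_def image_image)
    then show ?thesis by (simp add: \<tau>D_surj Q.quotient_carrier)
  qed
  \<comment> \<open>Injectivity of \<open>\<tau>D\<close> is what prevents elements outside the
    kernel of \<open>h\<close> from landing in \<open>Im\<close>.\<close>
  have \<kappa>_zero: "\<kappa> u = \<zero>\<^bsub>Q.C\<^esub> \<longleftrightarrow> h u = \<zero>\<^bsub>spc V x\<^esub>" if u: "u \<in> carrier ds.D" for u
  proof -
    have "\<tau>D u \<ominus>\<^bsub>dY.D\<^esub> \<zero>\<^bsub>dY.D\<^esub> = \<tau>D u"
      using dY.D.M.add_minus_cancel[of "\<tau>D u" "\<zero>\<^bsub>dY.D\<^esub>"] linear_map_closed[OF \<tau>D_lin u] by simp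
    then have "\<kappa> u = \<zero>\<^bsub>Q.C\<^esub> \<longleftrightarrow> \<tau>D u \<in> Im"
      using linear_map_closed[OF \<tau>D_lin u] by (simp add: \<kappa>_def Q.quotient_zero Q.coset_eq_iff)
    also have "\<dots> \<longleftrightarrow> u \<in> carrier Ker"
    proof
      assume "\<tau>D u \<in> Im"
      then obtain w where w: "w \<in> carrier Ker" "\<tau>D u = \<tau>D w" by (auto simp: Im_eq)
      have "w \<in> carrier ds.D" using w(1) Ker_simps(4) by blast
      then have "u = w" using w(2) by (rule \<tau>D_inj[OF u])
      then show "u \<in> carrier Ker" using w by simp
    qed (simp add: Im_eq)
    finally show ?thesis using u by (simp add: Ker_simps(4))
  qed
  \<comment> \<open>\<open>\<kappa>\<close> and \<open>h\<close> are both onto and have the same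
    kernel, so \<open>g\<close> is an isomorphism from the space at \<open>x\<close> to the
    cokernel.\<close>
  obtain g where g: "linear_map (k x) (spc V x) Q.C g" "\<And>u. u \<in> carrier ds.D \<Longrightarrow> g (h u) = \<kappa> u"
    using \<kappa>_zero[THEN iffD2] that
    by (rule linear_map_factor[OF ds.left_module Vx.left_module_axioms Qm.left_module_axioms h_linear surj \<kappa>_lin])
  have g_image: "g ` carrier (spc V x) = carrier Q.C"
  proof -
    have "g ` carrier (spc V x) = (\<lambda>u. g (h u)) ` carrier ds.D" by (simp add: surj[symmetric] image_image)
    also have "\<dots> = \<kappa> ` carrier ds.D" using g(2) by (intro image_cong) auto
    finally show ?thesis by (simp add: \<kappa>_surj)
  qed
  have g_bij: "bij_betw g (carrier (spc V x)) (carrier Q.C)"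
  proof (rule linear_map_bijI[OF Vx.left_module_axioms Qm.left_module_axioms g(1) g_image])
    fix m assume "m \<in> carrier (spc V x)" and gm: "g m = \<zero>\<^bsub>Q.C\<^esub>"
    then obtain u where u: "u \<in> carrier ds.D" "m = h u" using surj by auto
    then show "m = \<zero>\<^bsub>spc V x\<^esub>" using g(2) \<kappa>_zero gm by simp
  qed
  interpret Qv: vector_space_dr "k x" Q.C by (rule vector_space_k[OF Qm.left_module_axioms])
  have Q_fin: "fin_dim (k x) Q.C"
    using finitely_generated_image[OF Vx.left_module_axioms Qm.left_module_axioms g(1) g_image]
      rep_fin_dim[OF rep] Vx.fin_dim_iff Qv.fin_dim_iff by simp
  define \<theta>' :: "'v + 'r list \<Rightarrow> ('i \<Rightarrow> ('b, 'v + 'r list) tens) set" where "\<theta>' = coord_iso (k x) Q.C"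
  define W' :: "('r, 'v + 'r list) module" where "W' = coord_space (k x) (ldim (k x) Q.C)"
  have W': "left_module (k x) W'" "fin_dim (k x) W'"
    unfolding W'_def by (rule coord_space_left_module[OF ring_k], rule coord_fin_dim[OF division_ring_k Qm.left_module_axioms Q_fin])
  have \<theta>': "linear_map (k x) W' Q.C \<theta>'" "bij_betw \<theta>' (carrier W') (carrier Q.C)"
    unfolding W'_def \<theta>'_def
    by (rule coord_iso_linear[OF division_ring_k Qm.left_module_axioms Q_fin],
        rule coord_iso_bij[OF division_ring_k Qm.left_module_axioms Q_fin])
  interpret W': left_module "k x" W' by (rule W')
  define \<rho> where "\<rho> = inv_into (carrier W') \<theta>'"
  have \<rho>_lin: "linear_map (k x) Q.C W' \<rho>"
    unfolding \<rho>_def by (rule linear_map_inv_into[OF W'.M.abelian_group_axioms W'(1) \<theta>'])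
  have \<rho>_bij: "bij_betw \<rho> (carrier Q.C) (carrier W')" unfolding \<rho>_def by (rule bij_betw_inv_into[OF \<theta>'(2)])
  define G where "G = reflect_minus \<M> (reflect x \<Lambda>) x Y"
  have N': "{y. (x, y) \<in> reflect x \<Lambda>} = N" by (auto simp: reflect_iff N_def)
  have S_fun: "(\<lambda>y. tens x y (spc Y y)) = S" by (auto simp: S_def)
  have spc_G: "spc G = (spc Y)(x := W')"
    unfolding G_def reflect_minus_def Let_def N' S_fun c_def[symmetric] Im_def[symmetric] W'_def by simp
  have mp_G: "mp G i j = (if j = x then (\<lambda>t\<in>carrier (S i). \<rho> (Im +>\<^bsub>dY.D\<^esub> ds_inj N S i t)) else mp Y i j)" for i j
    unfolding G_def reflect_minus_def Let_def N' S_fun c_def[symmetric] Im_def[symmetric] W'_def[symmetric]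
      \<theta>'_def[symmetric] \<rho>_def[symmetric] ds_inj_def by (simp add: S_def)
  have arrow_cases: "i \<noteq> x \<and> (j = x \<and> i \<in> N \<or> j \<noteq> x \<and> (i, j) \<in> reflect x \<Lambda>)" if "(i, j) \<in> \<Lambda>" for i j
    using that sink by (auto simp: is_sink_def N_def reflect_iff)
  show "is_rep \<M> \<Lambda> (reflect_minus \<M> (reflect x \<Lambda>) x Y)"
    unfolding G_def[symmetric] is_rep_def
  proof (intro conjI allI ballI, goal_cases)
    case (1 i)
    then show ?case using W'(1) Ymod by (simp add: spc_G)
  next
    case (2 i)
    then show ?case using W'(2) rep_fin_dim[OF Y] by (simp add: spc_G)
  next
    case (3 a)
    obtain i j where a: "a = (i, j)" by (cases a)
    have ij: "(i, j) \<in> \<Lambda>" using 3 a by simp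
    have "mp G i j \<in> lin_hom (k j) (tens j i (spc G i)) (spc G j)"
    proof (cases "j = x")
      case True
      then have i: "i \<in> N" "i \<noteq> x" using arrow_cases[OF ij] by auto
      have "linear_map (k x) (S i) W' (\<lambda>t. \<rho> (Im +>\<^bsub>dY.D\<^esub> ds_inj N S i t))"
        by (rule linear_map_comp[OF linear_map_comp[OF dY.inj_linear[OF i(1)] Q.coset_map_linear] \<rho>_lin])
      then show ?thesis
        using restrict_lin_hom[OF dY.mods[OF i(1)]] i True by (simp add: mp_G spc_G S_def)
    next
      case False
      then show ?thesis using rep_mp[OF Y, of i j] arrow_cases[OF ij] by (simp add: mp_G spc_G)
    qed
    then show ?case by (simp add: a)
  qed
  \<comment> \<open>Away from \<open>x\<close> neither reflection changes the spaces, and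
    \<open>\<beta>\<close> itself is the isomorphism there.\<close>
  define \<alpha> where "\<alpha> i = (if i = x then (\<lambda>v\<in>carrier (spc V x). \<rho> (g v)) else \<beta> i)" for i
  have \<rho>g_lin: "linear_map (k x) (spc V x) W' (\<lambda>v. \<rho> (g v))" by (rule linear_map_comp[OF g(1) \<rho>_lin])
  have "is_rep_hom \<M> \<Lambda> V G \<alpha>"
    unfolding is_rep_hom_def
  proof (intro conjI allI ballI, goal_cases)
    case (1 i)
    show ?case
      using restrict_lin_hom[OF Vmod \<rho>g_lin] \<beta>_hom[of i] by (cases "i = x") (simp_all add: \<alpha>_def spc_G spc_F)
  next
    case (2 a)
    obtain i j where a: "a = (i, j)" by (cases a)
    have ij: "(i, j) \<in> \<Lambda>" using 2 a by simp
    have ix: "i \<noteq> x" using arrow_cases[OF ij] by simp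
    have "\<alpha> j (mp V i j t) = mp G i j (tensor_map (k i) (B j i) (spc G i) (\<alpha> i) t)"
      if t: "t \<in> carrier (tens j i (spc V i))" for t
    proof (cases "j = x")
      case True
      then have i: "i \<in> N" using arrow_cases[OF ij] by simp
      have tT: "t \<in> carrier (TT i)" using t True by simp
      have "\<tau>D (ds_inj N TT i t) = ds_inj N S i (\<tau> i t)"
      proof -
        have "\<tau> j \<zero>\<^bsub>TT j\<^esub> = \<zero>\<^bsub>S j\<^esub>" if "j \<in> N" for j
          using additive_map_zero[OF ds.mod_abelian[OF that] dY.mod_abelian[OF that] linear_map_additive[OF \<tau>_lin[OF that]]] .
        then show ?thesis by (auto simp: \<tau>D_def ds_inj_def intro!: restrict_ext)
      qed
      then have "g (mp V i x t) = Im +>\<^bsub>dY.D\<^esub> ds_inj N S i (\<tau> i t)"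
        using g(2)[OF ds.inj_closed[OF i tT]] h_inj[OF i tT] by (simp add: \<kappa>_def)
      moreover have "mp V i x t \<in> carrier (spc V x)" by (rule linear_map_closed[OF mp_linear[OF i] tT])
      moreover have "\<tau> i t \<in> carrier (S i)" by (rule linear_map_closed[OF \<tau>_lin[OF i] tT])
      ultimately show ?thesis using True ix by (simp add: \<alpha>_def mp_G spc_G \<tau>_def)
    next
      case False
      then have "(i, j) \<in> reflect x \<Lambda>" using arrow_cases[OF ij] by simp
      then show ?thesis using \<beta>_mp[of i j t] t ix False by (simp add: \<alpha>_def mp_G spc_G spc_F mp_F)
    qed
    then show ?case by (simp add: a)
  qed
  moreover have "bij_betw (\<alpha> i) (carrier (spc V i)) (carrier (spc G i))" for i
  proof (cases "i = x")
    case True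
    have "bij_betw (\<lambda>v. \<rho> (g v)) (carrier (spc V x)) (carrier W')"
      using bij_betw_trans[OF g_bij \<rho>_bij] by (simp add: comp_def)
    then show ?thesis using True by (simp add: \<alpha>_def spc_G)
  next
    case False
    then show ?thesis using \<beta>y(2) by (simp add: \<alpha>_def spc_G)
  qed
  ultimately show "rep_iso \<M> \<Lambda> V (reflect_minus \<M> (reflect x \<Lambda>) x Y)"
    unfolding rep_iso_def G_def[symmetric] by blast
qed

end

section \<open>Indecomposable representations concentrated at a sink\<close>

context valued_modulation
begin

text \<open>Every arrow starts at a zero space, so both sides of each compatibility condition vanish
  and any idempotent of a single space extends by zero.\<close>

lemma concentrated_idem_endo:
  assumes ori: "orientation (val \<M>) \<Lambda>" and rep: "is_rep \<M> \<Lambda> V" and out: "\<And>i j. (i, j) \<in> \<Lambda> \<Longrightarrow> carrier (spc V i) = {\<zero>\<^bsub>spc V i\<^esub>}"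
    and p: "linear_map (k x) (spc V x) (spc V x) p" "\<And>v. v \<in> carrier (spc V x) \<Longrightarrow> p (p v) = p v"
  shows "idem_endo \<M> \<Lambda> V (\<lambda>i. if i = x then p else (\<lambda>_. \<zero>\<^bsub>spc V i\<^esub>))" (is "idem_endo _ _ _ ?\<pi>")
proof -
  have lin: "linear_map (k i) (spc V i) (spc V i) (?\<pi> i)" for i
  proof -
    interpret Vi: left_module "k i" "spc V i" by (rule rep_left_module[OF rep])
    show ?thesis using p(1) by (cases "i = x") (auto intro!: linear_mapI)
  qed
  have zero: "?\<pi> i \<zero>\<^bsub>spc V i\<^esub> = \<zero>\<^bsub>spc V i\<^esub>" for i
  proof -
    interpret Vi: left_module "k i" "spc V i" by (rule rep_left_module[OF rep])
    show ?thesis by (rule additive_map_zero[OF Vi.M.abelian_group_axioms Vi.M.abelian_group_axioms linear_map_additive[OF lin]])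
  qed
  show ?thesis
    unfolding idem_endo_def
  proof (intro conjI allI ballI lin, goal_cases)
    case (1 i v)
    then show ?case using p(2) by (cases "i = x") simp_all
  next
    case (2 a)
    obtain i j where a: "a = (i, j)" by (cases a)
    have ij: "(i, j) \<in> \<Lambda>" using 2 a by simp
    interpret Vi: left_module "k i" "spc V i" by (rule rep_left_module[OF rep])
    interpret Vj: left_module "k j" "spc V j" by (rule rep_left_module[OF rep])
    interpret tensor_product "k j" "k i" "B j i" "spc V i" by (rule arrow_tensor_product[OF ori rep ij])
    have mz: "mp V i j \<zero>\<^bsub>T\<^esub> = \<zero>\<^bsub>spc V j\<^esub>"
      by (rule additive_map_zero[OF T.abelian_group_axioms Vj.M.abelian_group_axioms
            linear_map_additive[OF rep_mp_linear[OF rep ij, unfolded arrow_tensor_def]]])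
    have "?\<pi> j (mp V i j (pure b v)) = mp V i j (pure b (?\<pi> i v))"
      if bv: "b \<in> carrier (B j i)" "v \<in> carrier (spc V i)" for b v
    proof -
      have v: "v = \<zero>\<^bsub>spc V i\<^esub>" using out[OF ij] bv(2) by simp
      show ?thesis unfolding v zero[of i] pure_zero_right[OF bv(1)] mz by (rule zero)
    qed
    then show ?case by (simp add: a)
  qed
qed

text \<open>The space at \<open>x\<close> is a line: the projection onto the span of a nonzero
  vector extends to an idempotent endomorphism, which is not 0 and hence is the identity. As all
  arrows start at zero spaces, any family of linear bijections between the spaces is already an
  isomorphism.\<close>

lemma simple_rep_iso:
  fixes V :: "('i, 'r, 'b, 'v) rep"
  assumes ori: "orientation (val \<M>) \<Lambda>" and rep: "is_rep \<M> \<Lambda> V" and ind: "indecomposable_rep \<M> \<Lambda> V"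
    and sink: "is_sink \<Lambda> x" and conc: "\<And>y. y \<noteq> x \<Longrightarrow> carrier (spc V y) = {\<zero>\<^bsub>spc V y\<^esub>}"
  shows "is_rep \<M> \<Lambda> (simple_rep \<M> x :: ('i, 'r, 'b, 'u + 'r list) rep)"
    and "rep_iso \<M> \<Lambda> V (simple_rep \<M> x :: ('i, 'r, 'b, 'u + 'r list) rep)"
proof -
  let ?L = "simple_rep \<M> x :: ('i, 'r, 'b, 'u + 'r list) rep"
  define n where "n i = (if i = x then 1 else 0 :: nat)" for i
  have spcL: "spc ?L i = coord_space (k i) (n i)" for i by (simp add: simple_rep_def Let_def n_def)
  have mpL: "mp ?L i j = (\<lambda>t\<in>carrier (tens j i (spc ?L i)). \<zero>\<^bsub>spc ?L j\<^esub>)" for i j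
    by (simp add: simple_rep_def Let_def)
  have out: "i \<noteq> x" "carrier (spc V i) = {\<zero>\<^bsub>spc V i\<^esub>}" if "(i, j) \<in> \<Lambda>" for i j
  proof -
    show "i \<noteq> x" using that sink by (auto simp: is_sink_def)
    then show "carrier (spc V i) = {\<zero>\<^bsub>spc V i\<^esub>}" by (rule conc)
  qed
  have dim: "has_dim (k i) (spc V i) (n i)" for i
  proof -
    interpret Vi: vector_space_dr "k i" "spc V i" by (rule vector_space_k[OF rep_left_module[OF rep]])
    have span0: "span (k i) (spc V i) {} = {\<zero>\<^bsub>spc V i\<^esub>}"
      using span_least[OF Vi.submodule_zero_set, of "{}"] Vi.submodule_zero[OF Vi.span_submodule, of "{}"] by auto
    show ?thesis
    proof (cases "i = x")
      case False
      then show ?thesis unfolding Vi.has_dim_iff using span0 conc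
        by (intro exI[of _ "{}"]) (simp add: n_def Vi.independent_def)
    next
      case True
      have "\<exists>i. carrier (spc V i) \<noteq> {\<zero>\<^bsub>spc V i\<^esub>}" using ind by (auto simp: indecomposable_rep_def zero_rep_def)
      then have "carrier (spc V i) \<noteq> {\<zero>\<^bsub>spc V i\<^esub>}" using conc True by metis
      then obtain v where v: "v \<in> carrier (spc V i)" "v \<noteq> \<zero>\<^bsub>spc V i\<^esub>" using Vi.M.zero_closed by blast
      have vs: "{v} \<subseteq> carrier (spc V i)" using v by simp
      have fg: "finitely_generated (k i) (spc V i)" using rep_fin_dim[OF rep] Vi.fin_dim_iff by simp
      note U = Vi.span_submodule[OF vs]
      obtain C where C: "submodule C (k i) (spc V i)" "span (k i) (spc V i) {v} \<inter> C = {\<zero>\<^bsub>spc V i\<^esub>}"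
        "\<And>m. m \<in> carrier (spc V i) \<Longrightarrow> \<exists>u\<in>span (k i) (spc V i) {v}. \<exists>c\<in>C. m = u \<oplus>\<^bsub>spc V i\<^esub> c"
        using that by (rule Vi.complement_exists[OF U fg])
      obtain p where p: "linear_map (k i) (spc V i) (spc V i) p" "p \<in> carrier (spc V i) \<rightarrow> span (k i) (spc V i) {v}"
        "\<And>u. u \<in> span (k i) (spc V i) {v} \<Longrightarrow> p u = u" "\<And>c. c \<in> C \<Longrightarrow> p c = \<zero>\<^bsub>spc V i\<^esub>"
        "\<And>m. m \<in> carrier (spc V i) \<Longrightarrow> m \<ominus>\<^bsub>spc V i\<^esub> p m \<in> C"
        using C(3) that by (rule Vi.projection_exists[OF U C(1,2)])
      have pp: "p (p v) = p v" if "v \<in> carrier (spc V i)" for v using p(3) funcset_mem[OF p(2) that] by simp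
      have "idem_endo \<M> \<Lambda> V (\<lambda>j. if j = i then p else (\<lambda>_. \<zero>\<^bsub>spc V j\<^esub>))"
        by (rule concentrated_idem_endo[OF ori rep out(2) p(1) pp])
      from idem_endo_cases[OF ori rep ind this]
      have "span (k i) (spc V i) {v} = carrier (spc V i)"
      proof
        assume *: "\<forall>j. \<forall>w\<in>carrier (spc V j). (if j = i then p else (\<lambda>_. \<zero>\<^bsub>spc V j\<^esub>)) w = \<zero>\<^bsub>spc V j\<^esub>"
        have "p v = \<zero>\<^bsub>spc V i\<^esub>" using *[rule_format, OF v(1)] by simp
        moreover have "p v = v" using span_superset[of "{v}" "k i" "spc V i"] by (intro p(3)) simp
        ultimately show ?thesis using v(2) by simp
      next
        assume *: "\<forall>j. \<forall>w\<in>carrier (spc V j). (if j = i then p else (\<lambda>_. \<zero>\<^bsub>spc V j\<^esub>)) w = w"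
        have "w \<in> span (k i) (spc V i) {v}" if w: "w \<in> carrier (spc V i)" for w
        proof -
          have "p w = w" using *[rule_format, OF w] by simp
          then show ?thesis using funcset_mem[OF p(2) w] by simp
        qed
        then show ?thesis using Vi.span_closed[OF vs] by auto
      qed
      moreover have "Vi.independent {v}" using span0 v(2) by (simp add: Vi.independent_def)
      ultimately show ?thesis unfolding Vi.has_dim_iff using v(1) True
        by (intro exI[of _ "{v}"]) (simp add: n_def)
    qed
  qed
  have "\<exists>\<theta>. \<theta> \<in> lin_hom (k i) (spc ?L i) (spc V i) \<and> bij_betw \<theta> (carrier (spc ?L i)) (carrier (spc V i))" for i
  proof -
    interpret Vi: vector_space_dr "k i" "spc V i" by (rule vector_space_k[OF rep_left_module[OF rep]])
    show ?thesis unfolding spcL by (rule Vi.coord_iso_exists[OF dim])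
  qed
  then obtain \<theta> where \<theta>: "\<And>i. \<theta> i \<in> lin_hom (k i) (spc ?L i) (spc V i)"
    "\<And>i. bij_betw (\<theta> i) (carrier (spc ?L i)) (carrier (spc V i))" by metis
  define \<alpha> where "\<alpha> i = restrict (inv_into (carrier (spc ?L i)) (\<theta> i)) (carrier (spc V i))" for i
  have Lmod: "left_module (k i) (spc ?L i)" for i unfolding spcL by (rule coord_space_left_module[OF ring_k])
  have inv_lin: "linear_map (k i) (spc V i) (spc ?L i) (inv_into (carrier (spc ?L i)) (\<theta> i))" for i
    by (rule linear_map_inv_into[OF left_module.axioms(2)[OF Lmod] Lmod lin_hom_linear[OF \<theta>(1)] \<theta>(2)])
  have \<alpha>: "\<alpha> i \<in> lin_hom (k i) (spc V i) (spc ?L i)" for i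
    unfolding \<alpha>_def by (rule restrict_lin_hom[OF rep_left_module[OF rep] inv_lin])
  have \<alpha>_bij: "bij_betw (\<alpha> i) (carrier (spc V i)) (carrier (spc ?L i))" for i
    unfolding \<alpha>_def bij_betw_restrict_eq by (rule bij_betw_inv_into[OF \<theta>(2)])
  have Lfin: "fin_dim (k i) (spc ?L i)" for i
  proof -
    interpret Vi: vector_space_dr "k i" "spc V i" by (rule vector_space_k[OF rep_left_module[OF rep]])
    interpret Li: vector_space_dr "k i" "spc ?L i" by (rule vector_space_k[OF Lmod])
    show ?thesis
      using finitely_generated_image[OF Vi.left_module_axioms Li.left_module_axioms lin_hom_linear[OF \<alpha>]] \<alpha>_bij
        rep_fin_dim[OF rep] Vi.fin_dim_iff Li.fin_dim_iff by (simp add: bij_betw_def)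
  qed
  have mpL_hom: "mp ?L i j \<in> lin_hom (k j) (tens j i (spc ?L i)) (spc ?L j)" if "(i, j) \<in> \<Lambda>" for i j
  proof -
    interpret Lj: left_module "k j" "spc ?L j" by (rule Lmod)
    show ?thesis unfolding mpL
      by (rule restrict_lin_hom[OF tens_left_module[OF arrow_edge[OF ori that] Lmod]]) (auto intro: linear_mapI)
  qed
  show "is_rep \<M> \<Lambda> ?L"
    unfolding is_rep_def using Lmod Lfin mpL_hom by auto
  have "is_rep_hom \<M> \<Lambda> V ?L \<alpha>"
    unfolding is_rep_hom_def
  proof (intro conjI allI ballI \<alpha>, goal_cases)
    case (1 a)
    obtain i j where a: "a = (i, j)" by (cases a)
    have ij: "(i, j) \<in> \<Lambda>" using 1 a by simp
    interpret Vj: left_module "k j" "spc V j" by (rule rep_left_module[OF rep])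
    interpret Lj: left_module "k j" "spc ?L j" by (rule Lmod)
    interpret tensor_product "k j" "k i" "B j i" "spc V i" by (rule arrow_tensor_product[OF ori rep ij])
    have "\<alpha> j (mp V i j t) = mp ?L i j (tensor_map (k i) (B j i) (spc ?L i) (\<alpha> i) t)"
      if t: "t \<in> carrier (tens j i (spc V i))" for t
    proof -
      have t0: "t = \<zero>\<^bsub>T\<^esub>" using zero_tensor[OF out(2)[OF ij]] t by (simp add: arrow_tensor_def)
      have "mp V i j t = \<zero>\<^bsub>spc V j\<^esub>"
        unfolding t0
        by (rule additive_map_zero[OF T.abelian_group_axioms Vj.M.abelian_group_axioms
              linear_map_additive[OF rep_mp_linear[OF rep ij, unfolded arrow_tensor_def]]])
      moreover have "\<alpha> j \<zero>\<^bsub>spc V j\<^esub> = \<zero>\<^bsub>spc ?L j\<^esub>"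
        by (rule additive_map_zero[OF Vj.M.abelian_group_axioms Lj.M.abelian_group_axioms linear_map_additive[OF lin_hom_linear[OF \<alpha>]]])
      moreover have "tensor_map (k i) (B j i) (spc ?L i) (\<alpha> i) t \<in> carrier (tens j i (spc ?L i))"
        unfolding arrow_tensor_def
        by (rule linear_map_closed[OF tensor_map_linear[OF bimodule_B[OF arrow_edge[OF ori ij]] rep_left_module[OF rep] Lmod lin_hom_linear[OF \<alpha>]]
              t[unfolded arrow_tensor_def]])
      ultimately show ?thesis by (simp add: mpL)
    qed
    then show ?case by (simp add: a)
  qed
  then show "rep_iso \<M> \<Lambda> V ?L" unfolding rep_iso_def using \<alpha>_bij by blast
qed

end

section \<open>Tensor rings\<close>

lemma frag_extend_fun_diff: "frag_extend (\<lambda>c. f c - g c) u = frag_extend f u - frag_extend g u"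
  by (rule frag_induction[where c = u and S = UNIV]) (auto simp: frag_extend_diff)

lemma tensor_word_rel_add:
  "set us \<subseteq> carrier B \<Longrightarrow> b \<in> carrier B \<Longrightarrow> b' \<in> carrier B \<Longrightarrow> set ws \<subseteq> carrier B \<Longrightarrow> s \<in> carrier R \<Longrightarrow>
    frag_of (us @ (b \<oplus>\<^bsub>B\<^esub> b') # ws, s) - frag_of (us @ b # ws, s) - frag_of (us @ b' # ws, s) \<in> tensor_word_rel R B"
  unfolding tensor_word_rel_def by (rule UnI1, rule UnI1, rule UnI1, rule CollectI, intro exI conjI, rule refl)

lemma tensor_word_rel_add_scalar:
  "set us \<subseteq> carrier B \<Longrightarrow> s \<in> carrier R \<Longrightarrow> s' \<in> carrier R \<Longrightarrow>
    frag_of (us, s \<oplus>\<^bsub>R\<^esub> s') - frag_of (us, s) - frag_of (us, s') \<in> tensor_word_rel R B"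
  unfolding tensor_word_rel_def by (rule UnI1, rule UnI1, rule UnI2, rule CollectI, intro exI conjI, rule refl)

lemma tensor_word_rel_middle:
  "set us \<subseteq> carrier B \<Longrightarrow> b \<in> carrier B \<Longrightarrow> r \<in> carrier R \<Longrightarrow> b' \<in> carrier B \<Longrightarrow> set ws \<subseteq> carrier B \<Longrightarrow> s \<in> carrier R \<Longrightarrow>
    frag_of (us @ rsmult B b r # b' # ws, s) - frag_of (us @ b # (r \<odot>\<^bsub>B\<^esub> b') # ws, s) \<in> tensor_word_rel R B"
  unfolding tensor_word_rel_def by (rule UnI1, rule UnI2, rule CollectI, intro exI conjI, rule refl)

lemma tensor_word_rel_last:
  "set us \<subseteq> carrier B \<Longrightarrow> b \<in> carrier B \<Longrightarrow> r \<in> carrier R \<Longrightarrow> s \<in> carrier R \<Longrightarrow>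
    frag_of (us @ [rsmult B b r], s) - frag_of (us @ [b], r \<otimes>\<^bsub>R\<^esub> s) \<in> tensor_word_rel R B"
  unfolding tensor_word_rel_def by (rule UnI2, rule CollectI, intro exI conjI, rule refl)

lemma tensor_word_rel_cases [consumes 1, case_names add add_scalar middle last]:
  assumes "q \<in> tensor_word_rel R B"
    and "\<And>us b b' ws s. q = frag_of (us @ (b \<oplus>\<^bsub>B\<^esub> b') # ws, s) - frag_of (us @ b # ws, s) - frag_of (us @ b' # ws, s) \<Longrightarrow>
      set us \<subseteq> carrier B \<Longrightarrow> b \<in> carrier B \<Longrightarrow> b' \<in> carrier B \<Longrightarrow> set ws \<subseteq> carrier B \<Longrightarrow> s \<in> carrier R \<Longrightarrow> thesis"
    and "\<And>us s s'. q = frag_of (us, s \<oplus>\<^bsub>R\<^esub> s') - frag_of (us, s) - frag_of (us, s') \<Longrightarrow>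
      set us \<subseteq> carrier B \<Longrightarrow> s \<in> carrier R \<Longrightarrow> s' \<in> carrier R \<Longrightarrow> thesis"
    and "\<And>us b r b' ws s. q = frag_of (us @ rsmult B b r # b' # ws, s) - frag_of (us @ b # (r \<odot>\<^bsub>B\<^esub> b') # ws, s) \<Longrightarrow>
      set us \<subseteq> carrier B \<Longrightarrow> b \<in> carrier B \<Longrightarrow> r \<in> carrier R \<Longrightarrow> b' \<in> carrier B \<Longrightarrow> set ws \<subseteq> carrier B \<Longrightarrow>
      s \<in> carrier R \<Longrightarrow> thesis"
    and "\<And>us b r s. q = frag_of (us @ [rsmult B b r], s) - frag_of (us @ [b], r \<otimes>\<^bsub>R\<^esub> s) \<Longrightarrow>
      set us \<subseteq> carrier B \<Longrightarrow> b \<in> carrier B \<Longrightarrow> r \<in> carrier R \<Longrightarrow> s \<in> carrier R \<Longrightarrow> thesis"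
  shows thesis
  using assms(1) unfolding tensor_word_rel_def
  by (elim UnE CollectE exE conjE) (fact assms(2-5))+

locale tensor_ring_bimodule = bimodule R R B
  for R :: "'s ring" and B :: "('s, 'b) bimodule"
begin

abbreviation "TR \<equiv> tensor_ring R B"
abbreviation "words \<equiv> tensor_words R B"
abbreviation "wm \<equiv> tensor_word_mult R B"

lemma words_iff: "(bs, s) \<in> words \<longleftrightarrow> set bs \<subseteq> carrier B \<and> s \<in> carrier R"
  by (simp add: tensor_words_def)

sublocale presented_group words "tensor_word_rel R B" TR
proof
  fix q assume "q \<in> tensor_word_rel R B"
  then show "Poly_Mapping.keys q \<subseteq> words"
    by (cases rule: tensor_word_rel_cases)
      (auto dest!: subsetD[OF keys_diff] simp: words_iff rsmult_closed smult_closed)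
qed (auto simp: tensor_ring_def Let_def)

sublocale TR: abelian_group TR by (rule abelian_group)

text \<open>The element \<open>b_1 \<otimes> ... \<otimes> b_n s\<close> of the tensor ring. With
  the empty list it is a scalar, with one letter and scalar 1 it is an element of
  \<open>B\<close>.\<close>

definition wc :: "'b list \<Rightarrow> 's \<Rightarrow> ('b list \<times> 's \<Rightarrow>\<^sub>0 int) set" where "wc bs s = cls (frag_of (bs, s))"

lemma wc_closed: "set bs \<subseteq> carrier B \<Longrightarrow> s \<in> carrier R \<Longrightarrow> wc bs s \<in> carrier TR"
  unfolding wc_def by (rule cls_frag_closed) (simp add: words_iff)

lemma wc_add:
  assumes "set us \<subseteq> carrier B" "b \<in> carrier B" "b' \<in> carrier B" "set ws \<subseteq> carrier B" "s \<in> carrier R"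
  shows "wc (us @ (b \<oplus>\<^bsub>B\<^esub> b') # ws) s = wc (us @ b # ws) s \<oplus>\<^bsub>TR\<^esub> wc (us @ b' # ws) s"
proof -
  have "frag_of (us @ (b \<oplus>\<^bsub>B\<^esub> b') # ws, s) - frag_of (us @ b # ws, s) - frag_of (us @ b' # ws, s) \<in> relations"
    using assms by (intro subsetD[OF relations_superset] tensor_word_rel_add)
  then show ?thesis using assms unfolding wc_def by (subst cls_add) (auto simp: cls_eq_iff diff_diff_eq words_iff)
qed

lemma wc_add_scalar:
  assumes "set us \<subseteq> carrier B" "s \<in> carrier R" "s' \<in> carrier R"
  shows "wc us (s \<oplus>\<^bsub>R\<^esub> s') = wc us s \<oplus>\<^bsub>TR\<^esub> wc us s'"
proof -
  have "frag_of (us, s \<oplus>\<^bsub>R\<^esub> s') - frag_of (us, s) - frag_of (us, s') \<in> relations"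
    using assms by (intro subsetD[OF relations_superset] tensor_word_rel_add_scalar)
  then show ?thesis using assms unfolding wc_def by (subst cls_add) (auto simp: cls_eq_iff diff_diff_eq words_iff)
qed

lemma wc_middle:
  assumes "set us \<subseteq> carrier B" "b \<in> carrier B" "r \<in> carrier R" "b' \<in> carrier B" "set ws \<subseteq> carrier B" "s \<in> carrier R"
  shows "wc (us @ rsmult B b r # b' # ws) s = wc (us @ b # (r \<odot>\<^bsub>B\<^esub> b') # ws) s"
proof -
  have "frag_of (us @ rsmult B b r # b' # ws, s) - frag_of (us @ b # (r \<odot>\<^bsub>B\<^esub> b') # ws, s) \<in> relations"
    using assms by (intro subsetD[OF relations_superset] tensor_word_rel_middle)
  then show ?thesis unfolding wc_def by (simp add: cls_eq_iff)
qed

lemma wc_last: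
  assumes "set us \<subseteq> carrier B" "b \<in> carrier B" "r \<in> carrier R" "s \<in> carrier R"
  shows "wc (us @ [rsmult B b r]) s = wc (us @ [b]) (r \<otimes>\<^bsub>R\<^esub> s)"
proof -
  have "frag_of (us @ [rsmult B b r], s) - frag_of (us @ [b], r \<otimes>\<^bsub>R\<^esub> s) \<in> relations"
    using assms by (intro subsetD[OF relations_superset] tensor_word_rel_last)
  then show ?thesis unfolding wc_def by (simp add: cls_eq_iff)
qed

lemma wm_closed: "c \<in> words \<Longrightarrow> d \<in> words \<Longrightarrow> wm c d \<in> words"
  by (cases "(R, B, c, d)" rule: tensor_word_mult.cases) (auto simp: words_iff smult_closed)

lemma wm_assoc: "c \<in> words \<Longrightarrow> d \<in> words \<Longrightarrow> e \<in> words \<Longrightarrow> wm (wm c d) e = wm c (wm d e)"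
proof -
  obtain bs s cs t ds u where e: "c = (bs, s)" "d = (cs, t)" "e = (ds, u)" by (metis prod.exhaust)
  assume "c \<in> words" "d \<in> words" "e \<in> words"
  then show ?thesis unfolding e
    by (cases cs; cases ds) (auto simp: words_iff R.m_assoc smult_assoc)
qed

text \<open>The trailing scalar of \<open>c\<close> is absorbed by the first letter of the other
  factor, or by its scalar if there are no letters. The case split on \<open>us\<close> decides
  which slot of the relator is touched.\<close>

lemma left_stable:
  assumes c: "c \<in> words" and q: "q \<in> tensor_word_rel R B"
  shows "frag_extend (\<lambda>d. frag_of (wm c d)) q \<in> tensor_word_rel R B"
proof -
  obtain cs t where ct: "c = (cs, t)" "set cs \<subseteq> carrier B" "t \<in> carrier R"
    using c by (cases c) (auto simp: words_iff)
  note simps = frag_extend_diff ct(1) smult_r_distr R.r_distr smult_rsmult[symmetric]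
  from q show ?thesis
  proof (cases rule: tensor_word_rel_cases)
    case (add us b b' ws s)
    show ?thesis
    proof (cases us)
      case Nil
      then have "frag_extend (\<lambda>d. frag_of (wm c d)) q =
        frag_of (cs @ (t \<odot>\<^bsub>B\<^esub> b \<oplus>\<^bsub>B\<^esub> t \<odot>\<^bsub>B\<^esub> b') # ws, s) - frag_of (cs @ (t \<odot>\<^bsub>B\<^esub> b) # ws, s) - frag_of (cs @ (t \<odot>\<^bsub>B\<^esub> b') # ws, s)"
        using add ct by (simp add: simps)
      then show ?thesis using add ct by (simp add: tensor_word_rel_add smult_closed)
    next
      case (Cons u us')
      then have "frag_extend (\<lambda>d. frag_of (wm c d)) q =
        frag_of ((cs @ (t \<odot>\<^bsub>B\<^esub> u) # us') @ (b \<oplus>\<^bsub>B\<^esub> b') # ws, s) - frag_of ((cs @ (t \<odot>\<^bsub>B\<^esub> u) # us') @ b # ws, s)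
          - frag_of ((cs @ (t \<odot>\<^bsub>B\<^esub> u) # us') @ b' # ws, s)"
        using add ct by (simp add: simps)
      also have "\<dots> \<in> tensor_word_rel R B"
        using add ct Cons by (intro tensor_word_rel_add) (auto simp: smult_closed)
      finally show ?thesis .
    qed
  next
    case (add_scalar us s s')
    show ?thesis
    proof (cases us)
      case Nil
      then have "frag_extend (\<lambda>d. frag_of (wm c d)) q =
        frag_of (cs, t \<otimes>\<^bsub>R\<^esub> s \<oplus>\<^bsub>R\<^esub> t \<otimes>\<^bsub>R\<^esub> s') - frag_of (cs, t \<otimes>\<^bsub>R\<^esub> s) - frag_of (cs, t \<otimes>\<^bsub>R\<^esub> s')"
        using add_scalar ct by (simp add: simps)
      then show ?thesis using add_scalar ct by (simp add: tensor_word_rel_add_scalar)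
    next
      case (Cons u us')
      then have "frag_extend (\<lambda>d. frag_of (wm c d)) q =
        frag_of (cs @ (t \<odot>\<^bsub>B\<^esub> u) # us', s \<oplus>\<^bsub>R\<^esub> s') - frag_of (cs @ (t \<odot>\<^bsub>B\<^esub> u) # us', s) - frag_of (cs @ (t \<odot>\<^bsub>B\<^esub> u) # us', s')"
        using add_scalar ct by (simp add: simps)
      also have "\<dots> \<in> tensor_word_rel R B"
        using add_scalar ct Cons by (intro tensor_word_rel_add_scalar) (auto simp: smult_closed)
      finally show ?thesis .
    qed
  next
    case (middle us b r b' ws s)
    show ?thesis
    proof (cases us)
      case Nil
      then have "frag_extend (\<lambda>d. frag_of (wm c d)) q =
        frag_of (cs @ rsmult B (t \<odot>\<^bsub>B\<^esub> b) r # b' # ws, s) - frag_of (cs @ (t \<odot>\<^bsub>B\<^esub> b) # (r \<odot>\<^bsub>B\<^esub> b') # ws, s)"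
        using middle ct by (simp add: simps)
      then show ?thesis using middle ct by (simp add: tensor_word_rel_middle smult_closed)
    next
      case (Cons u us')
      then have "frag_extend (\<lambda>d. frag_of (wm c d)) q =
        frag_of ((cs @ (t \<odot>\<^bsub>B\<^esub> u) # us') @ rsmult B b r # b' # ws, s) -
        frag_of ((cs @ (t \<odot>\<^bsub>B\<^esub> u) # us') @ b # (r \<odot>\<^bsub>B\<^esub> b') # ws, s)"
        using middle ct by (simp add: simps)
      also have "\<dots> \<in> tensor_word_rel R B"
        using middle ct Cons by (intro tensor_word_rel_middle) (auto simp: smult_closed)
      finally show ?thesis .
    qed
  next
    case (last us b r s)
    show ?thesis
    proof (cases us)
      case Nil
      then have "frag_extend (\<lambda>d. frag_of (wm c d)) q =
        frag_of (cs @ [rsmult B (t \<odot>\<^bsub>B\<^esub> b) r], s) - frag_of (cs @ [t \<odot>\<^bsub>B\<^esub> b], r \<otimes>\<^bsub>R\<^esub> s)"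
        using last ct by (simp add: simps)
      then show ?thesis using last ct by (simp add: tensor_word_rel_last smult_closed)
    next
      case (Cons u us')
      then have "frag_extend (\<lambda>d. frag_of (wm c d)) q =
        frag_of ((cs @ (t \<odot>\<^bsub>B\<^esub> u) # us') @ [rsmult B b r], s) - frag_of ((cs @ (t \<odot>\<^bsub>B\<^esub> u) # us') @ [b], r \<otimes>\<^bsub>R\<^esub> s)"
        using last ct by (simp add: simps)
      also have "\<dots> \<in> tensor_word_rel R B"
        using last ct Cons by (intro tensor_word_rel_last) (auto simp: smult_closed)
      finally show ?thesis .
    qed
  qed
qed

text \<open>Appending a word with letters pushes the scalar slot of a relator into a letter. So
  additivity in the scalar becomes additivity in a letter, and the relation at the last letter
  becomes one between two neighbouring letters.\<close>

lemma right_stable: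
  assumes d: "d \<in> words" and q: "q \<in> tensor_word_rel R B"
  shows "frag_extend (\<lambda>c. frag_of (wm c d)) q \<in> tensor_word_rel R B"
proof (cases d)
  case (Pair ds t)
  then have dt: "set ds \<subseteq> carrier B" "t \<in> carrier R" using d by (auto simp: words_iff)
  from q show ?thesis
  proof (cases rule: tensor_word_rel_cases)
    case (add us b b' ws s)
    show ?thesis
    proof (cases ds)
      case Nil
      then show ?thesis using add dt Pair by (simp add: frag_extend_diff tensor_word_rel_add)
    next
      case (Cons e ds')
      have "frag_extend (\<lambda>c. frag_of (wm c d)) q = frag_of (us @ (b \<oplus>\<^bsub>B\<^esub> b') # (ws @ (s \<odot>\<^bsub>B\<^esub> e) # ds'), t)
        - frag_of (us @ b # (ws @ (s \<odot>\<^bsub>B\<^esub> e) # ds'), t) - frag_of (us @ b' # (ws @ (s \<odot>\<^bsub>B\<^esub> e) # ds'), t)"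
        using add Pair Cons by (simp add: frag_extend_diff)
      also have "\<dots> \<in> tensor_word_rel R B"
        using add dt Cons by (intro tensor_word_rel_add) (auto simp: smult_closed)
      finally show ?thesis .
    qed
  next
    case (add_scalar us s s')
    show ?thesis
    proof (cases ds)
      case Nil
      then show ?thesis using add_scalar dt Pair by (simp add: frag_extend_diff R.l_distr tensor_word_rel_add_scalar)
    next
      case (Cons e ds')
      have "frag_extend (\<lambda>c. frag_of (wm c d)) q = frag_of (us @ (s \<odot>\<^bsub>B\<^esub> e \<oplus>\<^bsub>B\<^esub> s' \<odot>\<^bsub>B\<^esub> e) # ds', t)
        - frag_of (us @ (s \<odot>\<^bsub>B\<^esub> e) # ds', t) - frag_of (us @ (s' \<odot>\<^bsub>B\<^esub> e) # ds', t)"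
        using add_scalar Pair Cons dt by (simp add: frag_extend_diff smult_l_distr)
      also have "\<dots> \<in> tensor_word_rel R B"
        using add_scalar dt Cons by (intro tensor_word_rel_add) (auto simp: smult_closed)
      finally show ?thesis .
    qed
  next
    case (middle us b r b' ws s)
    show ?thesis
    proof (cases ds)
      case Nil
      then show ?thesis using middle dt Pair by (simp add: frag_extend_diff tensor_word_rel_middle)
    next
      case (Cons e ds')
      have "frag_extend (\<lambda>c. frag_of (wm c d)) q = frag_of (us @ rsmult B b r # b' # (ws @ (s \<odot>\<^bsub>B\<^esub> e) # ds'), t)
        - frag_of (us @ b # (r \<odot>\<^bsub>B\<^esub> b') # (ws @ (s \<odot>\<^bsub>B\<^esub> e) # ds'), t)"
        using middle Pair Cons by (simp add: frag_extend_diff)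
      also have "\<dots> \<in> tensor_word_rel R B"
        using middle dt Cons by (intro tensor_word_rel_middle) (auto simp: smult_closed)
      finally show ?thesis .
    qed
  next
    case (last us b r s)
    show ?thesis
    proof (cases ds)
      case Nil
      then show ?thesis using last dt Pair by (simp add: frag_extend_diff tensor_word_rel_last R.m_assoc)
    next
      case (Cons e ds')
      have "frag_extend (\<lambda>c. frag_of (wm c d)) q = frag_of (us @ rsmult B b r # (s \<odot>\<^bsub>B\<^esub> e) # ds', t)
        - frag_of (us @ b # (r \<odot>\<^bsub>B\<^esub> (s \<odot>\<^bsub>B\<^esub> e)) # ds', t)"
        using last Pair Cons dt by (simp add: frag_extend_diff smult_assoc)
      also have "\<dots> \<in> tensor_word_rel R B"
        using last dt Cons by (intro tensor_word_rel_middle) (auto simp: smult_closed)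
      finally show ?thesis .
    qed
  qed
qed

definition frag_mult :: "('b list \<times> 's \<Rightarrow>\<^sub>0 int) \<Rightarrow> ('b list \<times> 's \<Rightarrow>\<^sub>0 int) \<Rightarrow> ('b list \<times> 's \<Rightarrow>\<^sub>0 int)" where
  "frag_mult u w = frag_extend (\<lambda>c. frag_extend (\<lambda>d. frag_of (wm c d)) w) u"

lemma frag_mult_simps:
  shows frag_mult_diff_left: "frag_mult (u - u') w = frag_mult u w - frag_mult u' w"
    and frag_mult_diff_right: "frag_mult u (w - w') = frag_mult u w - frag_mult u w'"
    and frag_mult_of: "frag_mult (frag_of c) (frag_of d) = frag_of (wm c d)"
    and frag_mult_zero_left: "frag_mult 0 w = 0"
    and frag_mult_zero_right: "frag_mult u 0 = 0"
  by (simp_all add: frag_mult_def frag_extend_diff frag_extend_fun_diff frag_extend_eq_0)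

lemma frag_mult_keys:
  assumes "Poly_Mapping.keys u \<subseteq> words" "Poly_Mapping.keys w \<subseteq> words"
  shows "Poly_Mapping.keys (frag_mult u w) \<subseteq> words"
proof -
  have 1: "Poly_Mapping.keys (frag_extend (\<lambda>d. frag_of (wm c d)) w) \<subseteq> words" if "c \<in> words" for c
    using keys_frag_extend[of "\<lambda>d. frag_of (wm c d)" w] wm_closed[OF that] assms(2) by fastforce
  show ?thesis
    unfolding frag_mult_def
    using keys_frag_extend[of "\<lambda>c. frag_extend (\<lambda>d. frag_of (wm c d)) w" u] 1 assms(1) by blast
qed

lemma frag_mult_rel_right:
  assumes u: "Poly_Mapping.keys u \<subseteq> words" and q: "q \<in> tensor_word_rel R B"
  shows "frag_mult u q \<in> relations"
proof (rule free_Abelian_group_induct[OF u, of "\<lambda>u. frag_mult u q \<in> relations"])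
  fix c assume "c \<in> words"
  then show "frag_mult (frag_of c) q \<in> relations"
    using subsetD[OF relations_superset left_stable[OF _ q]] by (simp add: frag_mult_def)
qed (auto simp: frag_mult_simps relations_zero intro: relations_minus)

lemma frag_mult_rel_left:
  assumes w: "Poly_Mapping.keys w \<subseteq> words" and q: "q \<in> tensor_word_rel R B"
  shows "frag_mult q w \<in> relations"
proof (rule free_Abelian_group_induct[OF w, of "\<lambda>w. frag_mult q w \<in> relations"])
  fix d assume "d \<in> words"
  then show "frag_mult q (frag_of d) \<in> relations"
    using subsetD[OF relations_superset right_stable[OF _ q]] by (simp add: frag_mult_def)
qed (auto simp: frag_mult_simps relations_zero intro: relations_minus)

text \<open>The product in \<open>tensor_ring\<close> is a union over all pairs of representatives.
  It is a single class because \<open>frag_mult\<close> carries relators in either argument to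
  relations; the inner union is collapsed for each fixed left representative.\<close>

lemma mult_cls:
  assumes u: "Poly_Mapping.keys u \<subseteq> words" and w: "Poly_Mapping.keys w \<subseteq> words"
  shows "cls u \<otimes>\<^bsub>TR\<^esub> cls w = cls (frag_mult u w)"
proof -
  have "(\<Union>w'\<in>cls w. cls (frag_mult u' w')) = cls (frag_mult u' w)" if "u' \<in> cls u" for u'
  proof -
    have "u' - u \<in> relations" using that in_cls_iff by simp
    then have k: "Poly_Mapping.keys u' \<subseteq> words" using relations_keys[of "u' - u"] u keys_add_sub[of "u' - u" u] by simp
    show ?thesis
      by (rule union_cls[OF presented_group_axioms]) (auto simp: frag_mult_diff_right frag_mult_rel_right[OF k])
  qed
  then have "cls u \<otimes>\<^bsub>TR\<^esub> cls w = (\<Union>u'\<in>cls u. cls (frag_mult u' w))"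
    by (simp add: tensor_ring_def Let_def tensor_word_class_def frag_mult_def)
  also have "\<dots> = cls (frag_mult u w)"
    by (rule union_cls[OF presented_group_axioms]) (auto simp: frag_mult_diff_left frag_mult_rel_left[OF w])
  finally show ?thesis .
qed

lemma mult_closed: "p \<in> carrier TR \<Longrightarrow> q \<in> carrier TR \<Longrightarrow> p \<otimes>\<^bsub>TR\<^esub> q \<in> carrier TR"
  by (elim cls_cases) (simp add: mult_cls cls_closed frag_mult_keys)

lemma frag_mult_add_left: "frag_mult (u + u') w = frag_mult u w + frag_mult u' w"
  using frag_mult_diff_left[of "u + u'" u' w] by (simp add: eq_diff_eq)

lemma frag_mult_add_right: "frag_mult u (w + w') = frag_mult u w + frag_mult u w'"
  using frag_mult_diff_right[of u "w + w'" w'] by (simp add: eq_diff_eq)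

lemma mult_additive_right:
  assumes p: "p \<in> carrier TR"
  shows "additive_map TR TR (\<lambda>q. p \<otimes>\<^bsub>TR\<^esub> q)"
proof (rule additive_mapI)
  obtain u where u: "Poly_Mapping.keys u \<subseteq> words" "p = cls u" using cls_cases[OF p] by metis
  fix m n assume "m \<in> carrier TR" "n \<in> carrier TR"
  then obtain v w where "Poly_Mapping.keys v \<subseteq> words" "m = cls v" "Poly_Mapping.keys w \<subseteq> words" "n = cls w"
    by (metis cls_cases)
  then show "p \<otimes>\<^bsub>TR\<^esub> (m \<oplus>\<^bsub>TR\<^esub> n) = p \<otimes>\<^bsub>TR\<^esub> m \<oplus>\<^bsub>TR\<^esub> p \<otimes>\<^bsub>TR\<^esub> n"
    using u by (simp add: cls_add mult_cls keys_add_sub frag_mult_keys frag_mult_add_right)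
qed (use p mult_closed in simp)

lemma mult_additive_left:
  assumes p: "p \<in> carrier TR"
  shows "additive_map TR TR (\<lambda>q. q \<otimes>\<^bsub>TR\<^esub> p)"
proof (rule additive_mapI)
  obtain u where u: "Poly_Mapping.keys u \<subseteq> words" "p = cls u" using cls_cases[OF p] by metis
  fix m n assume "m \<in> carrier TR" "n \<in> carrier TR"
  then obtain v w where "Poly_Mapping.keys v \<subseteq> words" "m = cls v" "Poly_Mapping.keys w \<subseteq> words" "n = cls w"
    by (metis cls_cases)
  then show "(m \<oplus>\<^bsub>TR\<^esub> n) \<otimes>\<^bsub>TR\<^esub> p = m \<otimes>\<^bsub>TR\<^esub> p \<oplus>\<^bsub>TR\<^esub> n \<otimes>\<^bsub>TR\<^esub> p"
    using u by (simp add: cls_add mult_cls keys_add_sub frag_mult_keys frag_mult_add_left)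
qed (use p mult_closed in simp)

lemma mult_word: "c \<in> words \<Longrightarrow> d \<in> words \<Longrightarrow> cls (frag_of c) \<otimes>\<^bsub>TR\<^esub> cls (frag_of d) = cls (frag_of (wm c d))"
  by (simp add: mult_cls frag_mult_of)

lemma TR_eqI:
  assumes "additive_map TR TR f" "additive_map TR TR g" "t \<in> carrier TR"
    and "\<And>c. c \<in> words \<Longrightarrow> f (cls (frag_of c)) = g (cls (frag_of c))"
  shows "f t = g t"
  by (rule additive_eqI[OF TR.abelian_group_axioms assms(1,2,4,3)])

text \<open>Both sides are additive in each argument, so the arguments are reduced to words one at a
  time, until \<open>wm_assoc\<close> applies.\<close>

lemma mult_assoc:
  assumes "p \<in> carrier TR" "q \<in> carrier TR" "r \<in> carrier TR"
  shows "(p \<otimes>\<^bsub>TR\<^esub> q) \<otimes>\<^bsub>TR\<^esub> r = p \<otimes>\<^bsub>TR\<^esub> (q \<otimes>\<^bsub>TR\<^esub> r)"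
proof -
  note L = mult_additive_left and Rt = mult_additive_right and comp = additive_map_comp
  have 1: "(cls (frag_of c) \<otimes>\<^bsub>TR\<^esub> cls (frag_of d)) \<otimes>\<^bsub>TR\<^esub> r = cls (frag_of c) \<otimes>\<^bsub>TR\<^esub> (cls (frag_of d) \<otimes>\<^bsub>TR\<^esub> r)"
    if "c \<in> words" "d \<in> words" "r \<in> carrier TR" for c d r
  proof (rule TR_eqI[OF _ _ that(3)])
    show "additive_map TR TR (\<lambda>r. (cls (frag_of c) \<otimes>\<^bsub>TR\<^esub> cls (frag_of d)) \<otimes>\<^bsub>TR\<^esub> r)"
      using that by (intro Rt mult_closed cls_frag_closed)
    show "additive_map TR TR (\<lambda>r. cls (frag_of c) \<otimes>\<^bsub>TR\<^esub> (cls (frag_of d) \<otimes>\<^bsub>TR\<^esub> r))"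
      using that by (intro comp[OF Rt Rt] cls_frag_closed)
  qed (use that in \<open>simp add: mult_word wm_closed wm_assoc\<close>)
  have 2: "(cls (frag_of c) \<otimes>\<^bsub>TR\<^esub> q) \<otimes>\<^bsub>TR\<^esub> r = cls (frag_of c) \<otimes>\<^bsub>TR\<^esub> (q \<otimes>\<^bsub>TR\<^esub> r)"
    if "c \<in> words" for c
  proof (rule TR_eqI[OF _ _ assms(2)])
    show "additive_map TR TR (\<lambda>q. (cls (frag_of c) \<otimes>\<^bsub>TR\<^esub> q) \<otimes>\<^bsub>TR\<^esub> r)"
      using that assms(3) by (intro comp[OF Rt L] cls_frag_closed)
    show "additive_map TR TR (\<lambda>q. cls (frag_of c) \<otimes>\<^bsub>TR\<^esub> (q \<otimes>\<^bsub>TR\<^esub> r))"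
      using that assms(3) by (intro comp[OF L Rt] cls_frag_closed)
  qed (use 1 that assms(3) in simp)
  show ?thesis
  proof (rule TR_eqI[OF _ _ assms(1)])
    show "additive_map TR TR (\<lambda>p. (p \<otimes>\<^bsub>TR\<^esub> q) \<otimes>\<^bsub>TR\<^esub> r)"
      using assms by (intro comp[OF L L])
    show "additive_map TR TR (\<lambda>p. p \<otimes>\<^bsub>TR\<^esub> (q \<otimes>\<^bsub>TR\<^esub> r))"
      using assms by (intro L mult_closed)
  qed (rule 2)
qed

lemma wc_mult_scalar_left:
  assumes "s \<in> carrier R" "set bs \<subseteq> carrier B" "b \<in> carrier B" "t \<in> carrier R"
  shows "wc [] s \<otimes>\<^bsub>TR\<^esub> wc (b # bs) t = wc ((s \<odot>\<^bsub>B\<^esub> b) # bs) t"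
  using assms by (simp add: wc_def mult_word words_iff)

lemma wc_mult_scalar_right:
  assumes "s \<in> carrier R" "set bs \<subseteq> carrier B" "t \<in> carrier R"
  shows "wc bs s \<otimes>\<^bsub>TR\<^esub> wc [] t = wc bs (s \<otimes>\<^bsub>R\<^esub> t)"
  using assms by (simp add: wc_def mult_word words_iff)

lemma wc_mult_elem:
  assumes "b \<in> carrier B" "set bs \<subseteq> carrier B" "t \<in> carrier R"
  shows "wc [b] \<one>\<^bsub>R\<^esub> \<otimes>\<^bsub>TR\<^esub> wc bs t = wc (b # bs) t"
  using assms by (cases bs) (simp_all add: wc_def mult_word words_iff smult_one)

end

section \<open>Indecomposable projectives\<close>

locale oriented_modulation = valued_modulation \<M> for \<M> :: "('i::finite, 'r, 'b, 'f) modulation" +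
  fixes \<Lambda> :: "('i \<times> 'i) set"
  assumes orientation: "orientation (val \<M>) \<Lambda>"
begin

abbreviation "PR \<equiv> product_ring \<M>"
abbreviation "AB \<equiv> arrow_bimodule \<M> \<Lambda>"

definition delta :: "'i \<Rightarrow> 'r \<Rightarrow> 'i \<Rightarrow> 'r" where "delta i s = (\<lambda>j. if j = i then s else \<zero>\<^bsub>k j\<^esub>)"
definition single :: "'i \<Rightarrow> 'i \<Rightarrow> 'b \<Rightarrow> 'i \<times> 'i \<Rightarrow> 'b" where
  "single i j b = (\<lambda>(i', j')\<in>\<Lambda>. if (i', j') = (i, j) then b else \<zero>\<^bsub>B j' i'\<^esub>)"

lemma k_simps:
  "\<zero>\<^bsub>k i\<^esub> \<in> carrier (k i)" "\<one>\<^bsub>k i\<^esub> \<in> carrier (k i)"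
  "s \<in> carrier (k i) \<Longrightarrow> t \<in> carrier (k i) \<Longrightarrow> s \<oplus>\<^bsub>k i\<^esub> t \<in> carrier (k i)"
  "s \<in> carrier (k i) \<Longrightarrow> t \<in> carrier (k i) \<Longrightarrow> s \<otimes>\<^bsub>k i\<^esub> t \<in> carrier (k i)"
  "s \<in> carrier (k i) \<Longrightarrow> \<zero>\<^bsub>k i\<^esub> \<otimes>\<^bsub>k i\<^esub> s = \<zero>\<^bsub>k i\<^esub>" "s \<in> carrier (k i) \<Longrightarrow> s \<otimes>\<^bsub>k i\<^esub> \<zero>\<^bsub>k i\<^esub> = \<zero>\<^bsub>k i\<^esub>"
  "s \<in> carrier (k i) \<Longrightarrow> \<one>\<^bsub>k i\<^esub> \<otimes>\<^bsub>k i\<^esub> s = s" "s \<in> carrier (k i) \<Longrightarrow> s \<otimes>\<^bsub>k i\<^esub> \<one>\<^bsub>k i\<^esub> = s"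
  "s \<in> carrier (k i) \<Longrightarrow> \<zero>\<^bsub>k i\<^esub> \<oplus>\<^bsub>k i\<^esub> s = s"
proof -
  interpret K: ring "k i" by (rule ring_k)
  show "\<zero>\<^bsub>k i\<^esub> \<in> carrier (k i)" "\<one>\<^bsub>k i\<^esub> \<in> carrier (k i)"
    "s \<in> carrier (k i) \<Longrightarrow> t \<in> carrier (k i) \<Longrightarrow> s \<oplus>\<^bsub>k i\<^esub> t \<in> carrier (k i)"
    "s \<in> carrier (k i) \<Longrightarrow> t \<in> carrier (k i) \<Longrightarrow> s \<otimes>\<^bsub>k i\<^esub> t \<in> carrier (k i)"
    "s \<in> carrier (k i) \<Longrightarrow> \<zero>\<^bsub>k i\<^esub> \<otimes>\<^bsub>k i\<^esub> s = \<zero>\<^bsub>k i\<^esub>" "s \<in> carrier (k i) \<Longrightarrow> s \<otimes>\<^bsub>k i\<^esub> \<zero>\<^bsub>k i\<^esub> = \<zero>\<^bsub>k i\<^esub>"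
    "s \<in> carrier (k i) \<Longrightarrow> \<one>\<^bsub>k i\<^esub> \<otimes>\<^bsub>k i\<^esub> s = s" "s \<in> carrier (k i) \<Longrightarrow> s \<otimes>\<^bsub>k i\<^esub> \<one>\<^bsub>k i\<^esub> = s"
    "s \<in> carrier (k i) \<Longrightarrow> \<zero>\<^bsub>k i\<^esub> \<oplus>\<^bsub>k i\<^esub> s = s"
    by simp_all
qed

lemma k_comm: "s \<in> carrier (k i) \<Longrightarrow> t \<in> carrier (k i) \<Longrightarrow> s \<oplus>\<^bsub>k i\<^esub> t = t \<oplus>\<^bsub>k i\<^esub> s"
  by (rule abelian_monoid.a_comm[OF abelian_group.axioms(1)[OF ring.is_abelian_group[OF ring_k]]])

lemma k_ring_laws:
  assumes "r \<in> carrier (k i)" "s \<in> carrier (k i)" "t \<in> carrier (k i)"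
  shows "(r \<otimes>\<^bsub>k i\<^esub> s) \<otimes>\<^bsub>k i\<^esub> t = r \<otimes>\<^bsub>k i\<^esub> (s \<otimes>\<^bsub>k i\<^esub> t)" "(r \<oplus>\<^bsub>k i\<^esub> s) \<oplus>\<^bsub>k i\<^esub> t = r \<oplus>\<^bsub>k i\<^esub> (s \<oplus>\<^bsub>k i\<^esub> t)"
    "(r \<oplus>\<^bsub>k i\<^esub> s) \<otimes>\<^bsub>k i\<^esub> t = r \<otimes>\<^bsub>k i\<^esub> t \<oplus>\<^bsub>k i\<^esub> s \<otimes>\<^bsub>k i\<^esub> t"
    "r \<otimes>\<^bsub>k i\<^esub> (s \<oplus>\<^bsub>k i\<^esub> t) = r \<otimes>\<^bsub>k i\<^esub> s \<oplus>\<^bsub>k i\<^esub> r \<otimes>\<^bsub>k i\<^esub> t"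
proof -
  interpret K: ring "k i" by (rule ring_k)
  show "(r \<otimes>\<^bsub>k i\<^esub> s) \<otimes>\<^bsub>k i\<^esub> t = r \<otimes>\<^bsub>k i\<^esub> (s \<otimes>\<^bsub>k i\<^esub> t)" "(r \<oplus>\<^bsub>k i\<^esub> s) \<oplus>\<^bsub>k i\<^esub> t = r \<oplus>\<^bsub>k i\<^esub> (s \<oplus>\<^bsub>k i\<^esub> t)"
    "(r \<oplus>\<^bsub>k i\<^esub> s) \<otimes>\<^bsub>k i\<^esub> t = r \<otimes>\<^bsub>k i\<^esub> t \<oplus>\<^bsub>k i\<^esub> s \<otimes>\<^bsub>k i\<^esub> t"
    "r \<otimes>\<^bsub>k i\<^esub> (s \<oplus>\<^bsub>k i\<^esub> t) = r \<otimes>\<^bsub>k i\<^esub> s \<oplus>\<^bsub>k i\<^esub> r \<otimes>\<^bsub>k i\<^esub> t"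
    by (rule K.m_assoc[OF assms], rule K.a_assoc[OF assms],
        rule K.l_distr[OF assms], rule K.r_distr[OF assms(2,3,1)])
qed

lemma ring_product_ring: "ring PR"
proof -
  note ab = ring.is_abelian_group[OF ring_k]
  have "abelian_group PR"
  proof (rule abelian_groupI)
    fix x assume x: "x \<in> carrier PR"
    show "\<exists>y\<in>carrier PR. y \<oplus>\<^bsub>PR\<^esub> x = \<zero>\<^bsub>PR\<^esub>"
      using x abelian_group.a_inv_closed[OF ab] abelian_group.l_neg[OF ab]
      by (intro bexI[of _ "\<lambda>i. \<ominus>\<^bsub>k i\<^esub> x i"]) (simp_all add: product_ring_def)
  next
    fix x y assume "x \<in> carrier PR" "y \<in> carrier PR"
    then show "x \<oplus>\<^bsub>PR\<^esub> y = y \<oplus>\<^bsub>PR\<^esub> x" by (simp add: product_ring_def fun_eq_iff k_comm)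
  qed (auto simp: product_ring_def k_simps k_ring_laws)
  moreover have "Group.monoid PR"
    by (rule monoidI) (auto simp: product_ring_def k_simps k_ring_laws)
  ultimately show ?thesis
    by (rule ringI) (auto simp: product_ring_def k_simps k_ring_laws)
qed

lemma PR_simps:
  shows PR_carrier: "s \<in> carrier PR \<longleftrightarrow> (\<forall>i. s i \<in> carrier (k i))"
    and PR_mult: "(s \<otimes>\<^bsub>PR\<^esub> t) = (\<lambda>i. s i \<otimes>\<^bsub>k i\<^esub> t i)"
    and PR_add: "(s \<oplus>\<^bsub>PR\<^esub> t) = (\<lambda>i. s i \<oplus>\<^bsub>k i\<^esub> t i)"
    and PR_one: "\<one>\<^bsub>PR\<^esub> = (\<lambda>i. \<one>\<^bsub>k i\<^esub>)"
    and PR_zero: "\<zero>\<^bsub>PR\<^esub> = (\<lambda>i. \<zero>\<^bsub>k i\<^esub>)"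
  by (auto simp: product_ring_def)

lemma arrow_bimodule_B: "(i, j) \<in> \<Lambda> \<Longrightarrow> bimodule (k j) (k i) (B j i)"
  by (rule bimodule_B[OF arrow_edge[OF orientation]])

lemma AB_simps:
  shows AB_carrier: "b \<in> carrier AB \<longleftrightarrow> b \<in> extensional \<Lambda> \<and> (\<forall>(i, j)\<in>\<Lambda>. b (i, j) \<in> carrier (B j i))"
    and AB_zero: "\<zero>\<^bsub>AB\<^esub> = (\<lambda>(i, j)\<in>\<Lambda>. \<zero>\<^bsub>B j i\<^esub>)"
    and AB_add: "b \<oplus>\<^bsub>AB\<^esub> c = (\<lambda>(i, j)\<in>\<Lambda>. b (i, j) \<oplus>\<^bsub>B j i\<^esub> c (i, j))"
    and AB_smult: "s \<odot>\<^bsub>AB\<^esub> b = (\<lambda>(i, j)\<in>\<Lambda>. s j \<odot>\<^bsub>B j i\<^esub> b (i, j))"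
    and AB_rsmult: "rsmult AB b s = (\<lambda>(i, j)\<in>\<Lambda>. rsmult (B j i) (b (i, j)) (s i))"
  by (auto simp: arrow_bimodule_def PiE_def Pi_def)

lemma AB_mem: "b \<in> carrier AB \<Longrightarrow> (i, j) \<in> \<Lambda> \<Longrightarrow> b (i, j) \<in> carrier (B j i)"
  by (auto simp: AB_carrier)

lemma AB_eqI: "b \<in> extensional \<Lambda> \<Longrightarrow> c \<in> extensional \<Lambda> \<Longrightarrow> (\<And>i j. (i, j) \<in> \<Lambda> \<Longrightarrow> b (i, j) = c (i, j)) \<Longrightarrow> b = c"
  by (rule extensionalityI[of _ \<Lambda>]) auto

lemma AB_apply:
  assumes "(i, j) \<in> \<Lambda>"
  shows "\<zero>\<^bsub>AB\<^esub> (i, j) = \<zero>\<^bsub>B j i\<^esub>" "(b \<oplus>\<^bsub>AB\<^esub> c) (i, j) = b (i, j) \<oplus>\<^bsub>B j i\<^esub> c (i, j)"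
    "(s \<odot>\<^bsub>AB\<^esub> b) (i, j) = s j \<odot>\<^bsub>B j i\<^esub> b (i, j)" "rsmult AB b s (i, j) = rsmult (B j i) (b (i, j)) (s i)"
  using assms by (simp_all add: AB_simps)

lemma AB_ext: "\<zero>\<^bsub>AB\<^esub> \<in> extensional \<Lambda>" "b \<oplus>\<^bsub>AB\<^esub> c \<in> extensional \<Lambda>" "s \<odot>\<^bsub>AB\<^esub> b \<in> extensional \<Lambda>"
  "rsmult AB b s \<in> extensional \<Lambda>" "b \<in> carrier AB \<Longrightarrow> b \<in> extensional \<Lambda>"
  by (simp_all add: AB_simps)

lemma AB_closedI: "b \<in> extensional \<Lambda> \<Longrightarrow> (\<And>i j. (i, j) \<in> \<Lambda> \<Longrightarrow> b (i, j) \<in> carrier (B j i)) \<Longrightarrow> b \<in> carrier AB"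
  by (auto simp: AB_carrier)

lemma bimodule_AB: "bimodule PR PR AB"
proof -
  note bi = arrow_bimodule_B
  note lm = bimodule.axioms(1)[OF bi]
  note ab = left_module.axioms(2)[OF lm]
  note mon = abelian_group.axioms(1)[OF ab]
  note cl = abelian_monoid.a_closed[OF mon] abelian_monoid.zero_closed[OF mon] abelian_monoid.a_assoc[OF mon]
    abelian_monoid.a_comm[OF mon] abelian_monoid.l_zero[OF mon] AB_mem
    left_module.smult_closed[OF lm] bimodule.rsmult_closed[OF bi]
  note eqs = left_module.smult_l_distr[OF lm] left_module.smult_r_distr[OF lm] left_module.smult_assoc[OF lm]
    left_module.smult_one[OF lm] bimodule.rsmult_r_distr[OF bi] bimodule.rsmult_l_distr[OF bi]
    bimodule.rsmult_assoc[OF bi] bimodule.rsmult_one[OF bi] bimodule.smult_rsmult[OF bi]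
  have "abelian_group AB"
  proof (rule abelian_groupI)
    fix x assume x: "x \<in> carrier AB"
    show "\<exists>y\<in>carrier AB. y \<oplus>\<^bsub>AB\<^esub> x = \<zero>\<^bsub>AB\<^esub>"
    proof (rule bexI)
      show "(\<lambda>(i, j)\<in>\<Lambda>. \<ominus>\<^bsub>B j i\<^esub> x (i, j)) \<in> carrier AB"
        using abelian_group.a_inv_closed[OF ab] AB_mem[OF x] by (intro AB_closedI) auto
      show "(\<lambda>(i, j)\<in>\<Lambda>. \<ominus>\<^bsub>B j i\<^esub> x (i, j)) \<oplus>\<^bsub>AB\<^esub> x = \<zero>\<^bsub>AB\<^esub>"
        using abelian_group.l_neg[OF ab] AB_mem[OF x] by (intro AB_eqI AB_ext) (simp add: AB_apply)
    qed
  qed (use cl in \<open>auto intro!: AB_closedI AB_eqI AB_ext simp: AB_apply AB_ext\<close>)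
  then have "left_module PR AB"
    using cl eqs
    by (intro left_module.intro left_module_axioms.intro ring_product_ring)
      (auto intro!: AB_closedI AB_eqI AB_ext simp: AB_apply AB_ext PR_simps)
  then show ?thesis
    using cl eqs
    by (intro bimodule.intro bimodule_axioms.intro ring_product_ring)
      (auto intro!: AB_closedI AB_eqI AB_ext simp: AB_apply AB_ext PR_simps)
qed

sublocale tr: tensor_ring_bimodule PR AB
  by (rule tensor_ring_bimodule.intro[OF bimodule_AB])

abbreviation "A \<equiv> tr.TR"
abbreviation "atv \<equiv> at_vertex \<M> \<Lambda>"
abbreviation "ata \<equiv> at_arrow \<M> \<Lambda>"
abbreviation "e \<equiv> idem \<M> \<Lambda>"

lemma atv_eq: "atv i s = tr.wc [] (delta i s)"
  by (simp add: at_vertex_def tensor_ring_scalar_def tensor_word_class_def tr.wc_def delta_def)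

lemma ata_eq: "ata i j b = tr.wc [single i j b] \<one>\<^bsub>PR\<^esub>"
  by (simp add: at_arrow_def tensor_ring_elem_def tensor_word_class_def tr.wc_def single_def)

lemma e_eq: "e i = atv i \<one>\<^bsub>k i\<^esub>"
  by (simp add: idem_def)

lemma delta_closed: "s \<in> carrier (k i) \<Longrightarrow> delta i s \<in> carrier PR"
  by (simp add: PR_carrier delta_def k_simps)

lemma delta_mult: "s \<in> carrier (k i) \<Longrightarrow> t \<in> carrier (k i) \<Longrightarrow> delta i s \<otimes>\<^bsub>PR\<^esub> delta i t = delta i (s \<otimes>\<^bsub>k i\<^esub> t)"
  by (auto simp: PR_mult delta_def k_simps)

lemma delta_commute: "r \<in> carrier PR \<Longrightarrow> delta i \<one>\<^bsub>k i\<^esub> \<otimes>\<^bsub>PR\<^esub> r = delta i (r i) \<otimes>\<^bsub>PR\<^esub> delta i \<one>\<^bsub>k i\<^esub>"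
  by (auto simp: PR_mult delta_def k_simps PR_carrier)

lemma delta_add: "s \<in> carrier (k i) \<Longrightarrow> t \<in> carrier (k i) \<Longrightarrow> delta i (s \<oplus>\<^bsub>k i\<^esub> t) = delta i s \<oplus>\<^bsub>PR\<^esub> delta i t"
  by (auto simp: PR_add delta_def k_simps)

lemma B_zero: "(i, j) \<in> \<Lambda> \<Longrightarrow> \<zero>\<^bsub>B j i\<^esub> \<in> carrier (B j i)"
  by (rule abelian_monoid.zero_closed[OF abelian_group.axioms(1)[OF left_module.axioms(2)[OF bimodule.axioms(1)[OF arrow_bimodule_B]]]])

lemma single_closed: "b \<in> carrier (B j i) \<Longrightarrow> single i j b \<in> carrier AB"
  by (rule AB_closedI) (auto simp: single_def B_zero)

lemma single_apply: "(i', j') \<in> \<Lambda> \<Longrightarrow> single i j b (i', j') = (if (i', j') = (i, j) then b else \<zero>\<^bsub>B j' i'\<^esub>)"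
  by (simp add: single_def)

lemma single_ext: "single i j b \<in> extensional \<Lambda>"
  by (simp add: single_def)

lemma single_add:
  assumes "b \<in> carrier (B j i)" "c \<in> carrier (B j i)"
  shows "single i j (b \<oplus>\<^bsub>B j i\<^esub> c) = single i j b \<oplus>\<^bsub>AB\<^esub> single i j c"
proof (rule AB_eqI[OF single_ext AB_ext(2)])
  fix i' j' assume a: "(i', j') \<in> \<Lambda>"
  interpret bimodule "k j'" "k i'" "B j' i'" by (rule arrow_bimodule_B[OF a])
  show "single i j (b \<oplus>\<^bsub>B j i\<^esub> c) (i', j') = (single i j b \<oplus>\<^bsub>AB\<^esub> single i j c) (i', j')"
    using a by (simp add: single_apply AB_apply)
qed

lemma (in bimodule) rsmult_zero: "s \<in> carrier S \<Longrightarrow> rsmult M \<zero>\<^bsub>M\<^esub> s = \<zero>\<^bsub>M\<^esub>"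
  by (rule additive_map_zero[OF M.abelian_group_axioms M.abelian_group_axioms, of "\<lambda>m. rsmult M m s"])
    (auto intro!: additive_mapI rsmult_closed rsmult_l_distr)

lemma single_smult:
  assumes "s \<in> carrier PR" "b \<in> carrier (B j i)"
  shows "s \<odot>\<^bsub>AB\<^esub> single i j b = single i j (s j \<odot>\<^bsub>B j i\<^esub> b)"
proof (rule AB_eqI[OF AB_ext(3) single_ext])
  fix i' j' assume a: "(i', j') \<in> \<Lambda>"
  interpret bimodule "k j'" "k i'" "B j' i'" by (rule arrow_bimodule_B[OF a])
  show "(s \<odot>\<^bsub>AB\<^esub> single i j b) (i', j') = single i j (s j \<odot>\<^bsub>B j i\<^esub> b) (i', j')"
    using a assms by (simp add: single_apply AB_apply PR_carrier)
qed

lemma single_rsmult: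
  assumes "s \<in> carrier PR" "b \<in> carrier (B j i)"
  shows "rsmult AB (single i j b) s = single i j (rsmult (B j i) b (s i))"
proof (rule AB_eqI[OF AB_ext(4) single_ext])
  fix i' j' assume a: "(i', j') \<in> \<Lambda>"
  interpret bimodule "k j'" "k i'" "B j' i'" by (rule arrow_bimodule_B[OF a])
  show "rsmult AB (single i j b) s (i', j') = single i j (rsmult (B j i) b (s i)) (i', j')"
    using a assms by (simp add: single_apply AB_apply PR_carrier rsmult_zero)
qed

lemma atv_closed: "s \<in> carrier (k i) \<Longrightarrow> atv i s \<in> carrier A"
  unfolding atv_eq by (rule tr.wc_closed) (simp_all add: delta_closed)

lemma e_closed: "e i \<in> carrier A"
  unfolding e_eq by (rule atv_closed[OF k_simps(2)])

lemma ata_closed: "b \<in> carrier (B j i) \<Longrightarrow> ata i j b \<in> carrier A"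
  unfolding ata_eq by (rule tr.wc_closed) (simp_all add: single_closed PR_carrier PR_one k_simps)

lemma atv_mult: "s \<in> carrier (k i) \<Longrightarrow> t \<in> carrier (k i) \<Longrightarrow> atv i s \<otimes>\<^bsub>A\<^esub> atv i t = atv i (s \<otimes>\<^bsub>k i\<^esub> t)"
  unfolding atv_eq by (simp add: tr.wc_mult_scalar_right delta_closed delta_mult)

lemma atv_add: "s \<in> carrier (k i) \<Longrightarrow> t \<in> carrier (k i) \<Longrightarrow> atv i (s \<oplus>\<^bsub>k i\<^esub> t) = atv i s \<oplus>\<^bsub>A\<^esub> atv i t"
  unfolding atv_eq delta_add by (rule tr.wc_add_scalar) (simp_all add: delta_closed)

lemma e_atv: "s \<in> carrier (k i) \<Longrightarrow> e i \<otimes>\<^bsub>A\<^esub> atv i s = atv i s" "s \<in> carrier (k i) \<Longrightarrow> atv i s \<otimes>\<^bsub>A\<^esub> e i = atv i s"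
  unfolding e_eq by (simp_all add: atv_mult k_simps)

lemma e_idem: "e i \<otimes>\<^bsub>A\<^esub> e i = e i"
  by (simp add: e_eq atv_mult k_simps)

text \<open>Used where a word is cut after its first letter: of the scalar at the cut, only the
  \<open>i\<close>-th component survives next to \<open>e i\<close>.\<close>

lemma e_scalar:
  assumes "r \<in> carrier PR" "t \<in> carrier A"
  shows "e i \<otimes>\<^bsub>A\<^esub> (tr.wc [] r \<otimes>\<^bsub>A\<^esub> t) = atv i (r i) \<otimes>\<^bsub>A\<^esub> (e i \<otimes>\<^bsub>A\<^esub> t)"
proof -
  have ri: "r i \<in> carrier (k i)" using assms(1) by (simp add: PR_carrier)
  have "e i \<otimes>\<^bsub>A\<^esub> tr.wc [] r = atv i (r i) \<otimes>\<^bsub>A\<^esub> e i"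
    unfolding e_eq atv_eq using assms(1) ri by (simp add: tr.wc_mult_scalar_right delta_closed k_simps delta_commute)
  moreover have "tr.wc [] r \<in> carrier A" using assms(1) by (intro tr.wc_closed) auto
  ultimately show ?thesis using assms(2) e_closed atv_closed[OF ri] by (simp add: tr.mult_assoc[symmetric])
qed

lemma ata_add: "b \<in> carrier (B j i) \<Longrightarrow> c \<in> carrier (B j i) \<Longrightarrow> ata i j (b \<oplus>\<^bsub>B j i\<^esub> c) = ata i j b \<oplus>\<^bsub>A\<^esub> ata i j c"
  unfolding ata_eq single_add
  using tr.wc_add[of "[]" "single i j b" "single i j c" "[]" "\<one>\<^bsub>PR\<^esub>"] by (simp add: single_closed)

lemma atv_ata:
  assumes "s \<in> carrier (k j)" "b \<in> carrier (B j i)"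
  shows "atv j s \<otimes>\<^bsub>A\<^esub> ata i j b = ata i j (s \<odot>\<^bsub>B j i\<^esub> b)"
  unfolding ata_eq atv_eq using assms single_smult[OF delta_closed[OF assms(1)] assms(2)]
  by (simp add: tr.wc_mult_scalar_left delta_closed single_closed) (simp add: delta_def)

lemma ata_atv:
  assumes "s \<in> carrier (k i)" "b \<in> carrier (B j i)"
  shows "ata i j b \<otimes>\<^bsub>A\<^esub> atv i s = ata i j (rsmult (B j i) b s)"
proof -
  have "tr.wc [rsmult AB (single i j b) (delta i s)] \<one>\<^bsub>PR\<^esub> = tr.wc [single i j b] (delta i s \<otimes>\<^bsub>PR\<^esub> \<one>\<^bsub>PR\<^esub>)"
    using tr.wc_last[of "[]" "single i j b" "delta i s" "\<one>\<^bsub>PR\<^esub>"] assms by (simp add: single_closed delta_closed)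
  also have "delta i s \<otimes>\<^bsub>PR\<^esub> \<one>\<^bsub>PR\<^esub> = delta i s" by (rule ext) (use assms in \<open>simp add: PR_mult PR_one delta_def k_simps\<close>)
  also have "tr.wc [single i j b] (delta i s) = tr.wc [single i j b] (\<one>\<^bsub>PR\<^esub> \<otimes>\<^bsub>PR\<^esub> delta i s)"
    using assms by (intro arg_cong[of _ _ "tr.wc _"] ext) (simp add: PR_mult PR_one delta_def k_simps)
  also have "\<dots> = tr.wc [single i j b] \<one>\<^bsub>PR\<^esub> \<otimes>\<^bsub>A\<^esub> tr.wc [] (delta i s)"
    using assms by (simp add: tr.wc_mult_scalar_right delta_closed single_closed)
  finally show ?thesis
    unfolding ata_eq atv_eq using single_rsmult[OF delta_closed[OF assms(1)] assms(2)] by (simp add: delta_def)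
qed

lemma e_ata:
  assumes "(i, j) \<in> \<Lambda>" "b \<in> carrier (B j i)"
  shows "e j \<otimes>\<^bsub>A\<^esub> ata i j b = ata i j b" "ata i j b \<otimes>\<^bsub>A\<^esub> e i = ata i j b"
proof -
  interpret bimodule "k j" "k i" "B j i" by (rule arrow_bimodule_B[OF assms(1)])
  show "e j \<otimes>\<^bsub>A\<^esub> ata i j b = ata i j b" "ata i j b \<otimes>\<^bsub>A\<^esub> e i = ata i j b"
    unfolding e_eq using assms by (simp_all add: atv_ata ata_atv k_simps smult_one rsmult_one)
qed

lemma ata_word:
  assumes "(i, j) \<in> \<Lambda>" "b \<in> carrier (B j i)" "set bs \<subseteq> carrier AB" "s \<in> carrier PR"
  shows "ata i j b \<otimes>\<^bsub>A\<^esub> tr.wc bs s = tr.wc (single i j b # bs) s"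
  unfolding ata_eq using assms by (simp add: tr.wc_mult_elem single_closed)

end

section \<open>The spaces and structure maps of an indecomposable projective\<close>

locale projective_at = oriented_modulation \<M> \<Lambda>
  for \<M> :: "('i::finite, 'r, 'b, 'f) modulation" and \<Lambda> +
  fixes x :: 'i
begin

definition P where "P = spc (projective_rep \<M> \<Lambda> x)"

lemma P_simps:
  shows P_carrier: "carrier (P i) = (\<lambda>n. e i \<otimes>\<^bsub>A\<^esub> n) ` (\<lambda>t. t \<otimes>\<^bsub>A\<^esub> e x) ` carrier A"
    and P_zero: "\<zero>\<^bsub>P i\<^esub> = \<zero>\<^bsub>A\<^esub>"
    and P_add: "m \<oplus>\<^bsub>P i\<^esub> n = m \<oplus>\<^bsub>A\<^esub> n"
    and P_smult: "s \<odot>\<^bsub>P i\<^esub> n = atv i s \<otimes>\<^bsub>A\<^esub> n"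
  by (simp_all add: P_def projective_rep_def rep_of_module_def projective_module_def Let_def quiver_algebra_def)

lemma mp_P: "mp (projective_rep \<M> \<Lambda> x) i j =
  (\<lambda>t\<in>carrier (tens j i (P i)). tensor_lift (P j) (\<lambda>b n. ata i j b \<otimes>\<^bsub>A\<^esub> n) t)"
  by (simp add: P_def projective_rep_def rep_of_module_def projective_module_def Let_def quiver_algebra_def)

text \<open>Replaces the nested images by equations: the space at \<open>i\<close> is
  \<open>e_i A e_x\<close>, and it consists of the elements fixed by the idempotents on both
  sides.\<close>

lemma P_iff: "n \<in> carrier (P i) \<longleftrightarrow> n \<in> carrier A \<and> e i \<otimes>\<^bsub>A\<^esub> n = n \<and> n \<otimes>\<^bsub>A\<^esub> e x = n"
proof
  assume "n \<in> carrier (P i)"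
  then obtain t where t: "t \<in> carrier A" "n = e i \<otimes>\<^bsub>A\<^esub> (t \<otimes>\<^bsub>A\<^esub> e x)" by (auto simp: P_carrier)
  show "n \<in> carrier A \<and> e i \<otimes>\<^bsub>A\<^esub> n = n \<and> n \<otimes>\<^bsub>A\<^esub> e x = n"
  proof (intro conjI)
    show "n \<in> carrier A" using t e_closed by (simp add: tr.mult_closed)
    have "e i \<otimes>\<^bsub>A\<^esub> (e i \<otimes>\<^bsub>A\<^esub> (t \<otimes>\<^bsub>A\<^esub> e x)) = (e i \<otimes>\<^bsub>A\<^esub> e i) \<otimes>\<^bsub>A\<^esub> (t \<otimes>\<^bsub>A\<^esub> e x)"
      using t e_closed by (intro tr.mult_assoc[symmetric] tr.mult_closed)
    then show "e i \<otimes>\<^bsub>A\<^esub> n = n" by (simp add: t(2) e_idem)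
    have "(e i \<otimes>\<^bsub>A\<^esub> (t \<otimes>\<^bsub>A\<^esub> e x)) \<otimes>\<^bsub>A\<^esub> e x = e i \<otimes>\<^bsub>A\<^esub> (t \<otimes>\<^bsub>A\<^esub> (e x \<otimes>\<^bsub>A\<^esub> e x))"
      using t e_closed by (simp add: tr.mult_assoc tr.mult_closed)
    then show "n \<otimes>\<^bsub>A\<^esub> e x = n" by (simp add: t(2) e_idem)
  qed
next
  assume n: "n \<in> carrier A \<and> e i \<otimes>\<^bsub>A\<^esub> n = n \<and> n \<otimes>\<^bsub>A\<^esub> e x = n"
  have "n = e i \<otimes>\<^bsub>A\<^esub> (n \<otimes>\<^bsub>A\<^esub> e x)" using n by simp
  then show "n \<in> carrier (P i)" unfolding P_carrier using n by (intro image_eqI[of _ _ "n \<otimes>\<^bsub>A\<^esub> e x"]) auto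
qed

text \<open>The projection of the whole algebra onto the space at \<open>i\<close>. It is needed
  because the tail of a word need not lie in any of these spaces.\<close>

definition \<phi> where "\<phi> i t = e i \<otimes>\<^bsub>A\<^esub> (t \<otimes>\<^bsub>A\<^esub> e x)"

lemma \<phi>_closed: "t \<in> carrier A \<Longrightarrow> \<phi> i t \<in> carrier (P i)"
  by (auto simp: P_carrier \<phi>_def)

lemma \<phi>_P: "n \<in> carrier (P i) \<Longrightarrow> \<phi> i n = n"
  by (simp add: P_iff \<phi>_def)

lemma \<phi>_additive: "additive_map A A (\<phi> i)"
  unfolding \<phi>_def
  by (rule additive_map_comp[OF tr.mult_additive_left[OF e_closed] tr.mult_additive_right[OF e_closed]])

lemma \<phi>_additive_P: "additive_map A (P i) (\<phi> i)"
  using \<phi>_additive[of i] \<phi>_closed by (auto simp: additive_map_def P_add)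

lemma P_left_module: "left_module (k i) (P i)"
proof -
  note ml = additive_mapD[OF tr.mult_additive_left] and mr = additive_mapD[OF tr.mult_additive_right]
  have "abelian_group (P i)"
  proof (rule abelian_groupI)
    fix m n assume "m \<in> carrier (P i)" "n \<in> carrier (P i)"
    then show "m \<oplus>\<^bsub>P i\<^esub> n \<in> carrier (P i)" using ml mr e_closed by (simp add: P_iff P_add)
  next
    show "\<zero>\<^bsub>P i\<^esub> \<in> carrier (P i)"
      using additive_map_zero[OF tr.TR.abelian_group_axioms tr.TR.abelian_group_axioms tr.mult_additive_left[OF e_closed]]
        additive_map_zero[OF tr.TR.abelian_group_axioms tr.TR.abelian_group_axioms tr.mult_additive_right[OF e_closed]]
      by (simp add: P_iff P_zero)
  next
    fix m assume m: "m \<in> carrier (P i)"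
    have "\<ominus>\<^bsub>A\<^esub> m \<in> carrier (P i)"
      using m additive_map_neg[OF tr.TR.abelian_group_axioms tr.TR.abelian_group_axioms tr.mult_additive_left[OF e_closed]]
        additive_map_neg[OF tr.TR.abelian_group_axioms tr.TR.abelian_group_axioms tr.mult_additive_right[OF e_closed]]
      by (simp add: P_iff)
    then show "\<exists>y\<in>carrier (P i). y \<oplus>\<^bsub>P i\<^esub> m = \<zero>\<^bsub>P i\<^esub>"
      using m by (intro bexI[of _ "\<ominus>\<^bsub>A\<^esub> m"]) (auto simp: P_iff P_add P_zero tr.TR.l_neg)
  qed (auto simp: P_iff P_add P_zero tr.TR.a_ac)
  then show ?thesis
  proof (intro left_module.intro left_module_axioms.intro ring_k)
    fix a m assume a: "a \<in> carrier (k i)" and "m \<in> carrier (P i)"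
    then have m: "m \<in> carrier A" "e i \<otimes>\<^bsub>A\<^esub> m = m" "m \<otimes>\<^bsub>A\<^esub> e x = m" by (auto simp: P_iff)
    note c = atv_closed[OF a] e_closed
    show "a \<odot>\<^bsub>P i\<^esub> m \<in> carrier (P i)"
      unfolding P_smult P_iff
      using m c e_atv[OF a] by (simp add: tr.mult_closed tr.mult_assoc) (simp add: tr.mult_assoc[symmetric] e_atv[OF a])
    fix b assume b: "b \<in> carrier (k i)"
    show "(a \<oplus>\<^bsub>k i\<^esub> b) \<odot>\<^bsub>P i\<^esub> m = a \<odot>\<^bsub>P i\<^esub> m \<oplus>\<^bsub>P i\<^esub> b \<odot>\<^bsub>P i\<^esub> m"
      using a b m ml atv_closed by (simp add: P_smult P_add atv_add)
    show "(a \<otimes>\<^bsub>k i\<^esub> b) \<odot>\<^bsub>P i\<^esub> m = a \<odot>\<^bsub>P i\<^esub> (b \<odot>\<^bsub>P i\<^esub> m)"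
      using a b m atv_closed by (simp add: P_smult atv_mult[symmetric] tr.mult_assoc)
  next
    fix a m n assume a: "a \<in> carrier (k i)" and "m \<in> carrier (P i)" "n \<in> carrier (P i)"
    then show "a \<odot>\<^bsub>P i\<^esub> (m \<oplus>\<^bsub>P i\<^esub> n) = a \<odot>\<^bsub>P i\<^esub> m \<oplus>\<^bsub>P i\<^esub> a \<odot>\<^bsub>P i\<^esub> n"
      using mr atv_closed by (simp add: P_smult P_add P_iff)
  qed (auto simp: P_smult P_iff e_eq[symmetric])
qed

lemma tensor_P: "(i, j) \<in> \<Lambda> \<Longrightarrow> tensor_product (k j) (k i) (B j i) (P i)"
  by (rule tensor_product.intro[OF arrow_bimodule_B P_left_module])

lemma ata_P_closed:
  assumes "(i, j) \<in> \<Lambda>" "b \<in> carrier (B j i)" "n \<in> carrier (P i)"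
  shows "ata i j b \<otimes>\<^bsub>A\<^esub> n \<in> carrier (P j)"
  using assms ata_closed[OF assms(2)] e_ata[OF assms(1,2)] e_closed
  by (simp add: P_iff tr.mult_closed tr.mult_assoc) (simp add: tr.mult_assoc[symmetric] e_ata[OF assms(1,2)])

lemma ata_balanced:
  assumes "(i, j) \<in> \<Lambda>"
  shows "balanced (k i) (B j i) (P i) (P j) (\<lambda>b n. ata i j b \<otimes>\<^bsub>A\<^esub> n)"
  unfolding balanced_def
proof (intro conjI ballI)
  fix b assume b: "b \<in> carrier (B j i)"
  show "additive_map (P i) (P j) (\<lambda>n. ata i j b \<otimes>\<^bsub>A\<^esub> n)"
    using ata_P_closed[OF assms b] additive_map_add[OF tr.mult_additive_right[OF ata_closed[OF b]]]
    by (intro additive_mapI) (auto simp: P_add P_iff)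
  fix s n assume "s \<in> carrier (k i)" "n \<in> carrier (P i)"
  then show "ata i j (rsmult (B j i) b s) \<otimes>\<^bsub>A\<^esub> n = ata i j b \<otimes>\<^bsub>A\<^esub> (s \<odot>\<^bsub>P i\<^esub> n)"
    using b ata_closed[OF b] atv_closed by (simp add: P_smult P_iff ata_atv[symmetric] tr.mult_assoc)
next
  fix n assume n: "n \<in> carrier (P i)"
  then have nA: "n \<in> carrier A" by (simp add: P_iff)
  show "additive_map (B j i) (P j) (\<lambda>b. ata i j b \<otimes>\<^bsub>A\<^esub> n)"
    using ata_P_closed[OF assms _ n] additive_map_add[OF tr.mult_additive_left[OF nA]]
    by (intro additive_mapI) (auto simp: P_add ata_add ata_closed)
qed

lemma mp_P_additive: "(i, j) \<in> \<Lambda> \<Longrightarrow> additive_map (tens j i (P i)) (P j) (mp (projective_rep \<M> \<Lambda> x) i j)"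
proof -
  assume ij: "(i, j) \<in> \<Lambda>"
  interpret tensor_product "k j" "k i" "B j i" "P i" by (rule tensor_P[OF ij])
  interpret Pj: left_module "k j" "P j" by (rule P_left_module)
  show ?thesis
    using tensor_lift_additive[OF Pj.M.abelian_group_axioms ata_balanced[OF ij]]
    by (auto simp: mp_P arrow_tensor_def additive_map_def)
qed

lemma mp_P_pure:
  assumes "(i, j) \<in> \<Lambda>" "b \<in> carrier (B j i)" "n \<in> carrier (P i)"
  shows "mp (projective_rep \<M> \<Lambda> x) i j (pure_tensor (k i) (B j i) (P i) b n) = ata i j b \<otimes>\<^bsub>A\<^esub> n"
proof -
  interpret tensor_product "k j" "k i" "B j i" "P i" by (rule tensor_P[OF assms(1)])
  interpret Pj: left_module "k j" "P j" by (rule P_left_module)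
  show ?thesis
    using tensor_lift_pure[OF Pj.M.abelian_group_axioms ata_balanced[OF assms(1)] assms(2,3)] pure_closed[OF assms(2,3)]
    by (simp add: mp_P arrow_tensor_def)
qed

text \<open>Splitting off the first letter of a word is a retraction of \<open>b \<otimes> n \<mapsto> b n\<close>.\<close>

definition peel where
  "peel z y = presented_lift (tens y z (P z)) (\<lambda>(bs, s). case bs of [] \<Rightarrow> \<zero>\<^bsub>tens y z (P z)\<^esub>
     | b # bs' \<Rightarrow> pure_tensor (k z) (B y z) (P z) (b (z, y)) (\<phi> z (tr.wc bs' s)))"

text \<open>A relator may lie in the first letter, in the tail, or at the seam between them. The
  first kind is respected because the tensor product is additive in the left factor, the second
  because it already holds in the algebra, the third by the balancing relation.\<close>

lemma peel_props:
  assumes zy: "(z, y) \<in> \<Lambda>"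
  shows peel_additive: "additive_map A (tens y z (P z)) (peel z y)"
    and peel_word: "b \<in> carrier AB \<Longrightarrow> set bs \<subseteq> carrier AB \<Longrightarrow> s \<in> carrier PR \<Longrightarrow>
      peel z y (tr.wc (b # bs) s) = pure_tensor (k z) (B y z) (P z) (b (z, y)) (\<phi> z (tr.wc bs s))"
proof -
  interpret tp: tensor_product "k y" "k z" "B y z" "P z" by (rule tensor_P[OF zy])
  define g where "g = (\<lambda>(bs, s). case bs of [] \<Rightarrow> \<zero>\<^bsub>tp.T\<^esub>
     | b # bs' \<Rightarrow> tp.pure (b (z, y)) (\<phi> z (tr.wc bs' s)))"
  have g_nil: "g ([], s) = \<zero>\<^bsub>tp.T\<^esub>" for s by (simp add: g_def)
  have g_cons: "g (b # bs, s) = tp.pure (b (z, y)) (\<phi> z (tr.wc bs s))" for b bs s by (simp add: g_def)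
  have gc: "g w \<in> carrier tp.T" if w: "w \<in> tr.words" for w
  proof (cases w)
    case (Pair bs s)
    then show ?thesis
      using w AB_mem[OF _ zy] tr.wc_closed \<phi>_closed
      by (cases bs) (auto simp: g_nil g_cons tr.words_iff intro!: tp.pure_closed)
  qed
  have gX: "g \<in> tr.words \<rightarrow> carrier tp.T" using gc by auto
  have ev: "frag_eval tp.T g (frag_of w) = g w" if "w \<in> tr.words" for w
    using frag_eval_frag_of[OF tp.T.abelian_group_axioms, of g w] gc[OF that] by simp
  have ev2: "frag_eval tp.T g (frag_of v - frag_of w) = \<zero>\<^bsub>tp.T\<^esub>"
    if "v \<in> tr.words" "w \<in> tr.words" "g v = g w" for v w
    using that gc by (simp add: frag_eval_diff[OF tp.T.abelian_group_axioms gX] ev tp.T.minus_self)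
  have ev3: "frag_eval tp.T g (frag_of u - frag_of v - frag_of w) = \<zero>\<^bsub>tp.T\<^esub>"
    if "u \<in> tr.words" "v \<in> tr.words" "w \<in> tr.words" "g u = g v \<oplus>\<^bsub>tp.T\<^esub> g w" for u v w
  proof -
    have k: "Poly_Mapping.keys (frag_of u - frag_of v) \<subseteq> tr.words" using that keys_diff[of "frag_of u" "frag_of v"] by auto
    show ?thesis
      using that gc k
      by (simp add: frag_eval_diff[OF tp.T.abelian_group_axioms gX] ev tp.T.add_minus_minus)
  qed
  have \<phi>a: "\<phi> z (s \<oplus>\<^bsub>A\<^esub> t) = \<phi> z s \<oplus>\<^bsub>P z\<^esub> \<phi> z t" if "s \<in> carrier A" "t \<in> carrier A" for s t
    by (rule additive_map_add[OF \<phi>_additive_P that])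
  \<comment> \<open>The seam: a scalar \<open>r\<close> moved from the first letter to the tail acts
    there through its component \<open>r z\<close> alone.\<close>
  have \<phi>s: "tp.pure (rsmult AB b r (z, y)) (\<phi> z t) = tp.pure (b (z, y)) (\<phi> z (tr.wc [] r \<otimes>\<^bsub>A\<^esub> t))"
    if "b \<in> carrier AB" "r \<in> carrier PR" "t \<in> carrier A" for b r t
  proof -
    have rz: "r z \<in> carrier (k z)" using that(2) by (simp add: PR_carrier)
    have rc: "tr.wc [] r \<in> carrier A" using that(2) by (intro tr.wc_closed) auto
    have "\<phi> z (tr.wc [] r \<otimes>\<^bsub>A\<^esub> t) = r z \<odot>\<^bsub>P z\<^esub> \<phi> z t"
      using that rc e_closed by (simp add: \<phi>_def P_smult tr.mult_assoc e_scalar tr.mult_closed)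
    then show ?thesis
      using tp.pure_rsmult[OF AB_mem[OF that(1) zy] rz \<phi>_closed[OF that(3)]] zy by (simp add: AB_apply)
  qed
  have Q: "frag_eval tp.T g q = \<zero>\<^bsub>tp.T\<^esub>" if "q \<in> tensor_word_rel PR AB" for q
    using that
  proof (cases rule: tensor_word_rel_cases)
    case (add us b b' ws s)
    have "g (us @ (b \<oplus>\<^bsub>AB\<^esub> b') # ws, s) = g (us @ b # ws, s) \<oplus>\<^bsub>tp.T\<^esub> g (us @ b' # ws, s)"
    proof (cases us)
      case Nil
      then show ?thesis
        using add AB_mem[OF _ zy] \<phi>_closed tr.wc_closed zy by (simp add: g_cons AB_apply tp.pure_add_left)
    next
      case (Cons u us')
      then show ?thesis
        using add AB_mem[OF _ zy] \<phi>_closed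
        by (simp add: g_cons tr.wc_add \<phi>a tr.wc_closed tp.pure_add_right)
    qed
    then show ?thesis using add by (simp only: add(1)) (intro ev3, auto simp: tr.words_iff)
  next
    case (add_scalar us s s')
    have "g (us, s \<oplus>\<^bsub>PR\<^esub> s') = g (us, s) \<oplus>\<^bsub>tp.T\<^esub> g (us, s')"
    proof (cases us)
      case (Cons u us')
      then show ?thesis
        using add_scalar AB_mem[OF _ zy] \<phi>_closed
        by (simp add: g_cons tr.wc_add_scalar \<phi>a tr.wc_closed tp.pure_add_right)
    qed (simp add: g_nil)
    then show ?thesis using add_scalar by (simp only: add_scalar(1)) (intro ev3, auto simp: tr.words_iff)
  next
    case (middle us b r b' ws s)
    have "g (us @ rsmult AB b r # b' # ws, s) = g (us @ b # (r \<odot>\<^bsub>AB\<^esub> b') # ws, s)"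
    proof (cases us)
      case Nil
      then show ?thesis
        using middle \<phi>s[of b r "tr.wc (b' # ws) s"]
        by (simp add: g_cons tr.wc_closed tr.wc_mult_scalar_left)
    next
      case (Cons u us')
      then show ?thesis using middle by (simp add: g_cons tr.wc_middle)
    qed
    then show ?thesis
      using middle by (simp only: middle(1)) (intro ev2, auto simp: tr.words_iff tr.rsmult_closed tr.smult_closed)
  next
    case (last us b r s)
    have "g (us @ [rsmult AB b r], s) = g (us @ [b], r \<otimes>\<^bsub>PR\<^esub> s)"
    proof (cases us)
      case Nil
      then show ?thesis
        using last \<phi>s[of b r "tr.wc [] s"] by (simp add: g_cons tr.wc_closed tr.wc_mult_scalar_right)
    next
      case (Cons u us')
      then show ?thesis using last by (simp add: g_cons tr.wc_last)
    qed
    then show ?thesis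
      using last by (simp only: last(1)) (intro ev2, auto simp: tr.words_iff tr.rsmult_closed)
  qed
  have eq: "peel z y = presented_lift tp.T g" unfolding peel_def g_def arrow_tensor_def ..
  show "additive_map A (tens y z (P z)) (peel z y)"
    unfolding eq arrow_tensor_def by (rule tr.presented_lift_additive[OF tp.T.abelian_group_axioms gX Q])
  show "peel z y (tr.wc (b # bs) s) = tp.pure (b (z, y)) (\<phi> z (tr.wc bs s))"
    if "b \<in> carrier AB" "set bs \<subseteq> carrier AB" "s \<in> carrier PR"
  proof -
    have "presented_lift tp.T g (tr.cls (frag_of (b # bs, s))) = g (b # bs, s)"
      by (rule tr.presented_lift_gen[OF tp.T.abelian_group_axioms gX Q]) (use that in \<open>simp_all add: tr.words_iff\<close>)
    then show ?thesis by (simp add: eq tr.wc_def g_cons)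
  qed
qed

text \<open>\<open>single z' y b\<close> vanishes at every arrow but its own, so its component at
  the arrow from \<open>z\<close> to \<open>y\<close> is \<open>b\<close> or 0.\<close>

lemma peel_ata:
  assumes zy: "(z, y) \<in> \<Lambda>" and z'y: "(z', y) \<in> \<Lambda>" and b: "b \<in> carrier (B y z')" and t: "t \<in> carrier A"
  shows "peel z y (ata z' y b \<otimes>\<^bsub>A\<^esub> t) = (if z' = z then pure_tensor (k z) (B y z) (P z) b (\<phi> z t) else \<zero>\<^bsub>tens y z (P z)\<^esub>)"
proof -
  interpret tp: tensor_product "k y" "k z" "B y z" "P z" by (rule tensor_P[OF zy])
  interpret Pz: left_module "k z" "P z" by (rule P_left_module)
  let ?s = "single z' y b (z, y)"
  have s: "?s \<in> carrier (B y z)" by (rule AB_mem[OF single_closed[OF b] zy])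
  have add_pure: "additive_map (P z) tp.T (tp.pure ?s)" using tp.balanced_pure s by (simp add: balanced_def)
  have "peel z y (ata z' y b \<otimes>\<^bsub>A\<^esub> t) = tp.pure ?s (\<phi> z t)"
  proof (rule tr.additive_eqI[OF tp.T.abelian_group_axioms _ _ _ t])
    show "additive_map A tp.T (\<lambda>t. peel z y (ata z' y b \<otimes>\<^bsub>A\<^esub> t))"
      using additive_map_comp[OF tr.mult_additive_right[OF ata_closed[OF b]] peel_additive[OF zy]] by (simp add: arrow_tensor_def)
    show "additive_map A tp.T (\<lambda>t. tp.pure ?s (\<phi> z t))"
      by (rule additive_map_comp[OF \<phi>_additive_P add_pure])
    fix w assume "w \<in> tr.words"
    then obtain bs s where w: "w = (bs, s)" "set bs \<subseteq> carrier AB" "s \<in> carrier PR" by (cases w) (auto simp: tr.words_iff)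
    then show "peel z y (ata z' y b \<otimes>\<^bsub>A\<^esub> tr.cls (frag_of w)) = tp.pure ?s (\<phi> z (tr.cls (frag_of w)))"
      using ata_word[OF z'y b w(2,3)] peel_word[OF zy single_closed[OF b] w(2,3)] by (simp add: tr.wc_def)
  qed
  moreover have "tp.pure \<zero>\<^bsub>B y z\<^esub> (\<phi> z t) = \<zero>\<^bsub>tp.T\<^esub>"
    using tp.balanced_pure \<phi>_closed[OF t]
    by (intro additive_map_zero[OF tp.B.M.abelian_group_axioms tp.T.abelian_group_axioms, of "\<lambda>b. tp.pure b (\<phi> z t)"])
      (simp add: balanced_def)
  ultimately show ?thesis using zy by (auto simp: single_apply arrow_tensor_def)
qed

text \<open>Thus \<open>peel z y\<close> picks out the summand of \<open>z\<close> from the map that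
  the arrows ending at \<open>y\<close> induce on the direct sum, which is therefore
  injective.\<close>

lemma peel_mp:
  assumes zy: "(z, y) \<in> \<Lambda>" and z'y: "(z', y) \<in> \<Lambda>" and t: "t \<in> carrier (tens y z' (P z'))"
  shows "peel z y (mp (projective_rep \<M> \<Lambda> x) z' y t) = (if z' = z then t else \<zero>\<^bsub>tens y z (P z)\<^esub>)"
proof -
  interpret tp: tensor_product "k y" "k z" "B y z" "P z" by (rule tensor_P[OF zy])
  interpret tp': tensor_product "k y" "k z'" "B y z'" "P z'" by (rule tensor_P[OF z'y])
  have mpA: "additive_map tp'.T A (mp (projective_rep \<M> \<Lambda> x) z' y)"
    using mp_P_additive[OF z'y] by (auto simp: additive_map_def arrow_tensor_def P_add P_iff)
  have pm: "additive_map tp'.T tp.T (\<lambda>t. peel z y (mp (projective_rep \<M> \<Lambda> x) z' y t))"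
    using additive_map_comp[OF mpA peel_additive[OF zy]] by (simp add: arrow_tensor_def)
  have "peel z y (mp (projective_rep \<M> \<Lambda> x) z' y (tp'.pure b n)) = (if z' = z then tp'.pure b n else \<zero>\<^bsub>tp.T\<^esub>)"
    if "b \<in> carrier (B y z')" "n \<in> carrier (P z')" for b n
    using peel_ata[OF zy z'y that(1), of n] that mp_P_pure[OF z'y that] \<phi>_P by (auto simp: P_iff arrow_tensor_def)
  note pure = this
  show ?thesis
  proof (cases "z' = z")
    case True
    have "peel z y (mp (projective_rep \<M> \<Lambda> x) z' y t) = t"
    proof (rule tp'.tensor_eqI[OF tp'.T.abelian_group_axioms _ _ t[unfolded arrow_tensor_def]])
      show "additive_map tp'.T tp'.T (\<lambda>t. peel z y (mp (projective_rep \<M> \<Lambda> x) z' y t))" using pm True by simp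
      show "additive_map tp'.T tp'.T (\<lambda>t. t)" by (rule additive_mapI) simp_all
    qed (use pure True in simp)
    then show ?thesis using True by simp
  next
    case False
    have "peel z y (mp (projective_rep \<M> \<Lambda> x) z' y t) = \<zero>\<^bsub>tp.T\<^esub>"
    proof (rule tp'.tensor_eqI[OF tp.T.abelian_group_axioms pm _ t[unfolded arrow_tensor_def]])
      show "additive_map tp'.T tp.T (\<lambda>t. \<zero>\<^bsub>tp.T\<^esub>)" by (rule additive_mapI) simp_all
    qed (use pure False in simp)
    then show ?thesis using False by (simp add: arrow_tensor_def)
  qed
qed

text \<open>In a ring given by generators and relations, an element is seen to be nonzero by means
  of a map out of the ring: here the additive map reading the \<open>x\<close>-component of the part
  of degree zero.\<close>

lemma e_nonzero: "e x \<in> carrier (P x)" "e x \<noteq> \<zero>\<^bsub>A\<^esub>"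
proof -
  show "e x \<in> carrier (P x)" by (simp add: P_iff e_closed e_idem)
  let ?M = "scalar_module (k x) (\<lambda>a. a)"
  have M: "abelian_group ?M"
  proof -
    interpret K: ring "k x" by (rule ring_k)
    show ?thesis
    proof (rule abelian_groupI)
      fix y assume "y \<in> carrier ?M"
      then show "\<exists>z\<in>carrier ?M. z \<oplus>\<^bsub>?M\<^esub> y = \<zero>\<^bsub>?M\<^esub>"
        by (intro bexI[of _ "\<ominus>\<^bsub>k x\<^esub> y"]) (simp_all add: scalar_module_def K.l_neg)
    qed (simp_all add: scalar_module_def K.a_assoc, simp add: scalar_module_def K.a_comm)
  qed
  interpret M: abelian_group ?M by (rule M)
  define g where "g = (\<lambda>(bs :: ('i \<times> 'i \<Rightarrow> 'b) list, s :: 'i \<Rightarrow> 'r). if bs = [] then s x else \<zero>\<^bsub>k x\<^esub>)"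
  have gX: "g \<in> tr.words \<rightarrow> carrier ?M"
    by (auto simp: g_def scalar_module_def tr.words_iff PR_carrier k_simps)
  have gc: "g w \<in> carrier ?M" if "w \<in> tr.words" for w using gX that by auto
  have z: "\<zero>\<^bsub>?M\<^esub> = \<zero>\<^bsub>k x\<^esub>" "\<And>a b. a \<oplus>\<^bsub>?M\<^esub> b = a \<oplus>\<^bsub>k x\<^esub> b" by (simp_all add: scalar_module_def)
  have ev: "frag_eval ?M g (frag_of w) = g w" if "w \<in> tr.words" for w
    using frag_eval_frag_of[OF M, of g w] gc[OF that] by simp
  have ev2: "frag_eval ?M g (frag_of v - frag_of w) = \<zero>\<^bsub>?M\<^esub>"
    if "v \<in> tr.words" "w \<in> tr.words" "g v = g w" for v w
    using that gc by (simp add: frag_eval_diff[OF M gX] ev M.minus_self)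
  have ev3: "frag_eval ?M g (frag_of u - frag_of v - frag_of w) = \<zero>\<^bsub>?M\<^esub>"
    if "u \<in> tr.words" "v \<in> tr.words" "w \<in> tr.words" "g u = g v \<oplus>\<^bsub>?M\<^esub> g w" for u v w
  proof -
    have k: "Poly_Mapping.keys (frag_of u - frag_of v) \<subseteq> tr.words" using that keys_diff[of "frag_of u" "frag_of v"] by auto
    show ?thesis
      using that gc k by (simp add: frag_eval_diff[OF M gX] ev M.add_minus_minus)
  qed
  have Q: "frag_eval ?M g q = \<zero>\<^bsub>?M\<^esub>" if "q \<in> tensor_word_rel PR AB" for q
    using that
  proof (cases rule: tensor_word_rel_cases)
    case (add us b b' ws s)
    then show ?thesis
      by (simp only: add(1)) (intro ev3, auto simp: tr.words_iff g_def z k_simps)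
  next
    case (add_scalar us s s')
    then show ?thesis
      by (simp only: add_scalar(1)) (intro ev3, auto simp: tr.words_iff g_def z PR_add PR_carrier k_simps)
  next
    case (middle us b r b' ws s)
    then show ?thesis
      by (simp only: middle(1)) (intro ev2, auto simp: tr.words_iff g_def tr.rsmult_closed tr.smult_closed)
  next
    case (last us b r s)
    then show ?thesis
      by (simp only: last(1)) (intro ev2, auto simp: tr.words_iff g_def tr.rsmult_closed)
  qed
  show "e x \<noteq> \<zero>\<^bsub>A\<^esub>"
  proof
    assume "e x = \<zero>\<^bsub>A\<^esub>"
    moreover have "presented_lift ?M g \<zero>\<^bsub>A\<^esub> = \<zero>\<^bsub>?M\<^esub>"
      by (rule additive_map_zero[OF tr.TR.abelian_group_axioms M tr.presented_lift_additive[OF M gX Q]])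
    moreover have "presented_lift ?M g (tr.cls (frag_of ([], delta x \<one>\<^bsub>k x\<^esub>))) = g ([], delta x \<one>\<^bsub>k x\<^esub>)"
      by (rule tr.presented_lift_gen[OF M gX Q]) (simp_all add: tr.words_iff delta_closed k_simps)
    ultimately have "\<one>\<^bsub>k x\<^esub> = \<zero>\<^bsub>k x\<^esub>"
      by (simp add: e_eq atv_eq tr.wc_def g_def z delta_def)
    then show False using division_ring_k[of x] by (simp add: division_ring_def)
  qed
qed

text \<open>An element of \<open>AB\<close> is the finite sum of its components. The induction runs
  over the set \<open>X\<close> of arrows at which \<open>b\<close> is retained, all other
  components being set to 0.\<close>

lemma AB_additive_zero:
  assumes f: "additive_map AB A f" and z: "\<And>i j. (i, j) \<in> \<Lambda> \<Longrightarrow> f (single i j (b (i, j))) = \<zero>\<^bsub>A\<^esub>" and b: "b \<in> carrier AB"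
  shows "f b = \<zero>\<^bsub>A\<^esub>"
proof -
  have "f (\<lambda>a\<in>\<Lambda>. if a \<in> X then b a else \<zero>\<^bsub>AB\<^esub> a) = \<zero>\<^bsub>A\<^esub>" if "finite X" for X
    using that
  proof (induction X)
    case empty
    have "(\<lambda>a\<in>\<Lambda>. if a \<in> {} then b a else \<zero>\<^bsub>AB\<^esub> a) = \<zero>\<^bsub>AB\<^esub>"
      by (rule AB_eqI) (auto simp: AB_ext)
    then show ?case by (simp add: additive_map_zero[OF tr.M.abelian_group_axioms tr.TR.abelian_group_axioms f])
  next
    case (insert a X)
    obtain i j where a: "a = (i, j)" by (cases a)
    show ?case
    proof (cases "a \<in> \<Lambda>")
      case False
      then have "(\<lambda>c\<in>\<Lambda>. if c \<in> insert a X then b c else \<zero>\<^bsub>AB\<^esub> c) = (\<lambda>c\<in>\<Lambda>. if c \<in> X then b c else \<zero>\<^bsub>AB\<^esub> c)"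
        by (intro restrict_ext) auto
      then show ?thesis using insert by simp
    next
      case True
      let ?r = "\<lambda>c\<in>\<Lambda>. if c \<in> X then b c else \<zero>\<^bsub>AB\<^esub> c"
      have rc: "?r \<in> carrier AB"
        using b by (intro AB_closedI) (auto simp: AB_mem AB_apply B_zero)
      have sc: "single i j (b (i, j)) \<in> carrier AB" using AB_mem[OF b] True a by (simp add: single_closed)
      have "(\<lambda>c\<in>\<Lambda>. if c \<in> insert a X then b c else \<zero>\<^bsub>AB\<^esub> c) = single i j (b (i, j)) \<oplus>\<^bsub>AB\<^esub> ?r"
      proof (rule AB_eqI)
        fix i' j' assume c: "(i', j') \<in> \<Lambda>"
        interpret bimodule "k j'" "k i'" "B j' i'" by (rule arrow_bimodule_B[OF c])
        show "(\<lambda>c\<in>\<Lambda>. if c \<in> insert a X then b c else \<zero>\<^bsub>AB\<^esub> c) (i', j') = (single i j (b (i, j)) \<oplus>\<^bsub>AB\<^esub> ?r) (i', j')"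
        proof (cases "(i', j') = a")
          case True
          have "single i j (b (i, j)) (i', j') = b (i', j')" using True a c by (simp add: single_apply)
          moreover have "?r (i', j') = \<zero>\<^bsub>B j' i'\<^esub>" using insert.hyps True c by (auto simp: AB_apply)
          moreover have "(\<lambda>c\<in>\<Lambda>. if c \<in> insert a X then b c else \<zero>\<^bsub>AB\<^esub> c) (i', j') = b (i', j')" using True c by simp
          ultimately show ?thesis unfolding AB_apply(2)[OF c] using AB_mem[OF b c] by (simp only: M.r_zero)
        next
          case False
          then show ?thesis using c a AB_mem[OF b c] by (auto simp: AB_apply single_apply)
        qed
      qed (auto simp: AB_ext)
      then have "f (\<lambda>c\<in>\<Lambda>. if c \<in> insert a X then b c else \<zero>\<^bsub>AB\<^esub> c) = f (single i j (b (i, j))) \<oplus>\<^bsub>A\<^esub> f ?r"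
        by (simp only: additive_map_add[OF f sc rc])
      also have "\<dots> = \<zero>\<^bsub>A\<^esub> \<oplus>\<^bsub>A\<^esub> \<zero>\<^bsub>A\<^esub>" using z[of i j] True a by (simp only: insert.IH)
      also have "\<dots> = \<zero>\<^bsub>A\<^esub>" by simp
      finally show ?thesis .
    qed
  qed
  from this[OF finite[of \<Lambda>]] have "f (\<lambda>a\<in>\<Lambda>. if a \<in> \<Lambda> then b a else \<zero>\<^bsub>AB\<^esub> a) = \<zero>\<^bsub>A\<^esub>" .
  moreover have "(\<lambda>a\<in>\<Lambda>. if a \<in> \<Lambda> then b a else \<zero>\<^bsub>AB\<^esub> a) = b"
    using b by (intro AB_eqI) (auto simp: AB_ext)
  ultimately show ?thesis by simp
qed

text \<open>A word without letters gives \<open>e_y s e_x = 0\<close>, as \<open>y\<close> and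
  \<open>x\<close> differ. In any other word the first letter is split into arrows: an arrow not
  ending at \<open>y\<close> is killed by \<open>e y\<close>, and behind one from \<open>z\<close>
  to \<open>y\<close> the tail projects into the zero space at \<open>z\<close>.\<close>

lemma P_zero_step:
  assumes ne: "y \<noteq> x" and pred: "\<And>z. (z, y) \<in> \<Lambda> \<Longrightarrow> carrier (P z) = {\<zero>\<^bsub>A\<^esub>}"
  shows "carrier (P y) = {\<zero>\<^bsub>A\<^esub>}"
proof -
  have zero_wc: "tr.wc [] \<zero>\<^bsub>PR\<^esub> = \<zero>\<^bsub>A\<^esub>"
  proof -
    have z: "\<zero>\<^bsub>PR\<^esub> \<in> carrier PR" by (simp add: PR_carrier PR_zero k_simps)
    have "\<zero>\<^bsub>PR\<^esub> \<oplus>\<^bsub>PR\<^esub> \<zero>\<^bsub>PR\<^esub> = \<zero>\<^bsub>PR\<^esub>" by (rule ext) (simp add: PR_add PR_zero k_simps)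
    then have "tr.wc [] \<zero>\<^bsub>PR\<^esub> \<oplus>\<^bsub>A\<^esub> tr.wc [] \<zero>\<^bsub>PR\<^esub> = tr.wc [] \<zero>\<^bsub>PR\<^esub>"
      using tr.wc_add_scalar[of "[]" "\<zero>\<^bsub>PR\<^esub>" "\<zero>\<^bsub>PR\<^esub>"] z by simp
    moreover have "tr.wc [] \<zero>\<^bsub>PR\<^esub> \<in> carrier A" using z by (intro tr.wc_closed) auto
    ultimately show ?thesis by (metis tr.TR.add.l_cancel_one')
  qed
  have word: "\<phi> y (tr.wc bs s) = \<zero>\<^bsub>A\<^esub>" if w: "set bs \<subseteq> carrier AB" "s \<in> carrier PR" for bs s
  proof (cases bs)
    case Nil
    have "\<phi> y (tr.wc [] s) = tr.wc [] (delta y \<one>\<^bsub>k y\<^esub> \<otimes>\<^bsub>PR\<^esub> (s \<otimes>\<^bsub>PR\<^esub> delta x \<one>\<^bsub>k x\<^esub>))"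
    proof -
      have "s \<otimes>\<^bsub>PR\<^esub> delta x \<one>\<^bsub>k x\<^esub> \<in> carrier PR"
        using w(2) delta_closed[OF k_simps(2), of x] by (simp add: PR_carrier PR_mult k_simps)
      then show ?thesis
        using w(2) by (simp add: \<phi>_def e_eq atv_eq tr.wc_mult_scalar_right delta_closed k_simps)
    qed
    also have "delta y \<one>\<^bsub>k y\<^esub> \<otimes>\<^bsub>PR\<^esub> (s \<otimes>\<^bsub>PR\<^esub> delta x \<one>\<^bsub>k x\<^esub>) = \<zero>\<^bsub>PR\<^esub>"
      by (rule ext) (use ne w(2) in \<open>auto simp: PR_mult PR_zero delta_def k_simps PR_carrier\<close>)
    finally show ?thesis using Nil zero_wc by simp
  next
    case (Cons b bs')
    then have b: "b \<in> carrier AB" and bs': "set bs' \<subseteq> carrier AB" using w by auto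
    have wc': "tr.wc bs' s \<in> carrier A" by (rule tr.wc_closed[OF bs' w(2)])
    have f1: "additive_map AB A (\<lambda>b. tr.wc (b # bs') s)"
      using tr.wc_add[of "[]" _ _ bs' s] tr.wc_closed[of "_ # bs'" s] bs' w(2)
      by (intro additive_mapI) auto
    have f: "additive_map AB A (\<lambda>b. \<phi> y (tr.wc (b # bs') s))"
      by (rule additive_map_comp[OF f1 \<phi>_additive])
    have "\<phi> y (tr.wc (b # bs') s) = \<zero>\<^bsub>A\<^esub>"
    proof (rule AB_additive_zero[OF f _ b])
      fix i j assume ij: "(i, j) \<in> \<Lambda>"
      let ?c = "b (i, j)"
      have c: "?c \<in> carrier (B j i)" by (rule AB_mem[OF b ij])
      have ac: "ata i j ?c \<in> carrier A" by (rule ata_closed[OF c])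
      interpret bimodule "k j" "k i" "B j i" by (rule arrow_bimodule_B[OF ij])
      note mzl = additive_map_zero[OF tr.TR.abelian_group_axioms tr.TR.abelian_group_axioms tr.mult_additive_left]
      note mzr = additive_map_zero[OF tr.TR.abelian_group_axioms tr.TR.abelian_group_axioms tr.mult_additive_right]
      have eq: "\<phi> y (tr.wc (single i j ?c # bs') s) = e y \<otimes>\<^bsub>A\<^esub> (ata i j ?c \<otimes>\<^bsub>A\<^esub> (tr.wc bs' s \<otimes>\<^bsub>A\<^esub> e x))"
        unfolding ata_word[OF ij c bs' w(2), symmetric] \<phi>_def using ac wc' e_closed by (simp add: tr.mult_assoc)
      have wx: "tr.wc bs' s \<otimes>\<^bsub>A\<^esub> e x \<in> carrier A" by (rule tr.mult_closed[OF wc' e_closed])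
      show "\<phi> y (tr.wc (single i j ?c # bs') s) = \<zero>\<^bsub>A\<^esub>"
      proof (cases "j = y")
        case True
        have "ata i j ?c \<otimes>\<^bsub>A\<^esub> (tr.wc bs' s \<otimes>\<^bsub>A\<^esub> e x) = ata i j ?c \<otimes>\<^bsub>A\<^esub> \<phi> i (tr.wc bs' s)"
          unfolding \<phi>_def using e_ata(2)[OF ij c] ac wx e_closed by (simp add: tr.mult_assoc[symmetric])
        also have "\<phi> i (tr.wc bs' s) = \<zero>\<^bsub>A\<^esub>"
          using \<phi>_closed[OF wc', of i] pred[of i] ij True by simp
        finally show ?thesis unfolding eq using mzr[OF ac] mzr[OF e_closed] by simp
      next
        case False
        have zA: "additive_map (B j i) A (\<lambda>c. ata i j c)"
          by (intro additive_mapI) (auto simp: ata_closed ata_add)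
        have "e y \<otimes>\<^bsub>A\<^esub> ata i j ?c = tr.wc [delta y \<one>\<^bsub>k y\<^esub> \<odot>\<^bsub>AB\<^esub> single i j ?c] \<one>\<^bsub>PR\<^esub>"
          unfolding e_eq atv_eq ata_eq using c
          by (simp add: tr.wc_mult_scalar_left delta_closed k_simps single_closed)
        also have "delta y \<one>\<^bsub>k y\<^esub> \<odot>\<^bsub>AB\<^esub> single i j ?c = single i j \<zero>\<^bsub>B j i\<^esub>"
          using single_smult[OF delta_closed[OF k_simps(2)] c] False c by (simp add: delta_def)
        also have "tr.wc [single i j \<zero>\<^bsub>B j i\<^esub>] \<one>\<^bsub>PR\<^esub> = \<zero>\<^bsub>A\<^esub>"
          using additive_map_zero[OF M.abelian_group_axioms tr.TR.abelian_group_axioms zA] by (simp add: ata_eq)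
        finally have "(e y \<otimes>\<^bsub>A\<^esub> ata i j ?c) \<otimes>\<^bsub>A\<^esub> (tr.wc bs' s \<otimes>\<^bsub>A\<^esub> e x) = \<zero>\<^bsub>A\<^esub>" using mzl[OF wx] by simp
        then show ?thesis unfolding eq using tr.mult_assoc[OF e_closed ac wx] by simp
      qed
    qed
    then show ?thesis using Cons by simp
  qed
  have "\<phi> y t = \<zero>\<^bsub>A\<^esub>" if t: "t \<in> carrier A" for t
  proof (rule tr.TR_eqI[OF \<phi>_additive _ t])
    show "additive_map A A (\<lambda>_. \<zero>\<^bsub>A\<^esub>)" by (rule additive_mapI) simp_all
    fix c assume "c \<in> tr.words"
    then show "\<phi> y (tr.cls (frag_of c)) = \<zero>\<^bsub>A\<^esub>"
      using word[of "fst c" "snd c"] by (cases c) (simp add: tr.wc_def tr.words_iff)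
  qed
  then have "n = \<zero>\<^bsub>A\<^esub>" if "n \<in> carrier (P y)" for n using that \<phi>_P[OF that] by (simp add: P_iff)
  moreover have "\<zero>\<^bsub>A\<^esub> \<in> carrier (P y)"
    using left_module.submodule_zero[OF P_left_module left_module.submodule_carrier_set[OF P_left_module]] by (simp add: P_zero)
  ultimately show ?thesis by blast
qed

text \<open>A predecessor of a vertex not reachable from \<open>x\<close> is not reachable either,
  so induction along the acyclic orientation applies.\<close>

lemma P_support:
  assumes "acyclic \<Lambda>" "(x, y) \<notin> \<Lambda>\<^sup>*"
  shows "carrier (P y) = {\<zero>\<^bsub>A\<^esub>}"
proof -
  have "wf \<Lambda>" by (rule finite_acyclic_wf[OF finite assms(1)])
  then show ?thesis using assms(2)
  proof (induction y rule: wf_induct_rule)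
    case (less y)
    have "y \<noteq> x" using less.prems by auto
    then show ?case
      by (rule P_zero_step) (use less in \<open>meson rtrancl.rtrancl_into_rtrancl\<close>)
  qed
qed

text \<open>The three properties on which the annihilation of a projective depends, transported to
  any representation isomorphic to it, so that the reflections can be applied to \<open>V\<close>
  directly.\<close>

lemma projective_rep_iso_props:
  assumes rep: "is_rep \<M> \<Lambda> V" and iso: "rep_iso \<M> \<Lambda> V (projective_rep \<M> \<Lambda> x)"
  shows projective_top: "carrier (spc V x) \<noteq> {\<zero>\<^bsub>spc V x\<^esub>}"
    and projective_support: "acyclic \<Lambda> \<Longrightarrow> (x, y) \<notin> \<Lambda>\<^sup>* \<Longrightarrow> carrier (spc V y) = {\<zero>\<^bsub>spc V y\<^esub>}"
    and projective_injective: "(\<And>z. (z, y) \<in> \<Lambda> \<Longrightarrow> u z \<in> carrier (tens y z (spc V z))) \<Longrightarrow>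
      (\<Oplus>\<^bsub>spc V y\<^esub>z\<in>{z. (z, y) \<in> \<Lambda>}. mp V z y (u z)) = \<zero>\<^bsub>spc V y\<^esub> \<Longrightarrow> (z, y) \<in> \<Lambda> \<Longrightarrow>
      u z = \<zero>\<^bsub>tens y z (spc V z)\<^esub>"
proof -
  obtain \<alpha> where \<alpha>: "is_rep_hom \<M> \<Lambda> V (projective_rep \<M> \<Lambda> x) \<alpha>"
    "\<And>i. bij_betw (\<alpha> i) (carrier (spc V i)) (carrier (P i))"
    using iso by (auto simp: rep_iso_def P_def)
  have lin: "linear_map (k i) (spc V i) (P i) (\<alpha> i)" for i
    using \<alpha>(1) by (auto simp: is_rep_hom_def lin_hom_iff P_def)
  have comm: "\<alpha> j (mp V i j t) = mp (projective_rep \<M> \<Lambda> x) i j (tensor_map (k i) (B j i) (P i) (\<alpha> i) t)"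
    if "(i, j) \<in> \<Lambda>" "t \<in> carrier (tens j i (spc V i))" for i j t
    using \<alpha>(1) that by (auto simp: is_rep_hom_def P_def)
  have \<alpha>0: "\<alpha> i \<zero>\<^bsub>spc V i\<^esub> = \<zero>\<^bsub>A\<^esub>" for i
    using additive_map_zero[OF left_module.axioms(2)[OF rep_left_module[OF rep]] left_module.axioms(2)[OF P_left_module]
        linear_map_additive[OF lin]] by (simp add: P_zero)
  have inj: "v = \<zero>\<^bsub>spc V i\<^esub>" if "v \<in> carrier (spc V i)" "\<alpha> i v = \<zero>\<^bsub>A\<^esub>" for i v
    using \<alpha>(2)[of i] that \<alpha>0[of i]
      left_module.submodule_zero[OF rep_left_module[OF rep] left_module.submodule_carrier_set[OF rep_left_module[OF rep]], of i]
    unfolding bij_betw_def inj_on_def by metis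
  show "carrier (spc V x) \<noteq> {\<zero>\<^bsub>spc V x\<^esub>}"
  proof
    assume "carrier (spc V x) = {\<zero>\<^bsub>spc V x\<^esub>}"
    then have "carrier (P x) = {\<zero>\<^bsub>A\<^esub>}" using \<alpha>(2)[of x] \<alpha>0 by (simp add: bij_betw_def)
    then show False using e_nonzero by auto
  qed
  show "carrier (spc V y) = {\<zero>\<^bsub>spc V y\<^esub>}" if "acyclic \<Lambda>" "(x, y) \<notin> \<Lambda>\<^sup>*"
  proof -
    interpret Vy: left_module "k y" "spc V y" by (rule rep_left_module[OF rep])
    have "v = \<zero>\<^bsub>spc V y\<^esub>" if "v \<in> carrier (spc V y)" for v
      using linear_map_closed[OF lin that] P_support[OF \<open>acyclic \<Lambda>\<close> \<open>(x, y) \<notin> \<Lambda>\<^sup>*\<close>] by (intro inj that) simp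
    then show ?thesis by auto
  qed
  assume u: "\<And>z. (z, y) \<in> \<Lambda> \<Longrightarrow> u z \<in> carrier (tens y z (spc V z))"
    and sum: "(\<Oplus>\<^bsub>spc V y\<^esub>z\<in>{z. (z, y) \<in> \<Lambda>}. mp V z y (u z)) = \<zero>\<^bsub>spc V y\<^esub>" and zy: "(z, y) \<in> \<Lambda>"
  let ?N = "{z. (z, y) \<in> \<Lambda>}" and ?\<tau> = "\<lambda>z. tensor_map (k z) (B y z) (P z) (\<alpha> z)"
  interpret Vy: left_module "k y" "spc V y" by (rule rep_left_module[OF rep])
  interpret Py: left_module "k y" "P y" by (rule P_left_module)
  interpret tP: tensor_product "k y" "k z" "B y z" "P z" by (rule tensor_P[OF zy])
  interpret tV: tensor_product "k y" "k z" "B y z" "spc V z" by (rule arrow_tensor_product[OF orientation rep zy])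
  have \<tau>: "linear_map (k y) (tens y z (spc V z)) (tens y z (P z)) (?\<tau> z)"
    "bij_betw (?\<tau> z) (carrier (tens y z (spc V z))) (carrier (tens y z (P z)))" if "z \<in> ?N" for z
    unfolding arrow_tensor_def using that
    by (auto intro!: tensor_map_linear tensor_map_bij arrow_bimodule_B rep_left_module[OF rep] P_left_module lin \<alpha>(2))
  have mpc: "mp V z y (u z) \<in> carrier (spc V y)" if "z \<in> ?N" for z
    using linear_map_closed[OF rep_mp_linear[OF rep]] u that by auto
  have mpP: "mp (projective_rep \<M> \<Lambda> x) z y (?\<tau> z (u z)) \<in> carrier (P y)" if "z \<in> ?N" for z
    using additive_map_closed[OF mp_P_additive] linear_map_closed[OF \<tau>(1)] u that by auto
  have "\<zero>\<^bsub>P y\<^esub> = \<alpha> y (\<Oplus>\<^bsub>spc V y\<^esub>z\<in>?N. mp V z y (u z))" using sum \<alpha>0 by (simp add: P_zero)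
  also have "\<dots> = (\<Oplus>\<^bsub>P y\<^esub>z\<in>?N. \<alpha> y (mp V z y (u z)))"
    using mpc by (intro additive_map_finsum[OF Vy.M.abelian_group_axioms Py.M.abelian_group_axioms linear_map_additive[OF lin]]) auto
  also have "\<dots> = (\<Oplus>\<^bsub>P y\<^esub>z\<in>?N. mp (projective_rep \<M> \<Lambda> x) z y (?\<tau> z (u z)))"
    using mpP comm u by (intro Py.M.add.finprod_cong'[OF refl]) auto
  finally have s0: "(\<Oplus>\<^bsub>P y\<^esub>z\<in>?N. mp (projective_rep \<M> \<Lambda> x) z y (?\<tau> z (u z))) = \<zero>\<^bsub>P y\<^esub>" by simp
  \<comment> \<open>Applying \<open>peel z y\<close> to the vanishing sum will leave only the
    summand of \<open>z\<close>.\<close>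
  have pa: "additive_map (P y) tP.T (peel z y)"
    using peel_additive[OF zy] by (auto simp: additive_map_def P_add P_iff arrow_tensor_def)
  have "\<zero>\<^bsub>tP.T\<^esub> = peel z y (\<Oplus>\<^bsub>P y\<^esub>w\<in>?N. mp (projective_rep \<M> \<Lambda> x) w y (?\<tau> w (u w)))"
    unfolding s0 by (rule additive_map_zero[OF Py.M.abelian_group_axioms tP.T.abelian_group_axioms pa, symmetric])
  also have "\<dots> = (\<Oplus>\<^bsub>tP.T\<^esub>w\<in>?N. peel z y (mp (projective_rep \<M> \<Lambda> x) w y (?\<tau> w (u w))))"
    using mpP by (intro additive_map_finsum[OF Py.M.abelian_group_axioms tP.T.abelian_group_axioms pa]) auto
  also have "\<dots> = (\<Oplus>\<^bsub>tP.T\<^esub>w\<in>?N. if z = w then ?\<tau> z (u z) else \<zero>\<^bsub>tP.T\<^esub>)"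
    using peel_mp[OF zy] linear_map_closed[OF \<tau>(1)] u zy
    by (intro tP.T.add.finprod_cong'[OF refl]) (auto simp: arrow_tensor_def)
  also have "\<dots> = ?\<tau> z (u z)"
    using zy linear_map_closed[OF \<tau>(1)] u by (subst tP.T.add.finprod_singleton[where f="\<lambda>_. ?\<tau> z (u z)"]) (auto simp: arrow_tensor_def)
  finally have t0: "?\<tau> z (u z) = \<zero>\<^bsub>tP.T\<^esub>" by simp
  have "?\<tau> z \<zero>\<^bsub>tV.T\<^esub> = \<zero>\<^bsub>tP.T\<^esub>"
    using additive_map_zero[OF tV.T.abelian_group_axioms tP.T.abelian_group_axioms] linear_map_additive[OF \<tau>(1)] zy
    by (simp add: arrow_tensor_def)
  then show "u z = \<zero>\<^bsub>tens y z (spc V z)\<^esub>"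
    using \<tau>(2)[of z] t0 u[OF zy] zy tV.T.zero_closed by (auto simp: bij_betw_def inj_on_def arrow_tensor_def)
qed

end

section \<open>Admissible sequences and their multiplicity functions\<close>

text \<open>The multiplicity functions of (+)-admissible sequences are the functions that are constant or
  increase by one along every arrow, and a sequence is determined up to \<open>\<sim>\<close> by its multiplicities.\<close>

definition compat :: "('i \<times> 'i) set \<Rightarrow> ('i \<Rightarrow> nat) \<Rightarrow> bool" where
  "compat \<Lambda> m \<longleftrightarrow> (\<forall>(i, j)\<in>\<Lambda>. m j = m i \<or> m j = Suc (m i))"

lemma compatD: "compat \<Lambda> m \<Longrightarrow> (i, j) \<in> \<Lambda> \<Longrightarrow> m j = m i \<or> m j = Suc (m i)"
  by (auto simp: compat_def)

lemma compat_path: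
  assumes "compat \<Lambda> m" "(i, j) \<in> \<Lambda>\<^sup>*"
  shows "m i \<le> m j"
  using assms(2)
proof (induction rule: rtrancl_induct)
  case (step j k)
  then show ?case using compatD[OF assms(1) step.hyps(2)] by auto
qed simp

lemma reflect_commute: "reflect x (reflect y \<Lambda>) = reflect y (reflect x \<Lambda>)"
  by (auto simp: reflect_def)

lemma reflect_seq_simps [simp]:
  "reflect_seq \<Lambda> [] = \<Lambda>" "reflect_seq \<Lambda> (x # S) = reflect_seq (reflect x \<Lambda>) S"
  "reflect_seq \<Lambda> (S @ T) = reflect_seq (reflect_seq \<Lambda> S) T"
  by (simp_all add: reflect_seq_def)

lemma admissible_append: "admissible \<Lambda> (S @ T) \<longleftrightarrow> admissible \<Lambda> S \<and> admissible (reflect_seq \<Lambda> S) T"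
  by (induction S arbitrary: \<Lambda>) auto

text \<open>Every occurrence of \<open>i\<close> or of \<open>j\<close> in \<open>S\<close> reverses
  the arrow between them, and nothing else does.\<close>

lemma reflect_seq_parity:
  "i \<noteq> j \<Longrightarrow> (i, j) \<in> reflect_seq \<Lambda> S \<longleftrightarrow>
    (if even (count_list S i + count_list S j) then (i, j) \<in> \<Lambda> else (j, i) \<in> \<Lambda>)"
  by (induction S arbitrary: \<Lambda>) (auto simp: reflect_iff)

lemma count_list_distinct: "distinct L \<Longrightarrow> count_list L y = of_bool (y \<in> set L)"
  by (induction L) auto

lemma count_list_concat: "count_list (concat Ss) y = (\<Sum>i<length Ss. count_list (Ss ! i) y)"
  by (induction Ss) (simp_all add: sum.lessThan_Suc_shift del: sum.lessThan_Suc)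

text \<open>After the reflection no arrow ends at \<open>x\<close>, so a cycle would avoid
  \<open>x\<close> and consist of arrows of \<open>\<Lambda>\<close>.\<close>

lemma acyclic_reflect:
  assumes "acyclic \<Lambda>" "is_sink \<Lambda> x"
  shows "acyclic (reflect x \<Lambda>)"
proof -
  have "c \<noteq> x \<and> (a \<noteq> x \<longrightarrow> (a, c) \<in> \<Lambda>\<^sup>+)" if "(a, c) \<in> (reflect x \<Lambda>)\<^sup>+" for a c
    using that
  proof (induction rule: trancl_induct)
    case (base c)
    then show ?case using assms(2) by (auto simp: reflect_iff is_sink_def split: if_splits)
  next
    case (step c d)
    then have "d \<noteq> x" "(c, d) \<in> \<Lambda>" using assms(2) by (auto simp: reflect_iff is_sink_def split: if_splits)
    then show ?case using step by auto
  qed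
  then show ?thesis using assms(1) unfolding acyclic_def by blast
qed

lemma acyclic_reflect_seq: "acyclic \<Lambda> \<Longrightarrow> admissible \<Lambda> S \<Longrightarrow> acyclic (reflect_seq \<Lambda> S)"
  by (induction S arbitrary: \<Lambda>) (auto simp: acyclic_reflect)

context symmetric_graph
begin

lemma orientation_reflect_seq: "orientation b \<Lambda> \<Longrightarrow> orientation b (reflect_seq \<Lambda> S)"
  by (induction S arbitrary: \<Lambda>) (auto simp: orientation_reflect)

text \<open>By induction on \<open>S\<close>. An arrow from \<open>i\<close> to the first reflected
  vertex \<open>x\<close> points the other way afterwards, and the additional occurrence of
  \<open>x\<close> exchanges the two alternatives.\<close>

lemma compat_count_list:
  "orientation b \<Lambda> \<Longrightarrow> admissible \<Lambda> S \<Longrightarrow> compat \<Lambda> (count_list S)"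
proof (induction S arbitrary: \<Lambda>)
  case (Cons x S)
  have c: "compat (reflect x \<Lambda>) (count_list S)" using Cons orientation_reflect by auto
  show ?case
    unfolding compat_def
  proof (intro ballI, clarify)
    fix i j assume ij: "(i, j) \<in> \<Lambda>" and n: "count_list (x # S) j \<noteq> Suc (count_list (x # S) i)"
    have ix: "i \<noteq> x" using ij Cons.prems(2) by (auto simp: is_sink_def)
    show "count_list (x # S) j = count_list (x # S) i"
    proof (cases "j = x")
      case True
      then have "(x, i) \<in> reflect x \<Lambda>" using ij by (simp add: reflect_iff)
      then show ?thesis using compatD[OF c] n ix True by fastforce
    next
      case False
      then have "(i, j) \<in> reflect x \<Lambda>" using ij ix by (simp add: reflect_iff)
      then show ?thesis using compatD[OF c] n ix False by fastforce
    qed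
  qed
qed (simp add: compat_def)

text \<open>Reflecting at one of two vertices not joined by an edge leaves the arrows at the other
  as they are.\<close>

lemma admissible_swap:
  assumes o: "orientation b \<Lambda>" and adm: "admissible \<Lambda> (us @ [y, x] @ ws)" and ne: "\<not> edge b y x"
  shows "admissible \<Lambda> (us @ [x, y] @ ws)"
proof (cases "x = y")
  case False
  let ?L = "reflect_seq \<Lambda> us"
  have oL: "orientation b ?L" by (rule orientation_reflect_seq[OF o])
  have "(x, y) \<notin> ?L" "(y, x) \<notin> ?L" using orientationD(1)[OF oL] ne sym by blast+
  moreover have "is_sink ?L y" "is_sink (reflect y ?L) x" using adm by (auto simp: admissible_append)
  ultimately have "is_sink ?L x" "is_sink (reflect x ?L) y"
    using False by (auto simp: is_sink_def reflect_iff split: if_splits)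
  then show ?thesis using adm by (simp add: admissible_append reflect_commute)
qed (use adm in simp)

section \<open>Equivalence of sequences in terms of multiplicities\<close>

lemma seq_equiv_refl: "admissible \<Lambda> S \<Longrightarrow> seq_equiv b \<Lambda> S S"
  by (simp add: seq_equiv_def)

lemma seq_equiv_trans: "seq_equiv b \<Lambda> S T \<Longrightarrow> seq_equiv b \<Lambda> T U \<Longrightarrow> seq_equiv b \<Lambda> S U"
  unfolding seq_equiv_def using equivclp_trans by metis

lemma seq_equiv_sym: "seq_equiv b \<Lambda> S T \<Longrightarrow> seq_equiv b \<Lambda> T S"
  unfolding seq_equiv_def using equivclp_sym by metis

lemma seq_equiv_invariant:
  assumes "seq_equiv b \<Lambda> S T" and inv: "\<And>S T. seq_swap b \<Lambda> S T \<Longrightarrow> f S = f T"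
  shows "f S = f T"
proof -
  have "equivclp (seq_swap b \<Lambda>) S T" using assms(1) by (simp add: seq_equiv_def)
  then show ?thesis
  proof (induction rule: equivclp_induct)
    case (step y z)
    then show ?case using inv by metis
  qed simp
qed

lemma seq_equiv_count: "seq_equiv b \<Lambda> S T \<Longrightarrow> count_list S y = count_list T y"
  by (rule seq_equiv_invariant[where f = "\<lambda>S. count_list S y"]) (auto simp: seq_swap_def)

lemma seq_equiv_Cons:
  assumes "is_sink \<Lambda> x" "seq_equiv b (reflect x \<Lambda>) S T"
  shows "seq_equiv b \<Lambda> (x # S) (x # T)"
proof -
  have sw: "seq_swap b \<Lambda> (x # A) (x # B)" if "seq_swap b (reflect x \<Lambda>) A B" for A B
  proof -
    obtain us y z ws where "A = us @ [y, z] @ ws" "B = us @ [z, y] @ ws" "\<not> edge b y z"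
      using \<open>seq_swap b (reflect x \<Lambda>) A B\<close> unfolding seq_swap_def by blast
    moreover have "admissible \<Lambda> (x # A)" "admissible \<Lambda> (x # B)"
      using that assms(1) by (auto simp: seq_swap_def)
    ultimately show ?thesis
      unfolding seq_swap_def by (intro conjI exI[of _ "x # us"] exI[of _ y] exI[of _ z] exI[of _ ws]) auto
  qed
  have "equivclp (seq_swap b (reflect x \<Lambda>)) S T" using assms(2) by (simp add: seq_equiv_def)
  then have "equivclp (seq_swap b \<Lambda>) (x # S) (x # T)"
  proof (induction rule: equivclp_induct)
    case (step y z)
    then have "equivclp (seq_swap b \<Lambda>) (x # y) (x # z)"
      using sw r_into_equivclp[of "seq_swap b \<Lambda>"] equivclp_sym[of "seq_swap b \<Lambda>"] by metis
    then show ?case using step.IH equivclp_trans by metis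
  qed simp
  then show ?thesis using assms by (simp add: seq_equiv_def)
qed

text \<open>The first occurrence of \<open>x\<close> moves left past each \<open>y\<close>. A
  neighbour \<open>y\<close> of the sink \<open>x\<close> has an arrow to \<open>x\<close>, so in an
  admissible prefix it cannot occur more often than \<open>x\<close>, that is, not at all.\<close>

lemma seq_equiv_move_front:
  assumes o: "orientation b \<Lambda>" and sink: "is_sink \<Lambda> x"
  shows "admissible \<Lambda> (us @ x # ws) \<Longrightarrow> x \<notin> set us \<Longrightarrow> seq_equiv b \<Lambda> (us @ x # ws) (x # us @ ws)"
proof (induction us arbitrary: ws rule: rev_induct)
  case Nil
  then show ?case by (simp add: seq_equiv_refl)
next
  case (snoc y us)
  have adm: "admissible \<Lambda> (us @ [y, x] @ ws)" using snoc.prems(1) by simp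
  have ne: "\<not> edge b y x"
  proof
    assume "edge b y x"
    then have "(y, x) \<in> \<Lambda>" using orientationD(2)[OF o] sink by (auto simp: is_sink_def)
    moreover have "compat \<Lambda> (count_list (us @ [y]))"
      using snoc.prems(1) by (intro compat_count_list[OF o]) (simp add: admissible_append)
    ultimately have "count_list (us @ [y]) y \<le> count_list (us @ [y]) x" using compatD by fastforce
    then show False using snoc.prems(2) by (auto simp: count_list_0_iff)
  qed
  have adm': "admissible \<Lambda> (us @ [x, y] @ ws)" by (rule admissible_swap[OF o adm ne])
  have "seq_swap b \<Lambda> (us @ [y, x] @ ws) (us @ [x, y] @ ws)"
    unfolding seq_swap_def using adm adm' ne by blast
  then have "seq_equiv b \<Lambda> (us @ [y, x] @ ws) (us @ [x, y] @ ws)"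
    using adm adm' by (simp add: seq_equiv_def r_into_equivclp)
  moreover have "seq_equiv b \<Lambda> (us @ x # (y # ws)) (x # us @ (y # ws))"
    using snoc.prems(2) adm' by (intro snoc.IH) auto
  ultimately show ?case using seq_equiv_trans by fastforce
qed

text \<open>The first vertex of \<open>S\<close> is a sink that occurs in \<open>T\<close>. Its
  first occurrence is brought to the front of \<open>T\<close>, and the rest follows by induction
  for the reflected orientation. So the subsequence relation is the pointwise order of
  multiplicities.\<close>

lemma extend_to_equiv:
  assumes "orientation b \<Lambda>" "admissible \<Lambda> S" "admissible \<Lambda> T" "\<And>y. count_list S y \<le> count_list T y"
  shows "\<exists>U. admissible (reflect_seq \<Lambda> S) U \<and> seq_equiv b \<Lambda> T (S @ U)"
  using assms
proof (induction S arbitrary: \<Lambda> T)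
  case Nil
  then show ?case by (auto intro: seq_equiv_refl)
next
  case (Cons x S)
  have sink: "is_sink \<Lambda> x" using Cons.prems(2) by simp
  have "0 < count_list T x" using Cons.prems(4)[of x] by simp
  then have "x \<in> set T" using count_list_0_iff[of T x] by auto
  then obtain us ws where T: "T = us @ x # ws" "x \<notin> set us" using split_list_first by fast
  have eq: "seq_equiv b \<Lambda> T (x # us @ ws)"
    unfolding T(1) using Cons.prems(3) T by (intro seq_equiv_move_front[OF Cons.prems(1) sink]) auto
  have adm: "admissible (reflect x \<Lambda>) (us @ ws)" using eq by (simp add: seq_equiv_def)
  have le: "count_list S y \<le> count_list (us @ ws) y" for y using Cons.prems(4)[of y] T(1) by (auto split: if_splits)
  obtain U where U: "admissible (reflect_seq (reflect x \<Lambda>) S) U" "seq_equiv b (reflect x \<Lambda>) (us @ ws) (S @ U)"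
    using Cons.IH[OF orientation_reflect[OF Cons.prems(1)] _ adm le] Cons.prems(2) by auto
  have "seq_equiv b \<Lambda> (x # us @ ws) (x # S @ U)" by (rule seq_equiv_Cons[OF sink U(2)])
  then show ?case using U(1) seq_equiv_trans[OF eq] by auto
qed

lemma subsequenceI:
  assumes "orientation b \<Lambda>" "admissible \<Lambda> S" "admissible \<Lambda> T" "\<And>y. count_list S y \<le> count_list T y"
  shows "subsequence b \<Lambda> S T"
  using extend_to_equiv[OF assms] assms(2,3) by (simp add: subsequence_def)

lemma subsequence_count: "subsequence b \<Lambda> S T \<Longrightarrow> count_list S y \<le> count_list T y"
  unfolding subsequence_def using seq_equiv_count by fastforce

text \<open>The extension supplied by \<open>extend_to_equiv\<close> has all multiplicities zero, so
  it is empty.\<close>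

lemma seq_equivI:
  assumes "orientation b \<Lambda>" "admissible \<Lambda> S" "admissible \<Lambda> T" "\<And>y. count_list S y = count_list T y"
  shows "seq_equiv b \<Lambda> S T"
proof -
  obtain U where U: "seq_equiv b \<Lambda> T (S @ U)" using extend_to_equiv[OF assms(1-3)] assms(4) by auto
  have "count_list U y = 0" for y using seq_equiv_count[OF U, of y] assms(4)[of y] by simp
  then have "U = []" by (metis count_list_0_iff list.set_intros(1) neq_Nil_conv)
  then show ?thesis using U seq_equiv_sym by auto
qed

text \<open>A vertex of \<open>F\<close> without successors in \<open>F\<close> is a sink, because
  \<open>F\<close> contains all successors of its members. Reflecting there leaves the rest of
  \<open>F\<close> closed under successors.\<close>

lemma enumerate_filter:
  assumes "orientation b \<Lambda>" "acyclic \<Lambda>" "\<And>i j. (i, j) \<in> \<Lambda> \<Longrightarrow> i \<in> F \<Longrightarrow> j \<in> F"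
  shows "\<exists>L. admissible \<Lambda> L \<and> distinct L \<and> set L = F"
  using assms
proof (induction "card F" arbitrary: F \<Lambda>)
  case 0
  then show ?case by (intro exI[of _ "[]"]) simp
next
  case (Suc n)
  have "wf (\<Lambda>\<inverse>)" using Suc.prems(2) by (intro finite_acyclic_wf) auto
  moreover have "F \<noteq> {}" using Suc.hyps(2) by auto
  ultimately obtain x where x: "x \<in> F" "\<And>y. (y, x) \<in> \<Lambda>\<inverse> \<Longrightarrow> y \<notin> F" by (metis wfE_min ex_in_conv)
  have sink: "is_sink \<Lambda> x" using x Suc.prems(3) by (auto simp: is_sink_def)
  have "\<exists>L. admissible (reflect x \<Lambda>) L \<and> distinct L \<and> set L = F - {x}"
  proof (rule Suc.hyps(1))
    show "n = card (F - {x})" using Suc.hyps(2) x(1) by simp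
    show "orientation b (reflect x \<Lambda>)" by (rule orientation_reflect[OF Suc.prems(1)])
    show "acyclic (reflect x \<Lambda>)" by (rule acyclic_reflect[OF Suc.prems(2) sink])
    show "j \<in> F - {x}" if "(i, j) \<in> reflect x \<Lambda>" "i \<in> F - {x}" for i j
      using that sink Suc.prems(3) by (auto simp: reflect_iff is_sink_def split: if_splits)
  qed
  then obtain L where L: "admissible (reflect x \<Lambda>) L" "distinct L" "set L = F - {x}" by blast
  then show ?case using sink x(1) by (intro exI[of _ "x # L"]) auto
qed

text \<open>The converse of \<open>compat_count_list\<close>. The first block runs through the
  support of \<open>m\<close>, and lowering \<open>m\<close> by one on it gives a function
  compatible with the reflected orientation. Blocks beyond the largest value of \<open>m\<close> are
  empty.\<close>

lemma blocks_exist: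
  assumes "orientation b \<Lambda>" "acyclic \<Lambda>" "compat \<Lambda> m" "\<And>y. m y \<le> r"
  shows "\<exists>Ss. length Ss = r \<and> admissible \<Lambda> (concat Ss) \<and> (\<forall>i<r. distinct (Ss ! i) \<and> set (Ss ! i) = {y. i < m y})"
  using assms
proof (induction r arbitrary: \<Lambda> m)
  case 0
  then show ?case by auto
next
  case (Suc r)
  let ?F = "{y. 0 < m y}"
  obtain L where L: "admissible \<Lambda> L" "distinct L" "set L = ?F"
    using enumerate_filter[OF Suc.prems(1,2), of ?F] compatD[OF Suc.prems(3)] by fastforce
  let ?L = "reflect_seq \<Lambda> L" and ?m = "\<lambda>y. m y - 1"
  have oL: "orientation b ?L" by (rule orientation_reflect_seq[OF Suc.prems(1)])
  have "compat ?L ?m"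
    unfolding compat_def
  proof (intro ballI, clarify)
    fix i j assume ij: "(i, j) \<in> ?L" and n: "m j - 1 \<noteq> Suc (m i - 1)"
    have "i \<noteq> j" using ij orientationD(3)[OF oL] by auto
    \<comment> \<open>An edge is reversed by the first block precisely when exactly one of its two
      ends lies in the block.\<close>
    then have "if (0 < m i) = (0 < m j) then (i, j) \<in> \<Lambda> else (j, i) \<in> \<Lambda>"
      using ij reflect_seq_parity[of i j \<Lambda> L] L(2,3) by (auto simp: count_list_distinct split: if_splits)
    then show "m j - 1 = m i - 1"
      using compatD[OF Suc.prems(3), of i j] compatD[OF Suc.prems(3), of j i] n by (auto split: if_splits)
  qed
  moreover have "?m y \<le> r" for y using Suc.prems(4)[of y] by simp
  ultimately obtain Ss where Ss: "length Ss = r" "admissible ?L (concat Ss)"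
    "\<forall>i<r. distinct (Ss ! i) \<and> set (Ss ! i) = {y. i < m y - 1}"
    using Suc.IH[OF oL acyclic_reflect_seq[OF Suc.prems(2) L(1)], of ?m] by blast
  have "distinct ((L # Ss) ! i) \<and> set ((L # Ss) ! i) = {y. i < m y}" if "i < Suc r" for i
    using that L Ss(3) by (cases i) auto
  then show ?case using L Ss by (intro exI[of _ "L # Ss"]) (auto simp: admissible_append)
qed

subsection \<open>Principal sequences\<close>

text \<open>Indexed from the last block: the supports of the blocks of \<open>S_{r,x}\<close>, read
  backwards, are the iterates for \<open>k = 0, 1, ..., r - 1\<close>.\<close>

definition hull_iter :: "('i \<times> 'i) set \<Rightarrow> 'i \<Rightarrow> nat \<Rightarrow> 'i set" where
  "hull_iter \<Lambda> x k = (filter_hull b \<Lambda> ^^ k) (principal_filter \<Lambda> x)"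

text \<open>The multiplicity that \<open>y\<close> must have in \<open>S_{r,x}\<close>, since each
  block consists of distinct vertices.\<close>

definition principal_mult :: "('i \<times> 'i) set \<Rightarrow> nat \<Rightarrow> 'i \<Rightarrow> 'i \<Rightarrow> nat" where
  "principal_mult \<Lambda> r x y = card {k. k < r \<and> y \<in> hull_iter \<Lambda> x k}"

lemma hull_iter_Suc: "hull_iter \<Lambda> x (Suc k) = filter_hull b \<Lambda> (hull_iter \<Lambda> x k)"
  by (simp add: hull_iter_def)

lemma filter_hull_superset: "F \<subseteq> filter_hull b \<Lambda> F"
  by (auto simp: filter_hull_def)

lemma hull_iter_mono: "k \<le> l \<Longrightarrow> hull_iter \<Lambda> x k \<subseteq> hull_iter \<Lambda> x l"
  by (rule lift_Suc_mono_le[of "hull_iter \<Lambda> x"]) (simp_all add: hull_iter_Suc filter_hull_superset)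

lemma hull_iter_self: "x \<in> hull_iter \<Lambda> x k"
  using hull_iter_mono[of 0 k \<Lambda> x] by (auto simp: hull_iter_def principal_filter_def)

lemma hull_iter_filter: "i \<in> hull_iter \<Lambda> x k \<Longrightarrow> (i, j) \<in> \<Lambda> \<Longrightarrow> j \<in> hull_iter \<Lambda> x k"
proof (cases k)
  case 0
  then show "i \<in> hull_iter \<Lambda> x k \<Longrightarrow> (i, j) \<in> \<Lambda> \<Longrightarrow> ?thesis"
    by (auto simp: hull_iter_def principal_filter_def)
next
  case (Suc l)
  then show "i \<in> hull_iter \<Lambda> x k \<Longrightarrow> (i, j) \<in> \<Lambda> \<Longrightarrow> ?thesis"
    unfolding Suc hull_iter_Suc filter_hull_def is_filter_def by blast
qed

lemma hull_iter_pred: "(i, j) \<in> \<Lambda> \<Longrightarrow> orientation b \<Lambda> \<Longrightarrow> j \<in> hull_iter \<Lambda> x k \<Longrightarrow> i \<in> hull_iter \<Lambda> x (Suc k)"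
  unfolding hull_iter_Suc filter_hull_def using orientationD(1) by blast

lemma principal_mult_le: "principal_mult \<Lambda> r x y \<le> r"
  unfolding principal_mult_def using card_mono[of "{..<r}" "{k. k < r \<and> y \<in> hull_iter \<Lambda> x k}"] by auto

text \<open>For an arrow from \<open>i\<close> to \<open>j\<close>, each hull containing
  \<open>i\<close> contains \<open>j\<close>, and the hull after one that contains \<open>j\<close>
  contains \<open>i\<close>.\<close>

lemma compat_principal_mult:
  assumes o: "orientation b \<Lambda>"
  shows "compat \<Lambda> (principal_mult \<Lambda> r x)"
proof -
  have "principal_mult \<Lambda> r x i \<le> principal_mult \<Lambda> r x j \<and> principal_mult \<Lambda> r x j \<le> Suc (principal_mult \<Lambda> r x i)"
    if ij: "(i, j) \<in> \<Lambda>" for i j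
  proof
    show "principal_mult \<Lambda> r x i \<le> principal_mult \<Lambda> r x j"
      unfolding principal_mult_def using hull_iter_filter[OF _ ij] by (intro card_mono) auto
    \<comment> \<open>Shifting by one maps the indices for \<open>j\<close> to indices for
      \<open>i\<close>, except that \<open>r - 1\<close> may go to \<open>r\<close>. This exception
      is the one extra unit that compatibility permits.\<close>
    let ?A = "{k. k < r \<and> j \<in> hull_iter \<Lambda> x k}" and ?B = "{k. k < r \<and> i \<in> hull_iter \<Lambda> x k}"
    have "Suc ` ?A \<subseteq> insert r ?B" using hull_iter_pred[OF ij o] by auto
    then have "card (Suc ` ?A) \<le> card (insert r ?B)" by (intro card_mono) auto
    also have "\<dots> \<le> Suc (card ?B)" by (rule card_insert_le_m1) auto
    finally show "principal_mult \<Lambda> r x j \<le> Suc (principal_mult \<Lambda> r x i)"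
      by (simp add: principal_mult_def card_image)
  qed
  then show ?thesis unfolding compat_def by (auto simp: le_Suc_eq) (metis le_Suc_eq le_antisym)
qed

text \<open>The hulls increase, so the indices counted by \<open>principal_mult\<close> form a final
  segment of the numbers below \<open>r\<close>. Blocks are numbered from the front and hulls from
  the back, hence \<open>r - 1 - i\<close>.\<close>

lemma less_principal_mult_iff:
  assumes "i < r"
  shows "i < principal_mult \<Lambda> r x y \<longleftrightarrow> y \<in> hull_iter \<Lambda> x (r - 1 - i)"
proof
  let ?A = "{k. k < r \<and> y \<in> hull_iter \<Lambda> x k}"
  assume y: "y \<in> hull_iter \<Lambda> x (r - 1 - i)"
  have "{r - 1 - i..<r} \<subseteq> ?A" using y hull_iter_mono[of "r - 1 - i"] by fastforce
  then have "card {r - 1 - i..<r} \<le> card ?A" by (intro card_mono) auto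
  then show "i < principal_mult \<Lambda> r x y" using assms by (simp add: principal_mult_def)
next
  let ?A = "{k. k < r \<and> y \<in> hull_iter \<Lambda> x k}"
  assume m: "i < principal_mult \<Lambda> r x y"
  show "y \<in> hull_iter \<Lambda> x (r - 1 - i)"
  proof (rule ccontr)
    assume n: "y \<notin> hull_iter \<Lambda> x (r - 1 - i)"
    have "r - i \<le> k" if "k \<in> ?A" for k
    proof (rule ccontr)
      assume "\<not> r - i \<le> k"
      then have "k \<le> r - 1 - i" by simp
      then show False using n that hull_iter_mono by blast
    qed
    then have "?A \<subseteq> {r - i..<r}" by auto
    then have "card ?A \<le> card {r - i..<r}" by (intro card_mono) auto
    then show False using m assms by (simp add: principal_mult_def)
  qed
qed

lemma principal_mult_self: "principal_mult \<Lambda> r x x = r"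
  by (simp add: principal_mult_def hull_iter_self)

text \<open>A compatible function decreases by at most one in passing to the next hull, so
  \<open>m x - k \<le> m y\<close> for \<open>y\<close> in the hull of index \<open>k\<close>. Hence
  only indices from \<open>r - m y\<close> on count, and at most \<open>m y\<close> of these are
  below \<open>r\<close>.\<close>

lemma principal_mult_minimal:
  assumes o: "orientation b \<Lambda>" and m: "compat \<Lambda> m" "r \<le> m x"
  shows "principal_mult \<Lambda> r x y \<le> m y"
proof -
  have hull: "m x - k \<le> m y" if "y \<in> hull_iter \<Lambda> x k" for k y
    using that
  proof (induction k arbitrary: y)
    case 0
    then show ?case using compat_path[OF m(1)] by (simp add: hull_iter_def principal_filter_def)
  next
    case (Suc k)
    let ?G = "{y. m x - Suc k \<le> m y}"
    have "is_filter \<Lambda> ?G" unfolding is_filter_def using compat_path[OF m(1)] le_trans by blast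
    moreover have "hull_iter \<Lambda> x k \<subseteq> ?G" using Suc.IH by fastforce
    moreover have "y \<in> ?G" if yz: "z \<in> hull_iter \<Lambda> x k" "edge b y z" for y z
    proof -
      have "m z \<le> Suc (m y)" using orientationD(2)[OF o yz(2)] compatD[OF m(1)] by fastforce
      then show ?thesis using Suc.IH[OF yz(1)] by simp
    qed
    ultimately have "filter_hull b \<Lambda> (hull_iter \<Lambda> x k) \<subseteq> ?G" unfolding filter_hull_def by (intro Inter_lower) auto
    then show ?case using Suc.prems by (auto simp: hull_iter_Suc)
  qed
  let ?A = "{k. k < r \<and> y \<in> hull_iter \<Lambda> x k}"
  have "?A \<subseteq> {r - m y..<r}" using hull m(2) by fastforce
  then have "card ?A \<le> card {r - m y..<r}" by (intro card_mono) auto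
  then show ?thesis by (simp add: principal_mult_def)
qed

text \<open>Blocks realising \<open>principal_mult\<close> have the iterated hulls as supports,
  which is what the canonical form of \<open>S_{r,x}\<close> prescribes.\<close>

lemma principal_seq_exists:
  assumes o: "orientation b \<Lambda>" and ac: "acyclic \<Lambda>" and r: "0 < r"
  shows "\<exists>T. principal_seq b \<Lambda> r x T"
proof -
  obtain Ss where Ss: "length Ss = r" "admissible \<Lambda> (concat Ss)"
    "\<And>i. i < r \<Longrightarrow> distinct (Ss ! i)" "\<And>i. i < r \<Longrightarrow> set (Ss ! i) = {y. i < principal_mult \<Lambda> r x y}"
    using blocks_exist[OF o ac compat_principal_mult[OF o] principal_mult_le] by metis
  have set_eq: "set (Ss ! i) = hull_iter \<Lambda> x (r - 1 - i)" if "i < r" for i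
    using Ss(4)[OF that] less_principal_mult_iff[OF that] by auto
  have "canonical_form b \<Lambda> (concat Ss) Ss"
    unfolding canonical_form_def
  proof (intro conjI ballI allI impI)
    show "seq_equiv b \<Lambda> (concat Ss) (concat Ss)" by (rule seq_equiv_refl[OF Ss(2)])
  next
    fix T assume "T \<in> set Ss"
    then obtain i where i: "i < r" "T = Ss ! i" using Ss(1) by (metis in_set_conv_nth)
    show "T \<noteq> []" using set_eq[OF i(1)] hull_iter_self[of x \<Lambda> "r - 1 - i"] i(2) by auto
    show "distinct T" using Ss(3) i by simp
  next
    \<comment> \<open>The supports decrease with the index, so a block already contains all vertices
      of the later ones.\<close>
    fix i assume i: "i < length Ss"
    have "Ss ! i \<in> set (drop i Ss)" using i by (metis Cons_nth_drop_Suc list.set_intros(1))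
    moreover have "set T \<subseteq> set (Ss ! i)" if "T \<in> set (drop i Ss)" for T
    proof -
      obtain k where "k < length Ss - i" "T = Ss ! (i + k)" using \<open>T \<in> set (drop i Ss)\<close> by (auto simp: in_set_conv_nth)
      then show ?thesis using Ss(1,4) i by auto
    qed
    ultimately show "set (Ss ! i) = set (concat (drop i Ss))" by auto
  qed
  moreover have "set (Ss ! (r - 1)) = principal_filter \<Lambda> x" using set_eq[of "r - 1"] r by (simp add: hull_iter_def)
  moreover have "set (Ss ! i) = filter_hull b \<Lambda> (set (Ss ! (i + 1)))" if "i + 1 < r" for i
  proof -
    have "r - 1 - i = Suc (r - 1 - (i + 1))" using that by simp
    then show ?thesis using set_eq[of i] set_eq[of "i + 1"] that hull_iter_Suc by simp
  qed
  ultimately have "principal_seq b \<Lambda> r x (concat Ss)" unfolding principal_seq_def using r Ss(1) by blast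
  then show ?thesis by blast
qed

text \<open>The defining conditions determine the supports from the last block backwards. So all
  representatives have equal multiplicities and are equivalent by \<open>seq_equivI\<close>.\<close>

lemma principal_seq_count:
  assumes "principal_seq b \<Lambda> r x T"
  shows "admissible \<Lambda> T" "count_list T y = principal_mult \<Lambda> r x y"
proof -
  obtain Ss where r: "0 < r" and cf: "canonical_form b \<Lambda> T Ss" and len: "length Ss = r"
    and top: "set (Ss ! (r - 1)) = principal_filter \<Lambda> x"
    and hull: "\<And>i. i + 1 < r \<Longrightarrow> set (Ss ! i) = filter_hull b \<Lambda> (set (Ss ! (i + 1)))"
    using assms unfolding principal_seq_def by blast
  have eq: "seq_equiv b \<Lambda> T (concat Ss)" and dist: "\<And>S. S \<in> set Ss \<Longrightarrow> distinct S"
    using cf by (auto simp: canonical_form_def)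
  show "admissible \<Lambda> T" using eq by (simp add: seq_equiv_def)
  have sets: "set (Ss ! (r - Suc k)) = hull_iter \<Lambda> x k" if "k < r" for k
    using that
  proof (induction k)
    case 0
    then show ?case using top by (simp add: hull_iter_def)
  next
    case (Suc k)
    have "r - Suc (Suc k) + 1 = r - Suc k" using Suc.prems by simp
    then show ?case using hull[of "r - Suc (Suc k)"] Suc by (simp add: hull_iter_Suc)
  qed
  have "count_list T y = (\<Sum>i<r. count_list (Ss ! i) y)"
    using seq_equiv_count[OF eq] len by (simp add: count_list_concat)
  also have "\<dots> = (\<Sum>i<r. of_bool (y \<in> set (Ss ! i)))"
    using dist len by (intro sum.cong) (auto simp: count_list_distinct)
  also have "\<dots> = (\<Sum>k<r. of_bool (y \<in> set (Ss ! (r - Suc k))))" by (rule sum.nat_diff_reindex[symmetric])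
  also have "\<dots> = (\<Sum>k<r. of_bool (y \<in> hull_iter \<Lambda> x k))" using sets by (intro sum.cong) auto
  also have "\<dots> = card ({..<r} \<inter> {k. y \<in> hull_iter \<Lambda> x k})" by simp
  also have "{..<r} \<inter> {k. y \<in> hull_iter \<Lambda> x k} = {k. k < r \<and> y \<in> hull_iter \<Lambda> x k}" by auto
  finally show "count_list T y = principal_mult \<Lambda> r x y" by (simp add: principal_mult_def)
qed

end

section \<open>Sequences of reflection functors\<close>

lemma reflect_plus_spc: "y \<noteq> x \<Longrightarrow> spc (reflect_plus \<M> \<Lambda> x V) y = spc V y"
  by (simp add: reflect_plus_def Let_def)

lemma reflect_plus_mp: "i \<noteq> x \<Longrightarrow> mp (reflect_plus \<M> \<Lambda> x V) i j = mp V i j"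
  by (simp add: reflect_plus_def Let_def)

lemma reflect_plus_seq_spc: "y \<notin> set S \<Longrightarrow> spc (reflect_plus_seq \<M> \<Lambda> S V) y = spc V y"
  by (induction S arbitrary: \<Lambda> V) (auto simp: reflect_plus_spc)

lemma reflect_plus_seq_mp: "i \<notin> set S \<Longrightarrow> mp (reflect_plus_seq \<M> \<Lambda> S V) i j = mp V i j"
  by (induction S arbitrary: \<Lambda> V) (auto simp: reflect_plus_mp)

lemma reflect_plus_seq_append:
  "reflect_plus_seq \<M> \<Lambda> (S @ T) V = reflect_plus_seq \<M> (reflect_seq \<Lambda> S) T (reflect_plus_seq \<M> \<Lambda> S V)"
  by (induction S arbitrary: \<Lambda> V) auto

text \<open>Representations of \<open>\<Lambda>\<close> with the same spaces and the same maps; since \<^const>\<open>mp\<close> is total, they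
  may differ off the arrows of \<open>\<Lambda>\<close>.\<close>

definition same_rep :: "('i \<times> 'i) set \<Rightarrow> ('i, 'r, 'b, 'v) rep \<Rightarrow> ('i, 'r, 'b, 'v) rep \<Rightarrow> bool" where
  "same_rep \<Lambda> V V' \<longleftrightarrow> spc V' = spc V \<and> (\<forall>(i, j)\<in>\<Lambda>. mp V' i j = mp V i j)"

lemma same_rep_zero: "same_rep \<Lambda> V V' \<Longrightarrow> zero_rep V' \<longleftrightarrow> zero_rep V"
  by (simp add: same_rep_def zero_rep_def)

text \<open>A reflection at \<open>x\<close> reads only the spaces at \<open>x\<close> and at its
  predecessors and the maps into \<open>x\<close>. If these agree, the kernels are equal as records,
  so the coordinates chosen by \<open>coord_iso\<close> agree too and the results are equal, not
  just isomorphic.\<close>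

lemma (in sink_reflection) reflect_plus_cong:
  assumes N: "\<And>z. (z, x) \<in> \<Lambda>' \<longleftrightarrow> (z, x) \<in> \<Lambda>" and sx: "spc V' x = spc V x"
    and s: "\<And>z. (z, x) \<in> \<Lambda> \<Longrightarrow> spc V' z = spc V z" and m: "\<And>z. (z, x) \<in> \<Lambda> \<Longrightarrow> mp V' z x = mp V z x"
  shows "spc (reflect_plus \<M> \<Lambda>' x V') x = spc F x"
    and "spc V' j = spc V j \<Longrightarrow> mp (reflect_plus \<M> \<Lambda>' x V') x j = mp F x j"
proof -
  let ?D' = "direct_sum {y. (y, x) \<in> \<Lambda>'} (\<lambda>y. tens x y (spc V' y))"
  let ?h' = "\<lambda>u. \<Oplus>\<^bsub>spc V' x\<^esub>y\<in>{y. (y, x) \<in> \<Lambda>'}. mp V' y x (u y)"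
  have N': "{y. (y, x) \<in> \<Lambda>'} = N" using N by (simp add: N_def)
  have sN: "spc V' y = spc V y" if "y \<in> N" for y using s that by (simp add: N_def)
  have mN: "mp V' y x = mp V y x" if "y \<in> N" for y using m that by (simp add: N_def)
  have D': "?D' = ds.D"
    unfolding N' direct_sum_def using sN by (auto intro!: PiE_cong restrict_ext ext)
  \<comment> \<open>Agreement on the carrier of the direct sum is enough, since the kernel is cut
    out there.\<close>
  have h': "?h' u = h u" if u: "u \<in> carrier ds.D" for u
    unfolding N' h_def sx
  proof (rule Vx.finsum_cong')
    show "(\<lambda>y. mp V y x (u y)) \<in> N \<rightarrow> carrier (spc V x)"
      using linear_map_closed[OF mp_linear ds.ds_mem[OF u]] by blast
  qed (simp_all add: mN)
  have Ker': "?D'\<lparr>carrier := {u \<in> carrier ?D'. ?h' u = \<zero>\<^bsub>spc V' x\<^esub>}\<rparr> = Ker"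
  proof -
    have "{u \<in> carrier ds.D. ?h' u = \<zero>\<^bsub>spc V x\<^esub>} = {u \<in> carrier ds.D. h u = \<zero>\<^bsub>spc V x\<^esub>}"
      using h' by (intro Collect_cong) auto
    then show ?thesis unfolding D' Ker_def sx by simp
  qed
  have W': "spc (reflect_plus \<M> \<Lambda>' x V') x = W"
    unfolding reflect_plus_def Let_def Ker' W_def by simp
  then show "spc (reflect_plus \<M> \<Lambda>' x V') x = spc F x" by (simp add: spc_F)
  show "mp (reflect_plus \<M> \<Lambda>' x V') x j = mp F x j" if "spc V' j = spc V j"
    unfolding reflect_plus_def Let_def Ker' mp_F W_def \<theta>_def using that by simp
qed

section \<open>Single reflections, their commutation and their composites\<close>

context valued_modulation
begin

lemma sink_reflection_intro:
  "orientation (val \<M>) \<Lambda> \<Longrightarrow> is_sink \<Lambda> x \<Longrightarrow> is_rep \<M> \<Lambda> V \<Longrightarrow> sink_reflection \<M> \<Lambda> x V"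
  by (intro sink_reflection.intro valued_modulation_axioms sink_reflection_axioms.intro)

context
  fixes \<Lambda> :: "('i \<times> 'i) set" and x :: 'i and V :: "('i, 'r, 'b, 'v + 'r list) rep"
  assumes ori: "orientation (val \<M>) \<Lambda>" and sink: "is_sink \<Lambda> x" and rep: "is_rep \<M> \<Lambda> V"
begin

interpretation sink_reflection \<M> \<Lambda> x V
  by (rule sink_reflection_intro[OF ori sink rep])

lemma rep_reflect_plus: "is_rep \<M> (reflect x \<Lambda>) (reflect_plus \<M> \<Lambda> x V)"
  using rep_F by (simp add: F_def)

lemma zero_reflect_plus: "zero_rep V \<Longrightarrow> zero_rep (reflect_plus \<M> \<Lambda> x V)"
  using zero_F by (simp add: F_def)

lemma zero_reflect_plusI:
  "(\<And>y. y \<noteq> x \<Longrightarrow> carrier (spc V y) = {\<zero>\<^bsub>spc V y\<^esub>}) \<Longrightarrow> zero_rep (reflect_plus \<M> \<Lambda> x V)"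
  using zero_F_if_concentrated by (simp add: F_def)

lemma zero_reflect_plusD:
  "zero_rep (reflect_plus \<M> \<Lambda> x V) \<Longrightarrow> y \<noteq> x \<Longrightarrow> carrier (spc V y) = {\<zero>\<^bsub>spc V y\<^esub>}"
  using concentrated_if_zero_F by (simp add: F_def)

lemma indecomposable_reflect_plus:
  "indecomposable_rep \<M> \<Lambda> V \<Longrightarrow> \<not> zero_rep (reflect_plus \<M> \<Lambda> x V) \<Longrightarrow>
    indecomposable_rep \<M> (reflect x \<Lambda>) (reflect_plus \<M> \<Lambda> x V)"
  using indecomposable_F by (simp add: F_def)

lemma reflect_minus_reflect_plus:
  fixes Y :: "('i, 'r, 'b, 'v + 'r list) rep"
  assumes "indecomposable_rep \<M> \<Lambda> V" "\<not> zero_rep (reflect_plus \<M> \<Lambda> x V)"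
    and "is_rep \<M> (reflect x \<Lambda>) Y" "rep_iso \<M> (reflect x \<Lambda>) (reflect_plus \<M> \<Lambda> x V) Y"
  shows "is_rep \<M> \<Lambda> (reflect_minus \<M> (reflect x \<Lambda>) x Y)"
    and "rep_iso \<M> \<Lambda> V (reflect_minus \<M> (reflect x \<Lambda>) x Y)"
  using reflect_minus_inverse[OF h_surj, of Y] assms by (simp_all add: F_def)

lemma same_rep_reflect_plus:
  assumes "same_rep \<Lambda> V V'"
  shows "same_rep (reflect x \<Lambda>) (reflect_plus \<M> \<Lambda> x V) (reflect_plus \<M> \<Lambda> x V')"
proof -
  have s: "spc V' = spc V" and m: "mp V' i j = mp V i j" if "(i, j) \<in> \<Lambda>" for i j
    using assms that by (auto simp: same_rep_def)
  have s: "spc V' = spc V" using assms by (simp add: same_rep_def)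
  note cong = reflect_plus_cong[of \<Lambda> V', unfolded F_def, OF refl, unfolded s, OF refl refl m]
  have "spc (reflect_plus \<M> \<Lambda> x V') y = spc (reflect_plus \<M> \<Lambda> x V) y" for y
    using cong(1) by (cases "y = x") (simp_all add: reflect_plus_spc s)
  moreover have "mp (reflect_plus \<M> \<Lambda> x V') i j = mp (reflect_plus \<M> \<Lambda> x V) i j" if "(i, j) \<in> reflect x \<Lambda>" for i j
  proof (cases "i = x")
    case True
    then show ?thesis using cong(2) by simp
  next
    case False
    then have "(i, j) \<in> \<Lambda>" using that sink by (auto simp: reflect_iff is_sink_def split: if_splits)
    then show ?thesis using False by (simp add: reflect_plus_mp m)
  qed
  ultimately show ?thesis by (auto simp: same_rep_def)
qed

text \<open>Reflecting at a sink \<open>y\<close> not joined to \<open>x\<close> changes none of the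
  data read at \<open>x\<close>. The map towards \<open>y\<close> is excepted because its target
  space has been replaced.\<close>

lemma reflect_plus_at_commute:
  assumes y: "is_sink \<Lambda> y" "x \<noteq> y" "\<not> E x y"
  shows "spc (reflect_plus \<M> (reflect y \<Lambda>) x (reflect_plus \<M> \<Lambda> y V)) x = spc (reflect_plus \<M> \<Lambda> x V) x"
    and "j \<noteq> y \<Longrightarrow>
      mp (reflect_plus \<M> (reflect y \<Lambda>) x (reflect_plus \<M> \<Lambda> y V)) x j = mp (reflect_plus \<M> \<Lambda> x V) x j"
proof -
  have arr: "(z, x) \<in> reflect y \<Lambda> \<longleftrightarrow> (z, x) \<in> \<Lambda>" for z
    using y sink by (auto simp: reflect_iff is_sink_def)
  have "z \<noteq> y" if "(z, x) \<in> \<Lambda>" for z using y(1) that by (auto simp: is_sink_def)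
  then have "spc (reflect_plus \<M> \<Lambda> y V) z = spc V z" "mp (reflect_plus \<M> \<Lambda> y V) z x = mp V z x"
    if "(z, x) \<in> \<Lambda>" for z
    using that by (simp_all add: reflect_plus_spc reflect_plus_mp)
  note cong = reflect_plus_cong[of "reflect y \<Lambda>" "reflect_plus \<M> \<Lambda> y V", unfolded F_def,
      OF arr reflect_plus_spc[OF y(2)] this]
  show "spc (reflect_plus \<M> (reflect y \<Lambda>) x (reflect_plus \<M> \<Lambda> y V)) x = spc (reflect_plus \<M> \<Lambda> x V) x"
    by (rule cong(1))
  show "mp (reflect_plus \<M> (reflect y \<Lambda>) x (reflect_plus \<M> \<Lambda> y V)) x j = mp (reflect_plus \<M> \<Lambda> x V) x j"
    if "j \<noteq> y"
    by (rule cong(2)[OF _ _ reflect_plus_spc[OF that]])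
qed

end

text \<open>The maps between \<open>x\<close> and \<open>y\<close> themselves may differ, but there
  is no arrow between these two; hence \<open>same_rep\<close> in place of equality.\<close>

lemma same_rep_commute:
  fixes V :: "('i, 'r, 'b, 'v + 'r list) rep"
  assumes ori: "orientation (val \<M>) \<Lambda>" and x: "is_sink \<Lambda> x" and y: "is_sink \<Lambda> y" and rep: "is_rep \<M> \<Lambda> V"
    and ne: "x \<noteq> y" "\<not> E x y"
  shows "same_rep (reflect y (reflect x \<Lambda>)) (reflect_plus \<M> (reflect x \<Lambda>) y (reflect_plus \<M> \<Lambda> x V))
    (reflect_plus \<M> (reflect y \<Lambda>) x (reflect_plus \<M> \<Lambda> y V))" (is "same_rep ?L ?A ?B")
proof -
  have ne': "\<not> E y x" using ne(2) edge_sym by blast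
  note cx = reflect_plus_at_commute[OF ori x rep y ne]
  note cy = reflect_plus_at_commute[OF ori y rep x ne(1)[symmetric] ne']
  have "spc ?B z = spc ?A z" for z
    using cx(1) cy(1) ne(1) by (cases "z = x"; cases "z = y") (simp_all add: reflect_plus_spc)
  moreover have "mp ?B i j = mp ?A i j" if "(i, j) \<in> ?L" for i j
  proof -
    have "E i j" using that gr.orientationD(1)[OF gr.orientation_reflect[OF gr.orientation_reflect[OF ori]]] by blast
    then have "i = x \<Longrightarrow> j \<noteq> y" "i = y \<Longrightarrow> j \<noteq> x" using ne(2) ne' by auto
    then show ?thesis
      using cx(2)[of j] cy(2)[of j] ne(1) by (cases "i = x"; cases "i = y") (simp_all add: reflect_plus_mp)
  qed
  ultimately show ?thesis by (auto simp: same_rep_def)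
qed

lemma rep_reflect_plus_seq:
  fixes V :: "('i, 'r, 'b, 'v + 'r list) rep"
  shows "orientation (val \<M>) \<Lambda> \<Longrightarrow> admissible \<Lambda> S \<Longrightarrow> is_rep \<M> \<Lambda> V \<Longrightarrow>
    is_rep \<M> (reflect_seq \<Lambda> S) (reflect_plus_seq \<M> \<Lambda> S V)"
  by (induction S arbitrary: \<Lambda> V) (auto intro: rep_reflect_plus gr.orientation_reflect)

lemma zero_reflect_plus_seq:
  fixes V :: "('i, 'r, 'b, 'v + 'r list) rep"
  shows "orientation (val \<M>) \<Lambda> \<Longrightarrow> admissible \<Lambda> S \<Longrightarrow> is_rep \<M> \<Lambda> V \<Longrightarrow> zero_rep V \<Longrightarrow>
    zero_rep (reflect_plus_seq \<M> \<Lambda> S V)"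
  by (induction S arbitrary: \<Lambda> V) (auto intro: rep_reflect_plus zero_reflect_plus gr.orientation_reflect)

lemma zero_reflect_plus_seq_append:
  fixes V :: "('i, 'r, 'b, 'v + 'r list) rep"
  assumes "orientation (val \<M>) \<Lambda>" "admissible \<Lambda> (S @ T)" "is_rep \<M> \<Lambda> V" "zero_rep (reflect_plus_seq \<M> \<Lambda> S V)"
  shows "zero_rep (reflect_plus_seq \<M> \<Lambda> (S @ T) V)"
  using zero_reflect_plus_seq[OF gr.orientation_reflect_seq[OF assms(1)] _ rep_reflect_plus_seq[OF assms(1) _ assms(3)] assms(4), of T]
    assms(2) by (simp add: reflect_plus_seq_append admissible_append)

text \<open>Zero representations stay zero. A nonzero end result therefore means that no
  intermediate one is zero, and each step preserves indecomposability.\<close>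

lemma indecomposable_reflect_plus_seq:
  fixes V :: "('i, 'r, 'b, 'v + 'r list) rep"
  shows "orientation (val \<M>) \<Lambda> \<Longrightarrow> admissible \<Lambda> S \<Longrightarrow> is_rep \<M> \<Lambda> V \<Longrightarrow> indecomposable_rep \<M> \<Lambda> V \<Longrightarrow>
    \<not> zero_rep (reflect_plus_seq \<M> \<Lambda> S V) \<Longrightarrow>
    indecomposable_rep \<M> (reflect_seq \<Lambda> S) (reflect_plus_seq \<M> \<Lambda> S V)"
proof (induction S arbitrary: \<Lambda> V)
  case (Cons x S)
  have x: "is_sink \<Lambda> x" and S: "admissible (reflect x \<Lambda>) S" using Cons.prems(2) by auto
  note o = gr.orientation_reflect[OF Cons.prems(1), of x] and r = rep_reflect_plus[OF Cons.prems(1) x Cons.prems(3)]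
  have nz: "\<not> zero_rep (reflect_plus \<M> \<Lambda> x V)" using zero_reflect_plus_seq[OF o S r] Cons.prems(5) by auto
  have "indecomposable_rep \<M> (reflect x \<Lambda>) (reflect_plus \<M> \<Lambda> x V)"
    by (rule indecomposable_reflect_plus[OF Cons.prems(1) x Cons.prems(3,4) nz])
  then show ?case using Cons.IH[OF o S r] Cons.prems(5) by simp
qed simp

lemma same_rep_reflect_plus_seq:
  fixes V :: "('i, 'r, 'b, 'v + 'r list) rep"
  shows "orientation (val \<M>) \<Lambda> \<Longrightarrow> admissible \<Lambda> S \<Longrightarrow> is_rep \<M> \<Lambda> V \<Longrightarrow> same_rep \<Lambda> V V' \<Longrightarrow>
    same_rep (reflect_seq \<Lambda> S) (reflect_plus_seq \<M> \<Lambda> S V) (reflect_plus_seq \<M> \<Lambda> S V')"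
  by (induction S arbitrary: \<Lambda> V V') (auto intro: rep_reflect_plus same_rep_reflect_plus gr.orientation_reflect)

text \<open>The reflections are undone from the last to the first, each stage being known up to
  isomorphism only. \<open>is_rep\<close> is carried along because undoing the next reflection asks
  for it.\<close>

lemma reflect_minus_seq_reflect_plus_seq:
  fixes V X :: "('i, 'r, 'b, 'v + 'r list) rep"
  assumes "orientation (val \<M>) \<Lambda>" "admissible \<Lambda> S" "is_rep \<M> \<Lambda> V" "indecomposable_rep \<M> \<Lambda> V"
    and "\<not> zero_rep (reflect_plus_seq \<M> \<Lambda> S V)"
    and "is_rep \<M> (reflect_seq \<Lambda> S) X" "rep_iso \<M> (reflect_seq \<Lambda> S) (reflect_plus_seq \<M> \<Lambda> S V) X"
  shows "is_rep \<M> \<Lambda> (reflect_minus_seq \<M> \<Lambda> S X) \<and> rep_iso \<M> \<Lambda> V (reflect_minus_seq \<M> \<Lambda> S X)"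
  using assms
proof (induction S arbitrary: \<Lambda> V)
  case (Cons x S)
  have x: "is_sink \<Lambda> x" and S: "admissible (reflect x \<Lambda>) S" using Cons.prems(2) by auto
  note o = gr.orientation_reflect[OF Cons.prems(1), of x] and r = rep_reflect_plus[OF Cons.prems(1) x Cons.prems(3)]
  have nz: "\<not> zero_rep (reflect_plus \<M> \<Lambda> x V)" using zero_reflect_plus_seq[OF o S r] Cons.prems(5) by auto
  note ind = indecomposable_reflect_plus[OF Cons.prems(1) x Cons.prems(3,4) nz]
  have "is_rep \<M> (reflect x \<Lambda>) (reflect_minus_seq \<M> (reflect x \<Lambda>) S X) \<and>
      rep_iso \<M> (reflect x \<Lambda>) (reflect_plus \<M> \<Lambda> x V) (reflect_minus_seq \<M> (reflect x \<Lambda>) S X)"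
    using Cons.prems(5-7) by (intro Cons.IH[OF o S r ind]) simp_all
  then show ?case
    using reflect_minus_reflect_plus[OF Cons.prems(1) x Cons.prems(3,4) nz] by simp
qed simp

subsection \<open>The place where an indecomposable representation is annihilated\<close>

text \<open>\<open>n\<close> counts the earlier occurrences, so the fatal reflection is at
  occurrence number \<open>n + 1\<close> of \<open>x\<close>. A vertex with its occurrence number,
  unlike a position in the list, keeps its meaning when two consecutive entries are
  interchanged.\<close>

definition kills_at ::
    "('i \<times> 'i) set \<Rightarrow> ('i, 'r, 'b, 'v + 'r list) rep \<Rightarrow> 'i list \<Rightarrow> 'i \<Rightarrow> nat \<Rightarrow> bool" where
  "kills_at \<Lambda> V S x n \<longleftrightarrow> (\<exists>us ws. S = us @ x # ws \<and> count_list us x = n \<and>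
     \<not> zero_rep (reflect_plus_seq \<M> \<Lambda> us V) \<and> zero_rep (reflect_plus_seq \<M> \<Lambda> (us @ [x]) V))"

text \<open>A representation annihilated by the reflections at two nonadjacent sinks is the direct sum of its
  spaces at these sinks.\<close>

lemma killed_at_second_sink:
  fixes V :: "('i, 'r, 'b, 'v + 'r list) rep"
  assumes ori: "orientation (val \<M>) \<Lambda>" and rep: "is_rep \<M> \<Lambda> V" and ind: "indecomposable_rep \<M> \<Lambda> V"
    and x: "is_sink \<Lambda> x" and y: "is_sink \<Lambda> y" "is_sink (reflect x \<Lambda>) y" "x \<noteq> y"
    and nz: "\<not> zero_rep (reflect_plus \<M> \<Lambda> x V)"
    and z: "zero_rep (reflect_plus \<M> (reflect x \<Lambda>) y (reflect_plus \<M> \<Lambda> x V))"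
  shows "zero_rep (reflect_plus \<M> \<Lambda> y V)"
proof (rule zero_reflect_plusI[OF ori y(1) rep])
  let ?V' = "reflect_plus \<M> \<Lambda> x V"
  have conc': "carrier (spc ?V' w) = {\<zero>\<^bsub>spc ?V' w\<^esub>}" if "w \<noteq> y" for w
    by (rule zero_reflect_plusD[OF gr.orientation_reflect[OF ori] y(2) rep_reflect_plus[OF ori x rep] z that])
  have conc: "carrier (spc V w) = {\<zero>\<^bsub>spc V w\<^esub>}" if "w \<noteq> x" "w \<noteq> y" for w
    using conc'[OF that(2)] by (simp add: reflect_plus_spc[OF that(1)])
  have "carrier (spc ?V' y) \<noteq> {\<zero>\<^bsub>spc ?V' y\<^esub>}"
    using nz conc' unfolding zero_rep_def by metis
  then have ynz: "carrier (spc V y) \<noteq> {\<zero>\<^bsub>spc V y\<^esub>}" using reflect_plus_spc[of y x \<M> \<Lambda> V] y(3) by simp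
  interpret Vy: left_module "k y" "spc V y" by (rule rep_left_module[OF rep])
  have out: "carrier (spc V i) = {\<zero>\<^bsub>spc V i\<^esub>}" if "(i, j) \<in> \<Lambda>" for i j
    using that x y(1) by (intro conc) (auto simp: is_sink_def)
  \<comment> \<open>The projection onto the space at \<open>y\<close>. It is not 0, because that
    space is nonzero, so it is the identity and all other spaces vanish.\<close>
  have endo: "idem_endo \<M> \<Lambda> V (\<lambda>i. if i = y then (\<lambda>v. v) else (\<lambda>_. \<zero>\<^bsub>spc V i\<^esub>))"
    using out by (rule concentrated_idem_endo[OF ori rep]) (simp_all add: linear_map_def additive_map_def)
  obtain v where v: "v \<in> carrier (spc V y)" "v \<noteq> \<zero>\<^bsub>spc V y\<^esub>" using ynz Vy.zero_closed by blast
  fix w assume w: "w \<noteq> y"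
  interpret Vw: left_module "k w" "spc V w" by (rule rep_left_module[OF rep])
  have "\<zero>\<^bsub>spc V w\<^esub> = u" if u: "u \<in> carrier (spc V w)" for u
    using idem_endo_cases[OF ori rep ind endo]
  proof
    assume *: "\<forall>i. \<forall>v\<in>carrier (spc V i). (if i = y then \<lambda>v. v else (\<lambda>_. \<zero>\<^bsub>spc V i\<^esub>)) v = \<zero>\<^bsub>spc V i\<^esub>"
    show ?thesis using bspec[OF spec[OF *, of y] v(1)] v(2) by simp
  next
    assume *: "\<forall>i. \<forall>v\<in>carrier (spc V i). (if i = y then \<lambda>v. v else (\<lambda>_. \<zero>\<^bsub>spc V i\<^esub>)) v = v"
    show ?thesis using bspec[OF spec[OF *, of w] u] w by simp
  qed
  then show "carrier (spc V w) = {\<zero>\<^bsub>spc V w\<^esub>}" using Vw.zero_closed by blast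
qed

text \<open>After the two interchanged reflections the representations agree in the sense of
  \<open>same_rep\<close>, and the remaining reflections preserve this.\<close>

lemma zero_rep_swap:
  fixes V :: "('i, 'r, 'b, 'v + 'r list) rep"
  assumes ori: "orientation (val \<M>) \<Lambda>" and rep: "is_rep \<M> \<Lambda> V"
    and adm: "admissible \<Lambda> (us @ [a, c] @ ws)" and ne: "a \<noteq> c" "\<not> E a c"
  shows "zero_rep (reflect_plus_seq \<M> \<Lambda> (us @ [a, c] @ ws) V) \<longleftrightarrow> zero_rep (reflect_plus_seq \<M> \<Lambda> (us @ [c, a] @ ws) V)"
proof -
  let ?L = "reflect_seq \<Lambda> us" and ?V = "reflect_plus_seq \<M> \<Lambda> us V"
  have oL: "orientation (val \<M>) ?L" by (rule gr.orientation_reflect_seq[OF ori])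
  have ws: "admissible (reflect c (reflect a ?L)) ws" and us: "admissible \<Lambda> us" and a: "is_sink ?L a"
    and ca: "is_sink (reflect a ?L) c"
    using adm by (auto simp: admissible_append)
  have c: "is_sink ?L c" using gr.admissible_swap[OF ori adm ne(2)] by (simp add: admissible_append)
  have rV: "is_rep \<M> ?L ?V" by (rule rep_reflect_plus_seq[OF ori us rep])
  have "is_rep \<M> (reflect c (reflect a ?L)) (reflect_plus \<M> (reflect a ?L) c (reflect_plus \<M> ?L a ?V))"
    by (rule rep_reflect_plus[OF gr.orientation_reflect[OF oL] ca rep_reflect_plus[OF oL a rV]])
  then have "same_rep (reflect_seq (reflect c (reflect a ?L)) ws)
      (reflect_plus_seq \<M> (reflect c (reflect a ?L)) ws (reflect_plus \<M> (reflect a ?L) c (reflect_plus \<M> ?L a ?V)))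
      (reflect_plus_seq \<M> (reflect c (reflect a ?L)) ws (reflect_plus \<M> (reflect c ?L) a (reflect_plus \<M> ?L c ?V)))"
    by (rule same_rep_reflect_plus_seq[OF gr.orientation_reflect[OF gr.orientation_reflect[OF oL]] ws _
          same_rep_commute[OF oL a c rV ne]])
  then show ?thesis
    using reflect_commute[of c a ?L] by (auto simp: reflect_plus_seq_append dest: same_rep_zero)
qed

text \<open>Only the cases in which \<open>a\<close> or \<open>c\<close> is the fatal entry need an
  argument. Before the interchanged pair nothing changes, and after it \<open>zero_rep_swap\<close>
  applies.\<close>

lemma kills_at_swap:
  fixes V :: "('i, 'r, 'b, 'v + 'r list) rep"
  assumes ori: "orientation (val \<M>) \<Lambda>" and rep: "is_rep \<M> \<Lambda> V" and ind: "indecomposable_rep \<M> \<Lambda> V"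
    and adm: "admissible \<Lambda> (us @ [a, c] @ ws)" and ne: "\<not> E a c" and ka: "kills_at \<Lambda> V (us @ [a, c] @ ws) x n"
  shows "kills_at \<Lambda> V (us @ [c, a] @ ws) x n"
proof (cases "a = c")
  case ac: False
  let ?F = "\<lambda>S. reflect_plus_seq \<M> \<Lambda> S V"
  let ?L = "reflect_seq \<Lambda> us"
  have oL: "orientation (val \<M>) ?L" by (rule gr.orientation_reflect_seq[OF ori])
  have us: "admissible \<Lambda> us" and a: "is_sink ?L a" and ca: "is_sink (reflect a ?L) c"
    using adm by (auto simp: admissible_append)
  have adm': "admissible \<Lambda> (us @ [c, a] @ ws)" by (rule gr.admissible_swap[OF ori adm ne])
  have c: "is_sink ?L c" using adm' by (simp add: admissible_append)
  have rV: "is_rep \<M> ?L (?F us)" by (rule rep_reflect_plus_seq[OF ori us rep])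
  have step: "?F (us @ [z]) = reflect_plus \<M> ?L z (?F us)" for z by (simp add: reflect_plus_seq_append)
  have swap: "zero_rep (?F (us @ [a, c] @ vs)) \<longleftrightarrow> zero_rep (?F (us @ [c, a] @ vs))" if "admissible \<Lambda> (us @ [a, c] @ vs)" for vs
    by (rule zero_rep_swap[OF ori rep that ac ne])
  have swap2: "zero_rep (?F (us @ [a, c])) \<longleftrightarrow> zero_rep (?F (us @ [c, a]))"
    using swap[of "[]"] adm by (simp add: admissible_append)
  obtain ps qs where S: "us @ [a, c] @ ws = ps @ x # qs" and n: "count_list ps x = n"
    and nz: "\<not> zero_rep (?F ps)" and z: "zero_rep (?F (ps @ [x]))"
    using ka unfolding kills_at_def by blast
  from S consider (before) us' where "us = ps @ x # us'" | (first) "ps = us" "x = a"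
    | (second) "ps = us @ [a]" "x = c" | (after) ps' where "ps = us @ [a, c] @ ps'" "ws = ps' @ x # qs"
    by (auto simp: append_eq_append_conv2 append_eq_Cons_conv Cons_eq_append_conv)
  then show ?thesis
  proof cases
    case before
    then show ?thesis unfolding kills_at_def using n nz z
      by (intro exI[of _ ps] exI[of _ "us' @ [c, a] @ ws"]) simp
  next
    \<comment> \<open>The representation is nonzero and concentrated at \<open>a\<close>, so it is
      not concentrated at \<open>c\<close> and survives the reflection there.\<close>
    case first
    have conc: "carrier (spc (?F us) y) = {\<zero>\<^bsub>spc (?F us) y\<^esub>}" if "y \<noteq> a" for y
      using zero_reflect_plusD[OF oL a rV _ that] z first step by simp
    have "\<not> zero_rep (?F (us @ [c]))"
    proof
      assume "zero_rep (?F (us @ [c]))"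
      then have "carrier (spc (?F us) y) = {\<zero>\<^bsub>spc (?F us) y\<^esub>}" if "y \<noteq> c" for y
        using zero_reflect_plusD[OF oL c rV _ that] step by simp
      then show False using conc ac nz first unfolding zero_rep_def by metis
    qed
    moreover have "zero_rep (?F (us @ [a, c]))"
      using zero_reflect_plus_seq_append[OF ori _ rep, of "us @ [a]" "[c]"] z first adm by (simp add: admissible_append)
    ultimately show ?thesis unfolding kills_at_def using n first ac swap2
      by (intro exI[of _ "us @ [c]"] exI[of _ ws]) auto
  next
    \<comment> \<open>The two reflections together annihilate an indecomposable representation that
      survives the one at \<open>a\<close>. So it lives at \<open>c\<close> alone, and the
      reflection at \<open>c\<close> kills it even before \<open>a\<close> is reached.\<close>
    case second
    have nz': "\<not> zero_rep (?F us)"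
      using zero_reflect_plus_seq_append[OF ori _ rep, of us "[a]"] nz second adm by (auto simp: admissible_append)
    have "indecomposable_rep \<M> ?L (?F us)" by (rule indecomposable_reflect_plus_seq[OF ori us rep ind nz'])
    moreover have "\<not> zero_rep (reflect_plus \<M> ?L a (?F us))" using nz second step by simp
    moreover have "zero_rep (reflect_plus \<M> (reflect a ?L) c (reflect_plus \<M> ?L a (?F us)))"
      using z second by (simp add: reflect_plus_seq_append)
    ultimately have "zero_rep (?F (us @ [c]))"
      unfolding step by (intro killed_at_second_sink[OF oL rV _ a c ca ac])
    then show ?thesis unfolding kills_at_def using n second ac nz'
      by (intro exI[of _ us] exI[of _ "a # ws"]) auto
  next
    case after
    have "admissible \<Lambda> (us @ [a, c] @ ps')" "admissible \<Lambda> (us @ [a, c] @ ps' @ [x])"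
      using adm after(2) by (auto simp: admissible_append)
    then have "\<not> zero_rep (?F (us @ [c, a] @ ps'))" "zero_rep (?F (us @ [c, a] @ ps' @ [x]))"
      using swap[of ps'] swap[of "ps' @ [x]"] nz z after(1) by auto
    then show ?thesis unfolding kills_at_def using n after
      by (intro exI[of _ "us @ [c, a] @ ps'"] exI[of _ qs]) auto
  qed
qed (use ka in simp)

lemma kills_at_equiv:
  fixes V :: "('i, 'r, 'b, 'v + 'r list) rep"
  assumes ori: "orientation (val \<M>) \<Lambda>" and rep: "is_rep \<M> \<Lambda> V" and ind: "indecomposable_rep \<M> \<Lambda> V"
    and eq: "seq_equiv (val \<M>) \<Lambda> S T"
  shows "kills_at \<Lambda> V S x n \<longleftrightarrow> kills_at \<Lambda> V T x n"
proof (rule gr.seq_equiv_invariant[OF eq, of "\<lambda>S. kills_at \<Lambda> V S x n"])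
  fix S T assume "seq_swap (val \<M>) \<Lambda> S T"
  then obtain us a c ws where S: "S = us @ [a, c] @ ws" "admissible \<Lambda> S" and T: "T = us @ [c, a] @ ws" "admissible \<Lambda> T"
    and ne: "\<not> E a c"
    unfolding seq_swap_def by blast
  have "\<not> E c a" using ne edge_sym by blast
  then show "kills_at \<Lambda> V S x n \<longleftrightarrow> kills_at \<Lambda> V T x n"
    using kills_at_swap[OF ori rep ind] S T ne by blast
qed

text \<open>Zero persists under further reflections, so \<open>T\<close> annihilates exactly when it
  includes the fatal occurrence.\<close>

lemma kills_at_prefix:
  fixes V :: "('i, 'r, 'b, 'v + 'r list) rep"
  assumes ori: "orientation (val \<M>) \<Lambda>" and rep: "is_rep \<M> \<Lambda> V"
    and adm: "admissible \<Lambda> (T @ U)" and ka: "kills_at \<Lambda> V (T @ U) x n"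
  shows "zero_rep (reflect_plus_seq \<M> \<Lambda> T V) \<longleftrightarrow> n < count_list T x"
proof -
  obtain us ws where S: "T @ U = us @ x # ws" and n: "count_list us x = n"
    and nz: "\<not> zero_rep (reflect_plus_seq \<M> \<Lambda> us V)" and z: "zero_rep (reflect_plus_seq \<M> \<Lambda> (us @ [x]) V)"
    using ka unfolding kills_at_def by blast
  from S consider (before) vs where "us = T @ vs" | (after) vs where "T = (us @ [x]) @ vs"
    by (auto simp: append_eq_append_conv2 append_eq_Cons_conv Cons_eq_append_conv)
  then show ?thesis
  proof cases
    case before
    then have "admissible \<Lambda> (T @ vs)" using adm S by (auto simp: admissible_append)
    then show ?thesis using zero_reflect_plus_seq_append[OF ori _ rep] nz n before by auto
  next
    case after
    then have "admissible \<Lambda> ((us @ [x]) @ vs)" using adm by (simp add: admissible_append)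
    then show ?thesis using zero_reflect_plus_seq_append[OF ori _ rep z, of vs] n after by simp
  qed
qed

subsection \<open>Annihilation of a projective by the Coxeter functor\<close>

text \<open>In a vertex \<open>y\<close> reached before \<open>x\<close> the neighbours already processed carry the zero space, and the
  maps from the others form the inclusion of the radical.\<close>

lemma projective_prefix:
  fixes V :: "('i, 'r, 'b, 'v + 'r list) rep"
  assumes ori: "orientation (val \<M>) \<Lambda>" and ac: "acyclic \<Lambda>" and rep: "is_rep \<M> \<Lambda> V"
    and iso: "rep_iso \<M> \<Lambda> V (projective_rep \<M> \<Lambda> x)"
    and adm: "admissible \<Lambda> us" and dist: "distinct us" and y: "y \<in> set us"
  shows "carrier (spc (reflect_plus_seq \<M> \<Lambda> us V) y) = {\<zero>\<^bsub>spc (reflect_plus_seq \<M> \<Lambda> us V) y\<^esub>}"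
  using adm dist y
proof (induction us arbitrary: y rule: rev_induct)
  case (snoc c us)
  let ?L = "reflect_seq \<Lambda> us" and ?V = "reflect_plus_seq \<M> \<Lambda> us V"
  have us: "admissible \<Lambda> us" and c: "is_sink ?L c" and d: "distinct us" "c \<notin> set us"
    using snoc.prems by (auto simp: admissible_append)
  have oL: "orientation (val \<M>) ?L" by (rule gr.orientation_reflect_seq[OF ori])
  have rV: "is_rep \<M> ?L ?V" by (rule rep_reflect_plus_seq[OF ori us rep])
  interpret P: projective_at \<M> \<Lambda> x
    by (intro projective_at.intro oriented_modulation.intro valued_modulation_axioms oriented_modulation_axioms.intro ori)
  interpret sr: sink_reflection \<M> ?L c ?V by (rule sink_reflection_intro[OF oL c rV])
  have step: "reflect_plus_seq \<M> \<Lambda> (us @ [c]) V = sr.F" by (simp add: reflect_plus_seq_append sr.F_def)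
  have cm: "compat \<Lambda> (count_list us)" by (rule gr.compat_count_list[OF ori us])
  \<comment> \<open>The prefix is admissible and misses \<open>c\<close>, so by compatibility it
    misses every predecessor of \<open>c\<close> in \<open>\<Lambda>\<close>.\<close>
  have sub: "z \<notin> set us" if "(z, c) \<in> \<Lambda>" for z
  proof -
    have "count_list us c = 0" using d(2) by (simp add: count_list_0_iff)
    then have "count_list us z = 0" using compatD[OF cm that] by auto
    then show ?thesis by (simp add: count_list_0_iff)
  qed
  have par: "(z, c) \<in> ?L \<longleftrightarrow> (z, c) \<in> \<Lambda>" if "z \<notin> set us" for z
  proof (cases "z = c")
    case True
    then show ?thesis using gr.orientationD(3)[OF oL] gr.orientationD(3)[OF ori] by simp
  next
    case False
    then show ?thesis using reflect_seq_parity[of z c \<Lambda> us] that d by (simp add: count_list_distinct)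
  qed
  have sp: "spc ?V z = spc V z" if "z \<notin> set us" for z by (rule reflect_plus_seq_spc[OF that])
  have Wz: "carrier sr.W = {\<zero>\<^bsub>sr.W\<^esub>}"
  proof (rule sr.W_zeroI)
    fix u assume u: "u \<in> carrier sr.ds.D" and hu: "sr.h u = \<zero>\<^bsub>spc ?V c\<^esub>"
    have zero: "u z = \<zero>\<^bsub>tens c z (spc ?V z)\<^esub>" if z: "z \<in> sr.N" "z \<in> set us" for z
      using sr.ds.ds_mem[OF u z(1)] sr.zero_TT[OF z(1) snoc.IH[OF us d(1) z(2)]] by blast
    \<comment> \<open>The sources of the arrows that ended at \<open>c\<close> from the beginning.
      The sum over all current arrows into \<open>c\<close> reduces to these, the others starting at
      spaces that have become zero; then the injectivity known for the projective applies.\<close>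
    let ?A = "{z. (z, c) \<in> \<Lambda>}"
    have AN: "?A \<subseteq> sr.N" using sub par by (auto simp: sr.N_def)
    have ut: "u z \<in> carrier (tens c z (spc V z))" if "(z, c) \<in> \<Lambda>" for z
      using sr.ds.ds_mem[OF u, of z] AN that sp[OF sub[OF that]] by auto
    have "(\<Oplus>\<^bsub>spc ?V c\<^esub>z\<in>?A. mp V z c (u z)) = (\<Oplus>\<^bsub>spc ?V c\<^esub>z\<in>sr.N. mp ?V z c (u z))"
    proof (rule sr.Vx.add.finprod_mono_neutral_cong_left)
      show "mp ?V z c (u z) = \<zero>\<^bsub>spc ?V c\<^esub>" if "z \<in> sr.N - ?A" for z
      proof -
        have zN: "z \<in> sr.N" and "z \<in> set us" using that par by (auto simp: sr.N_def)
        interpret tz: left_module "k c" "tens c z (spc ?V z)" by (rule sr.ds.mods[OF zN])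
        show ?thesis
          using zero[OF zN \<open>z \<in> set us\<close>]
            additive_map_zero[OF tz.M.abelian_group_axioms sr.Vx.M.abelian_group_axioms linear_map_additive[OF sr.mp_linear[OF zN]]]
          by simp
      qed
      show "mp V z c (u z) = mp ?V z c (u z)" if "z \<in> ?A" for z
        using that sub by (simp add: reflect_plus_seq_mp)
      show "(\<lambda>z. mp ?V z c (u z)) \<in> sr.N \<rightarrow> carrier (spc ?V c)"
        using linear_map_closed[OF sr.mp_linear sr.ds.ds_mem[OF u]] by blast
    qed (use AN sr.ds.fin in auto)
    then have "(\<Oplus>\<^bsub>spc V c\<^esub>z\<in>?A. mp V z c (u z)) = \<zero>\<^bsub>spc V c\<^esub>"
      using hu sp[OF d(2)] by (simp add: sr.h_def)
    then have uA: "u z = \<zero>\<^bsub>tens c z (spc V z)\<^esub>" if "(z, c) \<in> \<Lambda>" for z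
      using that ut by (rule P.projective_injective[OF rep iso, of c u z, rotated 1])
    show "u = \<zero>\<^bsub>sr.ds.D\<^esub>"
    proof (rule sr.ds.ds_eqI[OF u])
      show "u z = \<zero>\<^bsub>sr.ds.D\<^esub> z" if z: "z \<in> sr.N" for z
      proof (cases "z \<in> set us")
        case True
        then show ?thesis using zero[OF z] z by (simp add: sr.ds.ds_zero)
      next
        case False
        then have "(z, c) \<in> \<Lambda>" using z par by (simp add: sr.N_def)
        then show ?thesis using uA sp[OF False] z by (simp add: sr.ds.ds_zero)
      qed
    qed simp
  qed
  show ?case
  proof (cases "y = c")
    case True
    then show ?thesis unfolding step sr.spc_F using Wz by simp
  next
    case False
    then show ?thesis unfolding step sr.spc_F using snoc.IH[OF us d(1)] snoc.prems(3) by simp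
  qed
qed simp

text \<open>Just before \<open>x\<close> is reached, the vertices already reflected carry zero, and
  the others except \<open>x\<close> do not lie above \<open>x\<close>, because the multiplicities
  in \<open>us @ [x]\<close> do not decrease along paths. So only the space at \<open>x\<close>,
  still the original one, is left.\<close>

lemma projective_killed:
  fixes V :: "('i, 'r, 'b, 'v + 'r list) rep"
  assumes ori: "orientation (val \<M>) \<Lambda>" and ac: "acyclic \<Lambda>" and rep: "is_rep \<M> \<Lambda> V"
    and iso: "rep_iso \<M> \<Lambda> V (projective_rep \<M> \<Lambda> x)"
    and adm: "admissible \<Lambda> (us @ [x])" and dist: "distinct us" and x: "x \<notin> set us"
  shows "\<not> zero_rep (reflect_plus_seq \<M> \<Lambda> us V)" "zero_rep (reflect_plus_seq \<M> \<Lambda> (us @ [x]) V)"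
proof -
  interpret P: projective_at \<M> \<Lambda> x
    by (intro projective_at.intro oriented_modulation.intro valued_modulation_axioms oriented_modulation_axioms.intro ori)
  let ?L = "reflect_seq \<Lambda> us" and ?V = "reflect_plus_seq \<M> \<Lambda> us V"
  have us: "admissible \<Lambda> us" and sx: "is_sink ?L x" using adm by (auto simp: admissible_append)
  show "\<not> zero_rep ?V"
    using P.projective_top[OF rep iso] reflect_plus_seq_spc[OF x, of \<M> \<Lambda> V] unfolding zero_rep_def by metis
  have "carrier (spc ?V y) = {\<zero>\<^bsub>spc ?V y\<^esub>}" if y: "y \<noteq> x" for y
  proof (cases "y \<in> set us")
    case True
    then show ?thesis by (rule projective_prefix[OF ori ac rep iso us dist])
  next
    case False
    have "(x, y) \<notin> \<Lambda>\<^sup>*"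
    proof
      assume "(x, y) \<in> \<Lambda>\<^sup>*"
      then have "count_list (us @ [x]) x \<le> count_list (us @ [x]) y"
        by (rule compat_path[OF gr.compat_count_list[OF ori adm]])
      moreover have "count_list us y = 0" using False by (simp add: count_list_0_iff)
      ultimately show False using y by simp
    qed
    then show ?thesis using P.projective_support[OF rep iso ac] reflect_plus_seq_spc[OF False, of \<M> \<Lambda> V] by simp
  qed
  then show "zero_rep (reflect_plus_seq \<M> \<Lambda> (us @ [x]) V)"
    using zero_reflect_plusI[OF gr.orientation_reflect_seq[OF ori] sx rep_reflect_plus_seq[OF ori us rep]]
    by (simp add: reflect_plus_seq_append)
qed

text \<open>Every edge is reversed twice, once for each of its ends.\<close>

lemma coxeter_reflect_seq:
  assumes ori: "orientation (val \<M>) \<Lambda>" and K: "coxeter_seq \<Lambda> K"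
  shows "reflect_seq \<Lambda> K = \<Lambda>"
proof -
  have "(i, j) \<in> reflect_seq \<Lambda> K \<longleftrightarrow> (i, j) \<in> \<Lambda>" for i j
  proof (cases "i = j")
    case True
    then show ?thesis using gr.orientationD(3)[OF ori] gr.orientationD(3)[OF gr.orientation_reflect_seq[OF ori]] by simp
  next
    case False
    then show ?thesis using reflect_seq_parity[of i j \<Lambda> K] K by (simp add: coxeter_seq_def count_list_distinct)
  qed
  then show ?thesis by auto
qed

text \<open>\<open>K\<close> leaves \<open>\<Lambda>\<close> invariant, so iterating the Coxeter
  functor is the same as reflecting along repeated copies of \<open>K\<close>.\<close>

lemma coxeter_power:
  assumes ori: "orientation (val \<M>) \<Lambda>" and K: "coxeter_seq \<Lambda> K"
  shows "admissible \<Lambda> (concat (replicate n K))" "reflect_seq \<Lambda> (concat (replicate n K)) = \<Lambda>"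
    "count_list (concat (replicate n K)) y = n"
    "(reflect_plus_seq \<M> \<Lambda> K ^^ n) V = reflect_plus_seq \<M> \<Lambda> (concat (replicate n K)) V"
proof -
  note r = coxeter_reflect_seq[OF ori K]
  show "admissible \<Lambda> (concat (replicate n K))" using K r
    by (induction n) (auto simp: admissible_append coxeter_seq_def)
  show "reflect_seq \<Lambda> (concat (replicate n K)) = \<Lambda>" using r by (induction n) auto
  show "count_list (concat (replicate n K)) y = n"
    using K by (induction n) (auto simp: coxeter_seq_def count_list_distinct)
  show "(reflect_plus_seq \<M> \<Lambda> K ^^ n) V = reflect_plus_seq \<M> \<Lambda> (concat (replicate n K)) V"
  proof (induction n arbitrary: V)
    case (Suc n)
    then show ?case by (simp add: reflect_plus_seq_append funpow_Suc_right r del: funpow.simps(2))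
  qed simp
qed

text \<open>In a long power of \<open>K\<close> the representation dies at the occurrence of
  \<open>x\<close> in copy number \<open>n + 1\<close>. That power is equivalent to an extension of
  \<open>T\<close>, and the fatal occurrence is invariant under equivalence.\<close>

lemma zero_reflect_plus_seq_iff:
  fixes V :: "('i, 'r, 'b, 'v + 'r list) rep"
  assumes ori: "orientation (val \<M>) \<Lambda>" and ac: "acyclic \<Lambda>" and rep: "is_rep \<M> \<Lambda> V" and ind: "indecomposable_rep \<M> \<Lambda> V"
    and K: "coxeter_seq \<Lambda> K" and iso: "rep_iso \<M> \<Lambda> ((reflect_plus_seq \<M> \<Lambda> K ^^ n) V) (projective_rep \<M> \<Lambda> x)"
    and T: "admissible \<Lambda> T"
  shows "zero_rep (reflect_plus_seq \<M> \<Lambda> T V) \<longleftrightarrow> n < count_list T x"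
proof -
  let ?C = "\<lambda>m. concat (replicate m K)"
  note C = coxeter_power[OF ori K]
  obtain us ws where us: "K = us @ x # ws" using K by (metis UNIV_I coxeter_seq_def split_list)
  have usx: "admissible \<Lambda> (us @ [x])" "distinct us" "x \<notin> set us"
    using K us by (auto simp: coxeter_seq_def admissible_append)
  let ?V = "reflect_plus_seq \<M> \<Lambda> (?C n) V"
  have rV: "is_rep \<M> \<Lambda> ?V" using rep_reflect_plus_seq[OF ori C(1) rep, of n] by (simp add: C(2))
  have killed: "\<not> zero_rep (reflect_plus_seq \<M> \<Lambda> us ?V)" "zero_rep (reflect_plus_seq \<M> \<Lambda> (us @ [x]) ?V)"
    using projective_killed[OF ori ac rV _ usx] iso by (simp_all add: C(4))
  \<comment> \<open>\<open>n\<close> copies lead to the projective, one more contains the fatal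
    \<open>x\<close>, and the length of \<open>T\<close> bounds its multiplicities, so that
    \<open>T\<close> fits into the power.\<close>
  define m where "m = n + Suc (length T)"
  have Cm: "?C m = (?C n @ us) @ x # (ws @ ?C (length T))"
    unfolding m_def replicate_add by (simp add: us)
  have "kills_at \<Lambda> V (?C m) x n"
    unfolding kills_at_def
  proof (intro exI conjI)
    show "?C m = (?C n @ us) @ x # (ws @ ?C (length T))" by (rule Cm)
    show "count_list (?C n @ us) x = n" using usx(3) by (simp add: C(3) count_list_0_iff)
    show "\<not> zero_rep (reflect_plus_seq \<M> \<Lambda> (?C n @ us) V)"
      using killed(1) by (simp add: reflect_plus_seq_append C(2))
    show "zero_rep (reflect_plus_seq \<M> \<Lambda> ((?C n @ us) @ [x]) V)"
      using killed(2) by (simp add: reflect_plus_seq_append C(2))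
  qed
  moreover have "count_list T y \<le> count_list (?C m) y" for y
    using count_le_length[of T y] by (simp only: C(3)) (simp add: m_def)
  then obtain U where U: "seq_equiv (val \<M>) \<Lambda> (?C m) (T @ U)"
    using gr.extend_to_equiv[OF ori T C(1), of m] by blast
  ultimately have "kills_at \<Lambda> V (T @ U) x n" using kills_at_equiv[OF ori rep ind U] by blast
  moreover have "admissible \<Lambda> (T @ U)" using U by (simp add: seq_equiv_def)
  ultimately show ?thesis using kills_at_prefix[OF ori rep] by blast
qed

end

text \<open>The two existence clauses keep the universal part from being vacuous. It speaks of all
  representatives \<open>S\<close> and \<open>T\<close> because both sequences are unique only up to
  equivalence, and its sink condition is what makes the simple representation at \<open>x\<close>
  projective for the reflected orientation.\<close>

theorem corollary2p7:
  fixes \<M> :: "('i::finite, 'r, 'b, 'f) modulation"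
    and \<Lambda> :: "('i \<times> 'i) set"
    and M :: "('i, 'r, 'b, 'v + 'r list) rep"
    and \<nu> :: nat and x :: 'i and K :: "'i list"
  assumes "card (UNIV :: 'i set) > 1"
    and "valuation (val \<M>)" and "connected_graph (val \<M>)" and "is_modulation \<M>"
    and "orientation (val \<M>) \<Lambda>" and "acyclic \<Lambda>"
    and "is_rep \<M> \<Lambda> M" and "indecomposable_rep \<M> \<Lambda> M"
    and "coxeter_seq \<Lambda> K"
    and "rep_iso \<M> \<Lambda> ((reflect_plus_seq \<M> \<Lambda> K ^^ \<nu>) M) (projective_rep \<M> \<Lambda> x)"
  shows "(\<exists>S. shortest_annihilating \<M> \<Lambda> S M)
    \<and> (\<exists>T. principal_seq (val \<M>) \<Lambda> (\<nu> + 1) x T)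
    \<and> (\<forall>S. shortest_annihilating \<M> \<Lambda> S M \<longrightarrow>
         (\<forall>T. principal_seq (val \<M>) \<Lambda> (\<nu> + 1) x T \<longrightarrow> seq_equiv (val \<M>) \<Lambda> S T)
       \<and> S \<noteq> [] \<and> last S = x
       \<and> is_sink (reflect_seq \<Lambda> (butlast S)) x
       \<and> rep_iso \<M> \<Lambda> M
              (reflect_minus_seq \<M> \<Lambda> (butlast S) (simple_rep \<M> x :: ('i, 'r, 'b, 'v + 'r list) rep)))"
proof -
  interpret valued_modulation \<M> using assms(2,4) by (rule valued_modulation.intro)
  note ori = assms(5) and rep = assms(7) and ind = assms(8)
  \<comment> \<open>From here on annihilation by an admissible sequence is a condition on the
    multiplicity of \<open>x\<close> alone.\<close>
  have ann: "annihilates \<M> \<Lambda> T M \<longleftrightarrow> admissible \<Lambda> T \<and> \<nu> < count_list T x" for T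
    using zero_reflect_plus_seq_iff[OF assms(5-10)] by (auto simp: annihilates_def)
  obtain T where T: "principal_seq (val \<M>) \<Lambda> (\<nu> + 1) x T"
    using gr.principal_seq_exists[OF ori assms(6)] by fastforce
  have principal_sub: "subsequence (val \<M>) \<Lambda> T' S"
    if "principal_seq (val \<M>) \<Lambda> (\<nu> + 1) x T'" "annihilates \<M> \<Lambda> S M" for T' S
  proof (rule gr.subsequenceI[OF ori])
    show "admissible \<Lambda> T'" by (rule gr.principal_seq_count(1)[OF that(1)])
    show S: "admissible \<Lambda> S" using that(2) ann by blast
    show "count_list T' y \<le> count_list S y" for y
      unfolding gr.principal_seq_count(2)[OF that(1)]
      using gr.principal_mult_minimal[OF ori gr.compat_count_list[OF ori S]] that(2) ann by simp
  qed
  have principal_ann: "annihilates \<M> \<Lambda> T' M" if "principal_seq (val \<M>) \<Lambda> (\<nu> + 1) x T'" for T'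
    using gr.principal_seq_count[OF that] by (simp add: ann gr.principal_mult_self)
  have "shortest_annihilating \<M> \<Lambda> T M"
    unfolding shortest_annihilating_def
  proof (intro conjI principal_ann[OF T] allI impI notI)
    \<comment> \<open>An annihilating \<open>S\<close> has \<open>T\<close> as a subsequence, and
      two sequences that are subsequences of each other have equal multiplicities.\<close>
    fix S assume S: "subsequence (val \<M>) \<Lambda> S T \<and> \<not> seq_equiv (val \<M>) \<Lambda> S T" and "annihilates \<M> \<Lambda> S M"
    then have "subsequence (val \<M>) \<Lambda> T S" using principal_sub[OF T] by blast
    then have "count_list S y = count_list T y" for y
      using S gr.subsequence_count le_antisym by blast
    then have "seq_equiv (val \<M>) \<Lambda> S T" using S by (intro gr.seq_equivI[OF ori]) (auto simp: subsequence_def)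
    then show False using S by blast
  qed
  moreover have "(\<forall>T. principal_seq (val \<M>) \<Lambda> (\<nu> + 1) x T \<longrightarrow> seq_equiv (val \<M>) \<Lambda> S T)
       \<and> S \<noteq> [] \<and> last S = x \<and> is_sink (reflect_seq \<Lambda> (butlast S)) x
       \<and> rep_iso \<M> \<Lambda> M (reflect_minus_seq \<M> \<Lambda> (butlast S) (simple_rep \<M> x :: ('i, 'r, 'b, 'v + 'r list) rep))"
    if S: "shortest_annihilating \<M> \<Lambda> S M" for S
  proof -
    have Sa: "annihilates \<M> \<Lambda> S M" using S by (simp add: shortest_annihilating_def)
    then have adm: "admissible \<Lambda> S" and cS: "\<nu> < count_list S x" using ann by auto
    \<comment> \<open>\<open>T'\<close> annihilates and is a subsequence of \<open>S\<close>, so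
      minimality of \<open>S\<close> leaves only equivalence.\<close>
    have eq: "seq_equiv (val \<M>) \<Lambda> S T'" if "principal_seq (val \<M>) \<Lambda> (\<nu> + 1) x T'" for T'
      using S principal_sub[OF that Sa] principal_ann[OF that] gr.seq_equiv_sym
      by (auto simp: shortest_annihilating_def)
    have cS': "count_list S x = Suc \<nu>"
      using gr.seq_equiv_count[OF eq[OF T], of x] gr.principal_seq_count(2)[OF T, of x] by (simp add: gr.principal_mult_self)
    have ne: "S \<noteq> []" using cS by auto
    define R where "R = butlast S"
    have SR: "S = R @ [last S]" using ne by (simp add: R_def)
    have admR: "admissible \<Lambda> R" and sink: "is_sink (reflect_seq \<Lambda> R) (last S)"
      using adm SR admissible_append[of \<Lambda> R "[last S]"] by auto
    \<comment> \<open>Dropping the last vertex gives a subsequence in which that vertex occurs once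
      less, hence a proper one.\<close>
    have nR: "\<not> annihilates \<M> \<Lambda> R M"
    proof
      assume a: "annihilates \<M> \<Lambda> R M"
      have cSR: "count_list S y = count_list R y + count_list [last S] y" for y
        by (subst SR) (rule count_list_append)
      have "subsequence (val \<M>) \<Lambda> R S" by (rule gr.subsequenceI[OF ori admR adm]) (simp add: cSR)
      moreover have "\<not> seq_equiv (val \<M>) \<Lambda> R S"
      proof
        assume "seq_equiv (val \<M>) \<Lambda> R S"
        from gr.seq_equiv_count[OF this, of "last S"] show False using cSR[of "last S"] by simp
      qed
      ultimately show False using S a by (auto simp: shortest_annihilating_def)
    qed
    then have "\<not> \<nu> < count_list R x" using ann admR by blast
    moreover have "count_list S x = count_list R x + count_list [last S] x" by (subst SR) (rule count_list_append)
    \<comment> \<open>Without its last vertex \<open>S\<close> has at most \<open>\<nu>\<close>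
      occurrences of \<open>x\<close>, and with it \<open>\<nu> + 1\<close>; so the last vertex is
      \<open>x\<close>.\<close>
    ultimately have last: "last S = x" using cS' by (auto split: if_splits)
    have nz: "\<not> zero_rep (reflect_plus_seq \<M> \<Lambda> R M)" using nR admR by (simp add: annihilates_def)
    have oR: "orientation (val \<M>) (reflect_seq \<Lambda> R)" by (rule gr.orientation_reflect_seq[OF ori])
    note rR = rep_reflect_plus_seq[OF ori admR rep] and iR = indecomposable_reflect_plus_seq[OF ori admR rep ind nz]
    have sx: "is_sink (reflect_seq \<Lambda> R) x" using sink last by simp
    have "zero_rep (reflect_plus_seq \<M> \<Lambda> (R @ [x]) M)" using Sa SR last by (simp add: annihilates_def)
    then have "zero_rep (reflect_plus \<M> (reflect_seq \<Lambda> R) x (reflect_plus_seq \<M> \<Lambda> R M))"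
      by (simp add: reflect_plus_seq_append)
    \<comment> \<open>A reflection at \<open>x\<close> leaves the other spaces unchanged, so these
      are already zero before the last reflection.\<close>
    then have conc: "carrier (spc (reflect_plus_seq \<M> \<Lambda> R M) y) = {\<zero>\<^bsub>spc (reflect_plus_seq \<M> \<Lambda> R M) y\<^esub>}"
      if "y \<noteq> x" for y
      using that by (rule zero_reflect_plusD[OF oR sx rR])
    have "is_rep \<M> (reflect_seq \<Lambda> R) (simple_rep \<M> x :: ('i, 'r, 'b, 'v + 'r list) rep)"
      using conc by (rule simple_rep_iso(1)[OF oR rR iR sx])
    moreover have "rep_iso \<M> (reflect_seq \<Lambda> R) (reflect_plus_seq \<M> \<Lambda> R M) (simple_rep \<M> x :: ('i, 'r, 'b, 'v + 'r list) rep)"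
      using conc by (rule simple_rep_iso(2)[OF oR rR iR sx])
    ultimately have "rep_iso \<M> \<Lambda> M (reflect_minus_seq \<M> \<Lambda> R (simple_rep \<M> x :: ('i, 'r, 'b, 'v + 'r list) rep))"
      using reflect_minus_seq_reflect_plus_seq[OF ori admR rep ind nz] by blast
    then show ?thesis using eq ne last sx by (simp add: R_def)
  qed
  ultimately show ?thesis using T by blast
qed

end
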